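(* Let $d$ be a positive integer and let $\alpha$ be a real number with $\alpha\ge \frac{d+1}{2}$ if $d\ge 2$, and $\alpha\ge 2$ if $d=1$. Put $$A_\alpha(\mathbf{x})=(1-|\mathbf{x}|)_+^\alpha\qquad(\mathbf{x}\in\mathbb{R}^d),$$ $$\Lambda_{d,\alpha}(r) = {}_1F_2\left(\frac{d+1}{2};\, \frac{d+\alpha+1}{2},\, \frac{d+\alpha+2}{2};\, -\frac{r^2}{4}\right)\quad(r\ge 0),\qquad \gamma_{d,\alpha}=\frac{2^d\,\pi^{\frac{d-1}{2}}\,\Gamma(\alpha+1)\,\Gamma\left(\frac{d+1}{2}\right)}{\Gamma(\alpha+d+1)}.$$ Then $A_\alpha$ is continuous and positive definite on $\mathbb{R}^d$, with $$\widehat{A_\alpha}(\xi)=\gamma_{d,\alpha}\,\Lambda_{d,\alpha}(|\xi|)\qquad(\xi\in\mathbb{R}^d).$$ As a consequence, $A_\alpha(\mathbf{x}-\mathbf{y})$ is a reproducing kernel for the Sobolev space $H^{\frac{d+1}{2}}(\mathbb{R}^d)$ with respect to the inner product $$(u,v)_{A_\alpha(\mathbb{R}^d)}=(2\pi)^{-d}\cdot\frac{1}{\gamma_{d,\alpha}}\int_{\mathbb{R}^d}\frac{\widehat u(\xi)\,\overline{\widehat v(\xi)}}{\Lambda_{d,\alpha}(|\xi|)}\,d\xi.$$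
   Context: Notation. $|\cdot|$ is the Euclidean norm, $x_+=\max(x,0)$, and the Fourier transform is $\widehat f(\xi)=\int_{\mathbb{R}^d}e^{-i\xi\cdot\mathbf{x}}f(\mathbf{x})\,d\mathbf{x}$ for $f\in L^1(\mathbb{R}^d)$, extended to $L^2(\mathbb{R}^d)$ as usual. The generalized hypergeometric function is ${}_pF_q(a_1,\dots,a_p;b_1,\dots,b_q;r)=\sum_{k\ge0}\frac{(a_1)_k\cdots(a_p)_k}{k!\,(b_1)_k\cdots(b_q)_k}r^k$, with $(a)_0=1$ and $(a)_k=a(a+1)\cdots(a+k-1)$ for $k\ge1$. A function $\Phi$ on $\mathbb{R}^d$ is positive definite if $\sum_{j,k=1}^N\Phi(\mathbf{x}_j-\mathbf{x}_k)z_j\overline{z_k}\ge0$ for every $N$, all (pairwise distinct) $\mathbf{x}_1,\dots,\mathbf{x}_N\in\mathbb{R}^d$ and all $z_1,\dots,z_N\in\mathbb{C}$, with equality only when $z_1=\cdots=z_N=0$. For $\delta>0$, $H^\delta(\mathbb{R}^d)=\{u\in L^2(\mathbb{R}^d):(1+|\cdot|^2)^{\delta/2}\,\widehat u\in L^2(\mathbb{R}^d)\}$; when $\delta>d/2$ one has $H^\delta(\mathbb{R}^d)\subset C(\mathbb{R}^d)$, and elements are identified with their continuous representatives. For $\delta > d/2$, saying that $\Phi(\mathbf{x}-\mathbf{y})$ is a reproducing kernel for $H^\delta(\mathbb{R}^d)$ with respect to an inner product $(\cdot,\cdot)$ means that $H^\delta(\mathbb{R}^d)$ is a Hilbert space under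 $(\cdot,\cdot)$ and, for every $u\in H^\delta(\mathbb{R}^d)$ and $\mathbf{x}\in\mathbb{R}^d$, (i) $\Phi(\cdot-\mathbf{x})\in H^\delta(\mathbb{R}^d)$ and (ii) $u(\mathbf{x})=(u,\Phi(\cdot-\mathbf{x}))$. *)

theory Defs
  imports "HOL-Analysis.Analysis"
begin

definition askey :: "real \<Rightarrow> 'a::euclidean_space \<Rightarrow> real" where
  "askey \<alpha> x = (max (1 - norm x) 0) powr \<alpha>"

definition gen_hypergeometric :: "real list \<Rightarrow> real list \<Rightarrow> real \<Rightarrow> real" where
  "gen_hypergeometric as bs r =
    (\<Sum>k. (\<Prod>a\<leftarrow>as. pochhammer a k) / (fact k * (\<Prod>b\<leftarrow>bs. pochhammer b k)) * r ^ k)"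

definition Lambda_fun :: "nat \<Rightarrow> real \<Rightarrow> real \<Rightarrow> real" where
  "Lambda_fun d \<alpha> r =
    gen_hypergeometric [(real d + 1) / 2]
      [(real d + \<alpha> + 1) / 2, (real d + \<alpha> + 2) / 2] (- (r ^ 2) / 4)"

definition gamma_const :: "nat \<Rightarrow> real \<Rightarrow> real" where
  "gamma_const d \<alpha> =
    2 ^ d * pi powr ((real d - 1) / 2) * Gamma (\<alpha> + 1) * Gamma ((real d + 1) / 2)
      / Gamma (\<alpha> + real d + 1)"

definition positive_definite :: "('a::euclidean_space \<Rightarrow> complex) \<Rightarrow> bool" where
  "positive_definite \<Phi> \<longleftrightarrow>
    (\<forall>(N::nat) (x :: nat \<Rightarrow> 'a) (z :: nat \<Rightarrow> complex). inj_on x {..<N} \<longrightarrow>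
      (\<Sum>j<N. \<Sum>k<N. \<Phi> (x j - x k) * z j * cnj (z k)) \<in> \<real>\<^sub>\<ge>\<^sub>0 \<and>
      ((\<Sum>j<N. \<Sum>k<N. \<Phi> (x j - x k) * z j * cnj (z k)) = 0 \<longrightarrow> (\<forall>j<N. z j = 0)))"

definition square_integrable :: "('a::euclidean_space \<Rightarrow> complex) \<Rightarrow> bool" where
  "square_integrable f \<longleftrightarrow>
    f \<in> borel_measurable lborel \<and> integrable lborel (\<lambda>x. (norm (f x))\<^sup>2)"

definition fourier_L1 :: "('a::euclidean_space \<Rightarrow> complex) \<Rightarrow> 'a \<Rightarrow> complex" where
  "fourier_L1 f \<xi> = (LINT x|lborel. exp (- \<i> * complex_of_real (\<xi> \<bullet> x)) * f x)"

text \<open>The extension by continuity from \<open>L\<^sup>1 \<inter> L\<^sup>2\<close> to \<open>L\<^sup>2\<close>: \<open>g\<close> is a version of the transform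
  of \<open>f\<close> if some sequence in \<open>L\<^sup>1 \<inter> L\<^sup>2\<close> tends to \<open>f\<close> in \<open>L\<^sup>2\<close> while its transforms tend to \<open>g\<close>
  in \<open>L\<^sup>2\<close>. By Plancherel's theorem such a \<open>g\<close> exists and is unique almost everywhere.\<close>

definition is_fourier_L2 ::
    "('a::euclidean_space \<Rightarrow> complex) \<Rightarrow> ('a \<Rightarrow> complex) \<Rightarrow> bool" where
  "is_fourier_L2 f g \<longleftrightarrow> square_integrable f \<and> square_integrable g \<and>
    (\<exists>F :: nat \<Rightarrow> 'a \<Rightarrow> complex.
      (\<forall>n. integrable lborel (F n) \<and> square_integrable (F n)) \<and>
      (\<lambda>n. \<integral>\<^sup>+x. ennreal ((norm (F n x - f x))\<^sup>2) \<partial>lborel) \<longlonglongrightarrow> 0 \<and>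
      (\<lambda>n. \<integral>\<^sup>+\<xi>. ennreal ((norm (fourier_L1 (F n) \<xi> - g \<xi>))\<^sup>2) \<partial>lborel) \<longlonglongrightarrow> 0)"

text \<open>Outside \<open>L\<^sup>1\<close> the transform is determined only almost everywhere; a version is chosen.\<close>

definition fourier :: "('a::euclidean_space \<Rightarrow> complex) \<Rightarrow> 'a \<Rightarrow> complex" where
  "fourier f = (if integrable lborel f then fourier_L1 f else (SOME g. is_fourier_L2 f g))"

definition sobolev :: "real \<Rightarrow> ('a::euclidean_space \<Rightarrow> complex) set" where
  "sobolev \<delta> = {u. square_integrable u \<and>
    square_integrable (\<lambda>\<xi>. complex_of_real ((1 + (norm \<xi>)\<^sup>2) powr (\<delta> / 2)) * fourier u \<xi>)}"

text \<open>Elements of \<open>sobolev \<delta>\<close> are functions, not classes modulo null sets. For \<open>\<delta> > d / 2\<close> each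
  class contains exactly one continuous function, and the Sobolev space is identified with the
  set of these representatives.\<close>

definition sobolev_cont :: "real \<Rightarrow> ('a::euclidean_space \<Rightarrow> complex) set" where
  "sobolev_cont \<delta> = {u \<in> sobolev \<delta>. continuous_on UNIV u}"

definition inner_product_on ::
    "('a \<Rightarrow> complex) set \<Rightarrow> (('a \<Rightarrow> complex) \<Rightarrow> ('a \<Rightarrow> complex) \<Rightarrow> complex) \<Rightarrow> bool" where
  "inner_product_on H ip \<longleftrightarrow>
    (\<lambda>_. 0) \<in> H \<and>
    (\<forall>u\<in>H. \<forall>v\<in>H. (\<lambda>x. u x + v x) \<in> H) \<and>
    (\<forall>c. \<forall>u\<in>H. (\<lambda>x. c * u x) \<in> H) \<and>
    (\<forall>u\<in>H. \<forall>v\<in>H. \<forall>w\<in>H. ip (\<lambda>x. u x + v x) w = ip u w + ip v w) \<and>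
    (\<forall>c. \<forall>u\<in>H. \<forall>v\<in>H. ip (\<lambda>x. c * u x) v = c * ip u v) \<and>
    (\<forall>u\<in>H. \<forall>v\<in>H. ip v u = cnj (ip u v)) \<and>
    (\<forall>u\<in>H. ip u u \<in> \<real>\<^sub>\<ge>\<^sub>0 \<and> (ip u u = 0 \<longrightarrow> u = (\<lambda>_. 0)))"

definition ip_dist ::
    "(('a \<Rightarrow> complex) \<Rightarrow> ('a \<Rightarrow> complex) \<Rightarrow> complex) \<Rightarrow> ('a \<Rightarrow> complex) \<Rightarrow> ('a \<Rightarrow> complex) \<Rightarrow> real"
  where
  "ip_dist ip u v = sqrt (Re (ip (\<lambda>x. u x - v x) (\<lambda>x. u x - v x)))"

definition hilbert_space_on ::
    "('a \<Rightarrow> complex) set \<Rightarrow> (('a \<Rightarrow> complex) \<Rightarrow> ('a \<Rightarrow> complex) \<Rightarrow> complex) \<Rightarrow> bool" where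
  "hilbert_space_on H ip \<longleftrightarrow> inner_product_on H ip \<and>
    (\<forall>U :: nat \<Rightarrow> 'a \<Rightarrow> complex.
      (\<forall>n. U n \<in> H) \<and> (\<forall>\<epsilon>>0. \<exists>M. \<forall>m\<ge>M. \<forall>n\<ge>M. ip_dist ip (U m) (U n) < \<epsilon>) \<longrightarrow>
      (\<exists>u\<in>H. (\<lambda>n. ip_dist ip (U n) u) \<longlonglongrightarrow> 0))"

text \<open>The kernel is \<open>(x, y) \<mapsto> \<Phi> (x - y)\<close>.\<close>

definition reproducing_kernel ::
    "('a::euclidean_space \<Rightarrow> complex) \<Rightarrow> ('a \<Rightarrow> complex) set \<Rightarrow>
      (('a \<Rightarrow> complex) \<Rightarrow> ('a \<Rightarrow> complex) \<Rightarrow> complex) \<Rightarrow> bool" where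
  "reproducing_kernel \<Phi> H ip \<longleftrightarrow> hilbert_space_on H ip \<and>
    (\<forall>u\<in>H. \<forall>x. (\<lambda>y. \<Phi> (y - x)) \<in> H \<and> u x = ip u (\<lambda>y. \<Phi> (y - x)))"

definition askey_inner ::
    "real \<Rightarrow> ('a::euclidean_space \<Rightarrow> complex) \<Rightarrow> ('a \<Rightarrow> complex) \<Rightarrow> complex" where
  "askey_inner \<alpha> u v =
    complex_of_real (1 / (2 * pi) ^ DIM('a) * (1 / gamma_const DIM('a) \<alpha>)) *
    (LINT \<xi>|lborel. fourier u \<xi> * cnj (fourier v \<xi>)
        / complex_of_real (Lambda_fun DIM('a) \<alpha> (norm \<xi>)))"

end

theory Submission
  imports Defs "HOL-Complex_Analysis.Cauchy_Integral_Formula" "HOL-Real_Asymp.Real_Asymp"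
begin

text \<open>The radial function \<open>A\<close> is a superposition of indicators of balls, so its moments against powers
  of \<open>\<xi> \<bullet> x\<close> are those of a Gaussian up to explicit Gamma factors; summing them gives the transform.

  Everything else rests on \<open>c (1 + r\<^sup>2)\<^sup>-\<^sup>a \<le> \<Lambda> r \<le> C (1 + r\<^sup>2)\<^sup>-\<^sup>a\<close> with \<open>a = (d + 1) / 2\<close> and \<open>c > 0\<close>.
  For fixed \<open>a\<close>, a Beta integral writes the function for a large \<open>\<alpha>\<close> as a positive average of the one
  for a smaller \<open>\<alpha>\<close>, which leaves the critical \<open>\<alpha>\<close>. There convolution with \<open>1 - cos\<close> passes from
  \<open>a\<close> to \<open>a + 1\<close>. The bases are \<open>a = 1\<close> (\<open>t - sin t\<close>), \<open>a = 2\<close> (Cusa's inequality) and \<open>a = 3/2\<close>,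
  where the function is a positive mixture of dilates of \<open>(J\<^sub>1(t/2) / t)\<^sup>2\<close>.

  Positivity and integrability of \<open>\<Lambda>\<close> give inversion and hence positive definiteness, and the two-sided
  bound makes the norm of the stated inner product equivalent to the Sobolev norm. As the transform of
  \<open>A (\<sqdot> - x)\<close> is \<open>\<gamma> \<Lambda>\<close> times a character, the reproducing property is Fourier inversion.\<close>

section \<open>Moments and the transform of the Askey function\<close>

text \<open>With a = (d + 1) / 2 and q = 2 a + \<alpha>, the function
  \<open>t powr (q - 1) * evser (gs a q) t\<close> has Laplace transform s^(2 a - q) (1 + s^2)^(-a).
  Raising q is thus fractional integration, which is the Beta average. At the critical \<alpha> = a
  one has q = 3 a and the transform (s (1 + s^2))^(-a), so passing to a + 1 multiplies it by 1 / (s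
  (1 + s^2)), the transform of 1 - cos. There the oscillating part (from s = i and s = -i) and the
  monotone part (from s = 0) have the same order, which makes positivity delicate. The formal proof
  checks these identities on coefficients and by differentiation. For a = 1, q = 3 the function is
  (1 - cos t) / t^2, which has zeros: the bound fails, so integer a cannot start the chain at (1,
  3). At a = 3/2 nothing elementary is available: squares of J_1 have zeros, and only averaging over
  dilations gives a positive lower bound. Outside L^1 \<open>fourier\<close> is an arbitrary
  version, so linearity holds only almost everywhere; pointwise statements come back through
  continuity.\<close>

lemma nn_integral_lborel_scaleR:
  fixes f :: "'a::euclidean_space \<Rightarrow> ennreal"
  assumes [measurable]: "f \<in> borel_measurable borel" and "c > 0"
  shows "(\<integral>\<^sup>+x. f x \<partial>lborel) = ennreal (c ^ DIM('a)) * (\<integral>\<^sup>+x. f (c *\<^sub>R x) \<partial>lborel)"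
proof -
  have "(\<integral>\<^sup>+x. f x \<partial>lborel) = (\<integral>\<^sup>+x. f x \<partial>density (distr lborel borel (\<lambda>x. 0 + c *\<^sub>R x)) (\<lambda>_. ennreal
      (\<bar>c\<bar>^DIM('a))))"
    using lborel_affine[of c "0::'a"] assms(2) by simp
  also have "\<dots> = ennreal (c ^ DIM('a)) * (\<integral>\<^sup>+x. f (c *\<^sub>R x) \<partial>lborel)"
    using assms(2) by (simp add: nn_integral_density nn_integral_distr nn_integral_cmult)
  finally show ?thesis .
qed

lemma integral_lborel_uminus:
  fixes f :: "'a::euclidean_space \<Rightarrow> 'b::{banach, second_countable_topology}"
  assumes [measurable]: "f \<in> borel_measurable borel"
  shows "(LINT x|lborel. f (- x)) = (LINT x|lborel. f x)"
proof -
  have *: "lborel = distr lborel borel (\<lambda>x::'a. - x)"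
    using lborel_affine[of "-1" "0::'a"] by (simp add: density_1)
  show ?thesis by (subst (2) *) (simp add: integral_distr)
qed

lemma homogeneous_cball:
  fixes p :: "'a::euclidean_space \<Rightarrow> real"
  assumes [measurable]: "p \<in> borel_measurable borel" and p0: "\<And>x. p x \<ge> 0"
    and hom: "\<And>c x. c > 0 \<Longrightarrow> p (c *\<^sub>R x) = c ^ m * p x" and s: "s > 0"
  shows "(\<integral>\<^sup>+x. ennreal (p x) * indicator (cball 0 s) x \<partial>lborel) =
    ennreal (s ^ (DIM('a) + m)) * (\<integral>\<^sup>+x. ennreal (p x) * indicator (cball 0 1) x \<partial>lborel)"
proof -
  have eq: "ennreal (p (s *\<^sub>R x)) * indicator (cball 0 s) (s *\<^sub>R x) = ennreal (s ^ m) * (ennreal (p x) *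
      indicator (cball 0 1) x)" for x
    using s p0[of x] hom[OF s, of x] by (auto simp: indicator_def ennreal_mult abs_of_pos field_simps)
  have [measurable]: "cball 0 s \<in> sets (borel :: 'a measure)" "cball 0 1 \<in> sets (borel :: 'a measure)"
    by auto
  show ?thesis
    using s by (subst nn_integral_lborel_scaleR[where c=s])
      (simp_all add: eq nn_integral_cmult power_add ennreal_mult mult.assoc)
qed

text \<open>Layer cake: a radial function is a superposition of indicators of balls, and the integral of a
  homogeneous function over a ball is known up to one constant.\<close>

lemma homogeneous_layer_cake:
  fixes p :: "'a::euclidean_space \<Rightarrow> real" and \<psi> :: "real \<Rightarrow> ennreal" and \<rho> :: "real \<Rightarrow> real"
  assumes [measurable]: "p \<in> borel_measurable borel" and p0: "\<And>x. p x \<ge> 0"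
    and hom: "\<And>c x. c > 0 \<Longrightarrow> p (c *\<^sub>R x) = c ^ m * p x"
    and [measurable]: "\<psi> \<in> borel_measurable borel" "\<rho> \<in> borel_measurable borel"
    and pos: "\<And>t. \<psi> t \<noteq> 0 \<Longrightarrow> \<rho> t > 0"
  shows "(\<integral>\<^sup>+x. (\<integral>\<^sup>+t. \<psi> t * indicator {t. norm x \<le> \<rho> t} t \<partial>lborel) * p x \<partial>lborel) =
    (\<integral>\<^sup>+t. \<psi> t * ennreal (\<rho> t ^ (DIM('a) + m)) \<partial>lborel) * (\<integral>\<^sup>+x. ennreal (p x) * indicator (cball 0 1)
        x \<partial>lborel)"
proof -
  have "(\<integral>\<^sup>+x. (\<integral>\<^sup>+t. \<psi> t * indicator {t. norm x \<le> \<rho> t} t \<partial>lborel) * p x \<partial>lborel) =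
     (\<integral>\<^sup>+x. (\<integral>\<^sup>+t. \<psi> t * indicator {t. norm x \<le> \<rho> t} t * p x \<partial>lborel) \<partial>lborel)"
    by (subst nn_integral_multc) auto
  also have "\<dots> = (\<integral>\<^sup>+t. (\<integral>\<^sup>+x. \<psi> t * indicator {t. norm x \<le> \<rho> t} t * p x \<partial>lborel) \<partial>lborel)"
    by (subst lborel_pair.Fubini') auto
  also have "\<dots> = (\<integral>\<^sup>+t. \<psi> t * ennreal (\<rho> t ^ (DIM('a) + m)) * (\<integral>\<^sup>+x. ennreal (p x) * indicator (cball 0 1)
      x \<partial>lborel) \<partial>lborel)"
  proof (rule nn_integral_cong)
    fix t :: real
    have "(\<integral>\<^sup>+x. \<psi> t * indicator {t. norm x \<le> \<rho> t} t * p x \<partial>lborel) =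
        \<psi> t * (\<integral>\<^sup>+x. ennreal (p x) * indicator (cball 0 (\<rho> t)) x \<partial>lborel)"
      by (subst nn_integral_cmult[symmetric]) (auto simp: indicator_def intro!: nn_integral_cong)
    also have "\<dots> = \<psi> t * ennreal (\<rho> t ^ (DIM('a) + m)) * (\<integral>\<^sup>+x. ennreal (p x) * indicator (cball 0 1)
        x \<partial>lborel)"
    proof (cases "\<psi> t = 0")
      case False
      from homogeneous_cball[OF assms(1) p0 hom pos[OF False]]
      show ?thesis by (simp add: mult.assoc)
    qed simp
    finally show "(\<integral>\<^sup>+x. \<psi> t * indicator {t. norm x \<le> \<rho> t} t * p x \<partial>lborel) =
       \<psi> t * ennreal (\<rho> t ^ (DIM('a) + m)) * (\<integral>\<^sup>+x. ennreal (p x) * indicator (cball 0 1) x \<partial>lborel)" .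
  qed
  also have "\<dots> = (\<integral>\<^sup>+t. \<psi> t * ennreal (\<rho> t ^ (DIM('a) + m)) \<partial>lborel) * (\<integral>\<^sup>+x. ennreal (p x) * indicator
      (cball 0 1) x \<partial>lborel)"
    by (subst nn_integral_multc) auto
  finally show ?thesis .
qed

text \<open>exp (- e |x|^2) is the integral of exp (- t) over t >= e |x|^2, and e |x|^2 <= t says
  that x lies in the ball of radius sqrt (t / e).\<close>

lemma gaussian_layer_cake:
  assumes "e > 0"
  shows "ennreal (exp (- e * (norm x)\<^sup>2)) =
    (\<integral>\<^sup>+t. ennreal (exp (- t)) * indicator {0<..} t * indicator {t. norm x \<le> sqrt (t / e)} t \<partial>lborel)"
proof -
  let ?a = "e * (norm x)\<^sup>2"
  have "norm x \<le> sqrt (t / e) \<longleftrightarrow> ?a \<le> t" if "t > 0" for t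
  proof -
    have "norm x \<le> sqrt (t / e) \<longleftrightarrow> (norm x)\<^sup>2 \<le> t / e"
      using that assms by (metis norm_ge_zero real_sqrt_le_iff real_sqrt_unique)
    then show ?thesis using assms by (simp add: field_simps)
  qed
  then have "(\<integral>\<^sup>+t. ennreal (exp (- t)) * indicator {0<..} t * indicator {t. norm x \<le> sqrt (t / e)} t \<partial>lborel)
     = (\<integral>\<^sup>+t. ennreal (exp (- t)) * indicator {?a..} t * indicator {0<..} t \<partial>lborel)"
    by (intro nn_integral_cong) (auto simp: indicator_def)
  also have "\<dots> = (\<integral>\<^sup>+t. ennreal (exp (- t)) * indicator {?a..} t \<partial>lborel)"
    using AE_lborel_singleton[of "0::real"]
  proof (intro nn_integral_cong_AE, eventually_elim)
    case (elim t)
    have "0 \<le> e * (norm x)\<^sup>2" using assms by simp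
    then have "?a \<le> t \<Longrightarrow> 0 < t" using elim by linarith
    then show ?case by (auto simp: indicator_def)
  qed
  also have "\<dots> = ennreal (0 - (- exp (- ?a)))"
  proof (rule nn_integral_FTC_atLeast)
    show "((\<lambda>t::real. - exp (- t)) \<longlongrightarrow> 0) at_top"
      by real_asymp
  qed (auto intro!: derivative_eq_intros)
  finally show ?thesis by simp
qed

text \<open>The fundamental theorem of calculus for (1 - s)^\<alpha> between s = |x| and s = 1; the
  ball of radius s contains x exactly when |x| <= s.\<close>

lemma askey_layer_cake:
  assumes "\<alpha> \<ge> 1"
  shows "ennreal (askey \<alpha> x) =
    (\<integral>\<^sup>+s. ennreal (\<alpha> * (1 - s) powr (\<alpha> - 1)) * indicator {0<..<1} s * indicator {s. norm x \<le> s} s \<partial>lborel)"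
proof (cases "norm x \<le> 1")
  case True
  have "(\<integral>\<^sup>+s. ennreal (\<alpha> * (1 - s) powr (\<alpha> - 1)) * indicator {0<..<1} s * indicator {s. norm x \<le> s} s \<partial>lborel)
     = (\<integral>\<^sup>+s. ennreal (\<alpha> * (1 - s) powr (\<alpha> - 1)) * indicator {norm x..1} s \<partial>lborel)"
    using AE_lborel_singleton[of "0::real"] AE_lborel_singleton[of "1::real"]
    by (intro nn_integral_cong_AE, eventually_elim) (auto simp: indicator_def dest: order_trans[OF
        norm_ge_zero])
  also have "\<dots> = ennreal (0 - (- ((1 - norm x) powr \<alpha>)))"
  proof -
    have "((\<lambda>s. \<alpha> * (1 - s) powr (\<alpha> - 1)) has_integral (- ((1 - 1) powr \<alpha>) - (- ((1 - norm x) powr \<alpha>))))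
        {norm x..1}"
    proof (rule fundamental_theorem_of_calculus_interior[where f="\<lambda>s. - ((1 - s) powr \<alpha>)"])
      show "continuous_on {norm x..1} (\<lambda>s. - ((1 - s) powr \<alpha>))"
        using assms by (intro continuous_intros continuous_on_powr') auto
      fix s assume "s \<in> {norm x<..<1}"
      then show "((\<lambda>s. - ((1 - s) powr \<alpha>)) has_vector_derivative \<alpha> * (1 - s) powr (\<alpha> - 1)) (at s)"
        unfolding has_real_derivative_iff_has_vector_derivative[symmetric]
        by (auto intro!: derivative_eq_intros)
    qed (use True in auto)
    from nn_integral_has_integral_lebesgue'[OF _ this] show ?thesis using assms by auto
  qed
  finally show ?thesis using True by (simp add: askey_def)
next
  case False
  then have "(\<lambda>s. ennreal (\<alpha> * (1 - s) powr (\<alpha> - 1)) * indicator {0<..<1} s * indicator {s. norm x \<le> s} s) =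
      (\<lambda>_. 0)"
    by (auto simp: indicator_def fun_eq_iff)
  with False show ?thesis by (simp add: askey_def)
qed

text \<open>Here and in \<open>askey_homogeneous\<close> the integral is a radial constant times the
  same quantity, the integral of p over the unit ball. Comparing the two eliminates that quantity
  without spherical coordinates.\<close>

lemma gaussian_homogeneous:
  fixes p :: "'a::euclidean_space \<Rightarrow> real"
  assumes [measurable]: "p \<in> borel_measurable borel" and p0: "\<And>x. p x \<ge> 0"
    and hom: "\<And>c x. c > 0 \<Longrightarrow> p (c *\<^sub>R x) = c ^ m * p x" and e: "e > 0"
  shows "(\<integral>\<^sup>+x. ennreal (exp (- e * (norm x)\<^sup>2) * p x) \<partial>lborel) =
    ennreal (Gamma (real (DIM('a) + m) / 2 + 1) / e powr (real (DIM('a) + m) / 2)) *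
    (\<integral>\<^sup>+x. ennreal (p x) * indicator (cball 0 1) x \<partial>lborel)"
proof -
  let ?N = "real (DIM('a) + m)"
  have "(\<integral>\<^sup>+t. ennreal (exp (- t)) * indicator {0<..} t * ennreal (sqrt (t / e) ^ (DIM('a) + m)) \<partial>lborel) =
      (\<integral>\<^sup>+t. ennreal (1 / e powr (?N / 2)) * (ennreal (t powr ((?N / 2 + 1) - 1) / exp t) * indicator {0..} t)
          \<partial>lborel)"
    using AE_lborel_singleton[of "0::real"]
  proof (intro nn_integral_cong_AE, eventually_elim)
    case (elim t)
    show ?case
    proof (cases "t > 0")
      case True
      have "sqrt (t / e) ^ (DIM('a) + m) = (t / e) powr (?N / 2)"
        using True e by (simp add: powr_half_sqrt[symmetric] powr_powr powr_realpow[symmetric] del: of_nat_add)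
      also have "\<dots> = t powr (?N / 2) / e powr (?N / 2)"
        using True e by (simp add: powr_divide)
      finally show ?thesis using True e
        by (simp add: indicator_def ennreal_mult[symmetric] exp_minus field_simps del: of_nat_add)
    qed (use elim in \<open>auto simp: indicator_def\<close>)
  qed
  also have "\<dots> = ennreal (1 / e powr (?N / 2)) * ennreal (Gamma (?N / 2 + 1))"
  proof -
    have "((\<lambda>t. t powr ((?N / 2 + 1) - 1) / exp t) has_integral Gamma (?N / 2 + 1)) {0..}"
      by (rule Gamma_integral_real) (simp add: add_nonneg_pos del: of_nat_add)
    from nn_integral_has_integral_lebesgue'[OF _ this] show ?thesis
      by (subst nn_integral_cmult) auto
  qed
  finally have 1: "(\<integral>\<^sup>+t. ennreal (exp (- t)) * indicator {0<..} t * ennreal (sqrt (t / e) ^ (DIM('a) + m))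
      \<partial>lborel) =
      ennreal (Gamma (?N / 2 + 1) / e powr (?N / 2))"
    by (simp add: ennreal_mult[symmetric] Gamma_real_pos add_nonneg_pos less_imp_le del: of_nat_add)
  have "(\<integral>\<^sup>+x. ennreal (exp (- e * (norm x)\<^sup>2) * p x) \<partial>lborel) =
      (\<integral>\<^sup>+x. (\<integral>\<^sup>+t. ennreal (exp (- t)) * indicator {0<..} t * indicator {t. norm x \<le>
          sqrt (t / e)} t \<partial>lborel) * p x \<partial>lborel)"
    by (simp only: gaussian_layer_cake[OF e, symmetric]) (simp add: ennreal_mult p0)
  also have "\<dots> = (\<integral>\<^sup>+t. ennreal (exp (- t)) * indicator {0<..} t * ennreal (sqrt (t / e) ^ (DIM('a) + m))
      \<partial>lborel) *
     (\<integral>\<^sup>+x. ennreal (p x) * indicator (cball 0 1) x \<partial>lborel)"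
    by (rule homogeneous_layer_cake[OF assms(1) p0 hom]) (use e in \<open>auto simp: indicator_def split: if_splits\<close>)
  finally show ?thesis unfolding 1 .
qed

text \<open>The Gaussian reduction again, now with radius s and weight \<alpha> (1 - s)^(\<alpha> -
  1): with N = DIM + m, the radial integral of s^N is \<alpha> times the Beta function at N + 1 and
  \<alpha>.\<close>

lemma askey_homogeneous:
  fixes p :: "'a::euclidean_space \<Rightarrow> real"
  assumes [measurable]: "p \<in> borel_measurable borel" and p0: "\<And>x. p x \<ge> 0"
    and hom: "\<And>c x. c > 0 \<Longrightarrow> p (c *\<^sub>R x) = c ^ m * p x" and \<alpha>: "\<alpha> \<ge> 1"
  shows "(\<integral>\<^sup>+x. ennreal (askey \<alpha> x * p x) \<partial>lborel) =
    ennreal (Gamma (\<alpha> + 1) * Gamma (real (DIM('a) + m) + 1) / Gamma (real (DIM('a) + m) + \<alpha> + 1)) *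
    (\<integral>\<^sup>+x. ennreal (p x) * indicator (cball 0 1) x \<partial>lborel)"
proof -
  let ?N = "real (DIM('a) + m)"
  have "(\<integral>\<^sup>+t. ennreal (\<alpha> * (1 - t) powr (\<alpha> - 1)) * indicator {0<..<1} t * ennreal (t ^ (DIM('a) + m)) \<partial>lborel)
      =
      (\<integral>\<^sup>+t. ennreal \<alpha> * (ennreal (t powr ((?N + 1) - 1) * (1 - t) powr (\<alpha> - 1)) * indicator {0..1} t) \<partial>lborel)"
    using AE_lborel_singleton[of "0::real"] AE_lborel_singleton[of "1::real"]
  proof (intro nn_integral_cong_AE, eventually_elim)
    case (elim t)
    show ?case
    proof (cases "0 < t \<and> t < 1")
      case True
      then have "t ^ (DIM('a) + m) = t powr ?N"
        by (simp add: powr_realpow[symmetric] del: of_nat_add)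
      then show ?thesis using True \<alpha>
        by (simp add: indicator_def ennreal_mult[symmetric] field_simps del: of_nat_add)
    qed (use elim in \<open>auto simp: indicator_def\<close>)
  qed
  also have "\<dots> = ennreal \<alpha> * ennreal (Beta (?N + 1) \<alpha>)"
  proof -
    have "((\<lambda>t. t powr ((?N + 1) - 1) * (1 - t) powr (\<alpha> - 1)) has_integral Beta (?N + 1) \<alpha>) {0..1}"
      by (rule has_integral_Beta_real) (use \<alpha> in \<open>auto simp: add_nonneg_pos simp del: of_nat_add\<close>)
    from nn_integral_has_integral_lebesgue'[OF _ this] show ?thesis
      by (subst nn_integral_cmult) auto
  qed
  also have "\<dots> = ennreal (\<alpha> * Beta (?N + 1) \<alpha>)"
    using \<alpha> by (intro ennreal_mult[symmetric]) (auto simp: Beta_def Gamma_real_pos add_nonneg_pos less_imp_le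
        simp del: of_nat_add)
  also have "\<alpha> * Beta (?N + 1) \<alpha> = Gamma (\<alpha> + 1) * Gamma (?N + 1) / Gamma (?N + \<alpha> + 1)"
    using \<alpha> Gamma_plus1[of \<alpha>] nonpos_Ints_nonpos[of \<alpha>]
    by (fastforce simp: Beta_def add_ac simp del: of_nat_add)
  finally have 1: "(\<integral>\<^sup>+t. ennreal (\<alpha> * (1 - t) powr (\<alpha> - 1)) * indicator {0<..<1} t * ennreal (t ^ (DIM('a) +
      m)) \<partial>lborel) =
     ennreal (Gamma (\<alpha> + 1) * Gamma (?N + 1) / Gamma (?N + \<alpha> + 1))" .
  have "(\<integral>\<^sup>+x. ennreal (askey \<alpha> x * p x) \<partial>lborel) =
      (\<integral>\<^sup>+x. (\<integral>\<^sup>+s. ennreal (\<alpha> * (1 - s) powr (\<alpha> - 1)) * indicator {0<..<1} s * indicator {s. norm x \<le>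
          s} s \<partial>lborel) * p x \<partial>lborel)"
    by (simp only: askey_layer_cake[OF \<alpha>, symmetric]) (simp add: ennreal_mult p0 askey_def)
  also have "\<dots> = (\<integral>\<^sup>+t. ennreal (\<alpha> * (1 - t) powr (\<alpha> - 1)) * indicator {0<..<1} t * ennreal (t ^ (DIM('a) + m))
      \<partial>lborel) *
     (\<integral>\<^sup>+x. ennreal (p x) * indicator (cball 0 1) x \<partial>lborel)"
    by (rule homogeneous_layer_cake[OF assms(1) p0 hom]) (auto simp: indicator_def split: if_splits)
  finally show ?thesis unfolding 1 .
qed

section \<open>Gaussian integrals, moments and transforms\<close>

lemma gaussian_nn_integral:
  assumes e: "e > 0"
  shows "(\<integral>\<^sup>+x. ennreal (exp (- e * (norm (x::'a::euclidean_space))\<^sup>2)) \<partial>lborel) =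
      ennreal ((pi / e) powr (DIM('a) / 2))"
proof -
  have "Gamma (real DIM('a) / 2 + 1) > 0" by (rule Gamma_real_pos) (simp add: add_nonneg_pos)
  then have *: "Gamma (real DIM('a) / 2 + 1) / e powr (real DIM('a) / 2) * unit_ball_vol (real DIM('a)) =
      (pi / e) powr (DIM('a) / 2)"
    unfolding unit_ball_vol_def by (simp only: powr_divide) (simp add: less_imp_neq[THEN not_sym])
  \<comment> \<open>For p = 1 the ball integral is the volume of the unit ball, whose Gamma factor
    cancels the radial one.\<close>
  have "(\<integral>\<^sup>+x. ennreal (exp (- e * (norm (x::'a))\<^sup>2) * 1) \<partial>lborel) =
     ennreal (Gamma (real (DIM('a) + 0) / 2 + 1) / e powr (real (DIM('a) + 0) / 2)) *
     (\<integral>\<^sup>+x. ennreal 1 * indicator (cball (0::'a) 1) x \<partial>lborel)"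
    by (rule gaussian_homogeneous) (use e in auto)
  then show ?thesis
    using * by (simp add: emeasure_cball ennreal_mult[symmetric])
qed

lemma gaussian_integrable: "e > 0 \<Longrightarrow> integrable lborel (\<lambda>x::'a::euclidean_space. exp (- e * (norm x)\<^sup>2))"
  by (rule integrableI_nonneg) (simp_all add: gaussian_nn_integral[simplified])

lemma gaussian_integral:
  assumes e: "e > 0"
  shows "(LINT x|lborel. exp (- e * (norm (x::'a::euclidean_space))\<^sup>2)) = (pi / e) powr (DIM('a) / 2)"
  by (rule integral_eq_nn_integral[THEN trans]) (auto simp: gaussian_nn_integral[OF e, simplified])

lemma integrable_lborel_shift:
  fixes f :: "'a::euclidean_space \<Rightarrow> 'b::{banach, second_countable_topology}"
  shows "integrable lborel (\<lambda>x. f (c + x)) \<longleftrightarrow> integrable lborel f"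
proof -
  have *: "integrable lborel (\<lambda>x. f (c + x))" if i: "integrable lborel f" for f :: "'a \<Rightarrow> 'b" and c
  proof -
    have [measurable]: "f \<in> borel_measurable borel" using i by auto
    have "integrable (distr lborel borel ((+) c)) f" using i by (simp add: lborel_distr_plus)
    then show ?thesis by (simp add: integrable_distr_eq)
  qed
  from *[of f c] *[of "\<lambda>x. f (c + x)" "- c"] show ?thesis by auto
qed

lemma integral_lborel_shift:
  fixes f :: "'a::euclidean_space \<Rightarrow> 'b::{banach, second_countable_topology}"
  assumes [measurable]: "f \<in> borel_measurable borel"
  shows "(LINT x|lborel. f (c + x)) = (LINT x|lborel. f x)"
  by (subst (2) lborel_distr_plus[symmetric, of c]) (simp add: integral_distr)

text \<open>Completing the square: e |x|^2 - \<xi> . x = e |x - \<xi> / (2 e)|^2 - |\<xi>|^2 / (4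
  e).\<close>

lemma gaussian_laplace:
  fixes \<xi> :: "'a::euclidean_space"
  assumes e: "e > 0"
  shows "integrable lborel (\<lambda>x. exp (- e * (norm x)\<^sup>2) * exp (\<xi> \<bullet> x))"
    and "(LINT x|lborel. exp (- e * (norm x)\<^sup>2) * exp (\<xi> \<bullet> x)) = (pi / e) powr (DIM('a) / 2) * exp ((norm \<xi>)\<^sup>2 /
        (4 * e))"
proof -
  have eq: "exp (- e * (norm x)\<^sup>2) * exp (\<xi> \<bullet> x) = exp ((norm \<xi>)\<^sup>2 / (4 * e)) * exp (- e * (norm (- ((1 / (2 *
      e)) *\<^sub>R \<xi>) + x))\<^sup>2)" for x
  proof -
    have "(norm (- ((1 / (2 * e)) *\<^sub>R \<xi>) + x))\<^sup>2 = (norm x)\<^sup>2 - (1 / e) * (\<xi> \<bullet> x) + (1 / (2 * e))\<^sup>2 *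
        (norm \<xi>)\<^sup>2"
      unfolding power2_norm_eq_inner by (simp add: inner_add_left inner_add_right inner_commute power2_eq_square
          algebra_simps)
    then have "- e * (norm x)\<^sup>2 + \<xi> \<bullet> x = (norm \<xi>)\<^sup>2 / (4 * e) + (- e * (norm (- ((1 / (2 * e)) *\<^sub>R \<xi>) + x))\<^sup>2)"
      by (simp only:) (use e in \<open>simp add: field_simps power2_eq_square\<close>)
    then show ?thesis by (simp only: exp_add[symmetric])
  qed
  have i: "integrable lborel (\<lambda>x. exp (- e * (norm (- ((1 / (2 * e)) *\<^sub>R \<xi>) + x))\<^sup>2))"
    using integrable_lborel_shift[of "\<lambda>x. exp (- e * (norm x)\<^sup>2)" "- ((1 / (2 * e))
        *\<^sub>R \<xi>)"] gaussian_integrable[OF e] by simp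
  show "integrable lborel (\<lambda>x. exp (- e * (norm x)\<^sup>2) * exp (\<xi> \<bullet> x))"
    unfolding eq using i by simp
  show "(LINT x|lborel. exp (- e * (norm x)\<^sup>2) * exp (\<xi> \<bullet> x)) = (pi / e) powr (DIM('a) / 2) * exp ((norm \<xi>)\<^sup>2 /
      (4 * e))"
    unfolding eq using integral_lborel_shift[of "\<lambda>x. exp (- e * (norm x)\<^sup>2)" "- ((1 / (2 * e))
        *\<^sub>R \<xi>)"] gaussian_integral[OF e] by simp
qed

text \<open>Termwise integration, all partial sums being dominated by exp (|z| |\<xi>| |x|). A
  complex z serves two ends: real z identifies moments from a Laplace transform, while z = i or z =
  -i sums moments to a Fourier transform.\<close>

lemma exp_inner_sums:
  fixes f :: "'a::euclidean_space \<Rightarrow> real" and z :: complex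
  assumes [measurable]: "f \<in> borel_measurable borel"
    and i: "integrable lborel (\<lambda>x. f x * exp (norm z * norm \<xi> * norm x))"
  shows "integrable lborel (\<lambda>x. complex_of_real (f x) * exp (z * of_real (\<xi> \<bullet> x)))"
    and "(\<lambda>k. z ^ k / fact k * of_real (LINT x|lborel. f x * (\<xi> \<bullet> x) ^ k)) sums
      (LINT x|lborel. complex_of_real (f x) * exp (z * of_real (\<xi> \<bullet> x)))"
proof -
  let ?g = "\<lambda>(k::nat) (x::'a). (z * of_real (\<xi> \<bullet> x)) ^ k /\<^sub>R fact k"
  have bnd: "norm (z * of_real (\<xi> \<bullet> x)) \<le> norm z * norm \<xi> * norm x" for x
    using mult_left_mono[OF Cauchy_Schwarz_ineq2[of \<xi> x], of "norm z"] by (simp add: norm_mult mult_ac)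
  have part: "norm (\<Sum>k<N. ?g k x) \<le> exp (norm z * norm \<xi> * norm x)" for N x
  proof -
    have "norm (\<Sum>k<N. ?g k x) \<le> (\<Sum>k<N. norm (?g k x))" by (rule norm_sum)
    also have "\<dots> \<le> (\<Sum>k<N. (norm z * norm \<xi> * norm x) ^ k /\<^sub>R fact k)"
    proof (intro sum_mono)
      fix k
      show "norm (?g k x) \<le> (norm z * norm \<xi> * norm x) ^ k /\<^sub>R fact k"
        using power_mono[OF bnd[of x], of k] by (simp add: norm_power norm_mult power_mult_distrib divide_simps)
    qed
    also have "\<dots> \<le> (\<Sum>k. (norm z * norm \<xi> * norm x) ^ k /\<^sub>R fact k)"
      by (intro sum_le_suminf sums_summable[OF exp_converges]) auto
    finally show ?thesis by (simp add: exp_def)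
  qed
  have trm: "integrable lborel (\<lambda>x. complex_of_real (f x) * ?g k x)" for k
  proof (rule Bochner_Integration.integrable_bound[OF i])
    show "AE x in lborel. norm (complex_of_real (f x) * ?g k x) \<le> norm (f x * exp (norm z * norm \<xi> * norm x))"
    proof (rule AE_I2)
      fix x
      have "norm (?g k x) \<le> (norm z * norm \<xi> * norm x) ^ k /\<^sub>R fact k"
        using power_mono[OF bnd[of x], of k] by (simp add: norm_power norm_mult power_mult_distrib divide_simps)
      also have "\<dots> \<le> (\<Sum>k. (norm z * norm \<xi> * norm x) ^ k /\<^sub>R fact k)"
        using sum_le_suminf[OF sums_summable[OF exp_converges], of "{k}" "norm z * norm \<xi> * norm x"] by auto
      finally have "norm (?g k x) \<le> exp (norm z * norm \<xi> * norm x)" by (simp add: exp_def)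
      then show "norm (complex_of_real (f x) * ?g k x) \<le> norm (f x * exp (norm z * norm \<xi> * norm x))"
        unfolding norm_mult norm_of_real by (intro mult_mono) auto
    qed
  qed simp
  have conv: "AE x in lborel. (\<lambda>N. \<Sum>k<N. complex_of_real (f x) * ?g k x) \<longlonglongrightarrow>
      complex_of_real (f x) * exp (z * of_real (\<xi> \<bullet> x))"
    unfolding sum_distrib_left[symmetric]
    by (intro AE_I2 tendsto_mult tendsto_const exp_converges[unfolded sums_def])
  have dom: "AE x in lborel. norm (\<Sum>k<N. complex_of_real (f x) * ?g k x) \<le>
      norm (f x * exp (norm z * norm \<xi> * norm x))" for N
    unfolding sum_distrib_left[symmetric] norm_mult norm_of_real using part by (intro AE_I2 mult_mono) auto
  show "integrable lborel (\<lambda>x. complex_of_real (f x) * exp (z * of_real (\<xi> \<bullet> x)))"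
    by (rule integrable_dominated_convergence[OF _ _ integrable_norm[OF i] conv dom]) auto
  have "(\<lambda>N. LINT x|lborel. (\<Sum>k<N. complex_of_real (f x) * ?g k x)) \<longlonglongrightarrow> (LINT x|lborel. complex_of_real (f x) *
      exp (z * of_real (\<xi> \<bullet> x)))"
    by (rule integral_dominated_convergence[OF _ _ integrable_norm[OF i] conv dom]) auto
  also have "(\<lambda>N. LINT x|lborel. (\<Sum>k<N. complex_of_real (f x) * ?g k x)) =
     (\<lambda>N. \<Sum>k<N. z ^ k / fact k * of_real (LINT x|lborel. f x * (\<xi> \<bullet> x) ^ k))"
  proof
    fix N
    have "(LINT x|lborel. complex_of_real (f x) * ?g k x) = z ^ k / fact k * of_real (LINT x|lborel. f x *
        (\<xi> \<bullet> x) ^ k)" for k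
    proof -
      have "(\<lambda>x. complex_of_real (f x) * ?g k x) = (\<lambda>x. z ^ k / fact k * of_real (f x * (\<xi> \<bullet> x) ^ k))"
        by (auto simp: fun_eq_iff power_mult_distrib scaleR_conv_of_real field_simps)
      then show ?thesis by (simp only: integral_mult_right_zero integral_complex_of_real)
    qed
    then show "(LINT x|lborel. (\<Sum>k<N. complex_of_real (f x) * ?g k x)) =
      (\<Sum>k<N. z ^ k / fact k * of_real (LINT x|lborel. f x * (\<xi> \<bullet> x) ^ k))"
      by (subst Bochner_Integration.integral_sum[OF trm]) simp
  qed
  finally show "(\<lambda>k. z ^ k / fact k * of_real (LINT x|lborel. f x * (\<xi> \<bullet> x) ^ k)) sums
      (LINT x|lborel. complex_of_real (f x) * exp (z * of_real (\<xi> \<bullet> x)))"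
    by (simp add: sums_def)
qed

text \<open>Identity theorem: once a 0 = 0, a nonzero later coefficient would keep the sum away from
  0 on a punctured disc.\<close>

lemma sums_zero_imp_coeffs_zero:
  fixes a :: "nat \<Rightarrow> 'a::{real_normed_field,banach}"
  assumes "\<And>z. (\<lambda>k. a k * z ^ k) sums 0"
  shows "a k = 0"
proof (rule ccontr)
  assume k: "a k \<noteq> 0"
  have a0: "a 0 = 0" using assms[of 0] by (metis powser_sums_zero_iff)
  then have "k > 0" using k by (cases k) auto
  show False
  proof (rule powser_0_nonzero[of 1 0 a "\<lambda>_. 0" k])
    fix s :: real
    assume s: "0 < s" and nz: "\<And>z::'a. z \<in> cball 0 s - {0} \<Longrightarrow> (0 :: 'a) \<noteq> 0"
    from nz[of "of_real s"] s show False by auto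
  qed (use assms k a0 \<open>k > 0\<close> in auto)
qed

lemma gaussian_exp_integrable:
  assumes e: "e > 0"
  shows "integrable lborel (\<lambda>x::'a::euclidean_space. exp (- e * (norm x)\<^sup>2) * exp (c * norm x))"
proof (rule Bochner_Integration.integrable_bound)
  show "integrable lborel (\<lambda>x::'a. exp (c\<^sup>2 / (2 * e)) * exp (- (e / 2) * (norm x)\<^sup>2))"
    using gaussian_integrable[of "e / 2", where 'a='a] e by simp
  show "AE x::'a in lborel. norm (exp (- e * (norm x)\<^sup>2) * exp (c * norm x)) \<le>
      norm (exp (c\<^sup>2 / (2 * e)) * exp (- (e / 2) * (norm x)\<^sup>2))"
  proof (rule AE_I2)
    fix x :: 'a
    \<comment> \<open>Expanding the square gives c |x| <= c^2 / (2 e) + (e / 2) |x|^2, so half of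
      the Gaussian decay survives.\<close>
    have "0 \<le> (e * norm x - c)\<^sup>2 / (2 * e)" using e by simp
    then have "- e * (norm x)\<^sup>2 + c * norm x \<le> c\<^sup>2 / (2 * e) + (- (e / 2) * (norm x)\<^sup>2)"
      using e by (simp add: field_simps power2_eq_square)
    then show "norm (exp (- e * (norm x)\<^sup>2) * exp (c * norm x)) \<le> norm (exp (c\<^sup>2 / (2 * e)) * exp (- (e / 2) *
        (norm x)\<^sup>2))"
      by (simp add: exp_add[symmetric])
  qed
qed simp

text \<open>Analytic continuation by coefficients: along t \<xi> with real t the Laplace transform
  is known in closed form, comparing coefficients in t yields the moments, and the same entire
  series can then be summed at every complex z.\<close>

lemma gaussian_moment_sums:
  fixes \<xi> :: "'a::euclidean_space" and z :: complex
  assumes e: "e > 0"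
  defines "c \<equiv> \<lambda>k::nat. if even k then (pi / e) powr (real DIM('a) / 2) * ((norm \<xi>)\<^sup>2 / (4 * e)) ^ (k div 2)
      / fact (k div 2) else 0"
  shows "(LINT x|lborel. exp (- e * (norm x)\<^sup>2) * (\<xi> \<bullet> x) ^ k) = fact k * c k"
    and "(\<lambda>k. of_real (c k) * z ^ k) sums (of_real ((pi / e) powr (real DIM('a) / 2)) * exp (z\<^sup>2 * of_real
        ((norm \<xi>)\<^sup>2 / (4 * e))))"
proof -
  have S: "(\<lambda>k. of_real (c k) * z ^ k) sums (of_real ((pi / e) powr (real DIM('a) / 2)) * exp (z\<^sup>2 * of_real
      ((norm \<xi>)\<^sup>2 / (4 * e))))"
    for z :: "'b::{real_normed_field,banach}"
  proof -
    have "(\<lambda>k. of_real ((pi / e) powr (real DIM('a) / 2)) * ((z\<^sup>2 * of_real ((norm \<xi>)\<^sup>2 / (4 * e)))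
        ^ k /\<^sub>R fact k)) sums
       (of_real ((pi / e) powr (real DIM('a) / 2)) * exp (z\<^sup>2 * of_real ((norm \<xi>)\<^sup>2 / (4 * e))))"
      by (intro sums_mult exp_converges)
    then have "(\<lambda>k. of_real (c (2 * k)) * z ^ (2 * k)) sums (of_real ((pi / e) powr (real DIM('a) / 2)) * exp
        (z\<^sup>2 * of_real ((norm \<xi>)\<^sup>2 / (4 * e))))"
      by (simp add: c_def scaleR_conv_of_real power_mult_distrib power_divide power_mult[symmetric] field_simps)
    moreover have "(\<lambda>k. of_real (c (2 * k)) * z ^ (2 * k)) sums s \<longleftrightarrow> (\<lambda>k. of_real (c k) * z ^ k) sums s" for s
    proof (rule sums_mono_reindex)
      show "of_real (c n) * z ^ n = 0" if "n \<notin> range (\<lambda>k. 2 * k)" for n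
        using that by (cases "even n") (auto simp: c_def elim!: evenE)
    qed (auto simp: strict_mono_def)
    ultimately show ?thesis by blast
  qed
  from S show "(\<lambda>k. of_real (c k) * z ^ k) sums (of_real ((pi / e) powr (real DIM('a) / 2)) * exp (z\<^sup>2 * of_real
      ((norm \<xi>)\<^sup>2 / (4 * e))))" .
  let ?m = "\<lambda>k. LINT x|lborel. exp (- e * (norm x)\<^sup>2) * (\<xi> \<bullet> x) ^ k"
  have "(\<lambda>k. (c k - ?m k / fact k) * t ^ k) sums 0" for t :: real
  proof -
    have "complex_of_real (exp (- e * (norm x)\<^sup>2)) * exp (complex_of_real t * complex_of_real (\<xi> \<bullet> x)) =
        complex_of_real (exp (- e * (norm x)\<^sup>2) * exp ((t *\<^sub>R \<xi>) \<bullet> x))" for x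
      by (simp only: inner_scaleR_left of_real_mult exp_of_real[symmetric])
    note eq = this
    have "(\<lambda>k. complex_of_real t ^ k / fact k * of_real (?m k)) sums
       of_real ((pi / e) powr (real DIM('a) / 2) * exp ((norm (t *\<^sub>R \<xi>))\<^sup>2 / (4 * e)))"
      using exp_inner_sums(2)[OF _ gaussian_exp_integrable[OF e, of "norm (complex_of_real t) * norm \<xi>"]]
      unfolding eq integral_complex_of_real gaussian_laplace(2)[OF e] by simp
    then have "(\<lambda>k. complex_of_real (t ^ k / fact k * ?m k)) sums
       complex_of_real ((pi / e) powr (real DIM('a) / 2) * exp ((norm (t *\<^sub>R \<xi>))\<^sup>2 / (4 * e)))" by simp
    then have 1: "(\<lambda>k. t ^ k / fact k * ?m k) sums ((pi / e) powr (real DIM('a) / 2) * exp ((norm (t *\<^sub>R \<xi>))\<^sup>2 /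
        (4 * e)))"
      by (simp only: sums_of_real_iff)
    have "(\<lambda>k. c k * t ^ k - t ^ k / fact k * ?m k) sums 0"
      using sums_diff[OF S[of t] 1] by (simp add: power_mult_distrib)
    then show ?thesis by (simp add: algebra_simps)
  qed
  from sums_zero_imp_coeffs_zero[OF this] show "?m k = fact k * c k" by (simp add: field_simps)
qed

lemma gaussian_fourier:
  fixes \<xi> :: "'a::euclidean_space"
  assumes e: "e > 0"
  shows "integrable lborel (\<lambda>x. complex_of_real (exp (- e * (norm x)\<^sup>2)) * exp (\<i> * of_real (\<xi> \<bullet> x)))"
    and "(LINT x|lborel. complex_of_real (exp (- e * (norm x)\<^sup>2)) * exp (\<i> * of_real (\<xi> \<bullet> x))) =
      of_real ((pi / e) powr (real DIM('a) / 2) * exp (- ((norm \<xi>)\<^sup>2 / (4 * e))))"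
proof -
  have i: "integrable lborel (\<lambda>x::'a. exp (- e * (norm x)\<^sup>2) * exp (norm \<i> * norm \<xi> * norm x))"
    using gaussian_exp_integrable[OF e] by simp
  show "integrable lborel (\<lambda>x. complex_of_real (exp (- e * (norm x)\<^sup>2)) * exp (\<i> * of_real (\<xi> \<bullet> x)))"
    using exp_inner_sums(1)[OF _ i] by simp
  have "(\<lambda>k. \<i> ^ k / fact k * of_real (LINT x|lborel. exp (- e * (norm x)\<^sup>2) * (\<xi> \<bullet> x) ^ k)) sums
      (of_real ((pi / e) powr (real DIM('a) / 2)) * exp (\<i>\<^sup>2 * of_real ((norm \<xi>)\<^sup>2 / (4 * e))))"
    using gaussian_moment_sums(2)[OF e, of \<xi> \<i>] unfolding gaussian_moment_sums(1)[OF e]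
        by (simp add: mult.commute)
  with exp_inner_sums(2)[OF _ i]
  show "(LINT x|lborel. complex_of_real (exp (- e * (norm x)\<^sup>2)) * exp (\<i> * of_real (\<xi> \<bullet> x))) =
      of_real ((pi / e) powr (real DIM('a) / 2) * exp (- ((norm \<xi>)\<^sup>2 / (4 * e))))"
    by (auto dest: sums_unique2 simp: exp_of_real[symmetric])
qed

section \<open>Moments of the Askey function and its hypergeometric transform\<close>

lemma Gamma_duplication_real:
  fixes x :: real
  assumes "x > 0"
  shows "Gamma x * Gamma (x + 1 / 2) = 2 powr (1 - 2 * x) * sqrt pi * Gamma (2 * x)"
proof -
  have "complex_of_real y \<notin> \<int>\<^sub>\<le>\<^sub>0" if "y > 0" for y
    using that nonpos_Ints_nonpos[of y] by (auto simp: of_real_in_nonpos_Ints_iff)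
  from this[of x] this[of "x + 1 / 2"] assms
  have "complex_of_real x \<notin> \<int>\<^sub>\<le>\<^sub>0" "complex_of_real x + 1 / 2 \<notin> \<int>\<^sub>\<le>\<^sub>0" by simp_all
  from Gamma_legendre_duplication[OF this]
  have "complex_of_real (Gamma x * Gamma (x + 1 / 2)) = complex_of_real (exp ((1 - 2 * x) * ln 2) * sqrt pi *
      Gamma (2 * x))"
    by (simp add: Gamma_complex_of_real[symmetric] exp_of_real[symmetric])
  then show ?thesis by (simp only: of_real_eq_iff) (simp add: powr_def)
qed

lemma askey_borel [measurable]: "askey \<alpha> \<in> borel_measurable borel"
  unfolding askey_def[abs_def] by measurable

lemma askey_exp_integrable:
  assumes "\<alpha> \<ge> 0"
  shows "integrable lborel (\<lambda>x::'a::euclidean_space. askey \<alpha> x * exp (c * norm x))"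
proof (rule Bochner_Integration.integrable_bound)
  show "integrable lborel (\<lambda>x::'a. exp \<bar>c\<bar> * indicator (cball 0 1) x)"
    by (intro integrable_mult_right integrable_real_indicator) (auto simp: emeasure_cball)
  show "AE x::'a in lborel. norm (askey \<alpha> x * exp (c * norm x)) \<le> norm (exp \<bar>c\<bar> * indicator (cball 0 1)
      x :: real)"
  proof (rule AE_I2)
    fix x :: 'a
    show "norm (askey \<alpha> x * exp (c * norm x)) \<le> norm (exp \<bar>c\<bar> * indicator (cball 0 1) x :: real)"
    proof (cases "norm x \<le> 1")
      case True
      have "c * norm x \<le> \<bar>c\<bar>" using True
        by (metis abs_ge_self abs_ge_zero abs_mult abs_norm_cancel dual_order.trans mult.right_neutral
            mult_left_mono)
      moreover have "askey \<alpha> x \<le> 1" "askey \<alpha> x \<ge> 0" using True assms powr_mono2[of \<alpha> "1 - norm x" 1]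
          by (auto simp: askey_def)
      ultimately show ?thesis using True mult_mono[of "askey \<alpha> x" 1 "exp (c * norm x)" "exp \<bar>c\<bar>"]
          by (simp add: abs_mult)
    qed (simp add: askey_def)
  qed
qed simp

lemma ennreal_mult_eq_imp_divide:
  assumes "ennreal G * V = ennreal M" "G > 0" "M \<ge> 0"
  shows "V = ennreal (M / G)"
proof (cases V)
  case (real v)
  then have "G * v = M" using assms by (simp add: ennreal_mult[symmetric])
  then show ?thesis using real assms(2) by (auto simp: field_simps)
next
  case top
  then show ?thesis using assms by (simp add: ennreal_mult_top)
qed

text \<open>The Gaussian moment for e = 1 is known and determines the integral of the power over the
  unit ball, which is then fed into \<open>askey_homogeneous\<close>. An even exponent makes the
  integrand nonnegative, as the layer-cake lemmas require.\<close>

lemma askey_even_moment: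
  fixes \<xi> :: "'a::euclidean_space"
  assumes \<alpha>: "\<alpha> \<ge> 1"
  shows "(LINT x|lborel. askey \<alpha> x * (\<xi> \<bullet> x) ^ (2 * k)) =
    Gamma (\<alpha> + 1) * Gamma (real (DIM('a) + 2 * k) + 1) / Gamma (real (DIM('a) + 2 * k) + \<alpha> + 1) *
    (pi powr (real DIM('a) / 2) * fact (2 * k) * ((norm \<xi>)\<^sup>2 / 4) ^ k / fact k / Gamma (real (DIM('a) + 2 * k)
        / 2 + 1))"
proof -
  let ?p = "\<lambda>x. (\<xi> \<bullet> x) ^ (2 * k)" and ?N = "real (DIM('a) + 2 * k)"
  let ?M = "pi powr (real DIM('a) / 2) * fact (2 * k) * ((norm \<xi>)\<^sup>2 / 4) ^ k / fact k"
  have p: "?p \<in> borel_measurable borel" "\<And>x. ?p x \<ge> 0" "\<And>c x. c > 0 \<Longrightarrow> ?p (c *\<^sub>R x) = c ^ (2 * k) * ?p x"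
    by (auto simp: power_mult_distrib)
  have G: "Gamma (?N / 2 + 1) > 0" by (rule Gamma_real_pos) (simp add: add_nonneg_pos)
  have i: "integrable lborel (\<lambda>x. exp (- 1 * (norm x)\<^sup>2) * ?p x)"
  proof (rule Bochner_Integration.integrable_bound)
    show "integrable lborel (\<lambda>x. fact (2 * k) * (exp (- 1 * (norm x)\<^sup>2) * exp (norm \<xi> * norm x)))"
      using gaussian_exp_integrable[of 1] by (intro integrable_mult_right) auto
    show "AE x in lborel. norm (exp (- 1 * (norm x)\<^sup>2) * ?p x) \<le> norm (fact (2 * k) * (exp (- 1 * (norm x)\<^sup>2) *
        exp (norm \<xi> * norm x)))"
    proof (rule AE_I2)
      fix x
      have "\<bar>\<xi> \<bullet> x\<bar> ^ (2 * k) \<le> (norm \<xi> * norm x) ^ (2 * k)" by (intro power_mono Cauchy_Schwarz_ineq2) auto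
      also have "\<dots> / fact (2 * k) \<le> exp (norm \<xi> * norm x)"
      proof -
        have "(\<Sum>k\<in>{2 * k}. (norm \<xi> * norm x) ^ k /\<^sub>R fact k) \<le> (\<Sum>k. (norm \<xi> * norm x) ^ k /\<^sub>R fact k)"
          by (intro sum_le_suminf sums_summable[OF exp_converges]) auto
        then show ?thesis by (simp add: exp_def field_simps)
      qed
      then have "(norm \<xi> * norm x) ^ (2 * k) \<le> fact (2 * k) * exp (norm \<xi> * norm x)" by (simp add: field_simps)
      finally have "\<bar>?p x\<bar> \<le> fact (2 * k) * exp (norm \<xi> * norm x)" by (simp add: power_abs[symmetric])
      then show "norm (exp (- 1 * (norm x)\<^sup>2) * ?p x) \<le> norm (fact (2 * k) * (exp (- 1 * (norm x)\<^sup>2) * exp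
          (norm \<xi> * norm x)))"
        using mult_left_mono[of "\<bar>?p x\<bar>" _ "exp (- 1 * (norm x)\<^sup>2)"] by (simp add: abs_mult mult_ac)
    qed
  qed simp
  have "(LINT x|lborel. exp (- 1 * (norm x)\<^sup>2) * ?p x) = ?M"
    using gaussian_moment_sums(1)[of 1 \<xi> "2 * k"] by simp
  then have "(\<integral>\<^sup>+x. ennreal (exp (- 1 * (norm x)\<^sup>2) * ?p x) \<partial>lborel) = ennreal ?M"
    using nn_integral_eq_integral[OF i] by simp
  moreover have "(\<integral>\<^sup>+x. ennreal (exp (- 1 * (norm x)\<^sup>2) * ?p x) \<partial>lborel) =
     ennreal (Gamma (?N / 2 + 1)) * (\<integral>\<^sup>+x. ennreal (?p x) * indicator (cball 0 1) x \<partial>lborel)"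
    using gaussian_homogeneous[OF p, of 1] by simp
  ultimately have "(\<integral>\<^sup>+x. ennreal (?p x) * indicator (cball 0 1) x \<partial>lborel) = ennreal (?M / Gamma (?N / 2 + 1))"
    using G by (intro ennreal_mult_eq_imp_divide[of _ _ ?M]) simp_all
  then have "(\<integral>\<^sup>+x. ennreal (askey \<alpha> x * ?p x) \<partial>lborel) =
      ennreal (Gamma (\<alpha> + 1) * Gamma (?N + 1) / Gamma (?N + \<alpha> + 1)) * ennreal (?M / Gamma (?N / 2 + 1))"
    using askey_homogeneous[OF p \<alpha>] by simp
  also have "\<dots> = ennreal (Gamma (\<alpha> + 1) * Gamma (?N + 1) / Gamma (?N + \<alpha> + 1) * (?M / Gamma (?N / 2 + 1)))"
    using G \<alpha> by (intro ennreal_mult[symmetric]) (auto simp: Gamma_real_pos add_nonneg_pos less_imp_le simp del: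
        of_nat_add)
  finally have "(\<integral>\<^sup>+x. ennreal (askey \<alpha> x * ?p x) \<partial>lborel) = \<dots>" .
  then show ?thesis
    by (subst integral_eq_nn_integral)
      (use G \<alpha> in \<open>auto simp: askey_def Gamma_real_pos add_nonneg_pos less_imp_le simp del: of_nat_add\<close>)
qed

lemma askey_odd_moment:
  fixes \<xi> :: "'a::euclidean_space"
  assumes "odd k"
  shows "(LINT x|lborel. askey \<alpha> x * (\<xi> \<bullet> x) ^ k) = 0"
proof -
  have "(LINT x|lborel. askey \<alpha> (- x) * (\<xi> \<bullet> (- x)) ^ k) = (LINT x|lborel. askey \<alpha> x * (\<xi> \<bullet> x) ^ k)"
    by (rule integral_lborel_uminus) simp
  then show ?thesis using assms by (simp add: askey_def)
qed

text \<open>Gamma at n + 2 k + 1 and at n + \<alpha> + 2 k + 1 splits by duplication into 4^k times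
  two Pochhammer symbols. One of the upper pair, \<open>pochhammer (real n / 2 + 1) k\<close>,
  cancels against Gamma (n/2 + k + 1). One symbol above and two below remain, the shape of 1F2. X
  stands for the k-th power of - |\<xi>|^2 / 4.\<close>

lemma askey_moment_eq_coeff:
  fixes \<alpha> :: real
  assumes \<alpha>: "\<alpha> \<ge> 1" and n: "n > 0"
  shows "Gamma (\<alpha> + 1) * Gamma (real (n + 2 * k) + 1) / Gamma (real (n + 2 * k) + \<alpha> + 1) *
    (pi powr (real n / 2) * X / fact k / Gamma (real (n + 2 * k) / 2 + 1)) =
    gamma_const n \<alpha> * (pochhammer ((real n + 1) / 2) k /
      (fact k * (pochhammer ((real n + \<alpha> + 1) / 2) k * pochhammer ((real n + \<alpha> + 2) / 2) k)) * X)"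
proof -
  have pos: "Gamma (real n / 2 + 1) > 0" "Gamma (real n + \<alpha> + 1) > 0" "Gamma (real n + 1) > 0" "Gamma (\<alpha> + 1)
      > 0"
    using \<alpha> by (auto intro!: Gamma_real_pos add_nonneg_pos)
  have poch: "Gamma (x + real m) = Gamma x * pochhammer x m" if "x > 0" for x m
  proof -
    have "x \<notin> \<int>\<^sub>\<le>\<^sub>0" using that nonpos_Ints_nonpos[of x] by auto
    moreover from this have "Gamma x \<noteq> 0" by (simp add: Gamma_eq_zero_iff)
    ultimately show ?thesis by (simp add: pochhammer_Gamma)
  qed
  have ppos: "pochhammer (real n / 2 + 1) k > 0" "pochhammer ((real n + \<alpha> + 1) / 2) k > 0" "pochhammer
      ((real n + \<alpha> + 2) / 2) k > 0"
    using \<alpha> by (auto intro!: pochhammer_pos add_nonneg_pos)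
  have 1: "Gamma (real (n + 2 * k) + 1) = Gamma (real n + 1) * (4 ^ k * pochhammer ((real n + 1) / 2) k *
      pochhammer (real n / 2 + 1) k)"
    using poch[of "real n + 1" "2 * k"] pochhammer_double[of "(real n + 1) / 2" k]
    by (simp add: add_ac power_mult add_divide_distrib)
  have 2: "Gamma (real (n + 2 * k) + \<alpha> + 1) = Gamma (real n + \<alpha> + 1) * (4 ^ k * pochhammer ((real n + \<alpha> + 1)
      / 2) k * pochhammer ((real n + \<alpha> + 2) / 2) k)"
  proof -
    have e: "(real n + \<alpha> + 1) / 2 + 1 / 2 = (real n + \<alpha> + 2) / 2" "2 * ((real n + \<alpha> + 1) / 2) = real n + \<alpha> + 1"
      "real (n + 2 * k) + \<alpha> + 1 = real n + \<alpha> + 1 + real (2 * k)" by (simp_all add: field_simps)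
    show ?thesis
      using poch[of "real n + \<alpha> + 1" "2 * k"] pochhammer_double[of "(real n + \<alpha> + 1) / 2" k] \<alpha>
      unfolding e by (simp add: power_mult)
  qed
  have 3: "Gamma (real (n + 2 * k) / 2 + 1) = Gamma (real n / 2 + 1) * pochhammer (real n / 2 + 1) k"
    using poch[of "real n / 2 + 1" k] by (simp add: add_ac add_divide_distrib)
  \<comment> \<open>Legendre duplication trades Gamma (n + 1) / Gamma (n/2 + 1) for 2^n Gamma ((n +
    1) / 2) / sqrt pi, the form in which \<open>gamma_const\<close> is written.\<close>
  have "Gamma ((real n + 1) / 2) * Gamma (real n / 2 + 1) = 2 powr (- real n) * sqrt pi * Gamma (real n + 1)"
    using Gamma_duplication_real[of "(real n + 1) / 2"] by (simp add: add_divide_distrib add_ac)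
  then have du: "2 ^ n * (Gamma ((real n + 1) / 2) * Gamma (real n / 2 + 1)) = sqrt pi * Gamma (real n + 1)"
    by (simp add: powr_minus powr_realpow)
  have pp: "pi powr (real n / 2) = pi powr ((real n - 1) / 2) * sqrt pi"
    by (simp add: powr_half_sqrt[symmetric] powr_add[symmetric] diff_divide_distrib)
  have g: "gamma_const n \<alpha> = Gamma (\<alpha> + 1) * Gamma (real n + 1) * pi powr (real n / 2) / (Gamma (real n + \<alpha> + 1)
      * Gamma (real n / 2 + 1))"
  proof -
    have alg: "q * P' * A * Ga / R = A * Gn * (P' * sp) / (R * Gh)"
      if "q * (Ga * Gh) = sp * Gn" "Gh > 0" for q P' A Ga R Gn sp Gh :: real
    proof -
      have "A * Gn * (P' * sp) = A * P' * (sp * Gn)" by (simp only: mult_ac)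
      also have "\<dots> = (q * P' * A * Ga) * Gh" unfolding that(1)[symmetric] by (simp only: mult_ac)
      finally have "A * Gn * (P' * sp) / (R * Gh) = ((q * P' * A * Ga) * Gh) / (R * Gh)" by (rule arg_cong)
      then show ?thesis using that(2) by simp
    qed
    show ?thesis unfolding gamma_const_def pp add.commute[of \<alpha> "real n"] by (rule alg[OF du pos(1)])
  qed
  have alg: "a * (b * (q * A * H)) / (r * (q * B1 * B2)) * (P * X / f / (h * H)) =
      a * b * P / (r * h) * (A / (f * (B1 * B2)) * X)"
    if "q \<noteq> 0" "H \<noteq> 0" for a b q A H r B1 B2 P X f h :: real
    using that by simp (simp add: mult_ac)
  show ?thesis unfolding 1 2 3 g by (rule alg) (use ppos in auto)
qed

text \<open>The series of \<open>exp_inner_sums\<close> at z = -i: odd moments vanish by reflection,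
  and the even ones match the hypergeometric coefficients one by one.\<close>

theorem fourier_L1_askey:
  fixes \<xi> :: "'a::euclidean_space"
  assumes \<alpha>: "\<alpha> \<ge> 1"
  shows "fourier_L1 (\<lambda>x::'a. complex_of_real (askey \<alpha> x)) \<xi> = complex_of_real (gamma_const DIM('a) \<alpha> *
      Lambda_fun DIM('a) \<alpha> (norm \<xi>))"
    and "summable (\<lambda>k. pochhammer ((real DIM('a) + 1) / 2) k /
      (fact k * (pochhammer ((real DIM('a) + \<alpha> + 1) / 2) k * pochhammer ((real DIM('a) + \<alpha> + 2) / 2) k)) * (-
          ((norm \<xi>)\<^sup>2) / 4) ^ k)"
proof -
  let ?n = "DIM('a)"
  let ?c = "\<lambda>k. pochhammer ((real ?n + 1) / 2) k /
      (fact k * (pochhammer ((real ?n + \<alpha> + 1) / 2) k * pochhammer ((real ?n + \<alpha> + 2) / 2) k)) * (- ((norm \<xi>)\<^sup>2)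
          / 4) ^ k"
  let ?m = "\<lambda>k. LINT x|lborel. askey \<alpha> x * (\<xi> \<bullet> x) ^ k"
  have g: "gamma_const ?n \<alpha> \<noteq> 0"
  proof -
    have "Gamma (\<alpha> + 1) > 0" "Gamma ((real ?n + 1) / 2) > 0" "Gamma (\<alpha> + real ?n + 1) > 0"
      using \<alpha> by (intro Gamma_real_pos; simp)+
    then show ?thesis unfolding gamma_const_def
      by (metis divide_eq_0_iff less_irrefl mult_eq_0_iff pi_neq_zero power_not_zero powr_eq_0_iff
          zero_neq_numeral)
  qed
  have "(\<lambda>k. (- \<i>) ^ k / fact k * of_real (?m k)) sums fourier_L1 (\<lambda>x. complex_of_real (askey \<alpha> x)) \<xi>"
    unfolding fourier_L1_def using exp_inner_sums(2)[of "askey \<alpha>" "- \<i>" \<xi>] askey_exp_integrable[of \<alpha> "norm \<xi>"] \<alpha>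
    by (simp add: mult.commute)
  also have "?this \<longleftrightarrow> (\<lambda>k. (- \<i>) ^ (2 * k) / fact (2 * k) * of_real (?m (2 * k))) sums fourier_L1
      (\<lambda>x. complex_of_real (askey \<alpha> x)) \<xi>"
  proof (rule sums_mono_reindex[symmetric])
    fix k :: nat assume "k \<notin> range (\<lambda>k. 2 * k)"
    then have "odd k" by (auto elim!: evenE)
    then show "(- \<i>) ^ k / fact k * of_real (?m k) = 0" by (simp add: askey_odd_moment)
  qed (auto simp: strict_mono_def)
  also have "(\<lambda>k. (- \<i>) ^ (2 * k) / fact (2 * k) * of_real (?m (2 * k))) =
      (\<lambda>k. complex_of_real (gamma_const ?n \<alpha> * ?c k))"
  proof
    fix k
    have "(- \<i>) ^ (2 * k) = complex_of_real ((- 1) ^ k)" by (simp add: power_mult)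
    then have "(- \<i>) ^ (2 * k) / fact (2 * k) * of_real (?m (2 * k)) =
        complex_of_real ((- 1) ^ k / fact (2 * k) * ?m (2 * k))" by simp
    also have "(- 1) ^ k / fact (2 * k) * ?m (2 * k) = Gamma (\<alpha> + 1) * Gamma (real (?n + 2 * k) + 1) / Gamma
        (real (?n + 2 * k) + \<alpha> + 1) *
       (pi powr (real ?n / 2) * (- ((norm \<xi>)\<^sup>2) / 4) ^ k / fact k / Gamma (real (?n + 2 * k) / 2 + 1))"
    proof -
      have "(- ((norm \<xi>)\<^sup>2) / 4) ^ k = (- 1) ^ k * ((norm \<xi>)\<^sup>2 / 4) ^ k"
        by (simp add: power_mult_distrib[symmetric])
      moreover have "s / F * (G * (P * F * X / f / H)) = G * (P * (s * X) / f / H)" if "F \<noteq> 0"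
          for s F G P X f H :: real
        using that by simp
      ultimately show ?thesis unfolding askey_even_moment[OF \<alpha>] by simp
    qed
    also have "\<dots> = gamma_const ?n \<alpha> * ?c k" by (rule askey_moment_eq_coeff[OF \<alpha>]) simp
    finally show "(- \<i>) ^ (2 * k) / fact (2 * k) * of_real (?m (2 * k)) =
        complex_of_real (gamma_const ?n \<alpha> * ?c k)" .
  qed
  finally have s: "(\<lambda>k. complex_of_real (gamma_const ?n \<alpha> * ?c k)) sums fourier_L1 (\<lambda>x. complex_of_real
      (askey \<alpha> x)) \<xi>" .
  \<comment> \<open>\<open>Lambda_fun\<close> is a \<open>suminf\<close>, meaningful only for a
    convergent series. Convergence is inherited from the series of the transform, after division by
    the nonzero \<open>gamma_const\<close>.\<close>
  have "summable (\<lambda>k. Re (complex_of_real (gamma_const ?n \<alpha> * ?c k)))"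
    by (rule summable_Re[OF sums_summable[OF s]])
  then have "summable (\<lambda>k. gamma_const ?n \<alpha> * ?c k)" by (simp only: Re_complex_of_real)
  then show sm: "summable ?c" using g by (simp only: summable_cmult_iff) simp
  have L: "Lambda_fun ?n \<alpha> (norm \<xi>) = (\<Sum>k. ?c k)" by (simp add: Lambda_fun_def gen_hypergeometric_def)
  note r = sums_of_real[OF sums_mult[OF summable_sums[OF sm], of "gamma_const ?n \<alpha>"], where 'a=complex]
  from sums_unique2[OF s r] show "fourier_L1 (\<lambda>x::'a. complex_of_real (askey \<alpha> x)) \<xi> =
      complex_of_real (gamma_const ?n \<alpha> * Lambda_fun ?n \<alpha> (norm \<xi>))"
    unfolding L .
qed

section \<open>Two-sided decay of the transform\<close>

definition entire_coeffs :: "(nat \<Rightarrow> real) \<Rightarrow> bool" where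
  "entire_coeffs c \<longleftrightarrow> (\<forall>R. summable (\<lambda>k. \<bar>c k\<bar> * R ^ k))"

definition evser :: "(nat \<Rightarrow> real) \<Rightarrow> real \<Rightarrow> real" where
  "evser c x = (\<Sum>k. c k * x ^ (2 * k))"

lemma entire_coeffs_summable:
  assumes "entire_coeffs c" shows "summable (\<lambda>k. c k * y ^ k)"
proof (rule summable_comparison_test')
  show "summable (\<lambda>k. \<bar>c k\<bar> * \<bar>y\<bar> ^ k)" using assms by (simp add: entire_coeffs_def)
  show "norm (c n * y ^ n) \<le> \<bar>c n\<bar> * \<bar>y\<bar> ^ n" if "n \<ge> 0" for n by (simp add: abs_mult power_abs)
qed

lemma entire_coeffs_bound:
  assumes "entire_coeffs c" "B \<ge> 0" "\<And>k. \<bar>d k\<bar> \<le> M * B ^ k * \<bar>c k\<bar>"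
  shows "entire_coeffs d"
  unfolding entire_coeffs_def
proof
  fix R :: real
  have "summable (\<lambda>k. M * (\<bar>c k\<bar> * (B * \<bar>R\<bar>) ^ k))"
    using assms(1) by (intro summable_mult) (simp add: entire_coeffs_def)
  then show "summable (\<lambda>k. \<bar>d k\<bar> * R ^ k)"
  proof (rule summable_comparison_test')
    fix n :: nat
    have "norm (\<bar>d n\<bar> * R ^ n) = \<bar>d n\<bar> * \<bar>R\<bar> ^ n" by (simp add: abs_mult power_abs)
    also have "\<dots> \<le> M * B ^ n * \<bar>c n\<bar> * \<bar>R\<bar> ^ n" by (intro mult_right_mono assms) auto
    finally show "norm (\<bar>d n\<bar> * R ^ n) \<le> M * (\<bar>c n\<bar> * (B * \<bar>R\<bar>) ^ n)" by (simp add: power_mult_distrib mult_ac)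
  qed
qed

lemma entire_coeffs_ratio:
  assumes "\<And>k. \<bar>c (Suc k)\<bar> \<le> B / real (Suc k) * \<bar>c k\<bar>"
  shows "entire_coeffs c"
proof -
  have B: "0 \<le> B \<or> c 0 = 0" using assms[of 0] by (cases "c 0 = 0") (auto simp: zero_le_mult_iff dest:
      order_trans[OF abs_ge_zero])
  have le: "\<bar>c k\<bar> \<le> \<bar>c 0\<bar> * \<bar>B\<bar> ^ k * \<bar>inverse (fact k)\<bar>" for k
  proof (induction k)
    case (Suc k)
    have "\<bar>c (Suc k)\<bar> \<le> \<bar>B\<bar> / real (Suc k) * \<bar>c k\<bar>"
      using assms[of k] by (rule order_trans) (intro mult_right_mono divide_right_mono; simp)
    also have "\<dots> \<le> \<bar>B\<bar> / real (Suc k) * (\<bar>c 0\<bar> * \<bar>B\<bar> ^ k * \<bar>inverse (fact k)\<bar>)"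
      by (intro mult_left_mono Suc.IH) auto
    also have "\<dots> = \<bar>c 0\<bar> * \<bar>B\<bar> ^ Suc k * \<bar>inverse (fact (Suc k))\<bar>" by (simp add: field_simps)
    finally show ?case .
  qed simp
  have "entire_coeffs (\<lambda>k. inverse (fact k))"
    unfolding entire_coeffs_def using summable_exp[of "R::real" for R] by simp
  from entire_coeffs_bound[OF this _ le] show ?thesis by simp
qed

lemma evser_sums:
  assumes "entire_coeffs c" shows "(\<lambda>k. c k * x ^ (2 * k)) sums evser c x"
  unfolding evser_def using entire_coeffs_summable[OF assms, of "x\<^sup>2"]
  by (intro summable_sums) (simp add: power_mult)

lemma evser_0 [simp]: "evser c 0 = c 0"
  unfolding evser_def using powser_zero[of c] by (simp add: power_mult)

text \<open>A power series in x^2, differentiated by the chain rule. The result is reported as x D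
  (the Euler operator), because this keeps the series even: each x^(2 k) is merely multiplied by 2
  k.\<close>

lemma evser_has_derivative:
  assumes "entire_coeffs c"
  shows "\<exists>D. (evser c has_real_derivative D) (at x) \<and> x * D = evser (\<lambda>k. real (2 * k) * c k) x"
proof -
  have s: "summable (\<lambda>k. c k * y ^ k)" for y using entire_coeffs_summable[OF assms] .
  have d: "((\<lambda>y. \<Sum>k. c k * y ^ k) has_real_derivative (\<Sum>k. diffs c k * y ^ k)) (at y)" for y
    by (rule termdiffs_strong_converges_everywhere[OF s])
  have e: "evser c = (\<lambda>x. \<Sum>k. c k * (x\<^sup>2) ^ k)" by (simp add: evser_def fun_eq_iff power_mult)
  have D: "(evser c has_real_derivative (\<Sum>k. diffs c k * (x\<^sup>2) ^ k) * (2 * x)) (at x)"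
    unfolding e by (rule DERIV_chain2[OF d]) (auto intro!: derivative_eq_intros)
  have "(\<lambda>k. diffs c k * (x\<^sup>2) ^ k) sums (\<Sum>k. diffs c k * (x\<^sup>2) ^ k)"
    by (intro summable_sums termdiff_converges_all s)
  note m = sums_mult[OF this, of "2 * x\<^sup>2"]
  have "(\<lambda>k. real (2 * Suc k) * c (Suc k) * x ^ (2 * Suc k)) sums (2 * x\<^sup>2 * (\<Sum>k. diffs c k * (x\<^sup>2) ^ k))"
  proof -
    have "2 * x\<^sup>2 * (diffs c k * (x\<^sup>2) ^ k) = real (2 * Suc k) * c (Suc k) * x ^ (2 * Suc k)" for k
      unfolding power_mult[of x 2] by (simp add: diffs_def)
    with m show ?thesis by (simp only:)
  qed
  then have "(\<lambda>k. real (2 * k) * c k * x ^ (2 * k)) sums (2 * x\<^sup>2 * (\<Sum>k. diffs c k * (x\<^sup>2) ^ k))"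
    by (subst (asm) sums_Suc_iff) simp
  then have "x * ((\<Sum>k. diffs c k * (x\<^sup>2) ^ k) * (2 * x)) = evser (\<lambda>k. real (2 * k) * c k) x"
    by (simp add: evser_def sums_iff power2_eq_square mult_ac)
  with D show ?thesis by blast
qed

lemma continuous_on_evser [continuous_intros]:
  assumes "entire_coeffs c" "continuous_on S f" shows "continuous_on S (\<lambda>x. evser c (f x))"
proof -
  have "continuous_on UNIV (evser c)"
    unfolding continuous_on_eq_continuous_at[OF open_UNIV] using evser_has_derivative[OF assms(1)] DERIV_isCont
        by blast
  from continuous_on_compose2[OF this assms(2)] show ?thesis by auto
qed

lemma entire_coeffs_linear:
  assumes "entire_coeffs c" shows "entire_coeffs (\<lambda>k. (p + real (2 * k)) * c k)"
proof (rule entire_coeffs_bound[OF assms])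
  fix k
  have 1: "real k \<le> 2 ^ k" using of_nat_less_two_power[of k, where 'a=real] by simp
  have 2: "\<bar>p\<bar> \<le> \<bar>p\<bar> * 2 ^ k" by (simp add: mult_le_cancel_left1)
  have "\<bar>p + real (2 * k)\<bar> \<le> \<bar>p\<bar> * 2 ^ k + 2 * 2 ^ k" using 1 2 by linarith
  then have "\<bar>p + real (2 * k)\<bar> \<le> (\<bar>p\<bar> + 2) * 2 ^ k" by (simp only: distrib_right)
  then show "\<bar>(p + real (2 * k)) * c k\<bar> \<le> (\<bar>p\<bar> + 2) * 2 ^ k * \<bar>c k\<bar>"
    unfolding abs_mult by (rule mult_right_mono) simp
qed simp

lemma powr_evser_has_derivative:
  assumes c: "entire_coeffs c" and t: "t > 0"
  shows "((\<lambda>t. t powr p * evser c t) has_real_derivative t powr (p - 1) * evser (\<lambda>k. (p + real (2 * k)) * c k)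
      t) (at t)"
proof -
  obtain D where D: "(evser c has_real_derivative D) (at t)" "t * D = evser (\<lambda>k. real (2 * k) * c k) t"
    using evser_has_derivative[OF c] by blast
  have d: "evser (\<lambda>k. (0 + real (2 * k)) * c k) t = t * D" using D(2) by simp
  have "(\<lambda>k. p * (c k * t ^ (2 * k)) + (0 + real (2 * k)) * c k * t ^ (2 * k)) sums (p * evser c t + evser (\<lambda>k.
      (0 + real (2 * k)) * c k) t)"
    by (intro sums_add sums_mult evser_sums c entire_coeffs_linear)
  note m = this
  have e: "evser (\<lambda>k. (p + real (2 * k)) * c k) t = p * evser c t + t * D"
  proof -
    have f: "(\<lambda>k. p * (c k * t ^ (2 * k)) + (0 + real (2 * k)) * c k * t ^ (2 * k)) =
        (\<lambda>k. (p + real (2 * k)) * c k * t ^ (2 * k))"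
      by (simp add: fun_eq_iff algebra_simps)
    from m show ?thesis unfolding f d evser_def[of "\<lambda>k. (p + real (2 * k)) * c k"]
        by (rule sums_unique[symmetric])
  qed
  have "t powr p = t powr (p - 1) * t" using t by (simp add: powr_diff)
  then have "p * t powr (p - 1) * evser c t + D * t powr p = t powr (p - 1) * evser (\<lambda>k. (p + real (2 * k)) *
      c k) t"
    unfolding e by (simp add: algebra_simps)
  moreover have "((\<lambda>t. t powr p * evser c t) has_real_derivative p * t powr (p - 1) * evser c t + D * t powr p)
      (at t)"
    using t by (auto intro!: derivative_eq_intros D(1))
  ultimately show ?thesis by simp
qed

text \<open>Integrating an even power series against a weight on the unit interval multiplies its
  coefficients by the moments of the weight.\<close>

lemma evser_integral:
  assumes c: "entire_coeffs c" and w: "integrable lborel w" and supp: "\<And>x. x \<notin> {0..1} \<Longrightarrow> w x = 0"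
  shows "integrable lborel (\<lambda>x. w x * evser c (t * x))"
    and "(\<lambda>k. c k * t ^ (2 * k) * (LINT x|lborel. w x * x ^ (2 * k))) sums (LINT x|lborel. w x * evser c (t *
        x))"
proof -
  have [measurable]: "w \<in> borel_measurable borel" using w by auto
  have [measurable]: "(\<lambda>x. evser c (t * x)) \<in> borel_measurable borel"
    by (intro borel_measurable_continuous_onI continuous_intros c)
  let ?B = "\<Sum>k. \<bar>c k\<bar> * (t\<^sup>2) ^ k"
  have S: "summable (\<lambda>k. \<bar>c k\<bar> * (t\<^sup>2) ^ k)" using c by (simp add: entire_coeffs_def)
  have tb: "\<bar>w x * (c k * (t * x) ^ (2 * k))\<bar> \<le> \<bar>w x\<bar> * (\<bar>c k\<bar> * (t\<^sup>2) ^ k)" for k x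
  proof (cases "x \<in> {0..1}")
    case True
    then have "\<bar>(t * x) ^ (2 * k)\<bar> \<le> (t\<^sup>2) ^ k"
      by (simp add: power_mult_distrib power_mult[symmetric] abs_mult power_le_one mult_left_le
          power_abs[symmetric])
    then show ?thesis by (simp add: abs_mult mult_left_mono)
  qed (simp add: supp)
  have bnd: "AE x in lborel. norm (\<Sum>k<N. w x * (c k * (t * x) ^ (2 * k))) \<le> ?B * \<bar>w x\<bar>" for N
  proof (rule AE_I2)
    fix x
    have "norm (\<Sum>k<N. w x * (c k * (t * x) ^ (2 * k))) \<le> (\<Sum>k<N. \<bar>w x\<bar> * (\<bar>c k\<bar> * (t\<^sup>2) ^ k))"
      by (rule order_trans[OF norm_sum]) (intro sum_mono, simp only: real_norm_def tb)
    also have "\<dots> \<le> \<bar>w x\<bar> * ?B"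
      unfolding sum_distrib_left[symmetric] by (intro mult_left_mono sum_le_suminf S) auto
    finally show "norm (\<Sum>k<N. w x * (c k * (t * x) ^ (2 * k))) \<le> ?B * \<bar>w x\<bar>" by (simp add: mult.commute)
  qed
  have i: "integrable lborel (\<lambda>x. ?B * \<bar>w x\<bar>)" using w by simp
  have lim: "AE x in lborel. (\<lambda>N. \<Sum>k<N. w x * (c k * (t * x) ^ (2 * k))) \<longlonglongrightarrow> w x * evser c (t * x)"
    unfolding sum_distrib_left[symmetric]
    by (intro AE_I2 tendsto_mult tendsto_const evser_sums[OF c, unfolded sums_def])
  show "integrable lborel (\<lambda>x. w x * evser c (t * x))"
    by (rule integrable_dominated_convergence[OF _ _ i lim bnd]) auto
  have "(\<lambda>N. LINT x|lborel. (\<Sum>k<N. w x * (c k * (t * x) ^ (2 * k)))) \<longlonglongrightarrow> (LINT x|lborel. w x * evser c (t * x))"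
    by (rule integral_dominated_convergence[OF _ _ i lim bnd]) auto
  moreover have "(LINT x|lborel. (\<Sum>k<N. w x * (c k * (t * x) ^ (2 * k)))) =
      (\<Sum>k<N. c k * t ^ (2 * k) * (LINT x|lborel. w x * x ^ (2 * k)))" for N
  proof (subst Bochner_Integration.integral_sum)
    fix k
    show "integrable lborel (\<lambda>x. w x * (c k * (t * x) ^ (2 * k)))"
      by (rule Bochner_Integration.integrable_bound[of _ "\<lambda>x. (\<bar>c k\<bar> * (t\<^sup>2) ^ k) * w x"])
        (use w tb in \<open>auto simp: abs_mult mult_ac\<close>)
  next
    have "(\<lambda>x. w x * (c k * (t * x) ^ (2 * k))) = (\<lambda>x. c k * t ^ (2 * k) * (w x * x ^ (2 * k)))" for k
      by (simp add: fun_eq_iff power_mult_distrib)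
    then show "(\<Sum>k<N. LINT x|lborel. w x * (c k * (t * x) ^ (2 * k))) =
        (\<Sum>k<N. c k * t ^ (2 * k) * (LINT x|lborel. w x * x ^ (2 * k)))"
      by simp
  qed
  ultimately show "(\<lambda>k. c k * t ^ (2 * k) * (LINT x|lborel. w x * x ^ (2 * k))) sums (LINT x|lborel. w x *
      evser c (t * x))"
    by (simp add: sums_def)
qed

text \<open>\<open>\<Lambda>\<close> is a multiple of \<open>evser (gs a q)\<close> with \<open>a = (d + 1) / 2\<close> and \<open>q = d + \<alpha> + 1\<close>. Normalising by
  \<open>1 / Gamma q\<close> makes differentiation of \<open>t powr (q - 1) * evser (gs a q) t\<close> lower \<open>q\<close> by one.\<close>

definition gs :: "real \<Rightarrow> real \<Rightarrow> nat \<Rightarrow> real" where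
  "gs a q k = (- 1) ^ k * pochhammer a k / (fact k * Gamma (q + real (2 * k)))"

text \<open>With x = q + 2 k, consecutive coefficients have ratio (a + k) / ((k + 1) x (x + 1)) in
  absolute value, and a + k <= (a / q + 1) x.\<close>

lemma entire_coeffs_gs:
  assumes "a > 0" "q > 0" shows "entire_coeffs (gs a q)"
proof (rule entire_coeffs_ratio)
  fix k
  let ?x = "q + real (2 * k)"
  have x: "?x > 0" "?x \<notin> \<int>\<^sub>\<le>\<^sub>0" "?x + 1 \<notin> \<int>\<^sub>\<le>\<^sub>0" using assms nonpos_Ints_nonpos[of ?x] nonpos_Ints_nonpos[of
      "?x + 1"] by auto
  have "Gamma (q + real (2 * Suc k)) = (?x + 1) * (?x * Gamma ?x)"
    using Gamma_plus1[OF x(3)] Gamma_plus1[OF x(2)] by (simp add: add_ac)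
  note g = this
  have G: "Gamma ?x > 0" using x(1) by (rule Gamma_real_pos)
  have "gs a q (Suc k) = - (gs a q k * ((a + real k) / ((?x + 1) * ?x) / real (Suc k)))"
  proof -
    have "(- 1 * s) * (P * A) / ((K * f) * (y * (x * G))) = - ((s * P / (f * G)) * (A / (y * x) / K))"
        for s P A K f y x G :: real
      by (simp add: mult_ac)
    then show ?thesis unfolding gs_def pochhammer_Suc fact_Suc power_Suc g by (simp only: of_nat_id)
  qed
  then have "\<bar>gs a q (Suc k)\<bar> = \<bar>gs a q k\<bar> * ((a + real k) / ((?x + 1) * ?x) / real (Suc k))"
    using assms x by (simp add: abs_mult)
  also have "\<dots> \<le> \<bar>gs a q k\<bar> * ((a / q + 1) / real (Suc k))"
  proof (intro mult_left_mono divide_right_mono)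
    have "a * q + real k * q \<le> a * q + q * q + 2 * real k * a + 2 * real k * q" using assms by simp
    then have "a + real k \<le> (a / q + 1) * ?x" using assms by (simp add: field_simps)
    also have "\<dots> \<le> (a / q + 1) * ((?x + 1) * ?x)" using assms x by (intro mult_left_mono) auto
    finally show "(a + real k) / ((?x + 1) * ?x) \<le> a / q + 1" using x by (simp add: divide_le_eq)
  qed auto
  finally show "\<bar>gs a q (Suc k)\<bar> \<le> (a / q + 1) / real (Suc k) * \<bar>gs a q k\<bar>" by (simp add: mult.commute)
qed

lemma gs_diff:
  assumes "q > 0" shows "(q + real (2 * k)) * gs a (q + 1) k = gs a q k"
proof -
  have x: "q + real (2 * k) > 0" "q + real (2 * k) \<notin> \<int>\<^sub>\<le>\<^sub>0" using assms nonpos_Ints_nonpos[of "q + real (2 *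
      k)"] by auto
  have "q + 1 + real (2 * k) = q + real (2 * k) + 1" by simp
  then have "Gamma (q + 1 + real (2 * k)) = (q + real (2 * k)) * Gamma (q + real (2 * k))"
    using Gamma_plus1[OF x(2)] by (simp only:)
  then show ?thesis using x(1) by (simp add: gs_def)
qed

lemma Gs_has_derivative:
  assumes "a > 0" "q > 0" "t > 0"
  shows "((\<lambda>t. t powr q * evser (gs a (q + 1)) t) has_real_derivative t powr (q - 1) * evser (gs a q) t) (at t)"
proof -
  have "entire_coeffs (gs a (q + 1))" using assms by (intro entire_coeffs_gs) auto
  from powr_evser_has_derivative[OF this \<open>t > 0\<close>, of q] show ?thesis unfolding gs_diff[OF \<open>q > 0\<close>] .
qed

text \<open>On coefficients: (a + 1)_(k+1) - (k + 1) (a + 1)_k = (a)_(k+1), with q + 2 matching the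
  extra t^2. For Laplace transforms it says that (1 + s^(-2)) times (1 + s^(-2))^(-a-1) is (1 +
  s^(-2))^(-a).\<close>

lemma gs_rec:
  assumes "a > 0" "q > 0"
  shows "evser (gs (a + 1) q) t + t\<^sup>2 * evser (gs (a + 1) (q + 2)) t = evser (gs a q) t"
proof -
  have e: "gs (a + 1) q (Suc k) + gs (a + 1) (q + 2) k = gs a q (Suc k)" for k
  proof -
    have alg: "(- 1 * s) * (P * (a + K)) / (K * f * G) + s * P / (f * G) = (- 1 * s) * (a * P) / (K * f * G)"
      if "K \<noteq> 0" "f \<noteq> 0" "G \<noteq> 0" for s P K f G :: real
      using that by (simp add: field_simps)
    have "pochhammer a (Suc k) = a * pochhammer (a + 1) k" by (rule pochhammer_rec)
    moreover have "pochhammer (a + 1) (Suc k) = pochhammer (a + 1) k * (a + 1 + real k)"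
        by (rule pochhammer_Suc)
    moreover have "q + 2 + real (2 * k) = q + real (2 * Suc k)" by simp
    moreover have "Gamma (q + real (2 * Suc k)) > 0" using assms by (intro Gamma_real_pos) auto
    moreover have "fact (Suc k) = (1 + real k) * fact k" by simp
    ultimately show ?thesis unfolding gs_def using alg[of "1 + real k" "fact k" "Gamma (q + real (2 * Suc k))"
        "(- 1) ^ k"]
      by (simp only: power_Suc add.assoc) simp
  qed
  have 1: "(\<lambda>k. gs (a + 1) q (Suc k) * t ^ (2 * Suc k)) sums (evser (gs (a + 1) q) t - gs (a + 1) q 0)"
    using evser_sums[OF entire_coeffs_gs[of "a + 1" q], of t] assms by (subst sums_Suc_iff) simp
  have 2: "(\<lambda>k. t\<^sup>2 * (gs (a + 1) (q + 2) k * t ^ (2 * k))) sums (t\<^sup>2 * evser (gs (a + 1) (q + 2)) t)"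
    using assms by (intro sums_mult evser_sums entire_coeffs_gs) auto
  have "(\<lambda>k. gs a q (Suc k) * t ^ (2 * Suc k)) sums (evser (gs (a + 1) q) t - gs (a + 1) q 0 + t\<^sup>2 * evser (gs
      (a + 1) (q + 2)) t)"
    using sums_add[OF 1 2] by (simp add: e[symmetric] algebra_simps power2_eq_square)
  moreover have "(\<lambda>k. gs a q (Suc k) * t ^ (2 * Suc k)) sums (evser (gs a q) t - gs a q 0)"
    using evser_sums[OF entire_coeffs_gs[of a q], of t] assms by (subst sums_Suc_iff) simp
  ultimately have "evser (gs (a + 1) q) t - gs (a + 1) q 0 + t\<^sup>2 * evser (gs (a + 1) (q + 2)) t =
      evser (gs a q) t - gs a q 0"
    by (rule sums_unique2)
  then show ?thesis by (simp add: gs_def)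
qed

text \<open>By duplication the two lower Pochhammer symbols multiply to
  \<open>pochhammer q (2 * k)\<close> divided by 4^k, and this 4^k cancels the one in (- r^2 /
  4)^k.\<close>

lemma Lambda_fun_eq_evser:
  assumes "\<alpha> > 0"
  shows "Lambda_fun n \<alpha> r = Gamma (real n + \<alpha> + 1) * evser (gs ((real n + 1) / 2) (real n + \<alpha> + 1)) r"
proof -
  let ?q = "real n + \<alpha> + 1" and ?a = "(real n + 1) / 2"
  have q: "?q > 0" "?q \<notin> \<int>\<^sub>\<le>\<^sub>0" using assms nonpos_Ints_nonpos[of ?q] by auto
  have G: "Gamma ?q > 0" using q by (intro Gamma_real_pos)
  have "pochhammer ?a k / (fact k * (pochhammer ((real n + \<alpha> + 1) / 2) k * pochhammer ((real n + \<alpha> + 2) / 2) k))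
      * (- (r\<^sup>2) / 4) ^ k
     = Gamma ?q * (gs ?a ?q k * r ^ (2 * k))" for k
  proof -
    have e: "?q / 2 + 1 / 2 = (real n + \<alpha> + 2) / 2" "2 * (?q / 2) = ?q" by (simp_all add: field_simps)
    have "Gamma (?q + real (2 * k)) = Gamma ?q * pochhammer ?q (2 * k)"
      using pochhammer_Gamma[OF q(2), of "2 * k"] G by simp
    also have "pochhammer ?q (2 * k) = 4 ^ k * (pochhammer ((real n + \<alpha> + 1) / 2) k * pochhammer ((real n + \<alpha> +
        2) / 2) k)"
      using pochhammer_double[of "?q / 2" k] unfolding e by (simp add: power_mult)
    finally have g: "Gamma (?q + real (2 * k)) = Gamma ?q * (4 ^ k * (pochhammer ((real n + \<alpha> + 1) / 2) k *
        pochhammer ((real n + \<alpha> + 2) / 2) k))" .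
    have "(- (r\<^sup>2) / 4) ^ k = (- 1) ^ k * r ^ (2 * k) / 4 ^ k"
    proof -
      have "(- (r\<^sup>2) / 4) ^ k = ((- 1) * r\<^sup>2 / 4) ^ k" by simp
      also have "\<dots> = (- 1) ^ k * r ^ (2 * k) / 4 ^ k" by (simp only: power_divide power_mult_distrib power_mult)
      finally show ?thesis .
    qed
    have alg: "A / (f * B) * (s * R / p) = G * (s * A / (f * (G * (p * B))) * R)" if "G \<noteq> 0"
        for A f B s R p G :: real
      using that by simp (simp add: mult_ac)
    show ?thesis unfolding gs_def g \<open>(- (r\<^sup>2) / 4) ^ k = (- 1) ^ k * r ^ (2 * k) / 4 ^ k\<close>
        by (rule alg) (use G in simp)
  qed
  then have "Lambda_fun n \<alpha> r = (\<Sum>k. Gamma ?q * (gs ?a ?q k * r ^ (2 * k)))"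
    by (simp add: Lambda_fun_def gen_hypergeometric_def)
  also have "\<dots> = Gamma ?q * evser (gs ?a ?q) r"
    using sums_mult[OF evser_sums[OF entire_coeffs_gs[of ?a ?q]]] q by (simp add: sums_iff)
  finally show ?thesis .
qed

section \<open>Two-sided power decay and its propagation in the parameters\<close>

definition decay_comparable :: "real \<Rightarrow> real \<Rightarrow> bool" where
  "decay_comparable a q \<longleftrightarrow> (\<exists>c>0. \<exists>C. \<forall>t\<ge>0.
     c * (1 + t\<^sup>2) powr (- a) \<le> evser (gs a q) t \<and> evser (gs a q) t \<le> C * (1 + t\<^sup>2) powr (- a))"

text \<open>Up to T, continuity and positivity on a compact interval give a positive minimum and a
  finite maximum. Beyond T, t^2 <= 1 + t^2 <= 2 t^2, so the two powers differ by a factor of at most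
  2^a.\<close>

lemma compare_from_tail:
  fixes f :: "real \<Rightarrow> real"
  assumes cont: "continuous_on UNIV f" and pos: "\<And>t. t \<ge> 0 \<Longrightarrow> f t > 0"
    and a: "a > 0" and kl: "kl > 0" and T: "T \<ge> 1"
    and lo: "\<And>t. t \<ge> T \<Longrightarrow> kl * t powr (- 2 * a) \<le> f t"
    and up: "\<And>t. t \<ge> T \<Longrightarrow> f t \<le> ku * t powr (- 2 * a)"
  shows "\<exists>c>0. \<exists>C. \<forall>t\<ge>0. c * (1 + t\<^sup>2) powr (- a) \<le> f t \<and> f t \<le> C * (1 + t\<^sup>2) powr (- a)"
proof -
  have ne: "{0..T} \<noteq> {}" using T by simp
  have cT: "continuous_on {0..T} f" using cont by (rule continuous_on_subset) simp
  obtain m where m: "m \<in> {0..T}" "\<forall>t\<in>{0..T}. f m \<le> f t" using continuous_attains_inf[OF compact_Icc ne cT]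
      by blast
  obtain M where M: "M \<in> {0..T}" "\<forall>t\<in>{0..T}. f t \<le> f M" using continuous_attains_sup[OF compact_Icc ne cT]
      by blast
  have fm: "f m > 0" "f M > 0" using pos m(1) M(1) by auto
  have ku: "ku \<ge> 0"
  proof -
    have "0 < ku * T powr (- 2 * a)" using pos[of T] up[of T] T by linarith
    then show ?thesis using T by (simp add: zero_less_mult_iff)
  qed
  define C where "C = max (f M * (1 + T\<^sup>2) powr a) (ku * 2 powr a)"
  have "min (f m) kl * (1 + t\<^sup>2) powr (- a) \<le> f t \<and> f t \<le> C * (1 + t\<^sup>2) powr (- a)" if t: "t \<ge> 0" for t
  proof (cases "t \<le> T")
    case True
    have "(1 + t\<^sup>2) powr (- a) \<le> 1" using a by (simp add: powr_minus_divide ge_one_powr_ge_zero divide_le_eq_1)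
    then have "min (f m) kl * (1 + t\<^sup>2) powr (- a) \<le> f m * 1" using fm kl by (intro mult_mono) auto
    moreover have "f m \<le> f t" "f t \<le> f M" using m M True t by auto
    moreover have "f M \<le> C * (1 + t\<^sup>2) powr (- a)"
    proof -
      have "(1 + t\<^sup>2) powr a \<le> (1 + T\<^sup>2) powr a" using True t a by (intro powr_mono2 add_left_mono power_mono)
          auto
      then have "f M * (1 + t\<^sup>2) powr a \<le> f M * (1 + T\<^sup>2) powr a" using fm by (intro mult_left_mono) auto
      also have "\<dots> \<le> C" by (simp add: C_def)
      finally have "f M * (1 + t\<^sup>2) powr a \<le> C" .
      moreover have "1 + t\<^sup>2 > 0" by (rule add_pos_nonneg) auto
      then have "(1 + t\<^sup>2) powr a > 0" by simp
      ultimately show ?thesis by (simp add: powr_minus_divide pos_le_divide_eq)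
    qed
    ultimately show ?thesis by linarith
  next
    case False
    then have t1: "t \<ge> 1" "t \<ge> T" "t > 0" using T by auto
    have e: "t powr (- 2 * a) = (t\<^sup>2) powr (- a)"
    proof -
      have "t\<^sup>2 = t powr 2" using t1 by (simp add: powr_numeral)
      then show ?thesis by (simp add: powr_powr)
    qed
    have "(1 + t\<^sup>2) powr (- a) \<le> (t\<^sup>2) powr (- a)" using a t1 by (intro powr_mono2') auto
    then have "min (f m) kl * (1 + t\<^sup>2) powr (- a) \<le> kl * t powr (- 2 * a)" unfolding e using fm kl
        by (intro mult_mono) auto
    moreover have "t powr (- 2 * a) \<le> 2 powr a * (1 + t\<^sup>2) powr (- a)"
    proof -
      have "1 + t\<^sup>2 \<le> 2 * t\<^sup>2" using t1 by simp
      then have "(2 * t\<^sup>2) powr (- a) \<le> (1 + t\<^sup>2) powr (- a)" using a by (intro powr_mono2')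
          (auto simp: add_pos_nonneg)
      then have "2 powr a * (2 powr (- a) * (t\<^sup>2) powr (- a)) \<le> 2 powr a * (1 + t\<^sup>2) powr (- a)"
        by (intro mult_left_mono) (auto simp: powr_mult)
      then show ?thesis unfolding e by (simp add: powr_minus field_simps)
    qed
    then have "ku * t powr (- 2 * a) \<le> ku * (2 powr a * (1 + t\<^sup>2) powr (- a))" using ku by (rule mult_left_mono)
    moreover have "ku * 2 powr a * (1 + t\<^sup>2) powr (- a) \<le> C * (1 + t\<^sup>2) powr (- a)"
      by (intro mult_right_mono) (auto simp: C_def)
    ultimately show ?thesis using lo[OF t1(2)] up[OF t1(2)] by (simp only: mult.assoc) linarith
  qed
  moreover have "min (f m) kl > 0" using fm kl by simp
  ultimately show ?thesis by blast
qed

text \<open>Termwise, the Beta integral replaces the normaliser 1 / Gamma (q + 2 k) by Gamma s /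
  Gamma (q + s + 2 k), so averaging over dilations raises q by s.\<close>

lemma gs_beta_transfer:
  assumes a: "a > 0" and q: "q > 0" and s: "s > 0"
  defines "w \<equiv> \<lambda>x. indicator {0<..<1} x * (x powr (q - 1) * (1 - x) powr (s - 1))"
  shows "integrable lborel w" and "integrable lborel (\<lambda>x. w x * evser (gs a q) (t * x))"
    and "(LINT x|lborel. w x * evser (gs a q) (t * x)) = Gamma s * evser (gs a (q + s)) t"
proof -
  have [measurable]: "w \<in> borel_measurable borel" unfolding w_def by measurable
  have w0: "w x \<ge> 0" for x by (simp add: w_def)
  have m: "(\<integral>\<^sup>+x. ennreal (w x * x ^ (2 * k)) \<partial>lborel) = ennreal (Beta (q + real (2 * k)) s)" for k
  proof -
    have "(\<integral>\<^sup>+x. ennreal (w x * x ^ (2 * k)) \<partial>lborel) =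
      (\<integral>\<^sup>+x. ennreal (x powr (q + real (2 * k) - 1) * (1 - x) powr (s - 1)) * indicator {0..1} x \<partial>lborel)"
      using AE_lborel_singleton[of "0::real"] AE_lborel_singleton[of "1::real"]
    proof (intro nn_integral_cong_AE, eventually_elim)
      case (elim x)
      show ?case
      proof (cases "0 < x \<and> x < 1")
        case True
        then have "x powr (q + real (2 * k) - 1) = x powr (q - 1) * x ^ (2 * k)"
          by (simp add: powr_realpow[symmetric] powr_add[symmetric] algebra_simps del: of_nat_mult)
        then show ?thesis using True by (simp add: w_def mult_ac)
      qed (use elim in \<open>auto simp: w_def indicator_def\<close>)
    qed
    also have "\<dots> = ennreal (Beta (q + real (2 * k)) s)"
      using q s by (intro nn_integral_has_integral_lebesgue' has_integral_Beta_real) (auto simp: add_pos_nonneg)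
    finally show ?thesis .
  qed
  show wi: "integrable lborel w"
    using m[of 0] w0 by (intro integrableI_nonneg) auto
  have Bk: "(LINT x|lborel. w x * x ^ (2 * k)) = Beta (q + real (2 * k)) s" for k
  proof (rule integral_eq_nn_integral[THEN trans])
    have "Beta (q + real (2 * k)) s \<ge> 0" using q s unfolding Beta_def by
        (intro divide_nonneg_nonneg mult_nonneg_nonneg less_imp_le Gamma_real_pos) (auto simp: add_pos_nonneg)
    then show "enn2real (\<integral>\<^sup>+x. ennreal (w x * x ^ (2 * k)) \<partial>lborel) = Beta (q + real (2 * k)) s" unfolding m
        by simp
  qed (use w0 in auto)
  have supp: "w x = 0" if "x \<notin> {0..1}" for x using that by (auto simp: w_def)
  show "integrable lborel (\<lambda>x. w x * evser (gs a q) (t * x))"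
    by (rule evser_integral(1)[OF entire_coeffs_gs[OF a q] wi]) (rule supp)
  have ei: "(\<lambda>k. gs a q k * t ^ (2 * k) * (LINT x|lborel. w x * x ^ (2 * k))) sums (LINT x|lborel. w x * evser
      (gs a q) (t * x))"
    by (rule evser_integral(2)[OF entire_coeffs_gs[OF a q] wi]) (rule supp)
  have "gs a q k * t ^ (2 * k) * Beta (q + real (2 * k)) s = Gamma s * (gs a (q + s) k * t ^ (2 * k))" for k
  proof -
    have "Gamma (q + real (2 * k)) > 0" using q by (intro Gamma_real_pos) (auto simp: add_pos_nonneg)
    moreover have e: "q + s + real (2 * k) = q + real (2 * k) + s" by simp
    ultimately show ?thesis unfolding gs_def Beta_def e by (simp add: mult_ac del: of_nat_mult)
  qed
  then have "(\<lambda>k. Gamma s * (gs a (q + s) k * t ^ (2 * k))) sums (LINT x|lborel. w x * evser (gs a q) (t * x))"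
    using ei unfolding Bk by (simp only:)
  moreover have "(\<lambda>k. Gamma s * (gs a (q + s) k * t ^ (2 * k))) sums (Gamma s * evser (gs a (q + s)) t)"
    using a q s by (intro sums_mult evser_sums entire_coeffs_gs) auto
  ultimately show "(LINT x|lborel. w x * evser (gs a q) (t * x)) = Gamma s * evser (gs a (q + s)) t"
    by (rule sums_unique2)
qed

text \<open>The hypothesis \<open>q > 2 * a\<close> makes \<open>x powr (- 2 * a)\<close> integrable against the Beta weight.\<close>

lemma decay_comparable_raise:
  assumes a: "a > 0" and q: "q > 2 * a" and s: "s > 0" and dc: "decay_comparable a q"
  shows "decay_comparable a (q + s)"
proof -
  obtain c C where c: "c > 0" and b: "\<And>t. t \<ge> 0 \<Longrightarrow> c * (1 + t\<^sup>2) powr (- a) \<le> evser (gs a q) t \<and>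
      evser (gs a q) t \<le> C * (1 + t\<^sup>2) powr (- a)"
    using dc unfolding decay_comparable_def by blast
  have C: "C > 0" using b[of 0] c by simp
  define w where "w = (\<lambda>p x. indicator {0<..<1} x * (x powr (p - 1) * (1 - x) powr (s - 1)))"
  have q0: "q > 0" "q - 2 * a > 0" using a q by auto
  note T = gs_beta_transfer[OF a q0(1) s]
  have wi: "integrable lborel (w q)" "integrable lborel (w (q - 2 * a))"
    using gs_beta_transfer(1)[OF a q0(1) s] gs_beta_transfer(1)[OF a q0(2) s] unfolding w_def by auto
  define I where "I = (LINT x|lborel. w q x)"
  define J where "J = (LINT x|lborel. w (q - 2 * a) x)"
  have w0: "w p x \<ge> 0" for p x by (simp add: w_def)
  have Gs: "Gamma s > 0" using s by (rule Gamma_real_pos)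
  have I: "I > 0"
  proof -
    have G: "Gamma q > 0" "Gamma (q + s) > 0" using q0 s by (auto intro: Gamma_real_pos)
    \<comment> \<open>The transfer identity at t = 0 evaluates the mass of the weight.\<close>
    then have "I = Gamma s * Gamma q / Gamma (q + s)" using T(3)[of 0]
        by (simp add: I_def gs_def w_def divide_simps)
    then show ?thesis using Gs G by simp
  qed
  have "c * I / Gamma s * (1 + t\<^sup>2) powr (- a) \<le> evser (gs a (q + s)) t \<and> evser (gs a (q + s)) t \<le>
      C * J / Gamma s * (1 + t\<^sup>2) powr (- a)"
    if t: "t \<ge> 0" for t
  proof -
    have lo: "w q x * (c * (1 + t\<^sup>2) powr (- a)) \<le> w q x * evser (gs a q) (t * x)" for x
    proof (cases "x \<in> {0<..<1}")
      case True
      have "(t * x)\<^sup>2 \<le> t\<^sup>2" using True t by (intro power_mono) (auto simp: mult_left_le)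
      then have "(1 + t\<^sup>2) powr (- a) \<le> (1 + (t * x)\<^sup>2) powr (- a)" using a
          by (intro powr_mono2') (auto simp: add_pos_nonneg)
      then have "c * (1 + t\<^sup>2) powr (- a) \<le> c * (1 + (t * x)\<^sup>2) powr (- a)" using c
          by (intro mult_left_mono) auto
      also have "\<dots> \<le> evser (gs a q) (t * x)" using b[of "t * x"] True t by auto
      finally show ?thesis using w0 by (rule mult_left_mono)
    qed (simp add: w_def)
    have up: "w q x * evser (gs a q) (t * x) \<le> w (q - 2 * a) x * (C * (1 + t\<^sup>2) powr (- a))" for x
    proof (cases "x \<in> {0<..<1}")
      case True
      have "x\<^sup>2 \<le> 1" using True by (simp add: power_le_one)
      \<comment> \<open>Replacing t x by t in the upper bound costs x^(-2 a), uniformly in t. The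
        weight absorbs this factor by passing from q to q - 2 a.\<close>
      then have "x\<^sup>2 * (1 + t\<^sup>2) \<le> 1 + (t * x)\<^sup>2" by (simp add: algebra_simps)
      then have "(1 + (t * x)\<^sup>2) powr (- a) \<le> (x\<^sup>2 * (1 + t\<^sup>2)) powr (- a)" using a True
          by (intro powr_mono2') (auto simp: add_pos_nonneg)
      also have "\<dots> = x powr (- 2 * a) * (1 + t\<^sup>2) powr (- a)"
      proof -
        have "x\<^sup>2 = x powr 2" using True by (simp add: powr_numeral)
        then show ?thesis by (simp add: powr_mult powr_powr)
      qed
      finally have "C * (1 + (t * x)\<^sup>2) powr (- a) \<le> C * (x powr (- 2 * a) * (1 + t\<^sup>2) powr (- a))" using C
          by (intro mult_left_mono) auto
      then have "evser (gs a q) (t * x) \<le> C * (x powr (- 2 * a) * (1 + t\<^sup>2) powr (- a))"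
          using b[of "t * x"] True t by auto
      then have "w q x * evser (gs a q) (t * x) \<le> w q x * (C * (x powr (- 2 * a) * (1 + t\<^sup>2) powr (- a)))"
          using w0 by (rule mult_left_mono)
      also have "\<dots> = (w q x * x powr (- 2 * a)) * (C * (1 + t\<^sup>2) powr (- a))" by (simp only: mult_ac)
      also have "w q x * x powr (- 2 * a) = w (q - 2 * a) x"
      proof -
        have "x powr (q - 1) * x powr (- 2 * a) = x powr (q - 2 * a - 1)"
            by (simp add: powr_add[symmetric] algebra_simps)
        moreover have "w q x * x powr (- 2 * a) = indicator {0<..<1} x * ((x powr (q - 1) * x powr (- 2 * a)) *
            (1 - x) powr (s - 1))"
          by (simp only: w_def mult_ac)
        ultimately show ?thesis by (simp only: w_def)
      qed
      finally show ?thesis .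
    qed (simp add: w_def)
    have "(LINT x|lborel. w q x * (c * (1 + t\<^sup>2) powr (- a))) \<le> (LINT x|lborel. w q x * evser (gs a q) (t * x))"
      using wi T(2) lo by (intro integral_mono) (auto simp: w_def)
    moreover have "(LINT x|lborel. w q x * evser (gs a q) (t * x)) \<le> (LINT x|lborel. w (q - 2 * a) x * (C * (1 +
        t\<^sup>2) powr (- a)))"
      using wi T(2) up by (intro integral_mono) (auto simp: w_def)
    moreover have "(LINT x|lborel. w q x * evser (gs a q) (t * x)) = Gamma s * evser (gs a (q + s)) t"
      using T(3) by (simp add: w_def)
    ultimately show ?thesis using Gs by (simp add: I_def J_def field_simps)
  qed
  moreover have "c * I / Gamma s > 0" using c I Gs by simp
  ultimately show ?thesis unfolding decay_comparable_def by blast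
qed

text \<open>The operator \<open>D\<^sup>3 + D\<close>, whose fundamental solution is \<open>1 - cos\<close>, maps the right-hand side to the factor
  convolved with \<open>1 - cos\<close> on the left.\<close>

lemma Gs_convolution:
  assumes a: "a > 0" and t: "t > 0"
  shows "((\<lambda>u. u powr (3 * a - 1) * evser (gs a (3 * a)) u * (1 - cos (t - u))) has_integral
    t powr (3 * a + 2) * evser (gs (a + 1) (3 * a + 3)) t) {0..t}"
proof -
  define H where "H = (\<lambda>q u. u powr q * evser (gs (a + 1) (q + 1)) u)"
  have D: "(H q has_real_derivative H (q - 1) u) (at u)" if "q > 0" "u > 0" for q u
    unfolding H_def using Gs_has_derivative[of "a + 1" q u] that a by simp
  have C: "continuous_on {0..t} (H q)" if "q > 0" for q
    unfolding H_def using that a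
    by (intro continuous_on_mult continuous_on_powr' continuous_on_id continuous_on_const continuous_on_evser
        entire_coeffs_gs) auto
  \<comment> \<open>Repeated integration by parts: the successive primitives of H (3 a - 1) are
    paired with 1 - cos, sin and 1. In the derivative the sine terms cancel, leaving (H (3 a - 1) +
    H (3 a + 1)) (1 - cos), and \<open>gs_rec\<close> identifies that sum.\<close>
  define P where "P = (\<lambda>u. H (3 * a) u * (1 - cos (t - u)) + H (3 * a + 1) u * sin (t - u) + H (3 * a + 2) u)"
  have "((\<lambda>u. u powr (3 * a - 1) * evser (gs a (3 * a)) u * (1 - cos (t - u))) has_integral (P t - P 0)) {0..t}"
  proof (rule fundamental_theorem_of_calculus_interior)
    show "continuous_on {0..t} P"
      unfolding P_def using a by (intro continuous_on_add continuous_on_mult C continuous_intros) auto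
    fix u assume u: "u \<in> {0<..<t}"
    have "u powr (3 * a - 1) * evser (gs a (3 * a)) u = H (3 * a - 1) u + H (3 * a + 1) u"
    proof -
      have "u powr (3 * a + 1) = u powr (3 * a - 1) * u\<^sup>2"
        using u by (simp add: powr_numeral[symmetric] powr_add[symmetric] add.commute del: powr_numeral)
      then have "H (3 * a - 1) u + H (3 * a + 1) u =
          u powr (3 * a - 1) * (evser (gs (a + 1) (3 * a)) u + u\<^sup>2 * evser (gs (a + 1) (3 * a + 2)) u)"
        by (simp add: H_def distrib_left add.assoc)
      then show ?thesis using gs_rec[of a "3 * a" u] a by simp
    qed
    then have "u powr (3 * a - 1) * evser (gs a (3 * a)) u * (1 - cos (t - u)) =
       H (3 * a - 1) u * (1 - cos (t - u)) + H (3 * a) u * (- sin (t - u)) + (H (3 * a) u * sin (t - u) + H (3 *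
           a + 1) u * (- cos (t - u))) + H (3 * a + 1) u"
      by (simp add: algebra_simps)
    moreover have "(P has_real_derivative H (3 * a - 1) u * (1 - cos (t - u)) + H (3 * a) u * (- sin (t - u)) +
        (H (3 * a) u * sin (t - u) + H (3 * a + 1) u * (- cos (t - u))) + H (3 * a + 1) u) (at u)"
    proof -
      have e: "3 * a + 2 - 1 = 3 * a + 1" "3 * a + 1 - 1 = 3 * a" by simp_all
      have "(H (3 * a) has_real_derivative H (3 * a - 1) u) (at u)" by (rule D) (use a u in auto)
      moreover have "(H (3 * a + 1) has_real_derivative H (3 * a) u) (at u)"
        by (rule D[of "3 * a + 1" u, unfolded e]) (use a u in auto)
      moreover have "(H (3 * a + 2) has_real_derivative H (3 * a + 1) u) (at u)"
        by (rule D[of "3 * a + 2" u, unfolded e]) (use a u in auto)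
      ultimately show ?thesis unfolding P_def by (auto intro!: derivative_eq_intros)
    qed
    ultimately show "(P has_vector_derivative u powr (3 * a - 1) * evser (gs a (3 * a)) u * (1 - cos (t - u)))
        (at u)"
      by (simp add: has_real_derivative_iff_has_vector_derivative[symmetric])
  qed (use t in simp)
  moreover have "P 0 = 0" using a by (simp add: P_def H_def)
  moreover have "P t = t powr (3 * a + 2) * evser (gs (a + 1) (3 * a + 3)) t"
      by (simp add: P_def H_def add.commute)
  ultimately show ?thesis by simp
qed

lemma one_minus_cos_has_integral:
  assumes "s \<le> t" shows "((\<lambda>u. 1 - cos (t - u)) has_integral (t - s - sin (t - s))) {s..t::real}"
proof -
  have "((\<lambda>u. 1 - cos (t - u)) has_integral ((t + sin (t - t)) - (s + sin (t - s)))) {s..t}"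
    using assms by (intro fundamental_theorem_of_calculus)
      (auto simp: has_real_derivative_iff_has_vector_derivative[symmetric] intro!: derivative_eq_intros)
  then show ?thesis by (simp add: algebra_simps)
qed

lemma sin_less_self:
  assumes "0 < x" shows "sin x < (x::real)"
proof (cases "x \<le> 1")
  case True
  have "(\<lambda>x. x - sin x) 0 < (\<lambda>x. x - sin x) x"
  proof (rule DERIV_pos_imp_increasing_open[OF assms])
    fix y assume y: "0 < y" "y < x"
    then have "cos y < cos 0" using True pi_gt3 by (intro cos_monotone_0_pi) auto
    then show "\<exists>D. DERIV (\<lambda>x. x - sin x) y :> D \<and> 0 < D" by (intro exI[of _ "1 - cos y"])
        (auto intro!: derivative_eq_intros)
  qed (intro continuous_intros)
  then show ?thesis by simp
next
  case False
  then show ?thesis using sin_le_one[of x] by linarith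
qed

lemma Gs_pos_at_0: "q > 0 \<Longrightarrow> evser (gs a q) 0 > 0"
  by (simp add: gs_def Gamma_real_pos)

text \<open>The convolution integral is shown to have exact order t^a for large t; division by t^(3
  a + 2) then gives the order t^(-2 (a + 1)) required at a + 1.\<close>

lemma decay_comparable_step:
  assumes a: "a \<ge> 1" and dc: "decay_comparable a (3 * a)"
  shows "decay_comparable (a + 1) (3 * (a + 1))"
proof -
  obtain c C where c: "c > 0" and b: "\<And>t. t \<ge> 0 \<Longrightarrow> c * (1 + t\<^sup>2) powr (- a) \<le> evser (gs a (3 * a)) t \<and>
      evser (gs a (3 * a)) t \<le> C * (1 + t\<^sup>2) powr (- a)"
    using dc unfolding decay_comparable_def by blast
  have C: "C > 0" using b[of 0] c by simp
  define f where "f = (\<lambda>t u. u powr (3 * a - 1) * evser (gs a (3 * a)) u * (1 - cos (t - u)))"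
  define E where "E = evser (gs (a + 1) (3 * a + 3))"
  have conv: "(f t has_integral t powr (3 * a + 2) * E t) {0..t}" if "t > 0" for t
    using Gs_convolution[of a t] a that unfolding f_def E_def by simp
  have Epos: "evser (gs a (3 * a)) u > 0" if "u \<ge> 0" for u
  proof -
    have "1 + u\<^sup>2 > 0" by (rule add_pos_nonneg) auto
    then have "c * (1 + u\<^sup>2) powr (- a) > 0" using c by simp
    then show ?thesis using b[OF that] by linarith
  qed
  have f0: "f t u \<ge> 0" if "u \<ge> 0" for t u using Epos[OF that] by (simp add: f_def)
  define K where "K = (\<lambda>t. (t / 2) powr (3 * a - 1) * (c * (1 + t\<^sup>2) powr (- a)))"
  \<comment> \<open>Only u in [t/2, t] is kept. There both factors in front of 1 - cos are bounded
    below by their values in \<open>K\<close>, and 1 - cos integrates to t/2 - sin (t/2).\<close>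
  have lo: "K t * (t / 2 - sin (t / 2)) \<le> t powr (3 * a + 2) * E t" if t: "t > 0" for t
  proof -
    have K: "((\<lambda>u. K t * (1 - cos (t - u))) has_integral K t * (t / 2 - sin (t / 2))) {t / 2..t}"
      using has_integral_mult_right[OF one_minus_cos_has_integral[of "t / 2" t], of "K t"] t by simp
    then have K': "((\<lambda>u. if u \<in> {t / 2..t} then K t * (1 - cos (t - u)) else 0) has_integral K t * (t / 2 - sin
        (t / 2))) {0..t}"
      using t by (subst has_integral_restrict) auto
    show ?thesis
    proof (rule has_integral_le[OF K' conv[OF t]])
      have le: "K t * (1 - cos (t - u)) \<le> f t u" if u: "u \<in> {t / 2..t}" for u
      proof -
        have u2: "u\<^sup>2 \<le> t\<^sup>2" using u t by (intro power_mono) auto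
        have "(t / 2) powr (3 * a - 1) \<le> u powr (3 * a - 1)" using u t a by (intro powr_mono2) auto
        moreover have "(1 + t\<^sup>2) powr (- a) \<le> (1 + u\<^sup>2) powr (- a)" using a u2
            by (intro powr_mono2') (auto simp: add_pos_nonneg)
        then have "c * (1 + t\<^sup>2) powr (- a) \<le> c * (1 + u\<^sup>2) powr (- a)" using c by (intro mult_left_mono) auto
        then have "c * (1 + t\<^sup>2) powr (- a) \<le> evser (gs a (3 * a)) u"
          using b[of u] u t by auto
        ultimately have "K t \<le> u powr (3 * a - 1) * evser (gs a (3 * a)) u"
          unfolding K_def using c by (intro mult_mono) auto
        then show ?thesis unfolding f_def by (intro mult_right_mono) auto
      qed
      show "(if u \<in> {t / 2..t} then K t * (1 - cos (t - u)) else 0) \<le> f t u" if "u \<in> {0..t}" for u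
        using le[of u] f0[of u t] that by auto
    qed
  qed
  \<comment> \<open>u^(3 a - 1) u^(-2 a) = u^(a - 1) is largest at u = t because a >= 1. Together
    with 1 - cos <= 2 and the interval length t this yields 2 C t^a.\<close>
  have up: "t powr (3 * a + 2) * E t \<le> 2 * C * t powr a" if t: "t > 0" for t
  proof -
    have "f t u \<le> 2 * C * t powr (a - 1)" if u: "u \<in> {0..t}" for u
    proof (cases "u = 0")
      case False
      then have u0: "u > 0" "u \<le> t" using u by auto
      have "(1 + u\<^sup>2) powr (- a) \<le> (u\<^sup>2) powr (- a)" using a u0 by (intro powr_mono2') auto
      also have "(u\<^sup>2) powr (- a) = u powr (- 2 * a)"
      proof -
        have "u\<^sup>2 = u powr 2" using u0 by (simp add: powr_numeral)
        then show ?thesis by (simp add: powr_powr)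
      qed
      finally have "C * (1 + u\<^sup>2) powr (- a) \<le> C * u powr (- 2 * a)" using C by (intro mult_left_mono) auto
      then have "evser (gs a (3 * a)) u \<le> C * u powr (- 2 * a)" using b[of u] u0 by auto
      then have "u powr (3 * a - 1) * evser (gs a (3 * a)) u \<le> u powr (3 * a - 1) * (C * u powr (- 2 * a))"
          by (intro mult_left_mono) auto
      also have "\<dots> = C * u powr (a - 1)" by (simp add: powr_add[symmetric] algebra_simps)
      also have "\<dots> \<le> C * t powr (a - 1)" using u0 a C by (intro mult_left_mono powr_mono2) auto
      finally have "u powr (3 * a - 1) * evser (gs a (3 * a)) u \<le> C * t powr (a - 1)" .
      then have "f t u \<le> C * t powr (a - 1) * 2" unfolding f_def by (rule mult_mono) (use C cos_ge_minus_one[of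
          "t - u"] in auto)
      then show ?thesis by simp
    qed (use a C in \<open>auto simp: f_def\<close>)
    then have "t powr (3 * a + 2) * E t \<le> 2 * C * t powr (a - 1) * (t - 0)"
      using has_integral_le[OF conv[OF t] has_integral_const_real[of "2 * C * t powr (a - 1)" 0 t]] t
          by (simp add: mult_ac)
    also have "\<dots> = 2 * C * t powr a" using t by (simp add: powr_diff)
    finally show ?thesis .
  qed
  have "\<exists>c>0. \<exists>C. \<forall>t\<ge>0. c * (1 + t\<^sup>2) powr (- (a + 1)) \<le> E t \<and> E t \<le> C * (1 + t\<^sup>2) powr (- (a + 1))"
  proof (rule compare_from_tail[where T = 4])
    show "continuous_on UNIV E" unfolding E_def using a by (intro continuous_intros entire_coeffs_gs) auto
    show "E t > 0" if "t \<ge> 0" for t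
    proof (cases "t = 0")
      case True
      then show ?thesis using a by (simp add: E_def Gs_pos_at_0 del: evser_0)
    next
      case False
      with that have t: "t > 0" by simp
      have "1 + t\<^sup>2 > 0" by (rule add_pos_nonneg) auto
      then have "K t > 0" using t c by (simp add: K_def)
      moreover have "t / 2 - sin (t / 2) > 0" using sin_less_self[of "t / 2"] t by simp
      ultimately have "0 < t powr (3 * a + 2) * E t" using lo[OF t] mult_pos_pos[of "K t" "t / 2 - sin (t / 2)"]
          by linarith
      then show ?thesis using t by (simp add: zero_less_mult_iff)
    qed
    \<comment> \<open>The factors come from (t/2)^(3 a - 1), from 1 + t^2 <= 2 t^2, and from t/2 -
      sin (t/2) >= t/4.\<close>
    show "0 < c * 2 powr (1 - 3 * a) * 2 powr (- a) / 4" using c by simp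
    fix t :: real assume t4: "4 \<le> t"
    then have t: "t > 0" "1 + t\<^sup>2 \<le> 2 * t\<^sup>2" using self_le_power[of t 2] by auto
    have p: "t powr (3 * a + 2) > 0" using t by simp
    have "(2 * t\<^sup>2) powr (- a) \<le> (1 + t\<^sup>2) powr (- a)" using a t by (intro powr_mono2')
        (auto simp: add_pos_nonneg)
    also have "(2 * t\<^sup>2) powr (- a) = 2 powr (- a) * t powr (- 2 * a)"
    proof -
      have "t\<^sup>2 = t powr 2" using t by (simp add: powr_numeral)
      then show ?thesis by (simp add: powr_mult powr_powr)
    qed
    finally have 1: "2 powr (- a) * t powr (- 2 * a) \<le> (1 + t\<^sup>2) powr (- a)" .
    have 2: "(t / 2) powr (3 * a - 1) = t powr (3 * a - 1) * 2 powr (1 - 3 * a)"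
      using t powr_minus_divide[of 2 "3 * a - 1"] by (simp add: powr_divide)
    have "t powr (3 * a - 1) * 2 powr (1 - 3 * a) * (c * (2 powr (- a) * t powr (- 2 * a))) \<le> K t"
      unfolding K_def 2 using 1 c by (intro mult_left_mono) auto
    \<comment> \<open>This bound dictates T = 4: it follows from sin <= 1 as soon as t/4 >=
      1.\<close>
    moreover have "t / 4 \<le> t / 2 - sin (t / 2)" using sin_le_one[of "t / 2"] t4 by linarith
    ultimately have "(t powr (3 * a - 1) * 2 powr (1 - 3 * a) * (c * (2 powr (- a) * t powr (- 2 * a)))) *
        (t / 4) \<le> K t * (t / 2 - sin (t / 2))"
      using t c by (intro mult_mono) (auto simp: K_def)
    then have "(t powr (3 * a - 1) * 2 powr (1 - 3 * a) * (c * (2 powr (- a) * t powr (- 2 * a)))) * (t / 4) \<le>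
        t powr (3 * a + 2) * E t"
      using lo[OF t(1)] by linarith
    moreover have "(t powr (3 * a - 1) * 2 powr (1 - 3 * a) * (c * (2 powr (- a) * t powr (- 2 * a)))) * (t / 4)
        =
      t powr (3 * a + 2) * (c * 2 powr (1 - 3 * a) * 2 powr (- a) / 4 * t powr (- 2 * (a + 1)))"
    proof -
      have "t powr (3 * a - 1) * t powr (- 2 * a) * t = t powr (3 * a + 2) * t powr (- 2 * (a + 1))"
      proof -
        have "t powr (3 * a - 1) * t powr (- 2 * a) * t powr 1 = t powr (3 * a + 2) * t powr (- 2 * (a + 1))"
          unfolding powr_add[symmetric] by (rule arg_cong[where f="\<lambda>x. t powr x"]) simp
        then show ?thesis using t by simp
      qed
      then show ?thesis by (simp add: algebra_simps)
    qed
    ultimately show "c * 2 powr (1 - 3 * a) * 2 powr (- a) / 4 * t powr (- 2 * (a + 1)) \<le> E t"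
      using p by (metis mult_le_cancel_left_pos)
    have "t powr (3 * a + 2) * E t \<le> t powr (3 * a + 2) * (2 * C * t powr (- 2 * (a + 1)))"
    proof -
      have "t powr (3 * a + 2) * t powr (- 2 * (a + 1)) = t powr a"
        unfolding powr_add[symmetric] by (rule arg_cong[where f="\<lambda>x. t powr x"]) simp
      then show ?thesis using up[OF t(1)] by (simp add: mult_ac)
    qed
    then show "E t \<le> 2 * C * t powr (- 2 * (a + 1))" using p by (metis mult_le_cancel_left_pos)
  qed (use a in auto)
  then show ?thesis unfolding decay_comparable_def E_def by (simp add: algebra_simps)
qed

section \<open>Base cases with elementary closed forms\<close>

lemma Gs_1_4: "t - sin t = t ^ 3 * evser (gs 1 4) t"
proof -
  have "(\<lambda>k. (- 1) ^ Suc k / fact (2 * Suc k + 1) * t ^ (2 * Suc k + 1)) sums (sin t - t)"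
    using sin_paired[of t] by (subst sums_Suc_iff) simp
  from sums_minus[OF this] have "(\<lambda>k. (- 1) ^ k / fact (2 * k + 3) * t ^ (2 * k + 3)) sums (t - sin t)"
    by (simp add: numeral_3_eq_3)
  moreover have "(- 1) ^ k / fact (2 * k + 3) * t ^ (2 * k + 3) = t ^ 3 * (gs 1 4 k * t ^ (2 * k))" for k
  proof -
    have "Gamma (4 + real (2 * k)) = fact (2 * k + 3)"
      using Gamma_fact[of "2 * k + 3", where 'a=real] by (simp add: add_ac)
    \<comment> \<open>\<open>pochhammer 1 k\<close> is k!, which cancels the factorial in
      \<open>gs\<close>; what is left is the sine series without its first term, divided by
      t^3.\<close>
    then show ?thesis by (simp only: gs_def pochhammer_fact[symmetric]) (simp add: power_add)
  qed
  ultimately have "(\<lambda>k. t ^ 3 * (gs 1 4 k * t ^ (2 * k))) sums (t - sin t)" by simp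
  moreover have "(\<lambda>k. t ^ 3 * (gs 1 4 k * t ^ (2 * k))) sums (t ^ 3 * evser (gs 1 4) t)"
    by (intro sums_mult evser_sums entire_coeffs_gs) auto
  ultimately show ?thesis by (rule sums_unique2)
qed

text \<open>Identifies the function that \<open>Gs_convolution\<close> at a = 1 convolves with 1 -
  cos.\<close>

lemma Gs_1_3: "1 - cos t = t\<^sup>2 * evser (gs 1 3) t"
proof -
  have "(\<lambda>k. (- 1) ^ Suc k / fact (2 * Suc k) * t ^ (2 * Suc k)) sums (cos t - 1)"
    using cos_paired[of t] by (subst sums_Suc_iff) simp
  from sums_minus[OF this] have "(\<lambda>k. (- 1) ^ k / fact (2 * k + 2) * t ^ (2 * k + 2)) sums (1 - cos t)"
    by (simp add: numeral_2_eq_2)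
  moreover have "(- 1) ^ k / fact (2 * k + 2) * t ^ (2 * k + 2) = t\<^sup>2 * (gs 1 3 k * t ^ (2 * k))" for k
  proof -
    have "Gamma (3 + real (2 * k)) = fact (2 * k + 2)"
      using Gamma_fact[of "2 * k + 2", where 'a=real] by (simp add: add_ac)
    then show ?thesis by (simp only: gs_def pochhammer_fact[symmetric]) (simp add: power_add power2_eq_square)
  qed
  ultimately have "(\<lambda>k. t\<^sup>2 * (gs 1 3 k * t ^ (2 * k))) sums (1 - cos t)" by simp
  moreover have "(\<lambda>k. t\<^sup>2 * (gs 1 3 k * t ^ (2 * k))) sums (t\<^sup>2 * evser (gs 1 3) t)"
    by (intro sums_mult evser_sums entire_coeffs_gs) auto
  ultimately show ?thesis by (rule sums_unique2)
qed

text \<open>By \<open>Gs_convolution\<close> at a = 1 the right-hand side is the convolution of 1 -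
  cos with itself, which the product-to-sum formula makes explicit.\<close>

lemma Gs_2_6:
  assumes t: "t > 0" shows "t + t * cos t / 2 - 3 / 2 * sin t = t ^ 5 * evser (gs 2 6) t"
proof -
  have "((\<lambda>u. u powr 2 * evser (gs 1 3) u * (1 - cos (t - u))) has_integral t powr 5 * evser (gs 2 6) t) {0..t}"
    using Gs_convolution[of 1 t] t by simp
  then have 1: "((\<lambda>u. (1 - cos u) * (1 - cos (t - u))) has_integral t ^ 5 * evser (gs 2 6) t) {0..t}"
    by (rule has_integral_eq[rotated, THEN has_integral_eq_rhs]) (use t in \<open>auto simp: Gs_1_3 powr_numeral\<close>)
  have "((\<lambda>u. (1 - cos u) * (1 - cos (t - u))) has_integral
     ((t - sin t + sin (t - t) + t * cos t / 2 + sin (2 * t - t) / 4) - (0 - sin 0 + sin (t - 0) + 0 *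
         cos t / 2 + sin (2 * 0 - t) / 4))) {0..t}"
  proof (rule fundamental_theorem_of_calculus)
    fix u
    have "cos (2 * u - t) = cos (u - (t - u))" by (simp add: algebra_simps)
    also have "\<dots> = cos u * cos (t - u) + sin u * sin (t - u)" by (rule cos_diff)
    finally have "cos (2 * u - t) + cos t = 2 * (cos u * cos (t - u))"
      using cos_add[of u "t - u"] by simp
    then have "(1 - cos u) * (1 - cos (t - u)) = 1 - cos u - cos (t - u) + cos t / 2 + cos (2 * u - t) * 2 / 4"
      by (simp add: algebra_simps)
    moreover have "((\<lambda>u. u - sin u + sin (t - u) + u * cos t / 2 + sin (2 * u - t) / 4) has_real_derivative
      1 - cos u - cos (t - u) + cos t / 2 + cos (2 * u - t) * 2 / 4) (at u within {0..t})"
      by (auto intro!: derivative_eq_intros)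
    ultimately show "((\<lambda>u. u - sin u + sin (t - u) + u * cos t / 2 + sin (2 * u - t) / 4) has_vector_derivative
      (1 - cos u) * (1 - cos (t - u))) (at u within {0..t})"
      by (simp add: has_real_derivative_iff_has_vector_derivative[symmetric])
  qed (use t in simp)
  from has_integral_unique[OF this 1] show ?thesis by simp
qed

lemma decay_comparable_1_4: "decay_comparable 1 4"
  unfolding decay_comparable_def
\<comment> \<open>From t = 2 on, sin t <= 1 <= t/2, so t - sin t lies between t/2 and 2 t.\<close>
proof (rule compare_from_tail[where T = 2 and kl = "1 / 2" and ku = 2])
  show "evser (gs 1 4) t > 0" if "t \<ge> 0" for t
  proof (cases "t = 0")
    case False
    then have "0 < t ^ 3 * evser (gs 1 4) t" using sin_less_self[of t] that Gs_1_4[of t] by simp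
    then show ?thesis using that False by (simp add: zero_less_mult_iff)
  qed (simp add: Gs_pos_at_0 del: evser_0)
  fix t :: real assume t: "2 \<le> t"
  have e: "evser (gs 1 4) t = (t - sin t) / t ^ 3" using t by (simp add: Gs_1_4)
  have p: "t powr (- 2 * 1) = 1 / t\<^sup>2" using t by (simp add: powr_minus_divide powr_numeral)
  have "(t / 2) / t ^ 3 \<le> (t - sin t) / t ^ 3"
  proof (intro divide_right_mono)
    show "t / 2 \<le> t - sin t" using sin_le_one[of t] t by linarith
  qed (use t in auto)
  then show "1 / 2 * t powr (- 2 * 1) \<le> evser (gs 1 4) t" unfolding e p using t
      by (simp add: power3_eq_cube power2_eq_square)
  have "(t - sin t) / t ^ 3 \<le> (2 * t) / t ^ 3"
  proof (intro divide_right_mono)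
    show "t - sin t \<le> 2 * t" using sin_ge_minus_one[of t] t by linarith
  qed (use t in auto)
  then show "evser (gs 1 4) t \<le> 2 * t powr (- 2 * 1)" unfolding e p using t
      by (simp add: power3_eq_cube power2_eq_square)
qed (auto intro!: continuous_intros entire_coeffs_gs)

text \<open>Positivity of \<open>t * (2 + cos t) - 3 * sin t\<close> (Cusa's inequality): the derivative of
  \<open>t - 3 * sin t / (2 + cos t)\<close> is \<open>((1 - cos t) / (2 + cos t))\<^sup>2\<close>.\<close>

lemma cusa_inequality:
  fixes t :: real
  assumes t: "t > 0" shows "t + t * cos t / 2 - 3 / 2 * sin t > 0"
proof (cases "t < 2 * pi")
  case True
  have p: "2 + cos y > 0" for y :: real using cos_ge_minus_one[of y] by linarith
  then have nz: "2 + cos y \<noteq> 0" for y :: real using less_irrefl[of 0] by metis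
  have "(\<lambda>t. t - 3 * sin t / (2 + cos t)) 0 < (\<lambda>t. t - 3 * sin t / (2 + cos t)) t"
  proof (rule DERIV_pos_imp_increasing_open[OF t])
    fix y assume y: "0 < y" "y < t"
    \<comment> \<open>The derivative vanishes exactly where cos y = 1, at multiples of 2 pi. The
      restriction to t < 2 pi excludes these and makes the increase strict.\<close>
    have "cos y \<noteq> 1"
    proof
      assume "cos y = 1"
      then obtain n :: int where n: "y = of_int n * 2 * pi" using cos_one_2pi_int by blast
      have "0 < real_of_int n * (2 * pi)" using y(1) unfolding n by (simp only: mult.assoc)
      then have 0: "0 < real_of_int n" by (simp add: zero_less_mult_iff)
      have "real_of_int n * (2 * pi) < 1 * (2 * pi)" using less_trans[OF y(2) True] unfolding n
          by (simp only: mult.assoc mult_1)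
      then have "real_of_int n < 1" by (rule mult_right_less_imp_less) simp
      with 0 have "0 < n" "n < 1" by simp_all
      then show False by simp
    qed
    then have "0 < (1 - cos y)\<^sup>2 / (2 + cos y)\<^sup>2" using p[of y] by simp
    moreover have "((\<lambda>t. t - 3 * sin t / (2 + cos t)) has_real_derivative
      1 - (3 * cos y * (2 + cos y) - 3 * sin y * (- sin y)) / ((2 + cos y) * (2 + cos y))) (at y)"
      using nz by (auto intro!: derivative_eq_intros)
    moreover have "1 - (3 * cos y * (2 + cos y) - 3 * sin y * (- sin y)) / ((2 + cos y) * (2 + cos y)) =
        (1 - cos y)\<^sup>2 / (2 + cos y)\<^sup>2"
    proof -
      have "3 * cos y * (2 + cos y) - 3 * sin y * (- sin y) = 3 + 6 * cos y"
      proof -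
        have "3 * cos y * (2 + cos y) - 3 * sin y * (- sin y) = 6 * cos y + 3 * (cos y * cos y + sin y * sin y)"
          by algebra
        then show ?thesis by (simp add: sin_cos_squared_add3)
      qed
      then show ?thesis using nz[of y] by (simp add: power2_eq_square divide_simps) (simp add: algebra_simps)
    qed
    ultimately show "\<exists>D. ((\<lambda>t. t - 3 * sin t / (2 + cos t)) has_real_derivative D) (at y) \<and> 0 < D" by metis
  qed (use nz in \<open>auto intro!: continuous_intros\<close>)
  then have "3 * sin t / (2 + cos t) < t" by simp
  then have "3 * sin t < t * (2 + cos t)" using p[of t] by (simp add: divide_less_eq)
  then show ?thesis by (simp add: algebra_simps)
next
  case False
  \<comment> \<open>Beyond 2 pi crude bounds suffice: the expression is at least t/2 - 3/2.\<close>
  then have "t > 6" using pi_gt3 by linarith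
  moreover have "t * (- 1) \<le> t * cos t" using t by (intro mult_left_mono) auto
  ultimately show ?thesis using sin_le_one[of t] by linarith
qed

lemma decay_comparable_2_6: "decay_comparable 2 6"
  unfolding decay_comparable_def
proof (rule compare_from_tail[where T = 6 and kl = "1 / 4" and ku = 3])
  show "evser (gs 2 6) t > 0" if "t \<ge> 0" for t
  proof (cases "t = 0")
    case False
    then have "0 < t ^ 5 * evser (gs 2 6) t" using cusa_inequality[of t] that Gs_2_6[of t] by simp
    then show ?thesis using that False by (simp add: zero_less_mult_iff)
  qed (simp add: Gs_pos_at_0 del: evser_0)
  fix t :: real assume t: "6 \<le> t"
  have e: "evser (gs 2 6) t = (t + t * cos t / 2 - 3 / 2 * sin t) / t ^ 5" using t by (subst Gs_2_6) auto
  have p: "t powr (- 2 * 2) = 1 / t ^ 4" using t by (simp add: powr_minus_divide powr_numeral)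
  have q: "t ^ 5 = t * t ^ 4" by (simp add: power_numeral_reduce)
  have "t * (- 1) \<le> t * cos t" "t * cos t \<le> t * 1" using t by (intro mult_left_mono; simp)+
  \<comment> \<open>The middle expression is at least t/2 - 3/2, and t/2 - 3/2 >= t/4 is exactly t
    >= 6; hence the choice of T.\<close>
  then have b: "t / 4 \<le> t + t * cos t / 2 - 3 / 2 * sin t" "t + t * cos t / 2 - 3 / 2 * sin t \<le> 3 * t"
    using sin_le_one[of t] sin_ge_minus_one[of t] t by linarith+
  have "(t / 4) / t ^ 5 \<le> (t + t * cos t / 2 - 3 / 2 * sin t) / t ^ 5" using b t
      by (intro divide_right_mono) auto
  then show "1 / 4 * t powr (- 2 * 2) \<le> evser (gs 2 6) t" unfolding e p using t by (simp add: q)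
  have "(t + t * cos t / 2 - 3 / 2 * sin t) / t ^ 5 \<le> (3 * t) / t ^ 5" using b t
      by (intro divide_right_mono) auto
  then show "evser (gs 2 6) t \<le> 3 * t powr (- 2 * 2)" unfolding e p using t by (simp add: q)
qed (auto intro!: continuous_intros entire_coeffs_gs)

text \<open>The convolution step raises n by 2, so each parity needs its own first case: n = 2 (a =
  3/2) and n = 3 (a = 2).\<close>

lemma decay_comparable_half_integers:
  assumes "decay_comparable (3 / 2) (9 / 2)" "n \<ge> 2"
  shows "decay_comparable ((real n + 1) / 2) (3 * ((real n + 1) / 2))"
  using assms(2)
proof (induction n rule: less_induct)
  case (less n)
  consider "n = 2" | "n = 3" | m where "n = m + 2" "m \<ge> 2"
    using less.prems by (metis Suc_leI add.commute le_add_diff_inverse le_neq_implies_less less_2_cases_iff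
        numeral_2_eq_2 numeral_3_eq_3 not_less_eq_eq add_2_eq_Suc' Suc_le_mono)
  then show ?case
  proof cases
    case 3
    then have "decay_comparable ((real m + 1) / 2 + 1) (3 * ((real m + 1) / 2 + 1))"
      by (intro decay_comparable_step less.IH) auto
    then show ?thesis using 3 by (simp add: field_simps)
  qed (use assms(1) decay_comparable_2_6 in simp_all)
qed

section \<open>The Bessel functions J_0 and J_1\<close>

definition bessel_coeff0 :: "nat \<Rightarrow> real" where "bessel_coeff0 k = (- 1) ^ k / (4 ^ k * (fact k)\<^sup>2)"
text \<open>Coefficients of J_1 (t) / t, which is even; \<open>J1\<close> restores the factor
  t.\<close>

definition bessel_coeff1 :: "nat \<Rightarrow> real" where "bessel_coeff1 k = (- 1) ^ k / (2 * 4 ^ k * fact k * fact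
    (Suc k))"
definition J0 :: "real \<Rightarrow> real" where "J0 t = evser bessel_coeff0 t"
definition J1 :: "real \<Rightarrow> real" where "J1 t = t * evser bessel_coeff1 t"

lemma entire_coeffs_inverse_fact: "entire_coeffs (\<lambda>k. inverse (fact k))"
  unfolding entire_coeffs_def using summable_exp[of "R::real" for R] by simp

lemma entire_bessel_coeff0: "entire_coeffs bessel_coeff0"
proof (rule entire_coeffs_bound[OF entire_coeffs_inverse_fact, where B = 1 and M = 1])
  fix k
  have "(1::real) \<le> 4 ^ k * fact k" using mult_mono[of 1 "4 ^ k :: real" 1 "fact k"] by simp
  then show "\<bar>bessel_coeff0 k\<bar> \<le> 1 * 1 ^ k * \<bar>inverse (fact k)\<bar>"
    by (simp add: bessel_coeff0_def abs_mult power2_eq_square field_simps)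
qed simp

lemma entire_bessel_coeff1: "entire_coeffs bessel_coeff1"
proof (rule entire_coeffs_bound[OF entire_coeffs_inverse_fact, where B = 1 and M = 1])
  fix k
  have "(1::real) \<le> 4 ^ k" by simp
  then have "(1::real) \<le> 2 * 4 ^ k" by linarith
  from mult_mono[OF this fact_ge_1[of "Suc k", where 'a=real]]
  have "(1::real) \<le> (2 * 4 ^ k) * fact (Suc k)" by (simp del: fact_Suc)
  then show "\<bar>bessel_coeff1 k\<bar> \<le> 1 * 1 ^ k * \<bar>inverse (fact k)\<bar>"
    by (simp add: bessel_coeff1_def abs_mult field_simps del: fact_Suc)
qed simp

text \<open>The derivative is read off from its Euler form t D by dividing by t, whence t >
  0.\<close>

lemma J0_has_derivative:
  assumes t: "t > 0" shows "(J0 has_real_derivative - J1 t) (at t)"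
proof -
  obtain D where D: "(evser bessel_coeff0 has_real_derivative D) (at t)" "t * D =
      evser (\<lambda>k. real (2 * k) * bessel_coeff0 k) t"
    using evser_has_derivative[OF entire_bessel_coeff0] by blast
  have "(\<lambda>k. (0 + real (2 * k)) * bessel_coeff0 k * t ^ (2 * k)) sums (evser (\<lambda>k. (0 + real (2 * k)) *
      bessel_coeff0 k) t)"
    by (intro evser_sums entire_coeffs_linear entire_bessel_coeff0)
  then have "(\<lambda>k. real (2 * k) * bessel_coeff0 k * t ^ (2 * k)) sums (t * D)" by (simp add: D(2))
  then have "(\<lambda>k. real (2 * Suc k) * bessel_coeff0 (Suc k) * t ^ (2 * Suc k)) sums (t * D)"
      by (subst sums_Suc_iff) simp
  also have "(\<lambda>k. real (2 * Suc k) * bessel_coeff0 (Suc k) * t ^ (2 * Suc k)) =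
      (\<lambda>k. - t\<^sup>2 * (bessel_coeff1 k * t ^ (2 * k)))"
  proof
    fix k
    have "real (2 * Suc k) * bessel_coeff0 (Suc k) = - bessel_coeff1 k"
    proof -
      have "2 * K * (- 1 * s / ((4 * q) * (K * f)\<^sup>2)) = - (s / (2 * q * f * (K * f)))" if "K \<noteq> 0"
          for K s q f :: real
        using that by (simp add: power2_eq_square field_simps)
      from this[of "real (Suc k)" "(- 1) ^ k" "4 ^ k" "fact k"] show ?thesis
          by (simp add: bessel_coeff0_def bessel_coeff1_def)
    qed
    moreover have "t ^ (2 * Suc k) = t\<^sup>2 * t ^ (2 * k)" by (simp add: power2_eq_square)
    ultimately show "real (2 * Suc k) * bessel_coeff0 (Suc k) * t ^ (2 * Suc k) =
        - t\<^sup>2 * (bessel_coeff1 k * t ^ (2 * k))" by simp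
  qed
  finally have "t * D = - t\<^sup>2 * evser bessel_coeff1 t"
    using sums_mult[OF evser_sums[OF entire_bessel_coeff1], of "- t\<^sup>2" t] by (rule sums_unique2)
  then have "t * D = t * (- J1 t)" by (simp add: J1_def power2_eq_square)
  then have "D = - J1 t" using t by (simp only: mult_cancel_left) auto
  with D(1) show ?thesis by (simp add: J0_def[abs_def])
qed

text \<open>Equivalent to (t J_1)' = t J_0, which on coefficients is 2 (k + 1)
  \<open>bessel_coeff1 k\<close> = \<open>bessel_coeff0 k\<close>.\<close>

lemma J1_has_derivative:
  assumes t: "t > 0" shows "(J1 has_real_derivative J0 t - J1 t / t) (at t)"
proof -
  have e: "(1 + real (2 * k)) * bessel_coeff1 k = bessel_coeff0 k - bessel_coeff1 k" for k
  proof -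
    have "(K - 1 + K) * (s / (2 * q * f * (K * f))) = s / (q * f\<^sup>2) - s / (2 * q * f * (K * f))" if "K \<noteq> 0"
        for K s q f :: real
      using that by (simp add: power2_eq_square divide_simps) (simp add: algebra_simps)
    from this[of "real (Suc k)" "(- 1) ^ k" "4 ^ k" "fact k"] show ?thesis
        by (simp add: bessel_coeff0_def bessel_coeff1_def add.commute)
  qed
  have "evser (\<lambda>k. bessel_coeff0 k - bessel_coeff1 k) t = evser bessel_coeff0 t - evser bessel_coeff1 t"
    using sums_diff[OF evser_sums[OF entire_bessel_coeff0, of t] evser_sums[OF entire_bessel_coeff1, of t]]
    by (simp add: evser_def[of "\<lambda>k. bessel_coeff0 k - bessel_coeff1 k"] sums_iff algebra_simps)
  then have "((\<lambda>t. t powr 1 * evser bessel_coeff1 t) has_real_derivative evser bessel_coeff0 t -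
      evser bessel_coeff1 t) (at t)"
    using powr_evser_has_derivative[OF entire_bessel_coeff1 t, of 1] t unfolding e by simp
  then have "((\<lambda>t. t powr 1 * evser bessel_coeff1 t) has_real_derivative J0 t - J1 t / t) (at t)"
    using t by (simp add: J0_def J1_def)
  moreover have "eventually (\<lambda>x. x powr 1 * evser bessel_coeff1 x = J1 x) (nhds t)"
    using eventually_nhds_in_open[of "{0<..}" t] t by (auto elim!: eventually_mono simp: J1_def)
  ultimately show ?thesis using DERIV_cong_ev[OF refl _ refl] by fastforce
qed

text \<open>The k-th term is at most 4^(-k) in absolute value, so J_0 (1) >= 1 - 1/3. This gives the
  energy below a positive starting value.\<close>

lemma J0_1_pos: "J0 1 > 0"
proof -
  have s: "(\<lambda>k. bessel_coeff0 (Suc k) * 1 ^ (2 * Suc k)) sums (J0 1 - 1)"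
    using evser_sums[OF entire_bessel_coeff0, of 1] by (subst sums_Suc_iff) (simp add: J0_def bessel_coeff0_def)
  have g: "(\<lambda>k. - ((1 / 4) * (1 / 4) ^ k)) sums (- ((1 / 4) * (1 / (1 - 1 / 4 :: real))))"
    by (intro sums_minus sums_mult geometric_sums) simp
  have "- ((1 / 4) * (1 / (1 - 1 / 4))) \<le> J0 1 - 1"
  proof (rule sums_le[OF _ g s])
    fix k
    have "1 / (4 ^ Suc k * (fact (Suc k))\<^sup>2) \<le> 1 / (4 ^ Suc k :: real)"
      using power_mono[of 1 "fact (Suc k) :: real" 2] fact_ge_1[of "Suc k", where 'a=real]
          by (simp add: divide_simps del: fact_Suc)
    moreover have "- (1 / (4 ^ Suc k * (fact (Suc k))\<^sup>2)) \<le> bessel_coeff0 (Suc k)"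
      by (cases "even k") (simp_all add: bessel_coeff0_def del: fact_Suc)
    ultimately show "- (1 / 4 * (1 / 4) ^ k) \<le> bessel_coeff0 (Suc k) * 1 ^ (2 * Suc k)"
        by (simp add: power_divide)
  qed
  then show ?thesis by simp
qed

text \<open>The correction \<open>J0 * J1\<close> cancels the leading term of the derivative, so that the logarithmic derivative
  is \<open>O(1 / t\<^sup>2)\<close> and the energy stays between positive constants.\<close>

definition bessel_energy :: "real \<Rightarrow> real" where
  "bessel_energy t = t * ((J0 t)\<^sup>2 + (J1 t)\<^sup>2) - J0 t * J1 t"

lemma bessel_energy_has_derivative:
  assumes t: "t > 0" shows "(bessel_energy has_real_derivative J0 t * J1 t / t) (at t)"
proof -
  have "(bessel_energy has_real_derivative ((J0 t)\<^sup>2 + (J1 t)\<^sup>2) + t * (2 * J0 t * (- J1 t) + 2 * J1 t *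
      (J0 t - J1 t / t))
      - (- J1 t * J1 t + (J0 t - J1 t / t) * J0 t)) (at t)"
    unfolding bessel_energy_def[abs_def]
    by (auto intro!: derivative_eq_intros J0_has_derivative[OF t] J1_has_derivative[OF t])
  also have "((J0 t)\<^sup>2 + (J1 t)\<^sup>2) + t * (2 * J0 t * (- J1 t) + 2 * J1 t * (J0 t - J1 t / t))
      - (- J1 t * J1 t + (J0 t - J1 t / t) * J0 t) = J0 t * J1 t / t"
    using t by (simp add: field_simps power2_eq_square)
  finally show ?thesis .
qed

lemma abs_mult_le_half_sum_squares: "\<bar>x * y\<bar> \<le> (x\<^sup>2 + y\<^sup>2) / (2::real)"
  using sum_squares_bound[of "\<bar>x\<bar>" "\<bar>y\<bar>"] by (simp add: abs_mult)

text \<open>With S = J_0^2 + J_1^2 and t >= 1, |J_0 J_1| <= S / 2 <= t S / 2, so the correction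
  removes at most half of the main term t S.\<close>

lemma bessel_energy_bounds:
  assumes "t \<ge> 1"
  shows "t * ((J0 t)\<^sup>2 + (J1 t)\<^sup>2) \<le> 2 * bessel_energy t" and "\<bar>J0 t * J1 t / t\<bar> \<le> bessel_energy t / t\<^sup>2"
    and "0 \<le> bessel_energy t"
proof -
  let ?S = "(J0 t)\<^sup>2 + (J1 t)\<^sup>2"
  have a: "\<bar>J0 t * J1 t\<bar> \<le> ?S / 2" by (rule abs_mult_le_half_sum_squares)
  have "1 * ?S \<le> t * ?S" using assms by (intro mult_right_mono) auto
  then have "2 * (J0 t * J1 t) \<le> t * ?S" using abs_le_D1[OF a] by (simp add: mult.commute)
  moreover have "T \<le> 2 * (T - p)" if "2 * p \<le> T" for T p :: real using that by simp
  ultimately show 1: "t * ?S \<le> 2 * bessel_energy t" unfolding bessel_energy_def by blast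
  have "t * \<bar>J0 t * J1 t\<bar> \<le> t * (?S / 2)" using a assms by (intro mult_left_mono) auto
  with 1 have "t * \<bar>J0 t * J1 t\<bar> \<le> bessel_energy t" by simp
  then show "\<bar>J0 t * J1 t / t\<bar> \<le> bessel_energy t / t\<^sup>2" using assms by
      (simp add: field_simps power2_eq_square abs_mult)
  have "0 \<le> t * ?S" using assms by (intro mult_nonneg_nonneg) auto
  with 1 show "0 \<le> bessel_energy t" by linarith
qed

text \<open>Since |E'| <= E / t^2, E exp (-1/t) is nondecreasing and E exp (1/t) nonincreasing. As
  1/t^2 has integral 1 from 1 to infinity, E changes by at most the factor e in either
  direction.\<close>

lemma bessel_energy_two_sided:
  assumes t: "t \<ge> 1"
  shows "bessel_energy 1 * exp (- 1) \<le> bessel_energy t" and "bessel_energy t \<le> bessel_energy 1 * exp 1"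
proof -
  have "bessel_energy 1 * exp (- (1 / 1)) \<le> bessel_energy t * exp (- (1 / t))"
  proof (rule DERIV_nonneg_imp_nondecreasing[OF t])
    fix x :: real assume x: "1 \<le> x"
    have "((\<lambda>t. bessel_energy t * exp (- (1 / t))) has_real_derivative (J0 x * J1 x / x + bessel_energy x / x\<^sup>2)
        * exp (- (1 / x))) (at x)"
      using x by (auto intro!: derivative_eq_intros bessel_energy_has_derivative simp: field_simps
          power2_eq_square)
    moreover have "0 \<le> (J0 x * J1 x / x + bessel_energy x / x\<^sup>2) * exp (- (1 / x))"
    proof (rule mult_nonneg_nonneg)
      show "0 \<le> J0 x * J1 x / x + bessel_energy x / x\<^sup>2"
        using abs_le_D2[OF bessel_energy_bounds(2)[OF x]] by linarith
    qed simp
    ultimately show "\<exists>y. ((\<lambda>t. bessel_energy t * exp (- (1 / t))) has_real_derivative y) (at x) \<and> 0 \<le> y"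
        by blast
  qed
  moreover have "bessel_energy t * exp (- (1 / t)) \<le> bessel_energy t * 1"
    using t bessel_energy_bounds(3)[OF t] by (intro mult_left_mono) auto
  ultimately show "bessel_energy 1 * exp (- 1) \<le> bessel_energy t" by simp
  have "bessel_energy t * exp (1 / t) \<le> bessel_energy 1 * exp (1 / 1)"
  proof (rule DERIV_nonpos_imp_nonincreasing[OF t])
    fix x :: real assume x: "1 \<le> x"
    have "((\<lambda>t. bessel_energy t * exp (1 / t)) has_real_derivative (J0 x * J1 x / x - bessel_energy x / x\<^sup>2) *
        exp (1 / x)) (at x)"
      using x by (auto intro!: derivative_eq_intros bessel_energy_has_derivative simp: field_simps
          power2_eq_square)
    moreover have "(J0 x * J1 x / x - bessel_energy x / x\<^sup>2) * exp (1 / x) \<le> 0"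
    proof (rule mult_nonpos_nonneg)
      show "J0 x * J1 x / x - bessel_energy x / x\<^sup>2 \<le> 0"
        using abs_le_D1[OF bessel_energy_bounds(2)[OF x]] by linarith
    qed simp
    ultimately show "\<exists>y. ((\<lambda>t. bessel_energy t * exp (1 / t)) has_real_derivative y) (at x) \<and> y \<le> 0" by blast
  qed
  moreover have "bessel_energy t * 1 \<le> bessel_energy t * exp (1 / t)"
    using t bessel_energy_bounds(3)[OF t] by (intro mult_left_mono) auto
  ultimately show "bessel_energy t \<le> bessel_energy 1 * exp 1" by simp
qed

lemma bessel_energy_1_pos: "bessel_energy 1 > 0"
proof -
  have "0 < (J0 1)\<^sup>2 + (J1 1)\<^sup>2" using J0_1_pos by (intro add_pos_nonneg) auto
  then show ?thesis using bessel_energy_bounds(1)[of 1] by simp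
qed

lemma J1_decay: "t \<ge> 1 \<Longrightarrow> t * (J1 t)\<^sup>2 \<le> 2 * (bessel_energy 1 * exp 1)"
proof -
  assume t: "t \<ge> 1"
  have "t * (J1 t)\<^sup>2 \<le> t * ((J0 t)\<^sup>2 + (J1 t)\<^sup>2)" using t by (intro mult_left_mono) auto
  then show ?thesis using bessel_energy_bounds(1)[OF t] bessel_energy_two_sided(2)[OF t] by linarith
qed

lemma continuous_on_J1 [continuous_intros]: "continuous_on S f \<Longrightarrow> continuous_on S (\<lambda>x. J1 (f x))"
  unfolding J1_def by (intro continuous_intros entire_bessel_coeff1)

text \<open>J_1 has zeros, so only a mean of its square can be bounded below. \<open>Q\<close> is a
  primitive of 2 v^2 J_1^2 up to a bounded error in the derivative, and by the energy bound it grows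
  like s^2.\<close>

lemma J1_square_mean:
  obtains c s0 where "c > 0" "s0 \<ge> 1" "\<And>s. s \<ge> s0 \<Longrightarrow> c * s\<^sup>2 \<le> integral {0..s} (\<lambda>v. v\<^sup>2 * (J1 v)\<^sup>2)"
proof -
  define m where "m = bessel_energy 1 * exp (- 1)"
  define M where "M = bessel_energy 1 * exp 1"
  \<comment> \<open>Differentiating the first term produces v^2 (J_0^2 + J_1^2) and differentiating
    v^2 J_0 J_1 produces v^2 (J_0^2 - J_1^2). The difference isolates 2 v^2 J_1^2, up to multiples
    of v J_0 J_1, which stays bounded.\<close>
  define Q where "Q = (\<lambda>v. v\<^sup>2 * bessel_energy v / 2 - v\<^sup>2 * (J0 v * J1 v))"
  have m: "m > 0" and M: "M > 0" using bessel_energy_1_pos by (auto simp: m_def M_def)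
  have JJ: "\<bar>v * (J0 v * J1 v)\<bar> \<le> M" if "v \<ge> 1" for v
  proof -
    have "v * \<bar>J0 v * J1 v\<bar> \<le> v * (((J0 v)\<^sup>2 + (J1 v)\<^sup>2) / 2)" using that abs_mult_le_half_sum_squares
        by (intro mult_left_mono) auto
    moreover have "v * (((J0 v)\<^sup>2 + (J1 v)\<^sup>2) / 2) = v * ((J0 v)\<^sup>2 + (J1 v)\<^sup>2) / 2" by simp
    moreover have "\<bar>v * (J0 v * J1 v)\<bar> = v * \<bar>J0 v * J1 v\<bar>" using that by (simp add: abs_mult)
    ultimately show ?thesis using bessel_energy_bounds(1)[OF that] bessel_energy_two_sided(2)[OF that]
        unfolding M_def by linarith
  qed
  have Q': "(Q has_real_derivative 2 * (v\<^sup>2 * (J1 v)\<^sup>2) - 3 / 2 * (v * (J0 v * J1 v))) (at v)" if v: "v > 0"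
      for v
  proof -
    have "(Q has_real_derivative (2 * v * bessel_energy v + v\<^sup>2 * (J0 v * J1 v / v)) / 2 - (2 * v * (J0 v *
        J1 v) +
        v\<^sup>2 * (- J1 v * J1 v + (J0 v - J1 v / v) * J0 v))) (at v)"
      unfolding Q_def using v by (auto intro!: derivative_eq_intros J0_has_derivative[OF v] J1_has_derivative[OF
          v] bessel_energy_has_derivative[OF v] simp: field_simps power2_eq_square)
    also have "(2 * v * bessel_energy v + v\<^sup>2 * (J0 v * J1 v / v)) / 2 - (2 * v * (J0 v * J1 v) +
        v\<^sup>2 * (- J1 v * J1 v + (J0 v - J1 v / v) * J0 v)) = 2 * (v\<^sup>2 * (J1 v)\<^sup>2) - 3 / 2 * (v * (J0 v * J1 v))"
      using v unfolding bessel_energy_def by (simp add: field_simps power2_eq_square)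
    finally show ?thesis .
  qed
  let ?f = "\<lambda>v. v\<^sup>2 * (J1 v)\<^sup>2"
  have fi: "?f integrable_on {a..b}" for a b by (intro integrable_continuous_real continuous_intros)
  \<comment> \<open>Beyond this point the quadratic growth m s^2 / 2 of \<open>Q\<close> dominates
    the errors of size M s and the constant Q 1.\<close>
  define s0 where "s0 = max 1 ((10 * M + 4 * \<bar>Q 1\<bar>) / m)"
  have main: "m / 8 * s\<^sup>2 \<le> integral {0..s} ?f" if s: "s \<ge> s0" for s
  proof -
    have s1: "s \<ge> 1" and sm: "10 * M + 4 * \<bar>Q 1\<bar> \<le> s * m" using s m by (auto simp: s0_def divide_le_eq)
    have A: "((\<lambda>v. 2 * ?f v - 3 / 2 * (v * (J0 v * J1 v)) - 3 / 2 * M) has_integral (Q s - Q 1 - 3 / 2 * M *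
        (s - 1))) {1..s}"
    proof (rule has_integral_diff)
      show "((\<lambda>v. 2 * ?f v - 3 / 2 * (v * (J0 v * J1 v))) has_integral (Q s - Q 1)) {1..s}"
      proof (rule fundamental_theorem_of_calculus[where f = Q, OF s1])
        fix x assume "x \<in> {1..s}"
        then have "x > 0" by simp
        from has_field_derivative_at_within[OF Q'[OF this]]
        show "(Q has_vector_derivative 2 * ?f x - 3 / 2 * (x * (J0 x * J1 x))) (at x within {1..s})"
          by (simp only: has_real_derivative_iff_has_vector_derivative)
      qed
      show "((\<lambda>v. 3 / 2 * M) has_integral 3 / 2 * M * (s - 1)) {1..s}"
        using has_integral_const_real[of "3 / 2 * M" 1 s] s1 by (simp add: mult_ac)
    qed
    have B: "((\<lambda>v. 2 * ?f v) has_integral 2 * integral {1..s} ?f) {1..s}"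
      by (intro has_integral_mult_right integrable_integral fi)
    have f1: "Q s - Q 1 - 3 / 2 * M * (s - 1) \<le> 2 * integral {1..s} ?f"
    proof (rule has_integral_le[OF A B])
      fix v assume "v \<in> {1..s}"
      then show "2 * ?f v - 3 / 2 * (v * (J0 v * J1 v)) - 3 / 2 * M \<le> 2 * ?f v" using JJ[of v]
          by (auto simp: abs_le_iff)
    qed
    have f2: "integral {1..s} ?f \<le> integral {0..s} ?f"
      by (intro integral_subset_le fi) auto
    have f3: "s\<^sup>2 * m / 2 - s * M \<le> Q s"
    proof -
      have "s\<^sup>2 * m / 2 \<le> s\<^sup>2 * bessel_energy s / 2"
        using bessel_energy_two_sided(1)[OF s1] by (simp add: m_def mult_left_mono)
      moreover have "s * (s * (J0 s * J1 s)) \<le> s * M" using JJ[OF s1] s1 by (intro mult_left_mono) auto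
      ultimately show ?thesis unfolding Q_def by (simp add: power2_eq_square)
    qed
    have f4: "10 * M * s + 4 * \<bar>Q 1\<bar> \<le> s\<^sup>2 * m"
    proof -
      have "s * (10 * M + 4 * \<bar>Q 1\<bar>) \<le> s * (s * m)" using sm s1 by (intro mult_left_mono) auto
      moreover have "1 * (4 * \<bar>Q 1\<bar>) \<le> s * (4 * \<bar>Q 1\<bar>)" using s1 by (intro mult_right_mono) auto
      ultimately show ?thesis by (simp add: algebra_simps power2_eq_square)
    qed
    have alg: "X \<le> 8 * I" if "q - q1 - (3 / 2 * Z - 3 / 2 * M') \<le> 2 * I1" "I1 \<le> I" "X / 2 - Z \<le>
        q" "10 * Z + 4 * a \<le> X" "q1 \<le> a" "0 < M'"
      for X I q q1 Z M' I1 a :: real using that by (linarith | smt (verit))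
    have e: "3 / 2 * M * (s - 1) = 3 / 2 * (M * s) - 3 / 2 * M" "s * M = M * s" "10 * M * s = 10 * (M * s)"
      by (simp_all add: field_simps)
    have "s\<^sup>2 * m \<le> 8 * integral {0..s} ?f"
      by (rule alg[OF f1[unfolded e] f2 f3[unfolded e] f4[unfolded e] abs_ge_self M])
    then show ?thesis by (simp add: mult_ac)
  qed
  show thesis by (rule that[of "m / 8" s0]) (use m main in \<open>auto simp: s0_def\<close>)
qed

section \<open>The squared transform of the planar disc\<close>

text \<open>Taylor coefficients of (2 J_1 (y/2) / (y/2))^2, the square of the transform of the disc
  of diameter one divided by its area.\<close>

definition disc_coeff :: "nat \<Rightarrow> real" where
  "disc_coeff k = (- 1) ^ k * real ((2 * k + 2) choose k) / ((fact (Suc k))\<^sup>2 * 16 ^ k)"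

lemma entire_disc: "entire_coeffs disc_coeff"
proof (rule entire_coeffs_bound[OF entire_coeffs_inverse_fact, where B = 1 and M = 4])
  fix k
  have "real ((2 * k + 2) choose k) \<le> real (2 ^ (2 * k + 2))" by (intro of_nat_mono binomial_le_pow2)
  also have "\<dots> = 4 * 4 ^ k" by (simp add: power_mult power_add)
  also have "\<dots> \<le> 4 * (16 ^ k * fact (Suc k))"
    using mult_mono[of "4 ^ k" "16 ^ k :: real" 1 "fact (Suc k)"] power_mono[of 4 "16::real" k] fact_ge_1[of
        "Suc k", where 'a=real]
    by (simp del: fact_Suc)
  finally have "real ((2 * k + 2) choose k) / ((fact (Suc k))\<^sup>2 * 16 ^ k) \<le>
      4 * (16 ^ k * fact (Suc k)) / ((fact (Suc k))\<^sup>2 * 16 ^ k)"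
    by (rule divide_right_mono) simp
  also have "\<dots> = 4 / fact (Suc k)" by (simp add: power2_eq_square del: fact_Suc)
  also have "\<dots> \<le> 4 / fact k" by (intro divide_left_mono fact_mono) auto
  finally show "\<bar>disc_coeff k\<bar> \<le> 4 * 1 ^ k * \<bar>inverse (fact k)\<bar>"
    by (simp add: disc_coeff_def abs_mult divide_inverse)
qed simp

text \<open>A Cauchy product of the J_1 series with itself; Vandermonde's identity sums the products
  of binomials to \<open>(2 * k + 2) choose k\<close>.\<close>

lemma evser_disc: "evser disc_coeff y = 4 * (evser bessel_coeff1 (y / 2))\<^sup>2"
proof -
  let ?z = "y / 2"
  let ?a = "\<lambda>k. bessel_coeff1 k * ?z ^ (2 * k)"
  have n: "summable (\<lambda>k. norm (?a k))"
  proof -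
    have "summable (\<lambda>k. \<bar>bessel_coeff1 k\<bar> * (?z\<^sup>2) ^ k)" using entire_bessel_coeff1
        by (simp add: entire_coeffs_def)
    then show ?thesis by (simp add: abs_mult power_mult)
  qed
  have "(\<lambda>k. 4 * (\<Sum>i\<le>k. ?a i * ?a (k - i))) sums (4 * (evser bessel_coeff1 ?z * evser bessel_coeff1 ?z))"
    using Cauchy_product_sums[OF n n] by (intro sums_mult) (simp add: evser_def)
  also have "(\<lambda>k. 4 * (\<Sum>i\<le>k. ?a i * ?a (k - i))) = (\<lambda>k. disc_coeff k * y ^ (2 * k))"
  proof
    fix k
    have "?a i * ?a (k - i) = (- 1) ^ k * y ^ (2 * k) / (4 * 16 ^ k * (fact (Suc k))\<^sup>2) *
        real ((Suc k choose i) * (Suc k choose (k - i)))" if i: "i \<le> k" for i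
    proof -
      have 1: "real (Suc k choose i) = fact (Suc k) / (fact i * fact (Suc (k - i)))"
        using i by (simp add: binomial_fact Suc_diff_le del: fact_Suc)
      have "Suc k - (k - i) = Suc i" using i by simp
      then have 2: "real (Suc k choose (k - i)) = fact (Suc k) / (fact (k - i) * fact (Suc i))"
        using i by (simp add: binomial_fact del: fact_Suc)
      have p: "(- 1) ^ i * (- 1) ^ (k - i) = (- 1 :: real) ^ k" "(4::real) ^ i * 4 ^ (k - i) = 4 ^ k"
        "?z ^ (2 * i) * ?z ^ (2 * (k - i)) = ?z ^ (2 * k)"
        using i by (simp_all add: power_add[symmetric] diff_mult_distrib2)
      have "?z ^ (2 * k) = y ^ (2 * k) / 4 ^ k" by (simp add: power_divide power_mult)
      moreover have "(16::real) ^ k = 4 ^ k * 4 ^ k" by (simp add: power_mult_distrib[symmetric])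
      moreover have "?a i * ?a (k - i) = ((- 1) ^ i * (- 1) ^ (k - i)) * (?z ^ (2 * i) * ?z ^ (2 * (k - i))) /
          (4 * (4 ^ i * 4 ^ (k - i)) * (fact i * fact (Suc (k - i))) * (fact (k - i) * fact (Suc i)))"
        unfolding bessel_coeff1_def by (simp add: mult_ac del: fact_Suc)
      moreover have "s * (Y / q) / (4 * q * A * B) = s * Y / (4 * (q * q) * F\<^sup>2) * (F / A * (F / B))" if "F \<noteq> 0"
          for s Y q A B F :: real
        using that by (simp add: power2_eq_square)
      from this[of "fact (Suc k)"] have "(- 1) ^ k * (y ^ (2 * k) / 4 ^ k) / (4 * 4 ^ k * (fact i * fact (Suc
          (k - i))) * (fact (k - i) * fact (Suc i))) =
         (- 1) ^ k * y ^ (2 * k) / (4 * (4 ^ k * 4 ^ k) * (fact (Suc k))\<^sup>2) * (fact (Suc k) / (fact i * fact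
             (Suc (k - i))) * (fact (Suc k) / (fact (k - i) * fact (Suc i))))"
        by (simp del: fact_Suc)
      ultimately show ?thesis unfolding of_nat_mult 1 2 p by (simp only:)
    qed
    then have "(\<Sum>i\<le>k. ?a i * ?a (k - i)) = (\<Sum>i\<le>k. (- 1) ^ k * y ^ (2 * k) / (4 * 16 ^ k * (fact (Suc k))\<^sup>2) *
        real ((Suc k choose i) * (Suc k choose (k - i))))"
      by (intro sum.cong) auto
    also have "\<dots> = (- 1) ^ k * y ^ (2 * k) / (4 * 16 ^ k * (fact (Suc k))\<^sup>2) * real (\<Sum>i\<le>k. (Suc k choose i) *
        (Suc k choose (k - i)))"
      by (simp only: sum_distrib_left of_nat_sum)
    also have "(\<Sum>i\<le>k. (Suc k choose i) * (Suc k choose (k - i))) = (2 * k + 2) choose k"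
    proof -
      have "Suc k + Suc k = 2 * k + 2" by simp
      then show ?thesis by (simp only: vandermonde)
    qed
    finally have "(\<Sum>i\<le>k. ?a i * ?a (k - i)) = (- 1) ^ k * y ^ (2 * k) / (4 * 16 ^ k * (fact (Suc k))\<^sup>2) * real
        ((2 * k + 2) choose k)" .
    then show "4 * (\<Sum>i\<le>k. ?a i * ?a (k - i)) = disc_coeff k * y ^ (2 * k)"
      unfolding disc_coeff_def by (simp add: mult_ac del: fact_Suc)
  qed
  finally show ?thesis using evser_sums[OF entire_disc, of y] by (auto dest: sums_unique2 simp:
      power2_eq_square)
qed

lemma evser_disc_nonneg: "evser disc_coeff y \<ge> 0"
  by (simp add: evser_disc)

lemma evser_disc_J1: "y\<^sup>2 * evser disc_coeff y = 16 * (J1 (y / 2))\<^sup>2"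
  by (simp add: evser_disc J1_def power_mult_distrib power2_eq_square)

text \<open>y^2 times the series is 16 J_1 (y/2)^2, and \<open>J1_decay\<close> supplies one more
  power of y once y/2 >= 1. The range y <= 2 is covered by compactness.\<close>

lemma evser_disc_decay:
  obtains C where "C > 0" "\<And>y. y > 0 \<Longrightarrow> y ^ 3 * evser disc_coeff y \<le> C"
proof -
  define M where "M = 2 * (bessel_energy 1 * exp 1)"
  have "continuous_on {0..2} (\<lambda>y. y ^ 3 * evser disc_coeff y)" by (intro continuous_intros entire_disc)
  then have "\<exists>z\<in>{0..2}. \<forall>y\<in>{0..2}. y ^ 3 * evser disc_coeff y \<le> z ^ 3 * evser disc_coeff z"
    by (intro continuous_attains_sup) auto
  then obtain z where z: "\<forall>y\<in>{0..2}. y ^ 3 * evser disc_coeff y \<le> z ^ 3 * evser disc_coeff z" by blast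
  have "y ^ 3 * evser disc_coeff y \<le> max 1 (max (32 * M) (z ^ 3 * evser disc_coeff z))" if "y > 0" for y
  proof (cases "y \<le> 2")
    case True
    then show ?thesis using z that by (auto simp: le_max_iff_disj)
  next
    case False
    have "y ^ 3 * evser disc_coeff y = y * (y\<^sup>2 * evser disc_coeff y)"
        by (simp add: power3_eq_cube power2_eq_square)
    also have "\<dots> = 32 * (y / 2 * (J1 (y / 2))\<^sup>2)" by (simp add: evser_disc_J1)
    also have "\<dots> \<le> 32 * M" using J1_decay[of "y / 2"] False by (simp add: M_def)
    finally show ?thesis by simp
  qed
  then show thesis by (intro that[of "max 1 (max (32 * M) (z ^ 3 * evser disc_coeff z))"]) auto
qed

section \<open>The mixing weight from Abel's equation\<close>

text \<open>Minus the derivative of I (w), where I (w) is the integral of ((r^2 - w^2) (1 -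
  r))^(-1/2) over w < r < 1. The substitution r = w + (1 - w) x fixes the interval and turns the
  integrand into (x (1 - x))^(-1/2) (x + w (2 - x))^(-1/2), so that only the last factor is
  differentiated. The value I (1) = pi / sqrt 2 appears later as a point mass at w = 1.\<close>

definition cap_weight :: "real \<Rightarrow> ennreal" where
  "cap_weight w = (\<integral>\<^sup>+x. ennreal ((x * (1 - x)) powr (- 1 / 2) * ((2 - x) / 2 * (x + w * (2 - x)) powr
      (- 3 / 2))) * indicator {0<..<1} x \<partial>lborel)"

lemma cap_weight_borel [measurable]: "cap_weight \<in> borel_measurable borel"
  unfolding cap_weight_def[abs_def] by measurable

lemma nn_integral_arcsine:
  "(\<integral>\<^sup>+x. ennreal ((x * (1 - x)) powr (- 1 / 2)) * indicator {0<..<1} x \<partial>lborel) = ennreal pi"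
proof -
  have "(\<integral>\<^sup>+x. ennreal ((x * (1 - x)) powr (- 1 / 2)) * indicator {0<..<1} x \<partial>lborel) =
     (\<integral>\<^sup>+x. ennreal (x powr (1 / 2 - 1) * (1 - x) powr (1 / 2 - 1)) * indicator {0..1} x \<partial>lborel)"
    using AE_lborel_singleton[of "0::real"] AE_lborel_singleton[of "1::real"]
    by (intro nn_integral_cong_AE, eventually_elim) (auto simp: indicator_def powr_mult)
  also have "\<dots> = ennreal (Beta (1 / 2) (1 / 2))"
    by (intro nn_integral_has_integral_lebesgue' has_integral_Beta_real) auto
  also have "Beta (1 / 2) (1 / 2) = pi"
    by (simp add: Beta_def Gamma_one_half_real)
  finally show ?thesis .
qed

text \<open>Integration by parts in w. The boundary value at w = 1 is (x + (2 - x))^(-1/2),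
  independent of x; at w = 0 it vanishes because p >= 1.\<close>

lemma cap_inner_parts:
  assumes x: "0 < x" "x < 1" and p: "p \<ge> (1::nat)"
  shows "(\<integral>\<^sup>+w. ennreal (real p * w ^ (p - 1) * (x + w * (2 - x)) powr (- 1 / 2)) *
      indicator {0<..<1} w \<partial>lborel) =
    ennreal (2 powr (- 1 / 2)) + (\<integral>\<^sup>+w. ennreal (w ^ p * ((2 - x) / 2 * (x + w * (2 - x)) powr (- 3 / 2))) *
        indicator {0<..<1} w \<partial>lborel)"
proof -
  let ?m = "\<lambda>w. x + w * (2 - x)"
  have m: "?m w > 0" if "w \<in> {0..1}" for w using x that by (intro add_pos_nonneg mult_nonneg_nonneg) auto
  have D: "((\<lambda>w. w ^ p * ?m w powr (- 1 / 2)) has_real_derivative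
      real p * w ^ (p - 1) * ?m w powr (- 1 / 2) - w ^ p * ((2 - x) / 2 * ?m w powr (- 3 / 2)))
          (at w within {0..1})" if "w \<in> {0..1}" for w
  proof -
    have "((\<lambda>w. w ^ p * ?m w powr (- 1 / 2)) has_real_derivative
      real p * w ^ (p - 1) * ?m w powr (- 1 / 2) + ((- 1 / 2) * ?m w powr (- 1 / 2 - 1) * (2 - x)) * w ^ p)
          (at w within {0..1})"
      using m[OF that] by (auto intro!: derivative_eq_intros)
    then show ?thesis by (simp add: algebra_simps)
  qed
  have "((\<lambda>w. real p * w ^ (p - 1) * ?m w powr (- 1 / 2) - w ^ p * ((2 - x) / 2 * ?m w powr (- 3 / 2)))
      has_integral
      (1 ^ p * ?m 1 powr (- 1 / 2) - 0 ^ p * ?m 0 powr (- 1 / 2))) {0..1}"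
    by (rule fundamental_theorem_of_calculus) (use D in \<open>auto simp:
        has_real_derivative_iff_has_vector_derivative\<close>)
  then have A: "((\<lambda>w. real p * w ^ (p - 1) * ?m w powr (- 1 / 2) - w ^ p * ((2 - x) / 2 * ?m w powr (- 3 / 2)))
      has_integral 2 powr (- 1 / 2)) {0..1}"
    using p by (simp add: zero_power)
  let ?g = "\<lambda>w. w ^ p * ((2 - x) / 2 * ?m w powr (- 3 / 2))"
  have mne: "\<forall>w\<in>{0..1}. ?m w \<noteq> 0" using m by fastforce
  have "continuous_on {0..1} ?g" using mne by (intro continuous_intros) auto
  then have B: "(?g has_integral integral {0..1} ?g) {0..1}" by (intro integrable_integral
      integrable_continuous_real)
  have g0: "?g w \<ge> 0" if "w \<in> {0..1}" for w using x that by (intro mult_nonneg_nonneg) auto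
  have "integral {0..1} ?g \<ge> 0" using g0 by (intro integral_nonneg) (use B in blast)
  have C: "((\<lambda>w. real p * w ^ (p - 1) * ?m w powr (- 1 / 2)) has_integral 2 powr (- 1 / 2) + integral {0..1} ?g)
      {0..1}"
    using has_integral_add[OF A B] by simp
  have ind: "(\<integral>\<^sup>+w. ennreal (h w) * indicator {0<..<1} w \<partial>lborel) = (\<integral>\<^sup>+w. ennreal (h w) *
      indicator {0..1} w \<partial>lborel)" for h :: "real \<Rightarrow> real"
    using AE_lborel_singleton[of "0::real"] AE_lborel_singleton[of "1::real"]
    by (intro nn_integral_cong_AE, eventually_elim) (auto simp: indicator_def)
  have "(\<integral>\<^sup>+w. ennreal (?g w) * indicator {0<..<1} w \<partial>lborel) = ennreal (integral {0..1} ?g)"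
    unfolding ind by (rule nn_integral_has_integral_lebesgue'[OF g0 B])
  moreover have "(\<integral>\<^sup>+w. ennreal (real p * w ^ (p - 1) * ?m w powr (- 1 / 2)) * indicator {0<..<1} w \<partial>lborel) =
      ennreal (2 powr (- 1 / 2) + integral {0..1} ?g)"
    unfolding ind by (rule nn_integral_has_integral_lebesgue'[OF _ C]) auto
  ultimately show ?thesis using \<open>integral {0..1} ?g \<ge> 0\<close> by (simp add: ennreal_plus)
qed

text \<open>With r = w + (1 - w) x one has r - w = (1 - w) x, r + w = x + w (2 - x) and 1 - r = (1 -
  w) (1 - x). The two factors (1 - w)^(-1/2) cancel the Jacobian.\<close>

lemma cap_inner_substitution:
  assumes w: "0 < w" "w < (1::real)"
  shows "(\<integral>\<^sup>+r. ennreal ((r\<^sup>2 - w\<^sup>2) powr (- 1 / 2) * (1 - r) powr (- 1 / 2)) * indicator {w<..<1} r \<partial>lborel) =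
    (\<integral>\<^sup>+x. ennreal ((x * (1 - x)) powr (- 1 / 2) * (x + w * (2 - x)) powr (- 1 / 2)) *
        indicator {0<..<1} x \<partial>lborel)"
proof -
  have "(\<integral>\<^sup>+r. ennreal ((r\<^sup>2 - w\<^sup>2) powr (- 1 / 2) * (1 - r) powr (- 1 / 2)) * indicator {w<..<1} r \<partial>lborel) =
    ennreal \<bar>1 - w\<bar> * (\<integral>\<^sup>+x. ennreal (((w + (1 - w) * x)\<^sup>2 - w\<^sup>2) powr (- 1 / 2) * (1 - (w + (1 - w) * x)) powr
        (- 1 / 2)) * indicator {w<..<1} (w + (1 - w) * x) \<partial>lborel)"
    by (rule nn_integral_real_affine) (use w in auto)
  also have "\<dots> = (\<integral>\<^sup>+x. ennreal \<bar>1 - w\<bar> * (ennreal (((w + (1 - w) * x)\<^sup>2 - w\<^sup>2) powr (- 1 / 2) * (1 - (w + (1 -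
      w) * x)) powr (- 1 / 2)) * indicator {w<..<1} (w + (1 - w) * x)) \<partial>lborel)"
    by (rule nn_integral_cmult[symmetric]) measurable
  also have "\<dots> = (\<integral>\<^sup>+x. ennreal ((x * (1 - x)) powr (- 1 / 2) * (x + w * (2 - x)) powr (- 1 / 2)) *
      indicator {0<..<1} x \<partial>lborel)"
  proof (rule nn_integral_cong)
    fix x :: real
    have "w + (1 - w) * x < 1 \<longleftrightarrow> (1 - w) * x < (1 - w) * 1" by (simp add: algebra_simps)
    also have "\<dots> \<longleftrightarrow> x < 1" using w by (intro mult_less_cancel_left_pos) simp
    finally have i: "w + (1 - w) * x \<in> {w<..<1} \<longleftrightarrow> x \<in> {0<..<1}" using w by (auto simp: zero_less_mult_iff)
    show "ennreal \<bar>1 - w\<bar> * (ennreal (((w + (1 - w) * x)\<^sup>2 - w\<^sup>2) powr (- 1 / 2) * (1 - (w + (1 - w) * x)) powr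
        (- 1 / 2)) * indicator {w<..<1} (w + (1 - w) * x)) =
      ennreal ((x * (1 - x)) powr (- 1 / 2) * (x + w * (2 - x)) powr (- 1 / 2)) * indicator {0<..<1} x"
    proof (cases "x \<in> {0<..<1}")
      case True
      have "(w + (1 - w) * x)\<^sup>2 - w\<^sup>2 = (1 - w) * (x * (x + w * (2 - x)))"
          by (simp add: power2_eq_square algebra_simps)
      moreover have "1 - (w + (1 - w) * x) = (1 - w) * (1 - x)" by (simp add: algebra_simps)
      moreover have "x + w * (2 - x) > 0" using True w by (intro add_pos_nonneg mult_nonneg_nonneg) auto
      ultimately have "((w + (1 - w) * x)\<^sup>2 - w\<^sup>2) powr (- 1 / 2) * (1 - (w + (1 - w) * x)) powr (- 1 / 2) =
        ((1 - w) powr (- 1 / 2) * (1 - w) powr (- 1 / 2)) * ((x * (1 - x)) powr (- 1 / 2) * (x + w * (2 - x))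
            powr (- 1 / 2))"
        using True w by (simp add: powr_mult mult_ac)
      also have "(1 - w) powr (- 1 / 2) * (1 - w) powr (- 1 / 2) = 1 / (1 - w)"
        using w by (simp add: powr_add[symmetric] powr_minus_divide)
      finally have "\<bar>1 - w\<bar> * (((w + (1 - w) * x)\<^sup>2 - w\<^sup>2) powr (- 1 / 2) * (1 - (w + (1 - w) * x)) powr
          (- 1 / 2)) =
         (x * (1 - x)) powr (- 1 / 2) * (x + w * (2 - x)) powr (- 1 / 2)" using w by simp
      then show ?thesis using True i by (simp add: ennreal_mult[symmetric])
    qed (use i in \<open>auto simp: indicator_def\<close>)
  qed
  finally show ?thesis .
qed

text \<open>Scaling w = r s and then substituting v = s^2 leads to a Beta integral.\<close>

lemma cap_radial_integral:
  assumes r: "0 < r" and p: "p \<ge> (1::nat)"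
  shows "(\<integral>\<^sup>+w. ennreal (real p * w ^ (p - 1) * (r\<^sup>2 - w\<^sup>2) powr (- 1 / 2)) * indicator {0<..<r} w \<partial>lborel) =
    ennreal (r ^ (p - 1) * (real p / 2 * Beta (real p / 2) (1 / 2)))"
proof -
  have 1: "(\<integral>\<^sup>+s. ennreal (s ^ (p - 1) * (1 - s\<^sup>2) powr (- 1 / 2)) * indicator {0<..<1} s \<partial>lborel) =
      ennreal (1 / 2 * Beta (real p / 2) (1 / 2))"
  proof -
    define f where "f = (\<lambda>v::real. v powr (real p / 2 - 1) * (1 - v) powr (1 / 2 - 1))"
    have "(\<integral>\<^sup>+v. ennreal (f v) * indicator {0\<^sup>2..1\<^sup>2} v \<partial>lborel) = (\<integral>\<^sup>+s. ennreal (f (s\<^sup>2) * (2 * s)) *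
        indicator {0..1} s \<partial>lborel)"
    proof -
      have "(\<integral>\<^sup>+v. ennreal (f v * indicator {0\<^sup>2..1\<^sup>2} v) \<partial>lborel) = (\<integral>\<^sup>+s. ennreal (f (s\<^sup>2) * (2 * s) *
          indicator {0..1} s) \<partial>lborel)"
        by (rule nn_integral_substitution[where g = "\<lambda>s. s\<^sup>2" and g' = "\<lambda>s. 2 * s"])
          (auto simp: f_def set_borel_measurable_def intro!: derivative_eq_intros continuous_intros)
      moreover have e: "ennreal (y * indicator A s) = ennreal y * indicator A s"
          for y :: real and A and s :: real
        by (simp add: indicator_def)
      ultimately show ?thesis unfolding e by simp
    qed
    moreover have "(\<integral>\<^sup>+v. ennreal (f v) * indicator {0\<^sup>2..1\<^sup>2} v \<partial>lborel) = ennreal (Beta (real p / 2) (1 / 2))"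
      unfolding f_def using p by (simp only: zero_power2 power_one, intro nn_integral_has_integral_lebesgue'
          has_integral_Beta_real) auto
    moreover have "(\<integral>\<^sup>+s. ennreal (f (s\<^sup>2) * (2 * s)) * indicator {0..1} s \<partial>lborel) =
       (\<integral>\<^sup>+s. 2 * (ennreal (s ^ (p - 1) * (1 - s\<^sup>2) powr (- 1 / 2)) * indicator {0<..<1} s) \<partial>lborel)"
      using AE_lborel_singleton[of "0::real"] AE_lborel_singleton[of "1::real"]
    proof (intro nn_integral_cong_AE, eventually_elim)
      case (elim s)
      show ?case
      proof (cases "s \<in> {0<..<1}")
        case True
        have "s\<^sup>2 = s powr 2" using True by (simp add: powr_numeral)
        then have "(s\<^sup>2) powr (real p / 2 - 1) = s powr (2 * (real p / 2 - 1))" by (simp only: powr_powr)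
        then have "(s\<^sup>2) powr (real p / 2 - 1) * s = s powr (2 * (real p / 2 - 1)) * s powr 1" using True
            by simp
        also have "\<dots> = s powr (real (p - 1))"
          unfolding powr_add[symmetric] using p by (intro arg_cong[where f =
              "\<lambda>x. s powr x"]) (simp add: of_nat_diff)
        also have "\<dots> = s ^ (p - 1)" using True by (simp add: powr_realpow)
        finally have "(s\<^sup>2) powr (real p / 2 - 1) * s = s ^ (p - 1)" .
        then have "f (s\<^sup>2) * (2 * s) = 2 * (s ^ (p - 1) * (1 - s\<^sup>2) powr (- 1 / 2))"
            by (simp add: f_def mult_ac)
        moreover have "0 \<le> s ^ (p - 1) * (1 - s\<^sup>2) powr (- 1 / 2)" using True by simp
        ultimately have "ennreal (f (s\<^sup>2) * (2 * s)) = 2 * ennreal (s ^ (p - 1) * (1 - s\<^sup>2) powr (- 1 / 2))"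
          by (simp only: ennreal_mult ennreal_numeral)
        then show ?thesis using True by simp
      qed (use elim in \<open>auto simp: indicator_def\<close>)
    qed
    ultimately have "2 * (\<integral>\<^sup>+s. ennreal (s ^ (p - 1) * (1 - s\<^sup>2) powr (- 1 / 2)) * indicator {0<..<1} s \<partial>lborel)
        = ennreal (Beta (real p / 2) (1 / 2))"
      by (subst (asm) nn_integral_cmult) auto
    moreover have "Beta (real p / 2) (1 / 2) \<ge> 0" using p unfolding Beta_def
        by (intro divide_nonneg_nonneg mult_nonneg_nonneg less_imp_le Gamma_real_pos) auto
    ultimately show ?thesis
      by (cases "\<integral>\<^sup>+s. ennreal (s ^ (p - 1) * (1 - s\<^sup>2) powr (- 1 / 2)) * indicator {0<..<1} s \<partial>lborel")
        (auto simp: ennreal_mult[symmetric] numeral_mult_ennreal ennreal_mult_top)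
  qed
  have "(\<integral>\<^sup>+w. ennreal (real p * w ^ (p - 1) * (r\<^sup>2 - w\<^sup>2) powr (- 1 / 2)) * indicator {0<..<r} w \<partial>lborel) =
    ennreal \<bar>r\<bar> * (\<integral>\<^sup>+s. ennreal (real p * (0 + r * s) ^ (p - 1) * (r\<^sup>2 - (0 + r * s)\<^sup>2) powr (- 1 / 2)) *
        indicator {0<..<r} (0 + r * s) \<partial>lborel)"
    by (rule nn_integral_real_affine) (use r in auto)
  also have "\<dots> = (\<integral>\<^sup>+s. ennreal \<bar>r\<bar> * (ennreal (real p * (0 + r * s) ^ (p - 1) * (r\<^sup>2 - (0 + r * s)\<^sup>2) powr
      (- 1 / 2)) * indicator {0<..<r} (0 + r * s)) \<partial>lborel)"
    by (rule nn_integral_cmult[symmetric]) measurable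
  also have "\<dots> = (\<integral>\<^sup>+s. ennreal (real p * r ^ (p - 1)) * (ennreal (s ^ (p - 1) * (1 - s\<^sup>2) powr (- 1 / 2)) *
      indicator {0<..<1} s) \<partial>lborel)"
  proof (rule nn_integral_cong)
    fix s :: real
    have "r * s < r \<longleftrightarrow> r * s < r * 1" by simp
    also have "\<dots> \<longleftrightarrow> s < 1" using r by (intro mult_less_cancel_left_pos)
    finally have i: "r * s \<in> {0<..<r} \<longleftrightarrow> s \<in> {0<..<1}" using r by (auto simp: zero_less_mult_iff)
    show "ennreal \<bar>r\<bar> * (ennreal (real p * (0 + r * s) ^ (p - 1) * (r\<^sup>2 - (0 + r * s)\<^sup>2) powr (- 1 / 2)) *
        indicator {0<..<r} (0 + r * s)) =
      ennreal (real p * r ^ (p - 1)) * (ennreal (s ^ (p - 1) * (1 - s\<^sup>2) powr (- 1 / 2)) *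
          indicator {0<..<1} s)"
    proof (cases "s \<in> {0<..<1}")
      case True
      have "s\<^sup>2 \<le> 1" using True by (simp add: power_le_one)
      have "r\<^sup>2 - (0 + r * s)\<^sup>2 = r\<^sup>2 * (1 - s\<^sup>2)" by (simp add: algebra_simps power_mult_distrib)
      then have "(r\<^sup>2 - (0 + r * s)\<^sup>2) powr (- 1 / 2) = (r\<^sup>2) powr (- 1 / 2) * (1 - s\<^sup>2) powr (- 1 / 2)"
        using \<open>s\<^sup>2 \<le> 1\<close> by (simp add: powr_mult)
      also have "(r\<^sup>2) powr (- 1 / 2) = 1 / r"
      proof -
        have "r\<^sup>2 = r powr 2" using r by (simp add: powr_numeral)
        then show ?thesis using r by (simp add: powr_powr powr_minus_divide)
      qed
      finally have "\<bar>r\<bar> * (real p * (0 + r * s) ^ (p - 1) * (r\<^sup>2 - (0 + r * s)\<^sup>2) powr (- 1 / 2)) =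
        real p * r ^ (p - 1) * (s ^ (p - 1) * (1 - s\<^sup>2) powr (- 1 / 2))" using r
            by (simp add: power_mult_distrib)
      then show ?thesis using True i r by (simp add: ennreal_mult[symmetric])
    qed (use i in \<open>auto simp: indicator_def\<close>)
  qed
  also have "\<dots> = ennreal (real p * r ^ (p - 1)) * ennreal (1 / 2 * Beta (real p / 2) (1 / 2))"
    unfolding 1[symmetric] by (rule nn_integral_cmult) measurable
  also have "\<dots> = ennreal (r ^ (p - 1) * (real p / 2 * Beta (real p / 2) (1 / 2)))"
  proof -
    have "Beta (real p / 2) (1 / 2) \<ge> 0" using p unfolding Beta_def by
        (intro divide_nonneg_nonneg mult_nonneg_nonneg less_imp_le Gamma_real_pos) auto
    then show ?thesis using r by (simp add: ennreal_mult[symmetric] mult_ac)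
  qed
  finally show ?thesis .
qed

text \<open>Parts in w moves the derivative from the weight to w^p, the substitution brings back r,
  and Tonelli on 0 < w < r < 1 leaves one Beta integral in w and one in r. The boundary term is
  added on the left because subtraction in \<open>ennreal\<close> truncates.\<close>

lemma cap_weight_moment:
  assumes p: "p \<ge> (1::nat)"
  shows "(\<integral>\<^sup>+w. ennreal (w ^ p) * cap_weight w * indicator {0<..<1} w \<partial>lborel) + ennreal (2 powr (- 1 / 2) * pi)
      =
    ennreal (real p / 2 * Beta (real p / 2) (1 / 2) * Beta (real p) (1 / 2))"
proof -
  define \<kappa> where "\<kappa> = (\<lambda>x. ennreal ((x * (1 - x)) powr (- 1 / 2)) * indicator {0<..<1::real} x)"
  have [measurable]: "\<kappa> \<in> borel_measurable borel" unfolding \<kappa>_def by measurable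
  define A where "A = (\<lambda>x w. ennreal (w ^ p * ((2 - x) / 2 * (x + w * (2 - x)) powr (- 3 / 2))) *
      indicator {0<..<1::real} w)"
  define B where "B = (\<lambda>x w. ennreal (real p * w ^ (p - 1) * (x + w * (2 - x)) powr (- 1 / 2)) *
      indicator {0<..<1::real} w)"
  define K where "K = (\<lambda>w r. if 0 < w \<and> w < r \<and> r < 1 then ennreal (real p * w ^ (p - 1) * (r\<^sup>2 - w\<^sup>2) powr
      (- 1 / 2) * (1 - r) powr (- 1 / 2)) else 0)"
  have [measurable]: "(\<lambda>(x, w). A x w) \<in> borel_measurable (borel \<Otimes>\<^sub>M borel)" "(\<lambda>(x, w). B x w)
      \<in> borel_measurable (borel \<Otimes>\<^sub>M borel)"
    "(\<lambda>(w, r). K w r) \<in> borel_measurable (borel \<Otimes>\<^sub>M borel)"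
    unfolding A_def B_def K_def by measurable
  let ?c = "real p / 2 * Beta (real p / 2) (1 / 2)"
  have Bp: "Beta (real p / 2) (1 / 2) \<ge> 0" "Beta (real p) (1 / 2) \<ge> 0"
    using p unfolding Beta_def by (auto intro!: divide_nonneg_nonneg mult_nonneg_nonneg less_imp_le[OF
        Gamma_real_pos])
  have "(\<integral>\<^sup>+w. ennreal (w ^ p) * cap_weight w * indicator {0<..<1} w \<partial>lborel) =
      (\<integral>\<^sup>+w. (\<integral>\<^sup>+x. \<kappa> x * A x w \<partial>lborel) \<partial>lborel)"
  proof (rule nn_integral_cong)
    fix w :: real
    have "ennreal (w ^ p) * indicator {0<..<1} w * cap_weight w =
      (\<integral>\<^sup>+x. ennreal (w ^ p) * indicator {0<..<1} w * (ennreal ((x * (1 - x)) powr (- 1 / 2) * ((2 - x) / 2 *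
          (x + w * (2 - x)) powr (- 3 / 2))) * indicator {0<..<1} x) \<partial>lborel)"
      unfolding cap_weight_def by (rule nn_integral_cmult[symmetric]) measurable
    also have "\<dots> = (\<integral>\<^sup>+x. \<kappa> x * A x w \<partial>lborel)"
      by (intro nn_integral_cong) (auto simp: \<kappa>_def A_def indicator_def ennreal_mult[symmetric] mult_ac)
    finally show "ennreal (w ^ p) * cap_weight w * indicator {0<..<1} w = (\<integral>\<^sup>+x. \<kappa> x * A x w \<partial>lborel)"
      by (simp add: mult_ac)
  qed
  also have "\<dots> = (\<integral>\<^sup>+x. (\<integral>\<^sup>+w. \<kappa> x * A x w \<partial>lborel) \<partial>lborel)"
    by (rule lborel_pair.Fubini') measurable
  also have "\<dots> = (\<integral>\<^sup>+x. \<kappa> x * (\<integral>\<^sup>+w. A x w \<partial>lborel) \<partial>lborel)"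
    by (intro nn_integral_cong nn_integral_cmult) measurable
  finally have "(\<integral>\<^sup>+w. ennreal (w ^ p) * cap_weight w * indicator {0<..<1} w \<partial>lborel) + ennreal (2 powr
      (- 1 / 2) * pi) =
      (\<integral>\<^sup>+x. \<kappa> x * (\<integral>\<^sup>+w. A x w \<partial>lborel) \<partial>lborel) + (\<integral>\<^sup>+x. \<kappa> x * ennreal (2 powr (- 1 / 2)) \<partial>lborel)"
    using nn_integral_multc[of \<kappa> lborel "ennreal (2 powr (- 1 / 2))"] nn_integral_arcsine
    by (simp add: \<kappa>_def ennreal_mult mult.commute)
  also have "\<dots> = (\<integral>\<^sup>+x. \<kappa> x * (\<integral>\<^sup>+w. A x w \<partial>lborel) + \<kappa> x * ennreal (2 powr (- 1 / 2)) \<partial>lborel)"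
    by (rule nn_integral_add[symmetric]) measurable
  also have "\<dots> = (\<integral>\<^sup>+x. \<kappa> x * (\<integral>\<^sup>+w. B x w \<partial>lborel) \<partial>lborel)"
  proof (rule nn_integral_cong)
    fix x :: real
    show "\<kappa> x * (\<integral>\<^sup>+w. A x w \<partial>lborel) + \<kappa> x * ennreal (2 powr (- 1 / 2)) = \<kappa> x * (\<integral>\<^sup>+w. B x w \<partial>lborel)"
    proof (cases "x \<in> {0<..<1}")
      case True
      then have "(\<integral>\<^sup>+w. B x w \<partial>lborel) = ennreal (2 powr (- 1 / 2)) + (\<integral>\<^sup>+w. A x w \<partial>lborel)"
        using cap_inner_parts[of x p] p unfolding A_def B_def by auto
      then show ?thesis by (simp only: distrib_left add.commute)
    qed (simp add: \<kappa>_def)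
  qed
  also have "\<dots> = (\<integral>\<^sup>+x. (\<integral>\<^sup>+w. \<kappa> x * B x w \<partial>lborel) \<partial>lborel)"
    by (intro nn_integral_cong nn_integral_cmult[symmetric]) measurable
  also have "\<dots> = (\<integral>\<^sup>+w. (\<integral>\<^sup>+x. \<kappa> x * B x w \<partial>lborel) \<partial>lborel)"
    by (rule lborel_pair.Fubini'[symmetric]) measurable
  also have "\<dots> = (\<integral>\<^sup>+w. (\<integral>\<^sup>+r. K w r \<partial>lborel) \<partial>lborel)"
  proof (rule nn_integral_cong)
    fix w :: real
    show "(\<integral>\<^sup>+x. \<kappa> x * B x w \<partial>lborel) = (\<integral>\<^sup>+r. K w r \<partial>lborel)"
    proof (cases "w \<in> {0<..<1}")
      case True
      then have w: "0 < w" "w < 1" by auto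
      have "(\<integral>\<^sup>+x. \<kappa> x * B x w \<partial>lborel) = (\<integral>\<^sup>+x. ennreal (real p * w ^ (p - 1)) * (ennreal ((x * (1 - x)) powr
          (- 1 / 2) * (x + w * (2 - x)) powr (- 1 / 2)) * indicator {0<..<1} x) \<partial>lborel)"
        using w by (intro nn_integral_cong) (auto simp: \<kappa>_def B_def indicator_def ennreal_mult[symmetric]
            mult_ac)
      also have "\<dots> = ennreal (real p * w ^ (p - 1)) * (\<integral>\<^sup>+r. ennreal ((r\<^sup>2 - w\<^sup>2) powr (- 1 / 2) * (1 - r) powr
          (- 1 / 2)) * indicator {w<..<1} r \<partial>lborel)"
        unfolding cap_inner_substitution[OF w] by (rule nn_integral_cmult) measurable
      also have "\<dots> = (\<integral>\<^sup>+r. ennreal (real p * w ^ (p - 1)) * (ennreal ((r\<^sup>2 - w\<^sup>2) powr (- 1 / 2) * (1 - r) powr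
          (- 1 / 2)) * indicator {w<..<1} r) \<partial>lborel)"
        by (rule nn_integral_cmult[symmetric]) measurable
      also have "\<dots> = (\<integral>\<^sup>+r. K w r \<partial>lborel)"
        using w by (intro nn_integral_cong) (auto simp: K_def indicator_def ennreal_mult[symmetric] mult_ac)
      finally show ?thesis .
    next
      case False
      then have "(\<lambda>x. \<kappa> x * B x w) = (\<lambda>_. 0)" "(\<lambda>r. K w r) = (\<lambda>_. 0)" by (auto simp: B_def K_def fun_eq_iff)
      then show ?thesis by simp
    qed
  qed
  also have "\<dots> = (\<integral>\<^sup>+r. (\<integral>\<^sup>+w. K w r \<partial>lborel) \<partial>lborel)"
    by (rule lborel_pair.Fubini'[symmetric]) measurable
  also have "\<dots> = (\<integral>\<^sup>+r. ennreal ?c * (ennreal (r powr (real p - 1) * (1 - r) powr (1 / 2 - 1)) *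
      indicator {0..1} r) \<partial>lborel)"
    using AE_lborel_singleton[of "0::real"] AE_lborel_singleton[of "1::real"]
  proof (intro nn_integral_cong_AE, eventually_elim)
    case (elim r)
    show ?case
    proof (cases "r \<in> {0<..<1}")
      case True
      then have r: "0 < r" "r < 1" by auto
      have "(\<integral>\<^sup>+w. K w r \<partial>lborel) = (\<integral>\<^sup>+w. ennreal ((1 - r) powr (- 1 / 2)) * (ennreal (real p * w ^ (p - 1) *
          (r\<^sup>2 - w\<^sup>2) powr (- 1 / 2)) * indicator {0<..<r} w) \<partial>lborel)"
        using r by (intro nn_integral_cong) (auto simp: K_def indicator_def ennreal_mult[symmetric] mult_ac)
      also have "\<dots> = ennreal ((1 - r) powr (- 1 / 2)) * ennreal (r ^ (p - 1) * ?c)"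
        unfolding cap_radial_integral[OF r(1) p, symmetric] by (rule nn_integral_cmult) measurable
      also have "r ^ (p - 1) = r powr (real p - 1)"
        using r p by (simp add: powr_realpow[symmetric] of_nat_diff)
      finally show ?thesis using r Bp by (simp add: ennreal_mult[symmetric] mult_ac)
    next
      case False
      then have "(\<lambda>w. K w r) = (\<lambda>_. 0)" by (auto simp: K_def fun_eq_iff)
      then show ?thesis using False elim by (auto simp: indicator_def)
    qed
  qed
  also have "\<dots> = ennreal ?c * (\<integral>\<^sup>+r. ennreal (r powr (real p - 1) * (1 - r) powr (1 / 2 - 1)) *
      indicator {0..1} r \<partial>lborel)"
    by (rule nn_integral_cmult) measurable
  also have "(\<integral>\<^sup>+r. ennreal (r powr (real p - 1) * (1 - r) powr (1 / 2 - 1)) * indicator {0..1} r \<partial>lborel) =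
      ennreal (Beta (real p) (1 / 2))"
    using p by (intro nn_integral_has_integral_lebesgue' has_integral_Beta_real) auto
  also have "ennreal ?c * ennreal (Beta (real p) (1 / 2)) = ennreal (?c * Beta (real p) (1 / 2))"
    using Bp by (intro ennreal_mult[symmetric]) auto
  finally show ?thesis .
qed

text \<open>From x + w (2 - x) >= w the last factor is at most w^(-3/2), and the arcsine integral
  bounds the rest. This allows the weight to be used as a real density.\<close>

lemma cap_weight_finite:
  assumes w: "0 < w" "w < 1" shows "cap_weight w < \<infinity>"
proof -
  have "cap_weight w \<le> (\<integral>\<^sup>+x. ennreal (w powr (- 3 / 2)) * (ennreal ((x * (1 - x)) powr (- 1 / 2)) *
      indicator {0<..<1} x) \<partial>lborel)"
    unfolding cap_weight_def
  proof (rule nn_integral_mono)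
    fix x :: real
    show "ennreal ((x * (1 - x)) powr (- 1 / 2) * ((2 - x) / 2 * (x + w * (2 - x)) powr (- 3 / 2))) *
        indicator {0<..<1} x \<le>
      ennreal (w powr (- 3 / 2)) * (ennreal ((x * (1 - x)) powr (- 1 / 2)) * indicator {0<..<1} x)"
    proof (cases "x \<in> {0<..<1}")
      case True
      have "w * 1 \<le> w * (2 - x)" using w True by (intro mult_left_mono) auto
      then have "w \<le> x + w * (2 - x)" using True by auto
      then have "(x + w * (2 - x)) powr (- 3 / 2) \<le> w powr (- 3 / 2)" using w by (intro powr_mono2') auto
      then have "(2 - x) / 2 * (x + w * (2 - x)) powr (- 3 / 2) \<le> 1 * w powr (- 3 / 2)" using True
          by (intro mult_mono) auto
      then have "(x * (1 - x)) powr (- 1 / 2) * ((2 - x) / 2 * (x + w * (2 - x)) powr (- 3 / 2)) \<le>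
          (x * (1 - x)) powr (- 1 / 2) * (1 * w powr (- 3 / 2))"
        by (intro mult_left_mono) auto
      then show ?thesis using True by (simp add: ennreal_mult[symmetric] mult_ac ennreal_leI)
    qed simp
  qed
  also have "\<dots> = ennreal (w powr (- 3 / 2)) * ennreal pi"
    unfolding nn_integral_arcsine[symmetric] by (rule nn_integral_cmult) measurable
  also have "\<dots> < \<infinity>" by (simp add: ennreal_mult[symmetric])
  finally show ?thesis .
qed

text \<open>On 0 < x < 1 the three factors are at least 1, 1/2 and 2^(-3/2). A crude constant is
  enough, since it is only multiplied into integrals of nonnegative functions.\<close>

lemma cap_weight_ge:
  assumes w: "0 < w" "w < 1" shows "cap_weight w \<ge> ennreal (2 powr (- 3 / 2) / 2)"
proof -
  have "ennreal (2 powr (- 3 / 2) / 2) = (\<integral>\<^sup>+x. ennreal (2 powr (- 3 / 2) / 2) *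
      indicator {0<..<1::real} x \<partial>lborel)"
    by (subst nn_integral_cmult_indicator) auto
  also have "\<dots> \<le> cap_weight w"
    unfolding cap_weight_def
  proof (rule nn_integral_mono)
    fix x :: real
    show "ennreal (2 powr (- 3 / 2) / 2) * indicator {0<..<1} x \<le>
      ennreal ((x * (1 - x)) powr (- 1 / 2) * ((2 - x) / 2 * (x + w * (2 - x)) powr (- 3 / 2))) *
          indicator {0<..<1} x"
    proof (cases "x \<in> {0<..<1}")
      case True
      have "x * (1 - x) \<le> 1 * 1" using True by (intro mult_mono) auto
      then have "1 powr (- 1 / 2) \<le> (x * (1 - x)) powr (- 1 / 2)" using True by (intro powr_mono2') auto
      moreover have "w * (2 - x) \<le> 1 * (2 - x)" using w True by (intro mult_right_mono) auto
      then have "x + w * (2 - x) \<le> 2" by simp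
      moreover have "x + w * (2 - x) > 0" using w True by (intro add_pos_nonneg mult_nonneg_nonneg) auto
      ultimately have "2 powr (- 3 / 2) \<le> (x + w * (2 - x)) powr (- 3 / 2)" by (intro powr_mono2') auto
      then have "1 / 2 * 2 powr (- 3 / 2) \<le> (2 - x) / 2 * (x + w * (2 - x)) powr (- 3 / 2)" using True
          by (intro mult_mono) auto
      moreover have "0 \<le> (1::real) / 2 * 2 powr (- 3 / 2)" by simp
      ultimately have "1 * (1 / 2 * 2 powr (- 3 / 2)) \<le> (x * (1 - x)) powr (- 1 / 2) * ((2 - x) / 2 * (x + w *
          (2 - x)) powr (- 3 / 2))"
        using \<open>1 powr (- 1 / 2) \<le> (x * (1 - x)) powr (- 1 / 2)\<close> by (intro mult_mono[of 1]; (assumption | simp))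
      then show ?thesis using True by (simp add: ennreal_leI)
    qed simp
  qed
  finally show ?thesis .
qed

text \<open>The moment of order p = 2 k + 4 has Gamma (2 k + 9/2) in the denominator of its last
  Beta factor: this is the origin of q = 9/2. The other Gamma values reduce to factorials and
  \<open>pochhammer (3 / 2) k\<close>.\<close>

lemma disc_coeff_moment_eq_gs:
  "disc_coeff k * (real (2 * k + 4) / 2 * Beta (real (2 * k + 4) / 2) (1 / 2) * Beta (real (2 * k + 4)) (1 / 2))
      = 16 * sqrt pi * gs (3 / 2) (9 / 2) k"
proof -
  let ?P = "pochhammer (3 / 2 :: real) k" and ?G = "Gamma (9 / 2 + real (2 * k))"
  have 1: "Beta (real (2 * k + 4) / 2) (1 / 2) = fact (Suc k) * sqrt pi / ((real k + 3 / 2) * (sqrt pi / 2 *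
      ?P))"
  proof -
    have "Gamma (real k + 2) = fact (Suc k)" using Gamma_fact[of "Suc k", where 'a=real] by (simp add: add_ac)
    moreover have "Gamma (real k + 5 / 2) = (real k + 3 / 2) * Gamma (3 / 2 + real k)"
      using Gamma_plus1[of "real k + 3 / 2"] nonpos_Ints_nonpos[of "real k + 3 / 2"] by (fastforce simp: add_ac)
    moreover have "Gamma (3 / 2 + real k) = sqrt pi / 2 * ?P"
    proof -
      have g: "Gamma (3 / 2 :: real) = sqrt pi / 2" using Gamma_plus1[of "1 / 2 :: real"] nonpos_Ints_nonpos[of
          "1 / 2 :: real"]
        by (fastforce simp: Gamma_one_half_real)
      have "(3 / 2 :: real) \<notin> \<int>\<^sub>\<le>\<^sub>0" using nonpos_Ints_nonpos[of "3 / 2 :: real"] by auto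
      from pochhammer_Gamma[OF this, of k] show ?thesis by (simp add: g field_simps)
    qed
    moreover have "real (2 * k + 4) / 2 = real k + 2" "real k + 2 + 1 / 2 = real k + 5 / 2" by simp_all
    ultimately show ?thesis unfolding Beta_def by (simp only: Gamma_one_half_real)
  qed
  have 2: "Beta (real (2 * k + 4)) (1 / 2) = (2 * real k + 3) * fact (2 * Suc k) * sqrt pi / ?G"
  proof -
    have "Gamma (real (2 * k + 4)) = fact (2 * k + 3)" using Gamma_fact[of "2 * k + 3", where 'a=real]
        by (simp add: add_ac)
    also have "\<dots> = (2 * real k + 3) * fact (2 * Suc k)" by (simp add: numeral_3_eq_3)
    finally show ?thesis by (simp only: Beta_def Gamma_one_half_real) (simp add: add_ac)
  qed
  have 3: "(fact (2 * Suc k) :: real) = 2 * 4 ^ k * ?P * fact (Suc k)"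
    using fact_double[of "Suc k", where 'a=real] pochhammer_rec[of "1 / 2 :: real" k]
        by (simp add: power_mult del: fact_Suc)
  have 4: "real ((2 * k + 2) choose k) = fact (2 * Suc k) / (fact k * fact (k + 2))"
    by (simp add: binomial_fact del: fact_Suc)
  have 5: "(fact (k + 2) :: real) = (real k + 2) * fact (Suc k)" by (simp add: add_ac)
  have P: "?P > 0" by (simp add: pochhammer_pos)
  have pi2: "sqrt pi * sqrt pi = pi" by simp
  have alg: "s * ((2 * q * P * F) / (f * (E * F))) / (F\<^sup>2 * (q * q)) * (E * (F * r / (D * (r / 2 * P))) * (2 *
      D * (2 * q * P * F) * r / G)) =
      16 * r * (s * P / (f * G))" if "P > 0" "F > 0" "E > 0" "D > 0" "r > 0" "q > 0" "f > 0"
          for s q P F f E D r G :: real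
    using that by (simp add: power2_eq_square)
  have d: "2 * real k + 3 = 2 * (real k + 3 / 2)" by simp
  have "real (2 * k + 4) / 2 = real k + 2" "(16::real) ^ k = 4 ^ k * 4 ^ k"
      by (simp_all add: power_mult_distrib[symmetric])
  moreover have "real k + 2 > 0" "real k + 3 / 2 > 0" by simp_all
  ultimately show ?thesis unfolding disc_coeff_def gs_def 1 2 4 5 unfolding 3 d
    using alg[of ?P "fact (Suc k)" "real k + 2" "real k + 3 / 2" "sqrt pi" "4 ^ k" "fact k" "(- 1) ^ k" ?G] P
    by (simp only: pi_gt_zero real_sqrt_gt_0_iff fact_gt_zero zero_less_power zero_less_numeral)
qed

lemma cap_weight_real_moment:
  assumes p: "p \<ge> (1::nat)"
  defines "f \<equiv> \<lambda>w. indicator {0<..<1} w * (w ^ p * enn2real (cap_weight w))"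
  shows "integrable lborel f"
    and "(LINT w|lborel. f w) + 2 powr (- 1 / 2) * pi = real p / 2 * Beta (real p / 2) (1 / 2) * Beta (real p)
        (1 / 2)"
proof -
  let ?A = "real p / 2 * Beta (real p / 2) (1 / 2) * Beta (real p) (1 / 2)"
  have [measurable]: "f \<in> borel_measurable borel" unfolding f_def by measurable
  have f0: "f w \<ge> 0" for w by (auto simp: f_def indicator_def)
  have A: "?A \<ge> 0"
    using p unfolding Beta_def by (auto intro!: divide_nonneg_nonneg mult_nonneg_nonneg less_imp_le[OF
        Gamma_real_pos])
  have "(\<integral>\<^sup>+w. ennreal (f w) \<partial>lborel) = (\<integral>\<^sup>+w. ennreal (w ^ p) * cap_weight w * indicator {0<..<1} w \<partial>lborel)"
  proof (rule nn_integral_cong)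
    fix w :: real
    show "ennreal (f w) = ennreal (w ^ p) * cap_weight w * indicator {0<..<1} w"
    proof (cases "w \<in> {0<..<1}")
      case True
      then have "ennreal (enn2real (cap_weight w)) = cap_weight w" using cap_weight_finite[of w]
          by (simp add: less_top)
      then show ?thesis using True by (simp add: f_def ennreal_mult)
    qed (simp add: f_def)
  qed
  then have e: "(\<integral>\<^sup>+w. ennreal (f w) \<partial>lborel) + ennreal (2 powr (- 1 / 2) * pi) = ennreal ?A"
    using cap_weight_moment[OF p] by simp
  have "(\<integral>\<^sup>+w. ennreal (f w) \<partial>lborel) < \<infinity>"
  proof -
    have "(\<integral>\<^sup>+w. ennreal (f w) \<partial>lborel) \<le> ennreal ?A" unfolding e[symmetric] by simp
    then show ?thesis by (rule le_less_trans) simp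
  qed
  then show i: "integrable lborel f" using f0 by (intro integrableI_nonneg) auto
  have "ennreal ((LINT w|lborel. f w) + 2 powr (- 1 / 2) * pi) = ennreal ?A"
    using e nn_integral_eq_integral[OF i] f0 by (simp add: ennreal_plus integral_nonneg)
  moreover have "(LINT w|lborel. f w) + 2 powr (- 1 / 2) * pi \<ge> 0" using f0
      by (intro add_nonneg_nonneg integral_nonneg) auto
  ultimately show "(LINT w|lborel. f w) + 2 powr (- 1 / 2) * pi = ?A" using A by (simp only: ennreal_inj)
qed

text \<open>Shrinking the disc to diameter w scales its area by w^2, hence the transform of its
  autocorrelation by w^4.\<close>

definition cap_density :: "real \<Rightarrow> real" where
  "cap_density w = indicator {0<..<1} w * (w ^ 4 * enn2real (cap_weight w))"

lemma cap_density_integrable: "integrable lborel cap_density"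
  using cap_weight_real_moment(1)[of 4] by (simp add: cap_density_def[abs_def])

lemma cap_density_nonneg: "cap_density w \<ge> 0"
  by (auto simp: cap_density_def indicator_def)

text \<open>In the plane \<open>(2 J\<^sub>1(r/2) / (r/2))\<^sup>2\<close> is, up to a constant, the transform of the autocorrelation of the
  disc of diameter one, so this identity writes \<open>(1 - |x|)\<^sub>+\<close> to the power \<open>3/2\<close> as a positive
  superposition of scaled disc autocorrelations. The weight \<open>cap_weight\<close> comes from inverting Abel's
  integral equation.\<close>

lemma Gs_disc_representation:
  "integrable lborel (\<lambda>w. cap_density w * evser disc_coeff (t * w))"
  "16 * sqrt pi * evser (gs (3 / 2) (9 / 2)) t = 2 powr (- 1 / 2) * pi * evser disc_coeff t +
      (LINT w|lborel. cap_density w * evser disc_coeff (t * w))"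
proof -
  have supp: "cap_density w = 0" if "w \<notin> {0..1}" for w using that by (auto simp: cap_density_def)
  show "integrable lborel (\<lambda>w. cap_density w * evser disc_coeff (t * w))"
    by (rule evser_integral(1)[OF entire_disc cap_density_integrable]) (rule supp)
  have S: "(\<lambda>k. disc_coeff k * t ^ (2 * k) * (LINT w|lborel. cap_density w * w ^ (2 * k))) sums
      (LINT w|lborel. cap_density w * evser disc_coeff (t * w))"
    by (rule evser_integral(2)[OF entire_disc cap_density_integrable]) (rule supp)
  have "(LINT w|lborel. cap_density w * w ^ (2 * k)) + 2 powr (- 1 / 2) * pi =
      real (2 * k + 4) / 2 * Beta (real (2 * k + 4) / 2) (1 / 2) * Beta (real (2 * k + 4)) (1 / 2)" for k
  proof -
    have "cap_density w * w ^ (2 * k) = indicator {0<..<1} w * (w ^ (2 * k + 4) * enn2real (cap_weight w))"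
        for w
      by (simp add: cap_density_def power_add)
    then show ?thesis using cap_weight_real_moment(2)[of "2 * k + 4"] by (simp only:)
  qed
  note M = this
  have "(\<lambda>k. 2 powr (- 1 / 2) * pi * (disc_coeff k * t ^ (2 * k)) + disc_coeff k * t ^ (2 * k) *
      (LINT w|lborel. cap_density w * w ^ (2 * k))) sums
      (2 powr (- 1 / 2) * pi * evser disc_coeff t + (LINT w|lborel. cap_density w * evser disc_coeff (t * w)))"
    by (intro sums_add S sums_mult evser_sums entire_disc)
  also have "(\<lambda>k. 2 powr (- 1 / 2) * pi * (disc_coeff k * t ^ (2 * k)) + disc_coeff k * t ^ (2 * k) *
      (LINT w|lborel. cap_density w * w ^ (2 * k))) =
      (\<lambda>k. 16 * sqrt pi * (gs (3 / 2) (9 / 2) k * t ^ (2 * k)))"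
  proof
    fix k
    have "2 powr (- 1 / 2) * pi * (disc_coeff k * t ^ (2 * k)) + disc_coeff k * t ^ (2 * k) *
        (LINT w|lborel. cap_density w * w ^ (2 * k)) =
      disc_coeff k * ((LINT w|lborel. cap_density w * w ^ (2 * k)) + 2 powr (- 1 / 2) * pi) * t ^ (2 * k)"
          by algebra
    also have "\<dots> = 16 * sqrt pi * gs (3 / 2) (9 / 2) k * t ^ (2 * k)" unfolding M disc_coeff_moment_eq_gs ..
    finally show "2 powr (- 1 / 2) * pi * (disc_coeff k * t ^ (2 * k)) + disc_coeff k * t ^ (2 * k) *
        (LINT w|lborel. cap_density w * w ^ (2 * k)) =
      16 * sqrt pi * (gs (3 / 2) (9 / 2) k * t ^ (2 * k))" by (simp only: mult.assoc)
  qed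
  finally have "(\<lambda>k. 16 * sqrt pi * (gs (3 / 2) (9 / 2) k * t ^ (2 * k))) sums
      (2 powr (- 1 / 2) * pi * evser disc_coeff t + (LINT w|lborel. cap_density w * evser disc_coeff (t * w)))"
          .
  moreover have "(\<lambda>k. 16 * sqrt pi * (gs (3 / 2) (9 / 2) k * t ^ (2 * k))) sums (16 * sqrt pi * evser (gs
      (3 / 2) (9 / 2)) t)"
    by (intro sums_mult evser_sums entire_coeffs_gs) auto
  ultimately show "16 * sqrt pi * evser (gs (3 / 2) (9 / 2)) t = 2 powr (- 1 / 2) * pi * evser disc_coeff t +
      (LINT w|lborel. cap_density w * evser disc_coeff (t * w))"
    by (rule sums_unique2[symmetric])
qed

text \<open>The point mass contributes a nonnegative term and is dropped, and the weight is replaced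
  by the constant of \<open>cap_weight_ge\<close>.\<close>

lemma Gs_disc_lower:
  "2 powr (- 3 / 2) / 2 * integral {0..1} (\<lambda>w. w ^ 4 * evser disc_coeff (t * w)) \<le>
      16 * sqrt pi * evser (gs (3 / 2) (9 / 2)) t"
proof -
  let ?k = "2 powr (- 3 / 2) / 2 :: real" and ?g = "\<lambda>w. w ^ 4 * evser disc_coeff (t * w)"
  have c: "continuous_on {0..1} ?g" by (intro continuous_intros entire_disc)
  have si: "set_integrable lborel {0..1} ?g" by (rule borel_integrable_atLeastAtMost') (rule c)
  have "?k * integral {0..1} ?g = (LINT w|lborel. ?k * (indicator {0..1} w * ?g w))"
    using set_borel_integral_eq_integral(2)[OF si] by (simp add: set_lebesgue_integral_def)
  also have "\<dots> \<le> (LINT w|lborel. cap_density w * evser disc_coeff (t * w))"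
  proof (rule integral_mono_AE)
    show "integrable lborel (\<lambda>w. ?k * (indicator {0..1} w * ?g w))"
      using si by (simp add: set_integrable_def)
    show "AE w in lborel. ?k * (indicator {0..1} w * ?g w) \<le> cap_density w * evser disc_coeff (t * w)"
      using AE_lborel_singleton[of "0::real"] AE_lborel_singleton[of "1::real"]
    proof eventually_elim
      case (elim w)
      show ?case
      proof (cases "w \<in> {0<..<1}")
        case True
        have "ennreal (enn2real (cap_weight w)) = cap_weight w" using cap_weight_finite[of w] True
            by (simp add: less_top)
        then have "ennreal ?k \<le> ennreal (enn2real (cap_weight w))" using cap_weight_ge[of w] True by simp
        then have "?k \<le> enn2real (cap_weight w)" by (simp only: ennreal_le_iff enn2real_nonneg)
        then have "?k * ?g w \<le> enn2real (cap_weight w) * ?g w" using evser_disc_nonneg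
            by (intro mult_right_mono mult_nonneg_nonneg) auto
        then show ?thesis using True by (simp add: cap_density_def mult_ac)
      qed (use elim in \<open>auto simp: indicator_def cap_density_def\<close>)
    qed
  qed (rule Gs_disc_representation(1))
  also have "\<dots> \<le> 16 * sqrt pi * evser (gs (3 / 2) (9 / 2)) t"
    unfolding Gs_disc_representation(2) using evser_disc_nonneg[of t] by simp
  finally show ?thesis .
qed

text \<open>The substitution v = t w / 2 turns the average over dilations into the integral treated
  by \<open>J1_square_mean\<close>.\<close>

lemma evser_disc_weighted_integral:
  assumes t: "t > 0"
  shows "integral {0..1} (\<lambda>w. w ^ 4 * evser disc_coeff (t * w)) = 128 / t ^ 5 * integral {0..t / 2} (\<lambda>v. v\<^sup>2 *
      (J1 v)\<^sup>2)"
proof -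
  let ?f = "\<lambda>v. v\<^sup>2 * (J1 v)\<^sup>2"
  have "((\<lambda>w. (t / 2) *\<^sub>R ?f (t / 2 * w)) has_integral (integral {t / 2 * 0..t / 2 * 1} ?f)) {0..1}"
  proof (rule has_integral_substitution[where c = 0 and d = "t / 2"])
    show "(\<lambda>w. t / 2 * w) ` {0..1} \<subseteq> {0..t / 2}" using t by (auto simp: mult_left_le)
  qed (use t in \<open>auto intro!: continuous_intros derivative_eq_intros\<close>)
  from has_integral_mult_right[OF this, of "128 / t ^ 5"]
  have "((\<lambda>w. 128 / t ^ 5 * ((t / 2) * ?f (t / 2 * w))) has_integral 128 / t ^ 5 * integral {0..t / 2} ?f)
      {0..1}" by simp
  moreover have "128 / t ^ 5 * ((t / 2) * ?f (t / 2 * w)) = w ^ 4 * evser disc_coeff (t * w)" for w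
  proof -
    have J: "(J1 (t / 2 * w))\<^sup>2 = (t * w)\<^sup>2 * evser disc_coeff (t * w) / 16" using evser_disc_J1[of "t * w"]
        by simp
    show ?thesis unfolding J using t by (simp add: field_simps power_numeral_reduce)
  qed
  ultimately show ?thesis by (simp add: integral_unique)
qed

text \<open>Below: the integral of v^2 J_1^2 up to t/2 has order at least t^2, and the prefactor
  t^(-5) leaves t^(-3). Above: the disc series at t w is at most C / (t w)^3, and w^4 / w^3 leaves
  the first moment of \<open>cap_weight\<close>, which is finite.\<close>

lemma decay_comparable_three_halves: "decay_comparable (3 / 2) (9 / 2)"
proof -
  let ?E = "evser (gs (3 / 2) (9 / 2))" and ?k = "2 powr (- 3 / 2) / 2 :: real"
  obtain c s0 where c: "c > 0" and s0: "s0 \<ge> 1" and mean: "\<And>s. s \<ge> s0 \<Longrightarrow> c * s\<^sup>2 \<le>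
      integral {0..s} (\<lambda>v. v\<^sup>2 * (J1 v)\<^sup>2)"
    using J1_square_mean by blast
  obtain C where C: "C > 0" "\<And>y. y > 0 \<Longrightarrow> y ^ 3 * evser disc_coeff y \<le> C" using evser_disc_decay by blast
  define I where "I = (LINT w|lborel. indicator {0<..<1} w * (w ^ 1 * enn2real (cap_weight w)))"
  define K where "K = 16 * sqrt pi"
  have K: "K > 0" by (simp add: K_def)
  have p3: "t powr (- 2 * (3 / 2)) = 1 / t ^ 3" if "t > 0" for t :: real using that
      by (simp add: powr_minus_divide powr_numeral)
  have "\<exists>c>0. \<exists>C. \<forall>t\<ge>0. c * (1 + t\<^sup>2) powr (- (3 / 2)) \<le> ?E t \<and> ?E t \<le> C * (1 + t\<^sup>2) powr (- (3 / 2))"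
  proof (rule compare_from_tail[where T = "2 * s0" and kl = "?k * 32 * c / K" and ku =
      "(2 powr (- 1 / 2) * pi + I) * C / K"])
    show "continuous_on UNIV ?E" by (intro continuous_intros entire_coeffs_gs) auto
    show "?E t > 0" if "t \<ge> 0" for t
    proof (cases "t = 0")
      case False
      let ?g = "\<lambda>w. w ^ 4 * evser disc_coeff (t * w)"
      have cg: "continuous_on {0..1} ?g" by (intro continuous_intros entire_disc)
      have "integral {0..1} ?g \<noteq> 0"
      proof
        assume "integral {0..1} ?g = 0"
        then have "\<forall>w\<in>{0..1}. ?g w = 0" using evser_disc_nonneg by (subst (asm) integral_eq_0_iff[OF cg]) auto
        \<comment> \<open>If the integral were 0, the series would vanish at every t / (n + 1),
          hence by continuity at 0, where its value is 1.\<close>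
        then have z: "evser disc_coeff (t * inverse (real (Suc n))) = 0" for n
            by (auto simp: field_simps dest!: bspec[of _ _ "inverse (real (Suc n))"])
        have "(\<lambda>n. t * inverse (real (Suc n))) \<longlonglongrightarrow> t * 0" by (intro tendsto_mult tendsto_const
            LIMSEQ_inverse_real_of_nat)
        moreover have "isCont (evser disc_coeff) (t * 0)"
          using continuous_on_evser[OF entire_disc continuous_on_id[of UNIV]] continuous_on_eq_continuous_at[OF
              open_UNIV] by blast
        ultimately have "(\<lambda>n. evser disc_coeff (t * inverse (real (Suc n)))) \<longlonglongrightarrow> evser disc_coeff (t * 0)"
            by (rule isCont_tendsto_compose[rotated])
        then have "evser disc_coeff 0 = 0" unfolding z by (simp add: LIMSEQ_const_iff)
        then show False by (simp add: disc_coeff_def)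
      qed
      moreover have "integral {0..1} ?g \<ge> 0" using evser_disc_nonneg by
          (intro integral_nonneg integrable_continuous_real cg) auto
      ultimately have "0 < ?k * integral {0..1} ?g" by simp
      then have "0 < 16 * sqrt pi * ?E t" using Gs_disc_lower[of t] by linarith
      then show ?thesis by (simp add: zero_less_mult_iff)
    qed (simp add: Gs_pos_at_0 del: evser_0)
    show "0 < ?k * 32 * c / K" using c K by simp
    fix t :: real assume "2 * s0 \<le> t"
    then have t: "t > 0" "s0 \<le> t / 2" using s0 by auto
    have "?k * (128 / t ^ 5 * (c * (t / 2)\<^sup>2)) \<le> ?k * (128 / t ^ 5 * integral {0..t / 2} (\<lambda>v. v\<^sup>2 * (J1 v)\<^sup>2))"
      using mean[OF t(2)] t by (intro mult_left_mono) auto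
    also have "\<dots> \<le> K * ?E t" using Gs_disc_lower[of t] unfolding evser_disc_weighted_integral[OF t(1)] K_def .
    also have "?k * (128 / t ^ 5 * (c * (t / 2)\<^sup>2)) = ?k * 32 * c / t ^ 3" using t
        by (simp add: power_numeral_reduce power2_eq_square)
    finally have "?k * 32 * c / t ^ 3 / K \<le> ?E t" using K by (simp only: pos_divide_le_eq mult.commute)
    then show "?k * 32 * c / K * t powr (- 2 * (3 / 2)) \<le> ?E t" unfolding p3[OF t(1)] by (simp add: mult_ac)
    have tcb: "evser disc_coeff (t * w) \<le> C / t ^ 3 * (1 / w ^ 3)" if "w > 0" for w
      using C(2)[of "t * w"] that t by (simp add: field_simps power_mult_distrib)
    have "(LINT w|lborel. cap_density w * evser disc_coeff (t * w)) \<le> (LINT w|lborel. C / t ^ 3 *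
        (indicator {0<..<1} w * (w ^ 1 * enn2real (cap_weight w))))"
    proof (rule integral_mono[OF Gs_disc_representation(1)])
      show "integrable lborel (\<lambda>w. C / t ^ 3 * (indicator {0<..<1} w * (w ^ 1 * enn2real (cap_weight w))))"
        using cap_weight_real_moment(1)[of 1] by (intro integrable_mult_right) simp
      fix w :: real
      show "cap_density w * evser disc_coeff (t * w) \<le> C / t ^ 3 * (indicator {0<..<1} w * (w ^ 1 * enn2real
          (cap_weight w)))"
      proof (cases "w \<in> {0<..<1}")
        case True
        then have "cap_density w * evser disc_coeff (t * w) \<le> cap_density w * (C / t ^ 3 * (1 / w ^ 3))"
            using tcb[of w] cap_density_nonneg by (intro mult_left_mono) auto
        also have "\<dots> = C / t ^ 3 * (indicator {0<..<1} w * (w ^ 1 * enn2real (cap_weight w)))" using True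
            by (simp add: cap_density_def power_numeral_reduce)
        finally show ?thesis .
      qed (simp add: cap_density_def)
    qed
    then have "(LINT w|lborel. cap_density w * evser disc_coeff (t * w)) \<le> C / t ^ 3 * I" by (simp add: I_def)
    moreover have "2 powr (- 1 / 2) * pi * evser disc_coeff t \<le> 2 powr (- 1 / 2) * pi * (C / t ^ 3)"
        using tcb[of 1] by (intro mult_left_mono) auto
    ultimately have "K * ?E t \<le> 2 powr (- 1 / 2) * pi * (C / t ^ 3) + C / t ^ 3 * I"
        using Gs_disc_representation(2)[of t] by (simp add: K_def)
    also have "\<dots> = (2 powr (- 1 / 2) * pi + I) * C / t ^ 3" by (simp add: add_divide_distrib[symmetric]
        algebra_simps)
    finally have "?E t \<le> ((2 powr (- 1 / 2) * pi + I) * C / t ^ 3) / K" using K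
        by (simp only: pos_le_divide_eq mult.commute)
    then show "?E t \<le> (2 powr (- 1 / 2) * pi + I) * C / K * t powr (- 2 * (3 / 2))" unfolding p3[OF t(1)]
        by (simp add: mult.commute)
  qed (use s0 in auto)
  then show ?thesis by (simp add: decay_comparable_def)
qed

text \<open>Since q = 2 a + \<alpha>, the critical \<alpha> = a is q = 3 a.
  \<open>decay_comparable_raise\<close> asks for a strict increase, so equality is a separate case.
  For d = 1 the starting pair is (1, 4).\<close>

lemma Lambda_fun_two_sided:
  assumes "d \<ge> (1::nat)" "d \<ge> 2 \<Longrightarrow> \<alpha> \<ge> (real d + 1) / 2" "d = 1 \<Longrightarrow> \<alpha> \<ge> 2"
  obtains c C where "c > 0" "\<And>r. r \<ge> 0 \<Longrightarrow> c * (1 + r\<^sup>2) powr (- ((real d + 1) / 2)) \<le> Lambda_fun d \<alpha> r"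
    "\<And>r. r \<ge> 0 \<Longrightarrow> Lambda_fun d \<alpha> r \<le> C * (1 + r\<^sup>2) powr (- ((real d + 1) / 2))"
proof -
  let ?a = "(real d + 1) / 2" and ?q = "real d + \<alpha> + 1"
  have \<alpha>: "\<alpha> > 0" using assms by (cases "d = 1") auto
  have "decay_comparable ?a ?q"
  proof (cases "d = 1")
    case True
    show ?thesis
    proof (cases "\<alpha> = 2")
      case False
      then show ?thesis using decay_comparable_raise[of 1 4 "\<alpha> - 2"] decay_comparable_1_4 True assms(3)
          by (simp add: add.commute)
    qed (use True decay_comparable_1_4 in simp)
  next
    case False
    then have d: "d \<ge> 2" using assms(1) by simp
    note b = decay_comparable_half_integers[OF decay_comparable_three_halves d]
    show ?thesis
    proof (cases "\<alpha> = ?a")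
      case True
      then have "?q = 3 * ?a" by (simp add: field_simps)
      then show ?thesis using b by (simp only:)
    next
      case False
      have "3 * ?a + (\<alpha> - ?a) = ?q" by (simp add: field_simps)
      moreover have "decay_comparable ?a (3 * ?a + (\<alpha> - ?a))" using b False assms(2)[OF d] d
          by (intro decay_comparable_raise) auto
      ultimately show ?thesis by (simp only:)
    qed
  qed
  then obtain c C where c: "c > 0" and b: "\<And>t. t \<ge> 0 \<Longrightarrow> c * (1 + t\<^sup>2) powr (- ?a) \<le> evser (gs ?a ?q) t \<and>
      evser (gs ?a ?q) t \<le> C * (1 + t\<^sup>2) powr (- ?a)"
    unfolding decay_comparable_def by blast
  have G: "Gamma ?q > 0" using \<alpha> by (intro Gamma_real_pos) auto
  show thesis
  proof (rule that[of "Gamma ?q * c" "Gamma ?q * C"])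
    fix r :: real assume r: "r \<ge> 0"
    show "Gamma ?q * c * (1 + r\<^sup>2) powr (- ?a) \<le> Lambda_fun d \<alpha> r" "Lambda_fun d \<alpha> r \<le>
        Gamma ?q * C * (1 + r\<^sup>2) powr (- ?a)"
      unfolding Lambda_fun_eq_evser[OF \<alpha>] mult.assoc using b[OF r] G by (auto intro: mult_left_mono)
  qed (use c G in simp)
qed

section \<open>The Fourier transform of square integrable functions\<close>

lemma fourier_L1_integrand:
  assumes "integrable lborel (f :: 'a::euclidean_space \<Rightarrow> complex)"
  shows "integrable lborel (\<lambda>x. exp (- \<i> * complex_of_real (\<xi> \<bullet> x)) * f x)"
  by (rule Bochner_Integration.integrable_bound[OF assms])
    (use assms in \<open>auto simp: norm_mult\<close>)

lemma norm_fourier_L1_le: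
  assumes "integrable lborel (f :: 'a::euclidean_space \<Rightarrow> complex)"
  shows "norm (fourier_L1 f \<xi>) \<le> (LINT x|lborel. norm (f x))"
  unfolding fourier_L1_def
  by (rule order_trans[OF integral_norm_bound]) (simp add: norm_mult)

lemma continuous_fourier_L1:
  assumes f: "integrable lborel (f :: 'a::euclidean_space \<Rightarrow> complex)"
  shows "continuous_on UNIV (fourier_L1 f)"
proof (rule continuous_on_sequentiallyI)
  fix X :: "nat \<Rightarrow> 'a" and a assume X: "X \<longlonglongrightarrow> a"
  have [measurable]: "f \<in> borel_measurable borel" using f by auto
  show "(\<lambda>n. fourier_L1 f (X n)) \<longlonglongrightarrow> fourier_L1 f a"
    unfolding fourier_L1_def
  proof (rule integral_dominated_convergence[where w = "\<lambda>x. norm (f x)"])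
    show "AE x in lborel. (\<lambda>n. exp (- \<i> * complex_of_real (X n \<bullet> x)) * f x) \<longlonglongrightarrow>
        exp (- \<i> * complex_of_real (a \<bullet> x)) * f x"
      by (intro AE_I2 tendsto_intros X)
  qed (use f in \<open>auto simp: norm_mult\<close>)
qed

lemma borel_measurable_fourier_L1:
  assumes "integrable lborel (f :: 'a::euclidean_space \<Rightarrow> complex)"
  shows "fourier_L1 f \<in> borel_measurable borel"
  using continuous_fourier_L1[OF assms] by (rule borel_measurable_continuous_onI)

lemma fourier_L1_add:
  assumes "integrable lborel (f :: 'a::euclidean_space \<Rightarrow> complex)" "integrable lborel g"
  shows "fourier_L1 (\<lambda>x. f x + g x) \<xi> = fourier_L1 f \<xi> + fourier_L1 g \<xi>"
  unfolding fourier_L1_def distrib_left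
  by (rule Bochner_Integration.integral_add[OF fourier_L1_integrand[OF assms(1)] fourier_L1_integrand[OF
      assms(2)]])

lemma fourier_L1_cmult:
  "fourier_L1 (\<lambda>x. c * f x) \<xi> = c * fourier_L1 f (\<xi> :: 'a::euclidean_space)"
proof -
  have "(\<lambda>x. exp (- \<i> * complex_of_real (\<xi> \<bullet> x)) * (c * f x)) = (\<lambda>x. c * (exp (- \<i> * complex_of_real (\<xi> \<bullet> x)) *
      f x))"
    by (simp add: fun_eq_iff)
  then show ?thesis unfolding fourier_L1_def by (simp only: integral_mult_right_zero)
qed

section \<open>Gaussian smoothing and Plancherel's inequality\<close>

abbreviation gauss :: "real \<Rightarrow> 'a::euclidean_space \<Rightarrow> complex" where
  "gauss e \<xi> \<equiv> complex_of_real (exp (- e * (norm \<xi>)\<^sup>2))"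

lemma integrable_gauss: "e > 0 \<Longrightarrow> integrable lborel (gauss e)"
  using gaussian_integrable by (rule integrable_of_real)

lemma fourier_L1_smoothing_integrable:
  fixes f :: "'a::euclidean_space \<Rightarrow> complex"
  assumes f: "integrable lborel f" and g: "integrable lborel g"
  shows "integrable (lborel \<Otimes>\<^sub>M lborel) (\<lambda>(\<xi>, y). exp (- \<i> * complex_of_real (\<xi> \<bullet> y)) * f y * g \<xi>)"
proof (rule lborel_pair.Fubini_integrable)
  have [measurable]: "f \<in> borel_measurable borel" "g \<in> borel_measurable borel" using f g by auto
  show "(\<lambda>(\<xi>, y). exp (- \<i> * complex_of_real (\<xi> \<bullet> y)) * f y * g \<xi>) \<in> borel_measurable (lborel \<Otimes>\<^sub>M lborel)"
    by measurable
  have "(\<lambda>\<xi>. LINT y|lborel. norm (case (\<xi>, y) of (\<xi>, y) \<Rightarrow> exp (- \<i> * complex_of_real (\<xi> \<bullet> y)) * f y * g \<xi>)) =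
      (\<lambda>\<xi>. (LINT y|lborel. norm (f y)) * norm (g \<xi>))"
    by (simp add: norm_mult)
  then show "integrable lborel (\<lambda>\<xi>. LINT y|lborel. norm (case (\<xi>, y) of (\<xi>, y) \<Rightarrow> exp (- \<i> * complex_of_real
      (\<xi> \<bullet> y)) * f y * g \<xi>))"
    using g by simp
  show "AE \<xi> in lborel. integrable lborel (\<lambda>y. case (\<xi>, y) of (\<xi>, y) \<Rightarrow> exp (- \<i> * complex_of_real (\<xi> \<bullet> y)) *
      f y * g \<xi>)"
    using integrable_mult_left[OF fourier_L1_integrand[OF f]] by (intro AE_I2) (simp only: prod.case)
qed

text \<open>Fubini for the kernel exp (- i \<xi> . y). With a modulated Gaussian as g it is the
  source of both inversion and the Plancherel inequality.\<close>

lemma fourier_L1_multiplication: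
  fixes f :: "'a::euclidean_space \<Rightarrow> complex"
  assumes f: "integrable lborel f" and g: "integrable lborel g"
  shows "(LINT \<xi>|lborel. fourier_L1 f \<xi> * g \<xi>) = (LINT y|lborel. f y * fourier_L1 g y)"
proof -
  have "(LINT \<xi>|lborel. fourier_L1 f \<xi> * g \<xi>) = (LINT \<xi>|lborel. LINT y|lborel. exp (- \<i> * complex_of_real
      (\<xi> \<bullet> y)) * f y * g \<xi>)"
    by (simp add: fourier_L1_def)
  also have "\<dots> = (LINT y|lborel. LINT \<xi>|lborel. exp (- \<i> * complex_of_real (\<xi> \<bullet> y)) * f y * g \<xi>)"
    using lborel_pair.Fubini_integral[OF fourier_L1_smoothing_integrable[OF f g]] by simp
  also have "\<dots> = (LINT y|lborel. f y * fourier_L1 g y)"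
  proof -
    have "(\<lambda>\<xi>. exp (- \<i> * complex_of_real (\<xi> \<bullet> y)) * f y * g \<xi>) = (\<lambda>\<xi>. f y * (exp (- \<i> * complex_of_real
        (y \<bullet> \<xi>)) * g \<xi>))" for y
      by (simp add: fun_eq_iff inner_commute)
    then show ?thesis by (simp only: fourier_L1_def integral_mult_right_zero)
  qed
  finally show ?thesis .
qed

lemma fourier_L1_modulated_gauss:
  assumes "e > 0"
  shows "fourier_L1 (\<lambda>\<xi>. exp (\<i> * complex_of_real (\<xi> \<bullet> x)) * gauss e \<xi>) (y :: 'a::euclidean_space) =
    complex_of_real ((pi / e) powr (real DIM('a) / 2) * exp (- ((norm (x - y))\<^sup>2 / (4 * e))))"
proof -
  have "exp (- \<i> * complex_of_real (y \<bullet> \<xi>)) * (exp (\<i> * complex_of_real (\<xi> \<bullet> x)) * gauss e \<xi>) =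
      gauss e \<xi> * exp (\<i> * complex_of_real ((x - y) \<bullet> \<xi>))" for \<xi>
    by (simp add: exp_add[symmetric] inner_diff_left inner_commute algebra_simps del: of_real_exp)
  then show ?thesis unfolding fourier_L1_def using gaussian_fourier(2)[OF assms, of "x - y"] by (simp only:)
qed

lemma integrable_modulated_gauss:
  "e > 0 \<Longrightarrow> integrable lborel (\<lambda>\<xi> :: 'a::euclidean_space. exp (\<i> * complex_of_real (\<xi> \<bullet> x)) * gauss e \<xi>)"
  by (rule Bochner_Integration.integrable_bound[OF integrable_gauss]) (auto simp: norm_mult)

text \<open>The inverse transform, damped by a Gaussian, is a convolution of f with a Gaussian of
  width of order sqrt e. Both sides make sense for square integrable functions, so the identity can
  later be extended to them.\<close>

lemma fourier_L1_smoothing: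
  fixes f :: "'a::euclidean_space \<Rightarrow> complex"
  assumes f: "integrable lborel f" and e: "e > 0"
  shows "(LINT \<xi>|lborel. fourier_L1 f \<xi> * (exp (\<i> * complex_of_real (\<xi> \<bullet> x)) * gauss e \<xi>)) =
    complex_of_real ((pi / e) powr (real DIM('a) / 2)) * (LINT y|lborel. f y * complex_of_real (exp (- ((norm
        (x - y))\<^sup>2 / (4 * e)))))"
proof -
  have "f y * complex_of_real (c * k) = complex_of_real c * (f y * complex_of_real k)" for y c k by simp
  then show ?thesis
    unfolding fourier_L1_multiplication[OF f integrable_modulated_gauss[OF e]] fourier_L1_modulated_gauss[OF e]
    by (simp only: integral_mult_right_zero)
qed

lemma gauss_kernel_nn_integral:
  assumes e: "e > 0"
  shows "(\<integral>\<^sup>+y. ennreal (exp (- ((norm (x - y :: 'a::euclidean_space))\<^sup>2 / (4 * e)))) \<partial>lborel) =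
      ennreal ((4 * pi * e) powr (real DIM('a) / 2))"
proof -
  have m: "(\<lambda>y::'a. ennreal (exp (- (1 / (4 * e)) * (norm y)\<^sup>2))) \<in> borel_measurable borel" by measurable
  have "(\<integral>\<^sup>+y. ennreal (exp (- (1 / (4 * e)) * (norm (- x + y))\<^sup>2)) \<partial>lborel) =
      (\<integral>\<^sup>+y. ennreal (exp (- (1 / (4 * e)) * (norm y)\<^sup>2)) \<partial>distr lborel borel ((+) (- x)))"
    by (subst nn_integral_distr) auto
  also have "\<dots> = ennreal ((pi / (1 / (4 * e))) powr (real DIM('a) / 2))"
    unfolding lborel_distr_plus by (rule gaussian_nn_integral) (use e in simp)
  finally show ?thesis by (simp add: norm_minus_commute mult_ac)
qed

text \<open>The prefactor of the smoothing kernel times the mass of the kernel: its independence of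
  e makes the estimates uniform in e.\<close>

lemma smoothing_constants:
  assumes "e > 0" shows "(pi / e) powr (real n / 2) * (4 * pi * e) powr (real n / 2) = (2 * pi) ^ n"
proof -
  have "(pi / e) powr (real n / 2) * (4 * pi * e) powr (real n / 2) = ((2 * pi)\<^sup>2) powr (real n / 2)"
  proof -
    have "pi / e * (4 * pi * e) = (2 * pi)\<^sup>2" using assms by (simp add: power2_eq_square)
    then show ?thesis by (simp only: powr_mult[symmetric])
  qed
  also have "(2 * pi)\<^sup>2 = (2 * pi) powr 2" by simp
  finally show ?thesis by (simp only: powr_powr) (simp add: powr_realpow)
qed

text \<open>In the non-integrable case the Bochner integral has the default value 0, which satisfies
  the bound because B >= 0.\<close>

lemma norm_sq_nn_bound:
  "(norm (\<integral>x. h x \<partial>M)) \<le> B" if "(\<integral>\<^sup>+x. ennreal (norm (h x)) \<partial>M) \<le> ennreal B" "B \<ge> 0" for h :: "_ \<Rightarrow> complex"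
proof (cases "integrable M h")
  case True
  then have "ennreal (norm (\<integral>x. h x \<partial>M)) \<le> (\<integral>\<^sup>+x. ennreal (norm (h x)) \<partial>M)"
      by (rule integral_norm_bound_ennreal)
  then have "ennreal (norm (\<integral>x. h x \<partial>M)) \<le> ennreal B" using that(1) by simp
  then show ?thesis using that(2) by simp
next
  case False
  then show ?thesis using that(2) by (simp add: not_integrable_integral_eq)
qed

text \<open>Only the inequality in Plancherel's theorem is needed. Damping the transform by a Gaussian
  turns the left-hand side into a double integral of \<open>f\<close> against a Gaussian kernel.\<close>

lemma plancherel_le_gauss:
  fixes f :: "'a::euclidean_space \<Rightarrow> complex"
  assumes f: "integrable lborel f" and f2: "square_integrable f" and e: "e > 0"
  shows "(\<integral>\<^sup>+\<xi>. ennreal ((norm (fourier_L1 f \<xi>))\<^sup>2 * exp (- e * (norm \<xi>)\<^sup>2)) \<partial>lborel) \<le>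
      ennreal ((2 * pi) ^ DIM('a)) * (\<integral>\<^sup>+x. ennreal ((norm (f x))\<^sup>2) \<partial>lborel)"
proof -
  have [measurable]: "f \<in> borel_measurable borel" "fourier_L1 f \<in> borel_measurable borel"
    using f borel_measurable_fourier_L1[OF f] by auto
  let ?c = "(pi / e) powr (real DIM('a) / 2)"
  let ?K = "\<lambda>x y :: 'a. exp (- ((norm (x - y))\<^sup>2 / (4 * e)))"
  let ?I = "LINT x|lborel. (norm (f x))\<^sup>2"
  have I: "(\<integral>\<^sup>+x. ennreal ((norm (f x))\<^sup>2) \<partial>lborel) = ennreal ?I" "?I \<ge> 0"
    using f2 by (auto simp: square_integrable_def nn_integral_eq_integral)
  define h where "h = (\<lambda>\<xi>. fourier_L1 f \<xi> * gauss e \<xi>)"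
  have hi: "integrable lborel h"
    unfolding h_def
  proof (rule Bochner_Integration.integrable_bound)
    show "integrable lborel (\<lambda>\<xi>::'a. complex_of_real (LINT x|lborel. norm (f x)) * gauss e \<xi>)"
      using integrable_gauss[OF e] by (rule integrable_mult_right)
    show "AE \<xi> in lborel. norm (fourier_L1 f \<xi> * gauss e \<xi>) \<le> norm (complex_of_real (LINT x|lborel. norm (f x))
        * gauss e \<xi>)"
      using norm_fourier_L1_le[OF f] by (intro AE_I2) (simp add: norm_mult mult_right_mono abs_of_nonneg
          integral_nonneg)
  qed measurable
  have fc: "integrable lborel (\<lambda>x. cnj (f x))" using f by simp
  have [measurable]: "h \<in> borel_measurable borel" "fourier_L1 (\<lambda>x. cnj (f x)) \<in> borel_measurable borel"
    using hi borel_measurable_fourier_L1[OF fc] by auto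
  \<comment> \<open>Conjugation reflects the transform. The squared modulus thereby becomes a
    product with a transform as one factor, ready for the multiplication formula.\<close>
  have cf: "cnj (fourier_L1 f \<xi>) = fourier_L1 (\<lambda>x. cnj (f x)) (- \<xi>)" for \<xi>
  proof -
    have "cnj (fourier_L1 f \<xi>) = (LINT x|lborel. cnj (exp (- \<i> * complex_of_real (\<xi> \<bullet> x)) * f x))"
      by (simp only: fourier_L1_def Bochner_Integration.integral_cnj)
    then show ?thesis unfolding fourier_L1_def by (simp add: exp_cnj)
  qed
  have "complex_of_real ((norm (fourier_L1 f \<xi>))\<^sup>2 * exp (- e * (norm \<xi>)\<^sup>2)) =
      fourier_L1 (\<lambda>x. cnj (f x)) (- \<xi>) * h \<xi>" for \<xi>
    unfolding h_def cf[symmetric] by (simp add: complex_norm_square[symmetric] mult_ac del: of_real_exp)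
  note sq = this
  have "(LINT \<xi>|lborel. fourier_L1 (\<lambda>x. cnj (f x)) (- \<xi>) * h \<xi>) = (LINT \<xi>|lborel. fourier_L1 (\<lambda>x. cnj (f x)) (-
      (- \<xi>)) * h (- \<xi>))"
    by (rule integral_lborel_uminus[symmetric]) measurable
  also have "\<dots> = (LINT \<xi>|lborel. fourier_L1 (\<lambda>x. cnj (f x)) \<xi> * h (- \<xi>))" by simp
  also have "\<dots> = (LINT x|lborel. cnj (f x) * fourier_L1 (\<lambda>\<xi>. h (- \<xi>)) x)"
  proof (rule fourier_L1_multiplication[OF fc])
    have "lborel = distr lborel borel (\<lambda>x::'a. - x)" using lborel_affine[of "-1" "0::'a"]
        by (simp add: density_1)
    then have "integrable (distr lborel borel (\<lambda>x::'a. - x)) h" using hi by simp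
    then show "integrable lborel (\<lambda>\<xi>. h (- \<xi>))" by (simp add: integrable_distr_eq)
  qed
  also have "\<dots> = (LINT x|lborel. cnj (f x) * (complex_of_real ?c * (LINT y|lborel. f y * complex_of_real
      (?K x y))))"
  proof -
    have "fourier_L1 (\<lambda>\<xi>. h (- \<xi>)) x = complex_of_real ?c * (LINT y|lborel. f y * complex_of_real (?K x y))"
        for x
    proof -
      have "fourier_L1 (\<lambda>\<xi>. h (- \<xi>)) x = (LINT \<xi>|lborel. exp (- \<i> * complex_of_real (x \<bullet> (- (- \<xi>)))) * h (- \<xi>))"
        by (simp add: fourier_L1_def)
      also have "\<dots> = (LINT \<xi>|lborel. exp (- \<i> * complex_of_real (x \<bullet> (- \<xi>))) * h \<xi>)"
        by (rule integral_lborel_uminus[of "\<lambda>\<xi>. exp (- \<i> * complex_of_real (x \<bullet> (- \<xi>))) * h \<xi>"]) measurable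
      also have "\<dots> = (LINT \<xi>|lborel. fourier_L1 f \<xi> * (exp (\<i> * complex_of_real (\<xi> \<bullet> x)) * gauss e \<xi>))"
        by (simp add: h_def inner_commute mult_ac)
      finally show ?thesis unfolding fourier_L1_smoothing[OF f e] .
    qed
    then show ?thesis by simp
  qed
  finally have eq: "(LINT \<xi>|lborel. complex_of_real ((norm (fourier_L1 f \<xi>))\<^sup>2 * exp (- e * (norm \<xi>)\<^sup>2))) =
      (LINT x|lborel. cnj (f x) * (complex_of_real ?c * (LINT y|lborel. f y * complex_of_real (?K x y))))"
    unfolding sq .
  \<comment> \<open>Schur's test: |f x| |f y| is at most half the sum of the squares, and the kernel
    is symmetric with the same mass in every row, so the two halves give equal integrals.\<close>
  have "(\<integral>\<^sup>+x. ennreal (norm (cnj (f x) * (complex_of_real ?c * (LINT y|lborel. f y * complex_of_real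
      (?K x y))))) \<partial>lborel)
     \<le> (\<integral>\<^sup>+x. \<integral>\<^sup>+y. ennreal (?c / 2 * ((norm (f x))\<^sup>2 * ?K x y)) + ennreal (?c / 2 * ((norm (f y))\<^sup>2 * ?K x y))
         \<partial>lborel \<partial>lborel)"
  proof (rule nn_integral_mono)
    fix x
    have i: "integrable lborel (\<lambda>y. f y * complex_of_real (?K x y))"
      by (rule Bochner_Integration.integrable_bound[OF f]) (use e in \<open>auto simp: norm_mult intro!:
          mult_left_le\<close>)
    have "ennreal (norm (cnj (f x) * (complex_of_real ?c * (LINT y|lborel. f y * complex_of_real (?K x y))))) =
      ennreal (norm (LINT y|lborel. complex_of_real (?c * norm (f x)) * (f y * complex_of_real (?K x y))))"
      unfolding integral_mult_right_zero by (simp add: norm_mult mult_ac)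
    also have "\<dots> \<le> (\<integral>\<^sup>+y. ennreal (norm (complex_of_real (?c * norm (f x)) * (f y * complex_of_real (?K x y))))
        \<partial>lborel)"
      using i by (intro integral_norm_bound_ennreal integrable_mult_right)
    also have "\<dots> \<le> (\<integral>\<^sup>+y. ennreal (?c / 2 * ((norm (f x))\<^sup>2 * ?K x y)) + ennreal (?c / 2 * ((norm (f y))\<^sup>2 *
        ?K x y)) \<partial>lborel)"
    proof (rule nn_integral_mono)
      fix y
      have "norm (f x) * norm (f y) \<le> ((norm (f x))\<^sup>2 + (norm (f y))\<^sup>2) / 2"
        using sum_squares_bound[of "norm (f x)" "norm (f y)"] by simp
      then have "?c * ?K x y * (norm (f x) * norm (f y)) \<le> ?c * ?K x y * (((norm (f x))\<^sup>2 + (norm (f y))\<^sup>2)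
          / 2)"
        by (intro mult_left_mono) auto
      then have "norm (complex_of_real (?c * norm (f x)) * (f y * complex_of_real (?K x y))) \<le>
        ?c * ?K x y * (((norm (f x))\<^sup>2 + (norm (f y))\<^sup>2) / 2)"
        by (simp add: norm_mult mult_ac)
      also have "\<dots> = ?c / 2 * ((norm (f x))\<^sup>2 * ?K x y) + ?c / 2 * ((norm (f y))\<^sup>2 * ?K x y)"
        by (simp add: field_simps)
      finally have "ennreal (norm (complex_of_real (?c * norm (f x)) * (f y * complex_of_real (?K x y)))) \<le>
        ennreal (?c / 2 * ((norm (f x))\<^sup>2 * ?K x y) + ?c / 2 * ((norm (f y))\<^sup>2 * ?K x y))"
        by (rule ennreal_leI)
      also have "\<dots> = ennreal (?c / 2 * ((norm (f x))\<^sup>2 * ?K x y)) + ennreal (?c / 2 * ((norm (f y))\<^sup>2 *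
          ?K x y))"
        by (rule ennreal_plus) auto
      finally show "ennreal (norm (complex_of_real (?c * norm (f x)) * (f y * complex_of_real (?K x y)))) \<le>
        ennreal (?c / 2 * ((norm (f x))\<^sup>2 * ?K x y)) + ennreal (?c / 2 * ((norm (f y))\<^sup>2 * ?K x y))" .
    qed
    finally show "ennreal (norm (cnj (f x) * (complex_of_real ?c * (LINT y|lborel. f y * complex_of_real
        (?K x y))))) \<le>
      (\<integral>\<^sup>+y. ennreal (?c / 2 * ((norm (f x))\<^sup>2 * ?K x y)) + ennreal (?c / 2 * ((norm (f y))\<^sup>2 * ?K x y))
          \<partial>lborel)" .
  qed
  also have "\<dots> = (\<integral>\<^sup>+x. (\<integral>\<^sup>+y. ennreal (?c / 2 * ((norm (f x))\<^sup>2 * ?K x y)) \<partial>lborel) + (\<integral>\<^sup>+y. ennreal (?c / 2 *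
      ((norm (f y))\<^sup>2 * ?K x y)) \<partial>lborel) \<partial>lborel)"
    by (intro nn_integral_cong nn_integral_add) measurable
  also have "\<dots> = (\<integral>\<^sup>+x. \<integral>\<^sup>+y. ennreal (?c / 2 * ((norm (f x))\<^sup>2 * ?K x y)) \<partial>lborel \<partial>lborel) +
      (\<integral>\<^sup>+x. \<integral>\<^sup>+y. ennreal (?c / 2 * ((norm (f y))\<^sup>2 * ?K x y)) \<partial>lborel \<partial>lborel)"
    by (rule nn_integral_add) measurable
  also have "(\<integral>\<^sup>+x. \<integral>\<^sup>+y. ennreal (?c / 2 * ((norm (f y))\<^sup>2 * ?K x y)) \<partial>lborel \<partial>lborel) =
      (\<integral>\<^sup>+y. \<integral>\<^sup>+x. ennreal (?c / 2 * ((norm (f y))\<^sup>2 * ?K x y)) \<partial>lborel \<partial>lborel)"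
    by (rule lborel_pair.Fubini') measurable
  also have "\<dots> = (\<integral>\<^sup>+x. \<integral>\<^sup>+y. ennreal (?c / 2 * ((norm (f x))\<^sup>2 * ?K x y)) \<partial>lborel \<partial>lborel)"
    by (simp add: norm_minus_commute)
  also have "(\<integral>\<^sup>+x. \<integral>\<^sup>+y. ennreal (?c / 2 * ((norm (f x))\<^sup>2 * ?K x y)) \<partial>lborel \<partial>lborel) =
      (\<integral>\<^sup>+x. ennreal ((2 * pi) ^ DIM('a) / 2) * ennreal ((norm (f x))\<^sup>2) \<partial>lborel)"
  proof (rule nn_integral_cong)
    fix x
    have "(\<integral>\<^sup>+y. ennreal (?c / 2 * ((norm (f x))\<^sup>2 * ?K x y)) \<partial>lborel) =
        (\<integral>\<^sup>+y. ennreal (?c / 2 * (norm (f x))\<^sup>2) * ennreal (?K x y) \<partial>lborel)"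
      by (intro nn_integral_cong) (simp add: ennreal_mult[symmetric] mult.assoc)
    also have "\<dots> = ennreal (?c / 2 * (norm (f x))\<^sup>2) * ennreal ((4 * pi * e) powr (real DIM('a) / 2))"
      unfolding gauss_kernel_nn_integral[OF e, of x, symmetric] by (rule nn_integral_cmult) measurable
    also have "\<dots> = ennreal ((?c * (4 * pi * e) powr (real DIM('a) / 2)) / 2 * (norm (f x))\<^sup>2)"
      by (simp add: ennreal_mult[symmetric] mult_ac)
    also have "\<dots> = ennreal ((2 * pi) ^ DIM('a) / 2) * ennreal ((norm (f x))\<^sup>2)"
      unfolding smoothing_constants[OF e] by (rule ennreal_mult) auto
    finally show "(\<integral>\<^sup>+y. ennreal (?c / 2 * ((norm (f x))\<^sup>2 * ?K x y)) \<partial>lborel) =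
        ennreal ((2 * pi) ^ DIM('a) / 2) * ennreal ((norm (f x))\<^sup>2)" .
  qed
  also have "\<dots> = ennreal ((2 * pi) ^ DIM('a) / 2) * ennreal ?I"
    unfolding I(1)[symmetric] by (rule nn_integral_cmult) measurable
  also have "\<dots> + \<dots> = ennreal ((2 * pi) ^ DIM('a) * ?I)"
    using I(2) by (simp add: ennreal_mult[symmetric] ennreal_plus[symmetric] del: ennreal_plus)
  finally have b: "norm (LINT \<xi>|lborel. complex_of_real ((norm (fourier_L1 f \<xi>))\<^sup>2 * exp (- e * (norm \<xi>)\<^sup>2))) \<le>
      (2 * pi) ^ DIM('a) * ?I"
    unfolding eq using I(2) by (intro norm_sq_nn_bound) auto
  have ii: "integrable lborel (\<lambda>\<xi>. (norm (fourier_L1 f \<xi>))\<^sup>2 * exp (- e * (norm \<xi>)\<^sup>2))"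
  proof (rule Bochner_Integration.integrable_bound)
    show "integrable lborel (\<lambda>\<xi>::'a. (LINT x|lborel. norm (f x))\<^sup>2 * exp (- e * (norm \<xi>)\<^sup>2))"
      using gaussian_integrable[OF e] by (rule integrable_mult_right)
    show "AE \<xi> in lborel. norm ((norm (fourier_L1 f \<xi>))\<^sup>2 * exp (- e * (norm \<xi>)\<^sup>2)) \<le>
        norm ((LINT x|lborel. norm (f x))\<^sup>2 * exp (- e * (norm \<xi>)\<^sup>2))"
      using norm_fourier_L1_le[OF f] by (intro AE_I2) (simp add: abs_mult power_mono)
  qed measurable
  have "(\<integral>\<^sup>+\<xi>. ennreal ((norm (fourier_L1 f \<xi>))\<^sup>2 * exp (- e * (norm \<xi>)\<^sup>2)) \<partial>lborel) =
      ennreal (LINT \<xi>|lborel. (norm (fourier_L1 f \<xi>))\<^sup>2 * exp (- e * (norm \<xi>)\<^sup>2))"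
    by (rule nn_integral_eq_integral[OF ii]) simp
  also have "\<dots> \<le> ennreal ((2 * pi) ^ DIM('a) * ?I)"
    using b unfolding integral_complex_of_real norm_of_real by (intro ennreal_leI) linarith
  finally show ?thesis unfolding I(1) using I(2) by (simp add: ennreal_mult)
qed

text \<open>The damping is removed along e = 1 / (m + 1) by Fatou's lemma, the bound being uniform
  in e.\<close>

lemma plancherel_le:
  fixes f :: "'a::euclidean_space \<Rightarrow> complex"
  assumes f: "integrable lborel f" and f2: "square_integrable f"
  shows "(\<integral>\<^sup>+\<xi>. ennreal ((norm (fourier_L1 f \<xi>))\<^sup>2) \<partial>lborel) \<le> ennreal ((2 * pi) ^ DIM('a)) * (\<integral>\<^sup>+x. ennreal
      ((norm (f x))\<^sup>2) \<partial>lborel)"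
proof -
  have [measurable]: "fourier_L1 f \<in> borel_measurable borel" using borel_measurable_fourier_L1[OF f] .
  let ?g = "\<lambda>m \<xi>. ennreal ((norm (fourier_L1 f \<xi>))\<^sup>2 * exp (- inverse (real (Suc m)) * (norm \<xi>)\<^sup>2))"
  have "(\<lambda>m. ?g m \<xi>) \<longlonglongrightarrow> ennreal ((norm (fourier_L1 f \<xi>))\<^sup>2 * exp (- 0 * (norm \<xi>)\<^sup>2))" for \<xi>
    by (intro tendsto_ennrealI tendsto_intros LIMSEQ_inverse_real_of_nat)
  then have l: "ennreal ((norm (fourier_L1 f \<xi>))\<^sup>2) = liminf (\<lambda>m. ?g m \<xi>)" for \<xi>
    by (intro lim_imp_Liminf[symmetric]) auto
  have "(\<integral>\<^sup>+\<xi>. ennreal ((norm (fourier_L1 f \<xi>))\<^sup>2) \<partial>lborel) \<le> liminf (\<lambda>m. \<integral>\<^sup>+\<xi>. ?g m \<xi> \<partial>lborel)"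
    unfolding l by (rule nn_integral_liminf) measurable
  also have "\<dots> \<le> ennreal ((2 * pi) ^ DIM('a)) * (\<integral>\<^sup>+x. ennreal ((norm (f x))\<^sup>2) \<partial>lborel)"
    using plancherel_le_gauss[OF f f2] by (intro Liminf_le) auto
  finally show ?thesis .
qed

section \<open>Square integrable functions and completeness\<close>

text \<open>The squared L^2 norm in \<open>ennreal\<close>, so that estimates can precede
  finiteness. In place of the triangle inequality |a + b|^2 <= 2 |a|^2 + 2 |b|^2 is used; the
  factors 2 are harmless where only convergence to 0 matters.\<close>

definition norm2_sq :: "('a::euclidean_space \<Rightarrow> complex) \<Rightarrow> ennreal" where
  "norm2_sq f = (\<integral>\<^sup>+x. ennreal ((norm (f x))\<^sup>2) \<partial>lborel)"

lemma square_integrable_iff: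
  "square_integrable f \<longleftrightarrow> f \<in> borel_measurable borel \<and> norm2_sq f < \<infinity>"
  unfolding square_integrable_def norm2_sq_def by (auto simp: integrable_iff_bounded)

lemma square_integrableD: "square_integrable f \<Longrightarrow> f \<in> borel_measurable borel"
  by (simp add: square_integrable_def)

lemma norm_add_square_le: "(norm (a + b))\<^sup>2 \<le> 2 * (norm a)\<^sup>2 + 2 * (norm (b :: complex))\<^sup>2"
proof -
  have "(norm (a + b))\<^sup>2 \<le> (norm a + norm b)\<^sup>2" by (intro power_mono norm_triangle_ineq) auto
  also have "\<dots> \<le> 2 * (norm a)\<^sup>2 + 2 * (norm b)\<^sup>2" using sum_squares_bound[of "norm a" "norm b"]
      by (simp add: power2_sum)
  finally show ?thesis .
qed

lemma norm2_sq_add_le: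
  assumes [measurable]: "f \<in> borel_measurable borel" "g \<in> borel_measurable borel"
  shows "norm2_sq (\<lambda>x. f x + g x) \<le> 2 * norm2_sq f + 2 * norm2_sq g"
proof -
  have "norm2_sq (\<lambda>x. f x + g x) \<le> (\<integral>\<^sup>+x. 2 * ennreal ((norm (f x))\<^sup>2) + 2 * ennreal ((norm (g x))\<^sup>2) \<partial>lborel)"
    unfolding norm2_sq_def
  proof (rule nn_integral_mono)
    fix x
    have "ennreal ((norm (f x + g x))\<^sup>2) \<le> ennreal (2 * (norm (f x))\<^sup>2 + 2 * (norm (g x))\<^sup>2)"
      by (rule ennreal_leI[OF norm_add_square_le])
    also have "\<dots> = 2 * ennreal ((norm (f x))\<^sup>2) + 2 * ennreal ((norm (g x))\<^sup>2)"
      by (subst ennreal_plus) (auto simp: ennreal_mult)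
    finally show "ennreal ((norm (f x + g x))\<^sup>2) \<le> 2 * ennreal ((norm (f x))\<^sup>2) + 2 * ennreal ((norm (g x))\<^sup>2)"
        .
  qed
  also have "\<dots> = 2 * norm2_sq f + 2 * norm2_sq g"
    unfolding norm2_sq_def by (subst nn_integral_add) (auto simp: nn_integral_cmult)
  finally show ?thesis .
qed

lemma norm2_sq_cmult:
  assumes [measurable]: "f \<in> borel_measurable borel"
  shows "norm2_sq (\<lambda>x. c * f x) = ennreal ((norm c)\<^sup>2) * norm2_sq f"
  unfolding norm2_sq_def by (subst nn_integral_cmult[symmetric]) (auto simp: norm_mult power_mult_distrib
      ennreal_mult)

lemma norm2_sq_minus: "norm2_sq (\<lambda>x. f x - g x) = norm2_sq (\<lambda>x. g x - f x)"
  by (simp add: norm2_sq_def norm_minus_commute)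

lemma norm2_sq_triangle:
  assumes "f \<in> borel_measurable borel" "g \<in> borel_measurable borel" "h \<in> borel_measurable borel"
  shows "norm2_sq (\<lambda>x. f x - h x) \<le> 2 * norm2_sq (\<lambda>x. f x - g x) + 2 * norm2_sq (\<lambda>x. g x - h x)"
  using norm2_sq_add_le[of "\<lambda>x. f x - g x" "\<lambda>x. g x - h x"] assms by simp

lemma square_integrable_add:
  assumes "square_integrable f" "square_integrable g" shows "square_integrable (\<lambda>x. f x + g x)"
proof -
  have [measurable]: "f \<in> borel_measurable borel" "g \<in> borel_measurable borel" using assms
      by (auto simp: square_integrable_iff)
  have "2 * norm2_sq f + 2 * norm2_sq g < \<infinity>" using assms by (auto simp: square_integrable_iff
      ennreal_mult_less_top)
  then show ?thesis using norm2_sq_add_le[of f g] by (auto simp: square_integrable_iff intro: le_less_trans)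
qed

lemma square_integrable_cmult:
  assumes "square_integrable f" shows "square_integrable (\<lambda>x. c * f x)"
  using assms norm2_sq_cmult[of f c] by (auto simp: square_integrable_iff ennreal_mult_less_top)

lemma square_integrable_diff:
  assumes "square_integrable f" "square_integrable g" shows "square_integrable (\<lambda>x. f x - g x)"
  using square_integrable_add[OF assms(1) square_integrable_cmult[OF assms(2), of "- 1"]] by simp

lemma square_integrable_mono:
  assumes "square_integrable f" "g \<in> borel_measurable borel" "\<And>x. norm (g x) \<le> norm (f x)"
  shows "square_integrable g"
proof -
  have "norm2_sq g \<le> norm2_sq f" unfolding norm2_sq_def using assms(3)
      by (intro nn_integral_mono ennreal_leI power_mono) auto
  then show ?thesis using assms by (auto simp: square_integrable_iff intro: le_less_trans)
qed

lemma integrable_mult_square_integrable: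
  assumes "square_integrable f" "square_integrable g" shows "integrable lborel (\<lambda>x. f x * g x)"
proof (rule Bochner_Integration.integrable_bound)
  show "integrable lborel (\<lambda>x. (norm (f x))\<^sup>2 + (norm (g x))\<^sup>2)" using assms
      by (simp add: square_integrable_def)
  show "(\<lambda>x. f x * g x) \<in> borel_measurable lborel" using assms by (auto simp: square_integrable_def)
  show "AE x in lborel. norm (f x * g x) \<le> norm ((norm (f x))\<^sup>2 + (norm (g x))\<^sup>2)"
  proof (rule AE_I2)
    fix x
    have "2 * (norm (f x) * norm (g x)) \<le> (norm (f x))\<^sup>2 + (norm (g x))\<^sup>2"
        using sum_squares_bound[of "norm (f x)" "norm (g x)"] by simp
    moreover have "0 \<le> norm (f x) * norm (g x)" by simp
    ultimately have "norm (f x) * norm (g x) \<le> (norm (f x))\<^sup>2 + (norm (g x))\<^sup>2" by linarith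
    then show "norm (f x * g x) \<le> norm ((norm (f x))\<^sup>2 + (norm (g x))\<^sup>2)" by (simp add: norm_mult)
  qed
qed

lemma tendsto_zero_if_le_twice_sum:
  fixes a b c :: "nat \<Rightarrow> ennreal"
  assumes "\<And>n. a n \<le> 2 * b n + 2 * c n" "b \<longlonglongrightarrow> 0" "c \<longlonglongrightarrow> 0" shows "a \<longlonglongrightarrow> 0"
proof (rule tendsto_sandwich[OF _ _ tendsto_const])
  have "(\<lambda>n. 2 * b n + 2 * c n) \<longlonglongrightarrow> 2 * 0 + 2 * 0"
    by (intro tendsto_add ennreal_tendsto_cmult assms) auto
  then show "(\<lambda>n. 2 * b n + 2 * c n) \<longlonglongrightarrow> 0" by simp
qed (use assms(1) in auto)

lemma norm2_sq_converges_Cauchy: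
  assumes "\<And>n. F n \<in> borel_measurable borel" "f \<in> borel_measurable borel" "(\<lambda>n. norm2_sq (\<lambda>x. F n x - f x)) \<longlonglongrightarrow>
      0" "e > 0"
  shows "\<exists>N. \<forall>m\<ge>N. \<forall>n\<ge>N. norm2_sq (\<lambda>x. F m x - F n x) < ennreal e"
proof -
  have "eventually (\<lambda>n. norm2_sq (\<lambda>x. F n x - f x) < ennreal (e / 4)) sequentially"
    using assms(3,4) by (intro order_tendstoD) auto
  then obtain N where N: "\<And>n. n \<ge> N \<Longrightarrow> norm2_sq (\<lambda>x. F n x - f x) < ennreal (e / 4)"
    by (auto simp: eventually_sequentially)
  have "norm2_sq (\<lambda>x. F m x - F n x) < ennreal e" if "m \<ge> N" "n \<ge> N" for m n
  proof -
    have "norm2_sq (\<lambda>x. F m x - F n x) \<le> 2 * norm2_sq (\<lambda>x. F m x - f x) + 2 * norm2_sq (\<lambda>x. F n x - f x)"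
      using norm2_sq_triangle[of "F m" f "F n"] assms norm2_sq_minus[of f "F n"] by simp
    also have "\<dots> < 2 * ennreal (e / 4) + 2 * ennreal (e / 4)"
      using N[OF that(1)] N[OF that(2)] by (intro add_strict_mono ennreal_mult_strict_left_mono) auto
    also have "\<dots> = ennreal e" using assms(4)
      by (simp add: ennreal_plus[symmetric] ennreal_mult[symmetric] numeral_mult_ennreal del: ennreal_plus)
    finally show ?thesis .
  qed
  then show ?thesis by blast
qed

text \<open>Riesz-Fischer: a rapidly Cauchy subsequence converges almost everywhere, and Fatou's
  lemma shows that the whole sequence tends to its pointwise limit in L^2.\<close>

lemma norm2_sq_complete:
  fixes F :: "nat \<Rightarrow> 'a::euclidean_space \<Rightarrow> complex"
  assumes F: "\<And>n. square_integrable (F n)"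
    and Cauchy: "\<And>e. e > 0 \<Longrightarrow> \<exists>N. \<forall>m\<ge>N. \<forall>n\<ge>N. norm2_sq (\<lambda>x. F m x - F n x) < ennreal e"
  obtains f where "square_integrable f" "(\<lambda>n. norm2_sq (\<lambda>x. F n x - f x)) \<longlonglongrightarrow> 0"
proof -
  have [measurable]: "F n \<in> borel_measurable borel" for n using F by (simp add: square_integrable_iff)
  \<comment> \<open>The speed 8^(-k) leaves 4^(-k) after weighting with 2^k. A finite weighted sum S
    at x then forces the k-th increment to be at most sqrt S * 2^(-k/2), which is summable.\<close>
  have "\<exists>N. \<forall>k. (\<forall>m\<ge>N k. \<forall>n\<ge>N k. norm2_sq (\<lambda>x. F m x - F n x) < ennreal ((1 / 8) ^ k)) \<and> N k < N (Suc k)"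
  proof (rule dependent_nat_choice)
    fix N :: nat and k :: nat
    obtain M where "\<forall>m\<ge>M. \<forall>n\<ge>M. norm2_sq (\<lambda>x. F m x - F n x) < ennreal ((1 / 8) ^ Suc k)"
        using Cauchy[of "(1 / 8) ^ Suc k"] by auto
    then show "\<exists>M. (\<forall>m\<ge>M. \<forall>n\<ge>M. norm2_sq (\<lambda>x. F m x - F n x) < ennreal ((1 / 8) ^ Suc k)) \<and> N < M"
      by (intro exI[of _ "max M (Suc N)"]) auto
  qed (use Cauchy[of "(1 / 8) ^ 0"] in auto)
  then obtain r where r: "\<And>k m n. m \<ge> r k \<Longrightarrow> n \<ge> r k \<Longrightarrow> norm2_sq (\<lambda>x. F m x - F n x) < ennreal ((1 / 8) ^ k)" and
      r_less: "\<And>k. r k < r (Suc k)"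
    by blast
  have sm: "strict_mono r" using r_less by (rule strict_monoI_Suc)
  define d where "d = (\<lambda>k x. F (r (Suc k)) x - F (r k) x)"
  have [measurable]: "d k \<in> borel_measurable borel" for k unfolding d_def by measurable
  have "(\<integral>\<^sup>+x. (\<Sum>k. ennreal (2 ^ k * (norm (d k x))\<^sup>2)) \<partial>lborel) = (\<Sum>k. \<integral>\<^sup>+x. ennreal (2 ^ k * (norm (d k x))\<^sup>2)
      \<partial>lborel)"
    by (rule nn_integral_suminf) measurable
  also have "\<dots> \<le> (\<Sum>k. ennreal ((1 / 4) ^ k))"
  proof (rule suminf_le)
    fix k
    have "(\<integral>\<^sup>+x. ennreal (2 ^ k * (norm (d k x))\<^sup>2) \<partial>lborel) = ennreal (2 ^ k) * norm2_sq (d k)"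
      unfolding norm2_sq_def by (subst nn_integral_cmult[symmetric]) (auto simp: ennreal_mult)
    also have "\<dots> \<le> ennreal (2 ^ k) * ennreal ((1 / 8) ^ k)"
      unfolding d_def using r[of k "r (Suc k)" "r k"] r_less[of k] by (intro mult_left_mono less_imp_le) auto
    also have "\<dots> = ennreal ((1 / 4) ^ k)" by (simp add: ennreal_mult[symmetric] power_mult_distrib[symmetric])
    finally show "(\<integral>\<^sup>+x. ennreal (2 ^ k * (norm (d k x))\<^sup>2) \<partial>lborel) \<le> ennreal ((1 / 4) ^ k)" .
  qed auto
  also have "\<dots> = ennreal (\<Sum>k. (1 / 4) ^ k)" by (intro suminf_ennreal2 summable_geometric) auto
  also have "\<dots> < \<infinity>" by simp
  finally have "AE x in lborel. (\<Sum>k. ennreal (2 ^ k * (norm (d k x))\<^sup>2)) \<noteq> \<infinity>"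
    by (intro nn_integral_PInf_AE) auto
  then have conv: "AE x in lborel. convergent (\<lambda>k. F (r k) x)"
  proof eventually_elim
    case (elim x)
    define S where "S = enn2real (\<Sum>k. ennreal (2 ^ k * (norm (d k x))\<^sup>2))"
    have S: "S \<ge> 0" "(\<Sum>k. ennreal (2 ^ k * (norm (d k x))\<^sup>2)) = ennreal S"
      using elim by (simp_all add: S_def less_top)
    have "norm (d k x) \<le> sqrt S * (1 / sqrt 2) ^ k" for k
    proof -
      have "(\<Sum>k\<in>{k}. ennreal (2 ^ k * (norm (d k x))\<^sup>2)) \<le> (\<Sum>k. ennreal (2 ^ k * (norm (d k x))\<^sup>2))"
        by (rule sum_le_suminf) auto
      then have "ennreal (2 ^ k * (norm (d k x))\<^sup>2) \<le> ennreal S" by (simp only: S(2)) simp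
      then have "2 ^ k * (norm (d k x))\<^sup>2 \<le> S" using S(1) by simp
      then have "sqrt (2 ^ k * (norm (d k x))\<^sup>2) \<le> sqrt S" by (rule real_sqrt_le_mono)
      then have "sqrt 2 ^ k * norm (d k x) \<le> sqrt S" by (simp add: real_sqrt_mult real_sqrt_power)
      then show ?thesis by (simp add: power_divide pos_le_divide_eq mult.commute)
    qed
    note dle = this
    have "summable (\<lambda>k. sqrt S * (1 / sqrt 2) ^ k)" by (intro summable_mult summable_geometric) simp
    then have "summable (\<lambda>k. d k x)" by (rule summable_comparison_test') (rule dle)
    then have "convergent (\<lambda>n. \<Sum>k<n. d k x)" by (simp add: summable_iff_convergent)
    moreover have "(\<Sum>k<n. d k x) = F (r n) x - F (r 0) x" for n unfolding d_def by (rule sum_lessThan_telescope)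
    ultimately have "convergent (\<lambda>n. (F (r n) x - F (r 0) x) + F (r 0) x)"
        by (intro convergent_add convergent_const) simp
    then show ?case by simp
  qed
  \<comment> \<open>Where the subsequence diverges \<open>lim\<close> has an unspecified value;
    these points form a null set.\<close>
  define f where "f = (\<lambda>x. lim (\<lambda>k. F (r k) x))"
  have [measurable]: "f \<in> borel_measurable borel" unfolding f_def by measurable
  have le: "norm2_sq (\<lambda>x. F n x - f x) \<le> ennreal ((1 / 8) ^ k)" if n: "n \<ge> r k" for n k
  proof -
    have "norm2_sq (\<lambda>x. F n x - f x) = (\<integral>\<^sup>+x. liminf (\<lambda>j. ennreal ((norm (F n x - F (r j) x))\<^sup>2)) \<partial>lborel)"
      unfolding norm2_sq_def
    proof (rule nn_integral_cong_AE)
      show "AE x in lborel. ennreal ((norm (F n x - f x))\<^sup>2) = liminf (\<lambda>j. ennreal ((norm (F n x - F (r j)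
          x))\<^sup>2))"
        using conv
      proof eventually_elim
        case (elim x)
        then have "(\<lambda>j. F (r j) x) \<longlonglongrightarrow> f x" unfolding f_def by (simp add: convergent_LIMSEQ_iff)
        then have "(\<lambda>j. ennreal ((norm (F n x - F (r j) x))\<^sup>2)) \<longlonglongrightarrow> ennreal ((norm (F n x - f x))\<^sup>2)"
          by (intro tendsto_ennrealI tendsto_intros)
        then show ?case by (intro lim_imp_Liminf[symmetric]) auto
      qed
    qed
    also have "\<dots> \<le> liminf (\<lambda>j. norm2_sq (\<lambda>x. F n x - F (r j) x))"
      unfolding norm2_sq_def by (rule nn_integral_liminf) measurable
    also have "\<dots> \<le> ennreal ((1 / 8) ^ k)"
    proof (rule Liminf_le)
      have "norm2_sq (\<lambda>x. F n x - F (r j) x) \<le> ennreal ((1 / 8) ^ k)" if "j \<ge> k" for j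
        using r[of k n "r j"] n strict_mono_mono[OF sm] that by (auto simp: mono_def intro!: less_imp_le)
      then show "eventually (\<lambda>j. norm2_sq (\<lambda>x. F n x - F (r j) x) \<le> ennreal ((1 / 8) ^ k)) sequentially"
        unfolding eventually_sequentially by blast
    qed simp
    finally show ?thesis .
  qed
  have "square_integrable (\<lambda>x. F (r 0) x - f x)"
    using le[of 0 "r 0"] by (auto simp: square_integrable_iff intro: le_less_trans)
  from square_integrable_diff[OF F[of "r 0"] this] have f2: "square_integrable f" by simp
  have "(\<lambda>n. norm2_sq (\<lambda>x. F n x - f x)) \<longlonglongrightarrow> 0"
  proof (rule order_tendstoI)
    fix a :: ennreal assume a: "0 < a"
    have "(\<lambda>k. ennreal ((1 / 8) ^ k)) \<longlonglongrightarrow> ennreal 0" by (intro tendsto_ennrealI LIMSEQ_power_zero) simp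
    then have "eventually (\<lambda>k. ennreal ((1 / 8) ^ k) < a) sequentially" using a by (intro order_tendstoD) auto
    then obtain k where "ennreal ((1 / 8) ^ k) < a" by (auto simp: eventually_sequentially)
    then show "eventually (\<lambda>n. norm2_sq (\<lambda>x. F n x - f x) < a) sequentially"
      unfolding eventually_sequentially using le[of k] by (intro exI[of _ "r k"]) (auto intro: le_less_trans)
  qed simp
  with f2 show thesis by (rule that)
qed

section \<open>The transform on L^2: existence, uniqueness and closedness\<close>

lemma is_fourier_L2_iff:
  "is_fourier_L2 f g \<longleftrightarrow> square_integrable f \<and> square_integrable g \<and>
    (\<exists>F. (\<forall>n. integrable lborel (F n) \<and> square_integrable (F n)) \<and>
      (\<lambda>n. norm2_sq (\<lambda>x. F n x - f x)) \<longlonglongrightarrow> 0 \<and> (\<lambda>n. norm2_sq (\<lambda>\<xi>. fourier_L1 (F n) \<xi> - g \<xi>)) \<longlonglongrightarrow> 0)"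
  unfolding is_fourier_L2_def norm2_sq_def ..

lemma norm2_sq_fourier_L1_le:
  assumes "integrable lborel f" "square_integrable (f :: 'a::euclidean_space \<Rightarrow> complex)"
  shows "norm2_sq (fourier_L1 f) \<le> ennreal ((2 * pi) ^ DIM('a)) * norm2_sq f"
  unfolding norm2_sq_def by (rule plancherel_le[OF assms])

lemma square_integrable_fourier_L1:
  assumes "integrable lborel f" "square_integrable (f :: 'a::euclidean_space \<Rightarrow> complex)"
  shows "square_integrable (fourier_L1 f)"
  using norm2_sq_fourier_L1_le[OF assms] assms(2) borel_measurable_fourier_L1[OF assms(1)]
  by (auto simp: square_integrable_iff ennreal_mult_less_top intro: le_less_trans)

lemma fourier_L1_diff:
  assumes "integrable lborel (f :: 'a::euclidean_space \<Rightarrow> complex)" "integrable lborel g"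
  shows "fourier_L1 (\<lambda>x. f x - g x) \<xi> = fourier_L1 f \<xi> - fourier_L1 g \<xi>"
  using fourier_L1_add[OF assms(1), of "\<lambda>x. - 1 * g x"] assms(2) fourier_L1_cmult[of "- 1" g \<xi>] by simp

lemma norm2_sq_fourier_L1_diff_le:
  assumes "integrable lborel f" "square_integrable (f :: 'a::euclidean_space \<Rightarrow> complex)" "integrable lborel g"
      "square_integrable g"
  shows "norm2_sq (\<lambda>\<xi>. fourier_L1 f \<xi> - fourier_L1 g \<xi>) \<le> ennreal ((2 * pi) ^ DIM('a)) * norm2_sq (\<lambda>x. f x -
      g x)"
proof -
  have "fourier_L1 (\<lambda>x. f x - g x) = (\<lambda>\<xi>. fourier_L1 f \<xi> - fourier_L1 g \<xi>)"
    using fourier_L1_diff[OF assms(1,3)] by (rule ext)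
  then show ?thesis using norm2_sq_fourier_L1_le[of "\<lambda>x. f x - g x"] assms by (simp add: square_integrable_diff)
qed

text \<open>By Plancherel's inequality the transforms of the approximants form a Cauchy sequence,
  and completeness provides its limit.\<close>

lemma is_fourier_L2_exists_from_seq:
  fixes f :: "'a::euclidean_space \<Rightarrow> complex"
  assumes F: "\<And>n. integrable lborel (F n)" "\<And>n. square_integrable (F n)" and f: "square_integrable f"
    and lim: "(\<lambda>n. norm2_sq (\<lambda>x. F n x - f x)) \<longlonglongrightarrow> 0"
  shows "\<exists>g. is_fourier_L2 f g"
proof -
  let ?c = "(2 * pi) ^ DIM('a) :: real"
  have "\<exists>N. \<forall>m\<ge>N. \<forall>n\<ge>N. norm2_sq (\<lambda>\<xi>. fourier_L1 (F m) \<xi> - fourier_L1 (F n) \<xi>) < ennreal e" if e: "e > 0" for e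
  proof -
    have "\<exists>N. \<forall>m\<ge>N. \<forall>n\<ge>N. norm2_sq (\<lambda>x. F m x - F n x) < ennreal (e / ?c)"
      using F f e by (intro norm2_sq_converges_Cauchy[OF _ _ lim]) (auto simp: square_integrable_iff)
    then obtain N where N: "\<And>m n. m \<ge> N \<Longrightarrow> n \<ge> N \<Longrightarrow> norm2_sq (\<lambda>x. F m x - F n x) < ennreal (e / ?c)" by blast
    have "norm2_sq (\<lambda>\<xi>. fourier_L1 (F m) \<xi> - fourier_L1 (F n) \<xi>) < ennreal e" if "m \<ge> N" "n \<ge> N" for m n
    proof -
      have "norm2_sq (\<lambda>\<xi>. fourier_L1 (F m) \<xi> - fourier_L1 (F n) \<xi>) \<le> ennreal ?c * norm2_sq (\<lambda>x. F m x - F n x)"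
        by (intro norm2_sq_fourier_L1_diff_le F)
      also have "\<dots> < ennreal ?c * ennreal (e / ?c)" using N[OF that] by (intro ennreal_mult_strict_left_mono)
          auto
      also have "\<dots> = ennreal e" using e by (simp add: ennreal_mult[symmetric])
      finally show ?thesis .
    qed
    then show ?thesis by blast
  qed
  then obtain g where "square_integrable g" "(\<lambda>n. norm2_sq (\<lambda>\<xi>. fourier_L1 (F n) \<xi> - g \<xi>)) \<longlonglongrightarrow> 0"
    using norm2_sq_complete[of "\<lambda>n. fourier_L1 (F n)"] square_integrable_fourier_L1[OF F] by blast
  then show ?thesis unfolding is_fourier_L2_iff using F f lim by blast
qed

lemma is_fourier_L2_exists:
  fixes f :: "'a::euclidean_space \<Rightarrow> complex"
  assumes f: "square_integrable f" shows "\<exists>g. is_fourier_L2 f g"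
proof (rule is_fourier_L2_exists_from_seq[OF _ _ f])
  have [measurable]: "f \<in> borel_measurable borel" using f by (simp add: square_integrable_iff)
  have [measurable]: "cball (0::'a) r \<in> sets borel" for r by simp
  define F where "F = (\<lambda>n x. indicator (cball (0::'a) (real n)) x * f x)"
  have [measurable]: "F n \<in> borel_measurable borel" for n unfolding F_def by measurable
  show "square_integrable (F n)" for n
    by (rule square_integrable_mono[OF f]) (auto simp: F_def indicator_def)
  show "integrable lborel (F n)" for n
  proof (rule Bochner_Integration.integrable_bound)
    show "integrable lborel (\<lambda>x. indicator (cball (0::'a) (real n)) x + (norm (f x))\<^sup>2 :: real)"
      using f by (intro Bochner_Integration.integrable_add integrable_real_indicator)
          (auto simp: square_integrable_def emeasure_cball)
    \<comment> \<open>Square integrable functions truncated to a ball are integrable, since |f| <= 1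
      + |f|^2 and the ball has finite measure.\<close>
    have "a \<le> 1 + a\<^sup>2" for a :: real using zero_le_power2[of "2 * a - 1"] zero_le_power2[of a]
      by (simp add: power2_diff power_mult_distrib)
    then show "AE x in lborel. norm (F n x) \<le> norm (indicator (cball (0::'a) (real n)) x + (norm
        (f x))\<^sup>2 :: real)"
      by (intro AE_I2) (auto simp: F_def indicator_def abs_of_nonneg)
  qed measurable
  have "(\<lambda>n. LINT x|lborel. (norm (F n x - f x))\<^sup>2) \<longlonglongrightarrow> (LINT x::'a|lborel. 0::real)"
  proof (rule integral_dominated_convergence[where w = "\<lambda>x. (norm (f x))\<^sup>2"])
    show "AE x in lborel. (\<lambda>n. (norm (F n x - f x))\<^sup>2) \<longlonglongrightarrow> 0"
    proof (rule AE_I2, rule tendsto_eventually)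
      fix x
      show "eventually (\<lambda>n. (norm (F n x - f x))\<^sup>2 = 0) sequentially"
        using eventually_ge_at_top[of "nat \<lceil>norm x\<rceil>"] by eventually_elim
            (auto simp: F_def indicator_def nat_le_iff ceiling_le_iff)
    qed
    show "AE x in lborel. norm ((norm (F n x - f x))\<^sup>2) \<le> (norm (f x))\<^sup>2" for n
      by (intro AE_I2) (auto simp: F_def indicator_def)
  qed (use f in \<open>auto simp: square_integrable_def\<close>)
  then have "(\<lambda>n. ennreal (LINT x|lborel. (norm (F n x - f x))\<^sup>2)) \<longlonglongrightarrow> ennreal 0" by (intro tendsto_ennrealI) simp
  moreover have "norm2_sq (\<lambda>x. F n x - f x) = ennreal (LINT x|lborel. (norm (F n x - f x))\<^sup>2)" for n
    unfolding norm2_sq_def using square_integrable_diff[OF \<open>square_integrable (F n)\<close> f]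
    by (intro nn_integral_eq_integral) (auto simp: square_integrable_def)
  ultimately show "(\<lambda>n. norm2_sq (\<lambda>x. F n x - f x)) \<longlonglongrightarrow> 0" by simp
qed

text \<open>The factor 4 comes from applying the doubled triangle inequality twice. Its value does
  not matter: the estimate is applied to a function that is 0 and yields uniqueness.\<close>

lemma is_fourier_L2_norm_le:
  fixes f g :: "'a::euclidean_space \<Rightarrow> complex"
  assumes "is_fourier_L2 f g"
  shows "norm2_sq g \<le> 4 * (ennreal ((2 * pi) ^ DIM('a)) * norm2_sq f)"
proof -
  let ?c = "ennreal ((2 * pi) ^ DIM('a))"
  obtain F where F: "\<And>n. integrable lborel (F n)" "\<And>n. square_integrable (F n)" and f: "square_integrable f" and
      g: "square_integrable g"
    and lim: "(\<lambda>n. norm2_sq (\<lambda>x. F n x - f x)) \<longlonglongrightarrow> 0" "(\<lambda>n. norm2_sq (\<lambda>\<xi>. fourier_L1 (F n) \<xi> - g \<xi>)) \<longlonglongrightarrow> 0"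
    using assms unfolding is_fourier_L2_iff by blast
  note [measurable] = square_integrableD[OF F(2), simplified] square_integrableD[OF f,
      simplified] square_integrableD[OF g, simplified]
    borel_measurable_fourier_L1[OF F(1)]
  have le: "norm2_sq g \<le> 2 * norm2_sq (\<lambda>\<xi>. fourier_L1 (F n) \<xi> - g \<xi>) + 2 * (?c * (2 * norm2_sq (\<lambda>x. F n x - f x)
      + 2 * norm2_sq f))" for n
  proof -
    have "norm2_sq g \<le> 2 * norm2_sq (\<lambda>\<xi>. g \<xi> - fourier_L1 (F n) \<xi>) + 2 * norm2_sq (fourier_L1 (F n))"
      using norm2_sq_triangle[of g "fourier_L1 (F n)" "\<lambda>_. 0"] by simp
    moreover have "norm2_sq (fourier_L1 (F n)) \<le> ?c * norm2_sq (F n)" by (rule norm2_sq_fourier_L1_le[OF F])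
    moreover have "norm2_sq (F n) \<le> 2 * norm2_sq (\<lambda>x. F n x - f x) + 2 * norm2_sq f"
      using norm2_sq_triangle[of "F n" f "\<lambda>_. 0"] by simp
    then have "?c * norm2_sq (F n) \<le> ?c * (2 * norm2_sq (\<lambda>x. F n x - f x) + 2 * norm2_sq f)"
        by (intro mult_left_mono) auto
    ultimately show ?thesis unfolding norm2_sq_minus[of g]
      by (meson add_left_mono mult_left_mono order_trans zero_le)
  qed
  have "(\<lambda>n. 2 * norm2_sq (\<lambda>\<xi>. fourier_L1 (F n) \<xi> - g \<xi>) + 2 * (?c * (2 * norm2_sq (\<lambda>x. F n x - f x) + 2 *
      norm2_sq f)))
      \<longlonglongrightarrow> 2 * 0 + 2 * (?c * (2 * 0 + 2 * norm2_sq f))"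
    by (intro tendsto_add ennreal_tendsto_cmult lim tendsto_const) auto
  from LIMSEQ_le_const[OF this] le have "norm2_sq g \<le> 2 * 0 + 2 * (?c * (2 * 0 + 2 * norm2_sq f))" by blast
  also have "\<dots> = (2 * 2) * (?c * norm2_sq f)" by (simp only: mult_zero_right add_0_left) (simp only: mult_ac)
  finally show ?thesis by simp
qed

text \<open>One form covering sums (c = 1), differences (c = -1) and, with a zero first function,
  multiples.\<close>

lemma is_fourier_L2_lincomb:
  assumes "is_fourier_L2 f g" "is_fourier_L2 f' g'"
  shows "is_fourier_L2 (\<lambda>x. f x + c * f' x) (\<lambda>\<xi>. g \<xi> + c * g' \<xi>)"
proof -
  obtain F where F: "\<And>n. integrable lborel (F n)" "\<And>n. square_integrable (F n)" and
      f: "square_integrable f" "square_integrable g"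
    and lim: "(\<lambda>n. norm2_sq (\<lambda>x. F n x - f x)) \<longlonglongrightarrow> 0" "(\<lambda>n. norm2_sq (\<lambda>\<xi>. fourier_L1 (F n) \<xi> - g \<xi>)) \<longlonglongrightarrow> 0"
    using assms(1) unfolding is_fourier_L2_iff by blast
  obtain F' where F': "\<And>n. integrable lborel (F' n)" "\<And>n. square_integrable (F' n)" and
      f': "square_integrable f'" "square_integrable g'"
    and lim': "(\<lambda>n. norm2_sq (\<lambda>x. F' n x - f' x)) \<longlonglongrightarrow> 0" "(\<lambda>n. norm2_sq (\<lambda>\<xi>. fourier_L1 (F' n) \<xi> - g' \<xi>)) \<longlonglongrightarrow> 0"
    using assms(2) unfolding is_fourier_L2_iff by blast
  note [measurable] = square_integrableD[OF F(2), simplified] square_integrableD[OF f(1),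
      simplified] square_integrableD[OF f(2), simplified]
    square_integrableD[OF F'(2), simplified] square_integrableD[OF f'(1),
        simplified] square_integrableD[OF f'(2), simplified]
    borel_measurable_fourier_L1[OF F(1)] borel_measurable_fourier_L1[OF F'(1)]
  have key: "(\<lambda>n. norm2_sq (\<lambda>x. (a n x + c * a' n x) - (b x + c * b' x))) \<longlonglongrightarrow> 0"
    if [measurable]: "\<And>n. a n \<in> borel_measurable borel" "\<And>n. a' n \<in> borel_measurable borel"
        "b \<in> borel_measurable borel" "b' \<in> borel_measurable borel"
      and l: "(\<lambda>n. norm2_sq (\<lambda>x. a n x - b x)) \<longlonglongrightarrow> 0" "(\<lambda>n. norm2_sq (\<lambda>x. a' n x - b' x)) \<longlonglongrightarrow> 0"
    for a a' :: "nat \<Rightarrow> 'a \<Rightarrow> complex" and b b'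
  proof (rule tendsto_zero_if_le_twice_sum[OF _ l(1)])
    fix n
    have "norm2_sq (\<lambda>x. (a n x + c * a' n x) - (b x + c * b' x)) = norm2_sq (\<lambda>x. (a n x - b x) + c * (a' n x -
        b' x))"
      by (simp add: algebra_simps)
    also have "\<dots> \<le> 2 * norm2_sq (\<lambda>x. a n x - b x) + 2 * norm2_sq (\<lambda>x. c * (a' n x - b' x))"
      by (rule norm2_sq_add_le) measurable
    also have "norm2_sq (\<lambda>x. c * (a' n x - b' x)) = ennreal ((norm c)\<^sup>2) * norm2_sq (\<lambda>x. a' n x - b' x)"
      by (rule norm2_sq_cmult) measurable
    finally show "norm2_sq (\<lambda>x. (a n x + c * a' n x) - (b x + c * b' x)) \<le>
        2 * norm2_sq (\<lambda>x. a n x - b x) + 2 * (ennreal ((norm c)\<^sup>2) * norm2_sq (\<lambda>x. a' n x - b' x))" .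
  next
    have "(\<lambda>n. ennreal ((norm c)\<^sup>2) * norm2_sq (\<lambda>x. a' n x - b' x)) \<longlonglongrightarrow> ennreal ((norm c)\<^sup>2) * 0"
      by (intro ennreal_tendsto_cmult l) auto
    then show "(\<lambda>n. ennreal ((norm c)\<^sup>2) * norm2_sq (\<lambda>x. a' n x - b' x)) \<longlonglongrightarrow> 0" by simp
  qed
  have FT: "fourier_L1 (\<lambda>x. F n x + c * F' n x) = (\<lambda>\<xi>. fourier_L1 (F n) \<xi> + c * fourier_L1 (F' n) \<xi>)" for n
    using fourier_L1_add[OF F(1)[of n], of "\<lambda>x. c * F' n x"] F'(1)[of n] fourier_L1_cmult[of c "F' n"]
        by (intro ext) simp
  show ?thesis
    unfolding is_fourier_L2_iff
  proof (intro conjI exI[of _ "\<lambda>n x. F n x + c * F' n x"] allI)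
    show "(\<lambda>n. norm2_sq (\<lambda>x. F n x + c * F' n x - (f x + c * f' x))) \<longlonglongrightarrow> 0"
      by (rule key) (use lim lim' in measurable)
    show "(\<lambda>n. norm2_sq (\<lambda>\<xi>. fourier_L1 (\<lambda>x. F n x + c * F' n x) \<xi> - (g \<xi> + c * g' \<xi>))) \<longlonglongrightarrow> 0"
      unfolding FT by (rule key) (use lim lim' in measurable)
  qed (use F F' f f' in \<open>auto intro!: square_integrable_add square_integrable_cmult\<close>)
qed

lemma norm2_sq_eq_0_iff:
  assumes [measurable]: "f \<in> borel_measurable borel"
  shows "norm2_sq f = 0 \<longleftrightarrow> (AE x in lborel. f x = 0)"
  unfolding norm2_sq_def by (subst nn_integral_0_iff_AE) auto

lemma is_fourier_L2_unique:
  assumes "is_fourier_L2 f g" "is_fourier_L2 f g'" shows "AE \<xi> in lborel. g \<xi> = g' \<xi>"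
proof -
  have d: "is_fourier_L2 (\<lambda>x. f x + (- 1) * f x) (\<lambda>\<xi>. g \<xi> + (- 1) * g' \<xi>)"
      by (rule is_fourier_L2_lincomb[OF assms])
  have [measurable]: "g \<in> borel_measurable borel" "g' \<in> borel_measurable borel" using assms
      by (auto simp: is_fourier_L2_def square_integrable_iff)
  have "norm2_sq (\<lambda>\<xi>. g \<xi> + (- 1) * g' \<xi>) = 0" using is_fourier_L2_norm_le[OF d] by (simp add: norm2_sq_def)
  then have "AE \<xi> in lborel. g \<xi> + (- 1) * g' \<xi> = 0" by (subst (asm) norm2_sq_eq_0_iff) auto
  then show ?thesis by eventually_elim simp
qed

text \<open>An integrable function is approximated by the constant sequence of itself; in the other
  branch existence justifies the choice.\<close>

lemma is_fourier_L2_fourier: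
  assumes "square_integrable u" shows "is_fourier_L2 u (fourier u)"
proof (cases "integrable lborel u")
  case True
  have "norm2_sq (\<lambda>x. h x - h x) = 0" for h :: "'a \<Rightarrow> complex" by (simp add: norm2_sq_def)
  then show ?thesis using True assms square_integrable_fourier_L1[OF True assms]
    unfolding is_fourier_L2_iff fourier_def by (auto intro!: exI[of _ "\<lambda>_. u"])
next
  case False
  then show ?thesis using someI_ex[OF is_fourier_L2_exists[OF assms]] by (simp add: fourier_def)
qed

lemma square_integrable_fourier: "square_integrable u \<Longrightarrow> square_integrable (fourier u)"
  using is_fourier_L2_fourier by (auto simp: is_fourier_L2_def)

text \<open>The versions on the two sides are chosen independently, so equality can only hold almost
  everywhere.\<close>

lemma fourier_lincomb_AE:
  assumes "square_integrable u" "square_integrable v"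
  shows "AE \<xi> in lborel. fourier (\<lambda>x. u x + c * v x) \<xi> = fourier u \<xi> + c * fourier v \<xi>"
  using assms by (intro is_fourier_L2_unique[OF is_fourier_L2_fourier is_fourier_L2_lincomb]
      is_fourier_L2_fourier square_integrable_add square_integrable_cmult)

text \<open>A diagonal argument: the n-th pair is approximated by an integrable function and its
  transform to within 1 / (n + 1).\<close>

lemma is_fourier_L2_closed:
  assumes F: "\<And>n. is_fourier_L2 (u n) (g n)" and u: "square_integrable v" "square_integrable h"
    and lim: "(\<lambda>n. norm2_sq (\<lambda>x. u n x - v x)) \<longlonglongrightarrow> 0" "(\<lambda>n. norm2_sq (\<lambda>x. g n x - h x)) \<longlonglongrightarrow> 0"
  shows "is_fourier_L2 v h"
proof -
  have "\<exists>f. integrable lborel f \<and> square_integrable f \<and> norm2_sq (\<lambda>x. f x - u n x) <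
      ennreal (inverse (real (Suc n))) \<and>
      norm2_sq (\<lambda>\<xi>. fourier_L1 f \<xi> - g n \<xi>) < ennreal (inverse (real (Suc n)))" for n
  proof -
    obtain G where G: "\<And>k. integrable lborel (G k)" "\<And>k. square_integrable (G k)"
      and l: "(\<lambda>k. norm2_sq (\<lambda>x. G k x - u n x)) \<longlonglongrightarrow> 0" "(\<lambda>k. norm2_sq (\<lambda>\<xi>. fourier_L1 (G k) \<xi> - g n \<xi>)) \<longlonglongrightarrow> 0"
      using F[of n] unfolding is_fourier_L2_iff by blast
    have "eventually (\<lambda>k. norm2_sq (\<lambda>x. G k x - u n x) < ennreal (inverse (real (Suc n)))) sequentially"
      "eventually (\<lambda>k. norm2_sq (\<lambda>\<xi>. fourier_L1 (G k) \<xi> - g n \<xi>) < ennreal (inverse (real (Suc n))))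
          sequentially"
      by (rule order_tendstoD(2)[OF l(1)], simp) (rule order_tendstoD(2)[OF l(2)], simp)
    then have "eventually (\<lambda>k. norm2_sq (\<lambda>x. G k x - u n x) < ennreal (inverse (real (Suc n))) \<and>
      norm2_sq (\<lambda>\<xi>. fourier_L1 (G k) \<xi> - g n \<xi>) < ennreal (inverse (real (Suc n)))) sequentially"
          by (rule eventually_conj)
    then obtain k where "norm2_sq (\<lambda>x. G k x - u n x) < ennreal (inverse (real (Suc n))) \<and>
      norm2_sq (\<lambda>\<xi>. fourier_L1 (G k) \<xi> - g n \<xi>) < ennreal (inverse (real (Suc n)))"
          by (auto simp only: eventually_sequentially)
    then show ?thesis using G by blast
  qed
  then obtain f where f: "\<And>n. integrable lborel (f n)" "\<And>n. square_integrable (f n)"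
    "\<And>n. norm2_sq (\<lambda>x. f n x - u n x) < ennreal (inverse (real (Suc n)))" "\<And>n. norm2_sq (\<lambda>\<xi>. fourier_L1 (f n)
        \<xi> - g n \<xi>) < ennreal (inverse (real (Suc n)))"
    by metis
  have us: "square_integrable (u n)" "square_integrable (g n)" for n using F[of n]
      by (auto simp: is_fourier_L2_def)
  have z: "(\<lambda>n. ennreal (inverse (real (Suc n)))) \<longlonglongrightarrow> 0"
    using tendsto_ennrealI[OF LIMSEQ_inverse_real_of_nat] by simp
  have l1: "(\<lambda>n. norm2_sq (\<lambda>x. f n x - u n x)) \<longlonglongrightarrow> 0"
    by (rule tendsto_sandwich[OF _ _ tendsto_const z]) (use less_imp_le[OF f(3)] in auto)
  have l2: "(\<lambda>n. norm2_sq (\<lambda>\<xi>. fourier_L1 (f n) \<xi> - g n \<xi>)) \<longlonglongrightarrow> 0"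
    by (rule tendsto_sandwich[OF _ _ tendsto_const z]) (use less_imp_le[OF f(4)] in auto)
  have "(\<lambda>n. norm2_sq (\<lambda>x. f n x - v x)) \<longlonglongrightarrow> 0"
    by (rule tendsto_zero_if_le_twice_sum[OF _ l1 lim(1)], rule norm2_sq_triangle) (use f(2)
        us u in \<open>auto simp: square_integrable_iff\<close>)
  moreover have "(\<lambda>n. norm2_sq (\<lambda>\<xi>. fourier_L1 (f n) \<xi> - h \<xi>)) \<longlonglongrightarrow> 0"
    by (rule tendsto_zero_if_le_twice_sum[OF _ l2 lim(2)], rule norm2_sq_triangle)
      (use borel_measurable_fourier_L1[OF f(1)] us u in \<open>auto simp: square_integrable_iff\<close>)
  ultimately show ?thesis unfolding is_fourier_L2_iff using f u by blast
qed

section \<open>Fourier inversion at points of continuity\<close>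

text \<open>Cauchy-Schwarz in additive form, |p q| <= (s / 2) |p|^2 + |q|^2 / (2 s), with s chosen
  according to the error aimed at.\<close>

lemma pairing_tendsto:
  fixes h :: "nat \<Rightarrow> 'a::euclidean_space \<Rightarrow> complex"
  assumes h: "\<And>n. square_integrable (h n)" "square_integrable g" and k: "square_integrable k"
    and lim: "(\<lambda>n. norm2_sq (\<lambda>x. h n x - g x)) \<longlonglongrightarrow> 0"
  shows "(\<lambda>n. LINT x|lborel. h n x * k x) \<longlonglongrightarrow> (LINT x|lborel. g x * k x)"
proof -
  define B where "B = (LINT x|lborel. (norm (k x))\<^sup>2)"
  have B: "B \<ge> 0" unfolding B_def by simp
  define A where "A = (\<lambda>n. LINT x|lborel. (norm (h n x - g x))\<^sup>2)"
  have d: "square_integrable (\<lambda>x. h n x - g x)" for n using h by (intro square_integrable_diff)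
  have "norm2_sq (\<lambda>x. h n x - g x) = ennreal (A n)" for n
    unfolding norm2_sq_def A_def using d[of n] by (intro nn_integral_eq_integral)
        (auto simp: square_integrable_def)
  then have "(\<lambda>n. ennreal (A n)) \<longlonglongrightarrow> ennreal 0" using lim by simp
  then have A: "A \<longlonglongrightarrow> 0" by (subst (asm) tendsto_ennreal_iff) (auto simp: A_def)
  have bound: "norm ((LINT x|lborel. h n x * k x) - (LINT x|lborel. g x * k x)) \<le> s / 2 * A n + B / (2 * s)"
      if s: "s > 0" for n s
  proof -
    have "(LINT x|lborel. h n x * k x) - (LINT x|lborel. g x * k x) = (LINT x|lborel. h n x * k x - g x * k x)"
      by (rule Bochner_Integration.integral_diff[symmetric]) (intro integrable_mult_square_integrable h k)+
    also have "\<dots> = (LINT x|lborel. (h n x - g x) * k x)" by (simp only: left_diff_distrib)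
    also have "norm \<dots> \<le> (LINT x|lborel. norm ((h n x - g x) * k x))" by (rule integral_norm_bound)
    also have "\<dots> \<le> (LINT x|lborel. s / 2 * (norm (h n x - g x))\<^sup>2 + 1 / (2 * s) * (norm (k x))\<^sup>2)"
    proof (rule integral_mono)
      show "integrable lborel (\<lambda>x. norm ((h n x - g x) * k x))" using d[of n] k
          by (intro integrable_norm integrable_mult_square_integrable)
      show "integrable lborel (\<lambda>x. s / 2 * (norm (h n x - g x))\<^sup>2 + 1 / (2 * s) * (norm (k x))\<^sup>2)"
        using d[of n] k by (intro Bochner_Integration.integrable_add integrable_mult_right)
            (auto simp: square_integrable_def)
      fix x
      have "0 \<le> (s * norm (h n x - g x) - norm (k x))\<^sup>2 / (2 * s)" using s by simp
      also have "\<dots> = s / 2 * (norm (h n x - g x))\<^sup>2 + 1 / (2 * s) * (norm (k x))\<^sup>2 - norm (h n x - g x) * norm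
          (k x)"
        using s by (simp add: field_simps power2_eq_square)
      finally show "norm ((h n x - g x) * k x) \<le> s / 2 * (norm (h n x - g x))\<^sup>2 + 1 / (2 * s) * (norm (k x))\<^sup>2"
          by (simp add: norm_mult)
    qed
    also have "\<dots> = s / 2 * A n + B / (2 * s)"
      using d[of n] k unfolding A_def B_def by (subst Bochner_Integration.integral_add)
          (auto simp: square_integrable_def)
    finally show ?thesis .
  qed
  show ?thesis
  proof (rule LIMSEQ_I)
    fix e :: real assume e: "e > 0"
    \<comment> \<open>This makes B / (2 s) at most e / 2; taking B + 1 instead of B keeps s positive
      when B = 0.\<close>
    define s where "s = (B + 1) / e"
    have s: "s > 0" using e B by (simp add: s_def)
    have "B / (2 * s) = e / 2 * (B / (B + 1))" using e B by (simp add: s_def field_simps)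
    also have "\<dots> \<le> e / 2 * 1" using e B by (intro mult_left_mono) (auto simp: divide_le_eq_1)
    finally have 1: "B / (2 * s) \<le> e / 2" by simp
    have "(\<lambda>n. s / 2 * A n) \<longlonglongrightarrow> s / 2 * 0" by (intro tendsto_intros A)
    then have "eventually (\<lambda>n. s / 2 * A n < e / 2) sequentially"
      unfolding mult_zero_right by (rule order_tendstoD(2)) (use e in simp)
    then obtain N where N: "\<And>n. n \<ge> N \<Longrightarrow> s / 2 * A n < e / 2" by (auto simp only: eventually_sequentially)
    show "\<exists>no. \<forall>n\<ge>no. norm ((LINT x|lborel. h n x * k x) - (LINT x|lborel. g x * k x)) < e"
    proof (intro exI allI impI)
      fix n assume "n \<ge> N"
      from N[OF this] 1 bound[OF s, of n] show "norm ((LINT x|lborel. h n x * k x) - (LINT x|lborel. g x * k x))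
          < e" by linarith
    qed
  qed
qed

lemma square_integrable_modulated_gauss:
  assumes "e > 0" shows "square_integrable (\<lambda>\<xi> :: 'a::euclidean_space. exp (\<i> * complex_of_real (\<xi> \<bullet> x)) *
      gauss e \<xi>)"
proof -
  have "(norm (exp (\<i> * complex_of_real (\<xi> \<bullet> x)) * gauss e \<xi>))\<^sup>2 = exp (- (2 * e) * (norm \<xi>)\<^sup>2)" for \<xi> :: 'a
    by (simp add: norm_mult exp_double[symmetric] del: of_real_exp)
  then show ?thesis using gaussian_integrable[of "2 * e", where 'a='a] assms
      by (simp add: square_integrable_def)
qed

lemma square_integrable_gauss_kernel:
  assumes "e > 0" shows "square_integrable (\<lambda>y :: 'a::euclidean_space. complex_of_real (exp (- ((norm (x -
      y))\<^sup>2 / (4 * e)))))"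
proof -
  have "(norm (complex_of_real (exp (- ((norm (x - y))\<^sup>2 / (4 * e))))))\<^sup>2 =
      exp (- ((norm (x - y))\<^sup>2 / (4 * (e / 2))))" for y :: 'a
    by (simp add: exp_double[symmetric])
  then have "norm2_sq (\<lambda>y. complex_of_real (exp (- ((norm (x - y))\<^sup>2 / (4 * e))))) =
      ennreal ((4 * pi * (e / 2)) powr (real DIM('a) / 2))"
    unfolding norm2_sq_def using gauss_kernel_nn_integral[of "e / 2" x] assms by simp
  then show ?thesis by (simp add: square_integrable_iff)
qed

text \<open>Both sides pair with a fixed square integrable kernel, so the identity for integrable
  functions passes to the L^2 limit.\<close>

lemma is_fourier_L2_smoothing:
  fixes u g :: "'a::euclidean_space \<Rightarrow> complex"
  assumes ug: "is_fourier_L2 u g" and e: "e > 0"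
  shows "(LINT \<xi>|lborel. g \<xi> * (exp (\<i> * complex_of_real (\<xi> \<bullet> x)) * gauss e \<xi>)) =
    complex_of_real ((pi / e) powr (real DIM('a) / 2)) * (LINT y|lborel. u y * complex_of_real (exp (- ((norm
        (x - y))\<^sup>2 / (4 * e)))))"
proof -
  obtain F where F: "\<And>n. integrable lborel (F n)" "\<And>n. square_integrable (F n)" and
      f: "square_integrable u" "square_integrable g"
    and lim: "(\<lambda>n. norm2_sq (\<lambda>x. F n x - u x)) \<longlonglongrightarrow> 0" "(\<lambda>n. norm2_sq (\<lambda>\<xi>. fourier_L1 (F n) \<xi> - g \<xi>)) \<longlonglongrightarrow> 0"
    using ug unfolding is_fourier_L2_iff by blast
  have "(\<lambda>n. LINT \<xi>|lborel. fourier_L1 (F n) \<xi> * (exp (\<i> * complex_of_real (\<xi> \<bullet> x)) * gauss e \<xi>)) \<longlonglongrightarrow>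
      (LINT \<xi>|lborel. g \<xi> * (exp (\<i> * complex_of_real (\<xi> \<bullet> x)) * gauss e \<xi>))"
    by (rule pairing_tendsto[OF square_integrable_fourier_L1[OF F] f(2)
        square_integrable_modulated_gauss[OF e] lim(2)])
  moreover have "(\<lambda>n. complex_of_real ((pi / e) powr (real DIM('a) / 2)) * (LINT y|lborel. F n y *
      complex_of_real (exp (- ((norm (x - y))\<^sup>2 / (4 * e)))))) \<longlonglongrightarrow>
     complex_of_real ((pi / e) powr (real DIM('a) / 2)) * (LINT y|lborel. u y * complex_of_real (exp (- ((norm
         (x - y))\<^sup>2 / (4 * e)))))"
    by (intro tendsto_mult tendsto_const pairing_tendsto[OF F(2) f(1) square_integrable_gauss_kernel[OF e]
        lim(1)])
  ultimately show ?thesis unfolding fourier_L1_smoothing[OF F(1) e] by (rule LIMSEQ_unique)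
qed

lemma integral_lborel_affine:
  fixes f :: "'a::euclidean_space \<Rightarrow> complex"
  assumes [measurable]: "f \<in> borel_measurable borel" and s: "s > 0"
  shows "(LINT y|lborel. f y) = complex_of_real (s ^ DIM('a)) * (LINT z|lborel. f (x + s *\<^sub>R z))"
proof -
  have "(LINT y|lborel. f y) = (LINT y|density (distr lborel borel (\<lambda>z. x + s *\<^sub>R z)) (\<lambda>_. ennreal
      (\<bar>s\<bar> ^ DIM('a))). f y)"
    using lborel_affine[of s x] s by simp
  also have "\<dots> = (LINT y|distr lborel borel (\<lambda>z. x + s *\<^sub>R z). (\<bar>s\<bar> ^ DIM('a)) *\<^sub>R f y)"
    by (rule integral_density) auto
  also have "\<dots> = (LINT z|lborel. (\<bar>s\<bar> ^ DIM('a)) *\<^sub>R f (x + s *\<^sub>R z))"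
    by (rule integral_distr) auto
  finally show ?thesis using s by (simp add: scaleR_conv_of_real)
qed

text \<open>Substituting y = x + s z makes the Gaussian independent of m, and boundedness of b gives
  a dominating function. The kernel is that of the smoothing formula with e = s^2 / 4.\<close>

lemma gaussian_approx_identity_bounded:
  fixes b :: "'a::euclidean_space \<Rightarrow> complex"
  assumes [measurable]: "b \<in> borel_measurable borel" and bd: "\<And>y. norm (b y) \<le> B" and cont: "isCont b x"
  defines "s \<equiv> \<lambda>m. inverse (real (Suc m))"
  shows "(\<lambda>m. complex_of_real ((4 * pi) powr (real DIM('a) / 2) / s m ^ DIM('a)) *
      (LINT y|lborel. b y * complex_of_real (exp (- ((norm (x - y))\<^sup>2 / (s m)\<^sup>2))))) \<longlonglongrightarrow>
          complex_of_real ((2 * pi) ^ DIM('a)) * b x"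
proof -
  let ?c = "(4 * pi) powr (real DIM('a) / 2)"
  have s: "s m > 0" for m by (simp add: s_def)
  have s0: "s \<longlonglongrightarrow> 0" unfolding s_def by (rule LIMSEQ_inverse_real_of_nat)
  have eq: "complex_of_real (?c / s m ^ DIM('a)) * (LINT y|lborel. b y * complex_of_real (exp (- ((norm (x -
      y))\<^sup>2 / (s m)\<^sup>2)))) =
      complex_of_real ?c * (LINT z|lborel. b (x + s m *\<^sub>R z) * gauss 1 z)" for m
  proof -
    have "exp (- ((norm (x - (x + s m *\<^sub>R z)))\<^sup>2 / (s m)\<^sup>2)) = exp (- 1 * (norm z)\<^sup>2)" for z
      using s[of m] by (simp add: power_mult_distrib)
    then have "(LINT y|lborel. b y * complex_of_real (exp (- ((norm (x - y))\<^sup>2 / (s m)\<^sup>2)))) =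
        complex_of_real (s m ^ DIM('a)) * (LINT z|lborel. b (x + s m *\<^sub>R z) * gauss 1 z)"
      by (subst integral_lborel_affine[OF _ s[of m], where x = x]) simp_all
    then show ?thesis using s[of m] by (simp del: of_real_exp)
  qed
  have "(\<lambda>m. LINT z|lborel. b (x + s m *\<^sub>R z) * gauss 1 z) \<longlonglongrightarrow> (LINT z::'a|lborel. b x * gauss 1 z)"
  proof (rule integral_dominated_convergence[where w = "\<lambda>z::'a. B * exp (- 1 * (norm z)\<^sup>2)"])
    show "integrable lborel (\<lambda>z::'a. B * exp (- 1 * (norm z)\<^sup>2))" using gaussian_integrable[of 1]
        by (intro integrable_mult_right) simp
    show "AE z in lborel. (\<lambda>m. b (x + s m *\<^sub>R z) * gauss 1 z) \<longlonglongrightarrow> b x * gauss 1 z"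
    proof (rule AE_I2, intro tendsto_mult tendsto_const)
      fix z :: 'a
      have "(\<lambda>m. x + s m *\<^sub>R z) \<longlonglongrightarrow> x + 0 *\<^sub>R z" by (intro tendsto_intros s0)
      then have "(\<lambda>m. x + s m *\<^sub>R z) \<longlonglongrightarrow> x" by simp
      from isCont_tendsto_compose[OF cont this] show "(\<lambda>m. b (x + s m *\<^sub>R z)) \<longlonglongrightarrow> b x" .
    qed
    show "AE z in lborel. norm (b (x + s m *\<^sub>R z) * gauss 1 z) \<le> B * exp (- 1 * (norm z)\<^sup>2)" for m
      using bd by (intro AE_I2) (simp add: norm_mult mult_right_mono)
  qed auto
  then have "(\<lambda>m. complex_of_real ?c * (LINT z|lborel. b (x + s m *\<^sub>R z) * gauss 1 z)) \<longlonglongrightarrow>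
      complex_of_real ?c * (LINT z::'a|lborel. b x * gauss 1 z)"
    by (intro tendsto_intros)
  also have "complex_of_real ?c * (LINT z::'a|lborel. b x * gauss 1 z) =
      complex_of_real ((2 * pi) ^ DIM('a)) * b x"
  proof -
    have "(LINT z::'a|lborel. b x * gauss 1 z) = b x * complex_of_real (pi powr (real DIM('a) / 2))"
      using gaussian_integral[of 1, where 'a='a] by (simp only: integral_mult_right_zero
          integral_complex_of_real) simp
    moreover have "pi powr (real DIM('a) / 2) * (4 * pi) powr (real DIM('a) / 2) = (2 * pi) ^ DIM('a)"
      using smoothing_constants[of 1 "DIM('a)"] by simp
    then have "complex_of_real ((2 * pi) ^ DIM('a)) = complex_of_real (pi powr (real DIM('a) / 2)) *
        complex_of_real ((4 * pi) powr (real DIM('a) / 2))"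
      by (simp only: of_real_mult[symmetric])
    ultimately show ?thesis by (simp only: mult_ac)
  qed
  finally show ?thesis unfolding eq .
qed

lemma gaussian_decay_off_diagonal:
  assumes "\<delta> > 0"
  shows "(\<lambda>m. (real (Suc m)) ^ n * exp (- (\<delta>\<^sup>2 * (real (Suc m))\<^sup>2))) \<longlonglongrightarrow> 0"
proof -
  have y: "filterlim (\<lambda>m. \<delta>\<^sup>2 * (real (Suc m))\<^sup>2) at_top sequentially"
    using assms by real_asymp
  have "(\<lambda>m. (1 / \<delta>\<^sup>2) ^ n * ((\<delta>\<^sup>2 * (real (Suc m))\<^sup>2) ^ n / exp (\<delta>\<^sup>2 * (real (Suc m))\<^sup>2))) \<longlonglongrightarrow> (1 / \<delta>\<^sup>2) ^ n * 0"
    by (intro tendsto_mult tendsto_const filterlim_compose[OF tendsto_power_div_exp_0 y])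
  then have "(\<lambda>m. (1 / \<delta>\<^sup>2) ^ n * ((\<delta>\<^sup>2 * (real (Suc m))\<^sup>2) ^ n / exp (\<delta>\<^sup>2 * (real (Suc m))\<^sup>2))) \<longlonglongrightarrow> 0" by simp
  then show ?thesis
  proof (rule tendsto_sandwich[OF _ _ tendsto_const, rotated 2])
    show "eventually (\<lambda>m. (real (Suc m)) ^ n * exp (- (\<delta>\<^sup>2 * (real (Suc m))\<^sup>2)) \<le>
      (1 / \<delta>\<^sup>2) ^ n * ((\<delta>\<^sup>2 * (real (Suc m))\<^sup>2) ^ n / exp (\<delta>\<^sup>2 * (real (Suc m))\<^sup>2))) sequentially"
    proof (rule always_eventually, rule allI)
      fix m
      have "(1 / \<delta>\<^sup>2) ^ n * (\<delta>\<^sup>2 * (real (Suc m))\<^sup>2) ^ n = ((real (Suc m))\<^sup>2) ^ n"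
      proof -
        have "1 / \<delta>\<^sup>2 * (\<delta>\<^sup>2 * (real (Suc m))\<^sup>2) = (real (Suc m))\<^sup>2" using assms by simp
        then show ?thesis by (simp only: power_mult_distrib[symmetric])
      qed
      moreover have "real (Suc m) ^ n \<le> ((real (Suc m))\<^sup>2) ^ n" by (intro power_mono self_le_power) auto
      ultimately show "(real (Suc m)) ^ n * exp (- (\<delta>\<^sup>2 * (real (Suc m))\<^sup>2)) \<le>
        (1 / \<delta>\<^sup>2) ^ n * ((\<delta>\<^sup>2 * (real (Suc m))\<^sup>2) ^ n / exp (\<delta>\<^sup>2 * (real (Suc m))\<^sup>2))"
        by (simp only: exp_minus divide_inverse[symmetric] times_divide_eq_right) (rule divide_right_mono, auto)
    qed
  qed auto
qed

text \<open>A square integrable u may be unbounded away from x. Near x, continuity makes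
  \<open>u1\<close> bounded. Off the ball |u| <= 1 + |u|^2: the constant is handled by the bounded
  case for \<open>b\<close>, the indicator of the complement, which vanishes at x; the square meets
  a kernel of size at most exp (- \<delta>^2 / s^2), which beats the prefactor s^(-d).\<close>

lemma gaussian_approx_identity:
  fixes u :: "'a::euclidean_space \<Rightarrow> complex"
  assumes u: "square_integrable u" and cont: "isCont u x"
  defines "s \<equiv> \<lambda>m. inverse (real (Suc m))"
  shows "(\<lambda>m. complex_of_real ((4 * pi) powr (real DIM('a) / 2) / s m ^ DIM('a)) *
      (LINT y|lborel. u y * complex_of_real (exp (- ((norm (x - y))\<^sup>2 / (s m)\<^sup>2))))) \<longlonglongrightarrow>
          complex_of_real ((2 * pi) ^ DIM('a)) * u x"
proof -
  let ?C = "\<lambda>m. (4 * pi) powr (real DIM('a) / 2) / s m ^ DIM('a)"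
  let ?K = "\<lambda>m y. exp (- ((norm (x - y))\<^sup>2 / (s m)\<^sup>2))"
  have [measurable]: "u \<in> borel_measurable borel" using u by (simp add: square_integrable_iff)
  have s: "s m > 0" for m by (simp add: s_def)
  obtain \<delta> where \<delta>: "\<delta> > 0" and near: "\<And>y. dist y x < \<delta> \<Longrightarrow> dist (u y) (u x) < 1"
    using cont unfolding continuous_at_eps_delta by (metis zero_less_one)
  have [measurable]: "ball x \<delta> \<in> sets borel" by simp
  define u1 where "u1 = (\<lambda>y. indicator (ball x \<delta>) y * u y)"
  define u2 where "u2 = (\<lambda>y. u y - u1 y)"
  define b where "b = (\<lambda>y. 1 - indicator (ball x \<delta>) y :: complex)"
  have [measurable]: "u1 \<in> borel_measurable borel" "u2 \<in> borel_measurable borel" "b \<in> borel_measurable borel"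
    unfolding u1_def u2_def b_def by measurable
  have ev: "eventually (\<lambda>y. y \<in> ball x \<delta>) (nhds x)" using \<delta> by (intro eventually_nhds_in_open) auto
  have c1: "isCont u1 x"
  proof -
    have "eventually (\<lambda>y. u1 y = u y) (nhds x)" using ev by (rule eventually_mono) (simp add: u1_def)
    from isCont_cong[OF this] cont show ?thesis by blast
  qed
  have cb: "isCont b x"
  proof -
    have "eventually (\<lambda>y. b y = 0) (nhds x)" using ev by (rule eventually_mono) (simp add: b_def)
    from isCont_cong[OF this] show ?thesis by simp
  qed
  have bd1: "norm (u1 y) \<le> norm (u x) + 1" for y
  proof (cases "y \<in> ball x \<delta>")
    case True
    then have "norm (u y - u x) < 1" using near[of y] by (simp add: dist_norm norm_minus_commute)
    then show ?thesis using True norm_triangle_ineq2[of "u y" "u x"] by (simp add: u1_def)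
  qed (simp add: u1_def)
  have L1: "(\<lambda>m. complex_of_real (?C m) * (LINT y|lborel. u1 y * complex_of_real (?K m y))) \<longlonglongrightarrow>
      complex_of_real ((2 * pi) ^ DIM('a)) * u1 x"
    unfolding s_def by (rule gaussian_approx_identity_bounded[OF _ bd1 c1]) measurable
  have bdb: "norm (b y) \<le> 1" for y by (auto simp: b_def indicator_def)
  have Lb: "(\<lambda>m. complex_of_real (?C m) * (LINT y|lborel. b y * complex_of_real (?K m y))) \<longlonglongrightarrow>
      complex_of_real ((2 * pi) ^ DIM('a)) * b x"
    unfolding s_def by (rule gaussian_approx_identity_bounded[OF _ bdb cb]) measurable
  have Ki: "integrable lborel (\<lambda>y. complex_of_real (?K m y))" for m
  proof -
    have "(\<integral>\<^sup>+y. ennreal (exp (- ((norm (x - y))\<^sup>2 / (4 * ((s m)\<^sup>2 / 4))))) \<partial>lborel) =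
        ennreal ((4 * pi * ((s m)\<^sup>2 / 4)) powr (real DIM('a) / 2))"
      using s[of m] by (intro gauss_kernel_nn_integral) simp
    then have "integrable lborel (\<lambda>y. ?K m y)" by (intro integrableI_nonneg) auto
    then show ?thesis by (rule integrable_of_real)
  qed
  let ?I = "LINT y|lborel. (norm (u y))\<^sup>2"
  have bound: "norm (complex_of_real (?C m) * (LINT y|lborel. u2 y * complex_of_real (?K m y))) \<le>
     norm (complex_of_real (?C m) * (LINT y|lborel. b y * complex_of_real (?K m y))) +
     (4 * pi) powr (real DIM('a) / 2) * ?I * ((real (Suc m)) ^ DIM('a) * exp (- (\<delta>\<^sup>2 * (real (Suc m))\<^sup>2)))"
         for m
  proof -
    define E where "E = exp (- (\<delta>\<^sup>2 / (s m)\<^sup>2))"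
    have "norm (u2 y * complex_of_real (?K m y)) \<le> Re (b y * complex_of_real (?K m y)) + E * (norm (u y))\<^sup>2"
        for y
    proof (cases "y \<in> ball x \<delta>")
      case True
      then show ?thesis by (simp add: u2_def u1_def b_def E_def)
    next
      case False
      then have "\<delta>\<^sup>2 \<le> (norm (x - y))\<^sup>2" using \<delta> by (intro power_mono) (auto simp: dist_norm)
      then have KE: "?K m y \<le> E" unfolding E_def using s[of m] by (simp add: divide_right_mono)
      have "norm (u y) \<le> 1 + (norm (u y))\<^sup>2"
        using zero_le_power2[of "2 * norm (u y) - 1"] zero_le_power2[of "norm (u y)"]
            by (simp add: power2_diff power_mult_distrib)
      then have "norm (u y) * ?K m y \<le> (1 + (norm (u y))\<^sup>2) * ?K m y" by (intro mult_right_mono) auto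
      also have "\<dots> \<le> ?K m y + (norm (u y))\<^sup>2 * E" using KE by (simp add: distrib_right mult_left_mono)
      finally show ?thesis using False by (simp add: u2_def u1_def b_def norm_mult mult.commute)
    qed
    note pt = this
    have bi: "integrable lborel (\<lambda>y. b y * complex_of_real (?K m y))"
      by (rule Bochner_Integration.integrable_bound[OF Ki[of m]]) (auto simp: b_def indicator_def norm_mult)
    have "norm (LINT y|lborel. u2 y * complex_of_real (?K m y)) \<le> (LINT y|lborel. norm (u2 y * complex_of_real
        (?K m y)))" by (rule integral_norm_bound)
    also have "\<dots> \<le> (LINT y|lborel. Re (b y * complex_of_real (?K m y)) + E * (norm (u y))\<^sup>2)"
    proof (rule integral_mono)
      show i2: "integrable lborel (\<lambda>y. Re (b y * complex_of_real (?K m y)) + E * (norm (u y))\<^sup>2)"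
        using bi u by (intro Bochner_Integration.integrable_add integrable_Re integrable_mult_right)
            (auto simp: square_integrable_def)
      have "AE y in lborel. norm (norm (u2 y * complex_of_real (?K m y))) \<le>
          norm (Re (b y * complex_of_real (?K m y)) + E * (norm (u y))\<^sup>2)"
      proof (rule AE_I2)
        fix y show "norm (norm (u2 y * complex_of_real (?K m y))) \<le> norm (Re (b y * complex_of_real (?K m y)) +
            E * (norm (u y))\<^sup>2)"
          using pt[of y] abs_ge_self[of "Re (b y * complex_of_real (?K m y)) + E * (norm (u y))\<^sup>2"]
              by (simp only: real_norm_def abs_norm_cancel)
      qed
      then show "integrable lborel (\<lambda>y. norm (u2 y * complex_of_real (?K m y)))"
        by (rule Bochner_Integration.integrable_bound[OF i2, rotated]) measurable
    qed (rule pt)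
    also have "\<dots> = Re (LINT y|lborel. b y * complex_of_real (?K m y)) + E * ?I"
    proof -
      have "integrable lborel (\<lambda>y. E * (norm (u y))\<^sup>2)" using u by (intro integrable_mult_right)
          (auto simp: square_integrable_def)
      from Bochner_Integration.integral_add[OF integrable_Re[OF bi] this] show ?thesis
        by (simp only: integral_Re[OF bi] integral_mult_right_zero)
    qed
    also have "\<dots> \<le> norm (LINT y|lborel. b y * complex_of_real (?K m y)) + E * ?I" using complex_Re_le_cmod
        by simp
    finally have "?C m * norm (LINT y|lborel. u2 y * complex_of_real (?K m y)) \<le>
        ?C m * (norm (LINT y|lborel. b y * complex_of_real (?K m y)) + E * ?I)"
      using s[of m] by (intro mult_left_mono) auto
    moreover have "?C m * (E * ?I) = (4 * pi) powr (real DIM('a) / 2) * ?I * ((real (Suc m)) ^ DIM('a) * exp (-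
        (\<delta>\<^sup>2 * (real (Suc m))\<^sup>2)))"
    proof -
      have e: "x / inverse y ^ k = x * y ^ k" for x y :: real and k
        by (simp only: power_inverse divide_inverse inverse_inverse_eq)
      show ?thesis unfolding E_def s_def e by (simp only: mult_ac)
    qed
    moreover have "?C m \<ge> 0" using s[of m] by simp
    ultimately show ?thesis by (simp only: norm_mult norm_of_real distrib_left abs_of_nonneg)
  qed
  have "(\<lambda>m. norm (complex_of_real (?C m) * (LINT y|lborel. b y * complex_of_real (?K m y))) +
     (4 * pi) powr (real DIM('a) / 2) * ?I * ((real (Suc m)) ^ DIM('a) * exp (- (\<delta>\<^sup>2 * (real (Suc m))\<^sup>2)))) \<longlonglongrightarrow>
     norm (complex_of_real ((2 * pi) ^ DIM('a)) * b x) + (4 * pi) powr (real DIM('a) / 2) * ?I * 0"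
    by (intro tendsto_add tendsto_mult tendsto_norm Lb[THEN tendsto_norm] tendsto_const
        gaussian_decay_off_diagonal \<delta>)
  then have "(\<lambda>m. norm (complex_of_real (?C m) * (LINT y|lborel. b y * complex_of_real (?K m y))) +
     (4 * pi) powr (real DIM('a) / 2) * ?I * ((real (Suc m)) ^ DIM('a) * exp (- (\<delta>\<^sup>2 * (real (Suc m))\<^sup>2)))) \<longlonglongrightarrow> 0"
    using \<delta> by (simp add: b_def)
  then have L2: "(\<lambda>m. complex_of_real (?C m) * (LINT y|lborel. u2 y * complex_of_real (?K m y))) \<longlonglongrightarrow> 0"
    by (rule Lim_null_comparison[rotated]) (intro always_eventually allI bound)
  have i1: "integrable lborel (\<lambda>y. u1 y * complex_of_real (?K m y))" for m
  proof (rule Bochner_Integration.integrable_bound)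
    show "integrable lborel (\<lambda>y. complex_of_real (norm (u x) + 1) * complex_of_real (?K m y))" using Ki
        by (rule integrable_mult_right)
    show "AE y in lborel. norm (u1 y * complex_of_real (?K m y)) \<le> norm (complex_of_real (norm (u x) + 1) *
        complex_of_real (?K m y))"
      using bd1 by (intro AE_I2) (simp only: norm_mult norm_of_real, intro mult_right_mono,
          auto intro: order_trans)
  qed measurable
  have iu: "integrable lborel (\<lambda>y. u y * complex_of_real (?K m y))" for m
    using integrable_mult_square_integrable[OF u square_integrable_gauss_kernel[of "(s m)\<^sup>2 / 4" x]] s[of m]
        by simp
  have "(LINT y|lborel. u y * complex_of_real (?K m y)) = (LINT y|lborel. u1 y * complex_of_real (?K m y)) +
      (LINT y|lborel. u2 y * complex_of_real (?K m y))" for m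
  proof -
    have "(LINT y|lborel. u2 y * complex_of_real (?K m y)) = (LINT y|lborel. u y * complex_of_real (?K m y) -
        u1 y * complex_of_real (?K m y))"
      by (simp only: u2_def left_diff_distrib)
    also have "\<dots> = (LINT y|lborel. u y * complex_of_real (?K m y)) - (LINT y|lborel. u1 y * complex_of_real
        (?K m y))"
      by (rule Bochner_Integration.integral_diff[OF iu i1])
    finally show ?thesis by (simp del: of_real_exp)
  qed
  then have "complex_of_real (?C m) * (LINT y|lborel. u y * complex_of_real (?K m y)) =
      complex_of_real (?C m) * (LINT y|lborel. u1 y * complex_of_real (?K m y)) + complex_of_real (?C m) *
          (LINT y|lborel. u2 y * complex_of_real (?K m y))" for m
    by (simp only: distrib_left)
  moreover have "u1 x = u x" using \<delta> by (simp add: u1_def)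
  ultimately show ?thesis using tendsto_add[OF L1 L2] by simp
qed

text \<open>Fourier inversion holds at every point of continuity once the transform is integrable.\<close>

lemma fourier_inversion:
  fixes u g :: "'a::euclidean_space \<Rightarrow> complex"
  assumes ug: "is_fourier_L2 u g" and g: "integrable lborel g" and cont: "isCont u x"
  shows "complex_of_real ((2 * pi) ^ DIM('a)) * u x = (LINT \<xi>|lborel. g \<xi> * exp (\<i> * complex_of_real (\<xi> \<bullet> x)))"
proof -
  have u: "square_integrable u" using ug by (simp add: is_fourier_L2_def)
  have [measurable]: "g \<in> borel_measurable borel" using g by auto
  let ?s = "\<lambda>m. inverse (real (Suc m))"
  have "(\<lambda>m. LINT \<xi>|lborel. g \<xi> * (exp (\<i> * complex_of_real (\<xi> \<bullet> x)) * gauss ((?s m)\<^sup>2 / 4) \<xi>)) \<longlonglongrightarrow>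
      (LINT \<xi>|lborel. g \<xi> * exp (\<i> * complex_of_real (\<xi> \<bullet> x)))"
  proof (rule integral_dominated_convergence[where w = "\<lambda>\<xi>. norm (g \<xi>)"])
    show "AE \<xi> in lborel. (\<lambda>m. g \<xi> * (exp (\<i> * complex_of_real (\<xi> \<bullet> x)) * gauss ((?s m)\<^sup>2 / 4) \<xi>)) \<longlonglongrightarrow>
        g \<xi> * exp (\<i> * complex_of_real (\<xi> \<bullet> x))"
    proof (rule AE_I2)
      fix \<xi>
      have "(\<lambda>m. g \<xi> * (exp (\<i> * complex_of_real (\<xi> \<bullet> x)) * gauss ((?s m)\<^sup>2 / 4) \<xi>)) \<longlonglongrightarrow>
          g \<xi> * (exp (\<i> * complex_of_real (\<xi> \<bullet> x)) * gauss (0\<^sup>2 / 4) \<xi>)"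
        by (intro tendsto_mult tendsto_const tendsto_of_real tendsto_exp tendsto_minus tendsto_divide
            tendsto_power LIMSEQ_inverse_real_of_nat) simp
      then show "(\<lambda>m. g \<xi> * (exp (\<i> * complex_of_real (\<xi> \<bullet> x)) * gauss ((?s m)\<^sup>2 / 4) \<xi>)) \<longlonglongrightarrow>
          g \<xi> * exp (\<i> * complex_of_real (\<xi> \<bullet> x))" by simp
    qed
    show "AE \<xi> in lborel. norm (g \<xi> * (exp (\<i> * complex_of_real (\<xi> \<bullet> x)) * gauss ((?s m)\<^sup>2 / 4) \<xi>)) \<le>
        norm (g \<xi>)" for m
      by (intro AE_I2) (auto simp: norm_mult intro!: mult_left_le)
  qed (use g in auto)
  moreover have "(LINT \<xi>|lborel. g \<xi> * (exp (\<i> * complex_of_real (\<xi> \<bullet> x)) * gauss ((?s m)\<^sup>2 / 4) \<xi>)) =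
      complex_of_real ((4 * pi) powr (real DIM('a) / 2) / ?s m ^ DIM('a)) * (LINT y|lborel. u y *
          complex_of_real (exp (- ((norm (x - y))\<^sup>2 / (?s m)\<^sup>2))))" for m
  proof -
    have "(pi / ((?s m)\<^sup>2 / 4)) powr (real DIM('a) / 2) = (4 * pi) powr (real DIM('a) / 2) / ((?s m)\<^sup>2) powr
        (real DIM('a) / 2)"
      by (simp add: powr_divide[symmetric] mult.commute)
    also have "((?s m)\<^sup>2) powr (real DIM('a) / 2) = ?s m ^ DIM('a)"
    proof -
      have p: "?s m > 0" by simp
      then have "(?s m)\<^sup>2 = ?s m powr 2" by (simp only: powr_numeral)
      then have "((?s m)\<^sup>2) powr (real DIM('a) / 2) = ?s m powr (real DIM('a))" by (simp only: powr_powr) simp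
      then show ?thesis using p by (simp only: powr_realpow)
    qed
    finally show ?thesis using is_fourier_L2_smoothing[OF ug, of "(?s m)\<^sup>2 / 4" x] by simp
  qed
  ultimately show ?thesis using LIMSEQ_unique[OF gaussian_approx_identity[OF u cont]] by simp
qed

section \<open>Positive definiteness and the reproducing property\<close>

text \<open>A transform that vanishes almost everywhere is integrable, so inversion applies and
  returns 0 at every point. This makes the inner product definite on continuous
  representatives.\<close>

lemma is_fourier_L2_continuous_zero:
  fixes u :: "'a::euclidean_space \<Rightarrow> complex"
  assumes "is_fourier_L2 u g" "AE \<xi> in lborel. g \<xi> = 0" "continuous_on UNIV u"
  shows "u = (\<lambda>_. 0)"
proof
  fix x
  have [measurable]: "g \<in> borel_measurable borel" using assms(1) by (simp add: is_fourier_L2_def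
      square_integrable_iff)
  have g: "integrable lborel g \<longleftrightarrow> integrable lborel (\<lambda>_::'a. 0 :: complex)"
    using assms(2) by (intro integrable_cong_AE) auto
  have "isCont u x" using assms(3) by (simp add: continuous_on_eq_continuous_at)
  then have "complex_of_real ((2 * pi) ^ DIM('a)) * u x = (LINT \<xi>|lborel. g \<xi> * exp (\<i> * complex_of_real
      (\<xi> \<bullet> x)))"
    using g by (intro fourier_inversion[OF assms(1)]) auto
  also have "\<dots> = (LINT \<xi>::'a|lborel. 0)"
    using assms(2) by (intro integral_cong_AE) (auto elim!: eventually_mono)
  finally show "u x = 0" by simp
qed

lemma continuous_fourier_L1_reflected:
  assumes "integrable lborel (g :: 'a::euclidean_space \<Rightarrow> complex)"
  shows "continuous_on UNIV (\<lambda>x. fourier_L1 g (- x))"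
  using continuous_on_compose2[OF continuous_fourier_L1[OF assms], of UNIV "\<lambda>x. - x"]
      by (simp add: continuous_on_minus)

lemma inverse_fourier_eq:
  "(LINT \<xi>|lborel. g \<xi> * exp (\<i> * complex_of_real (\<xi> \<bullet> x))) = fourier_L1 g (- x)"
  unfolding fourier_L1_def by (simp add: inner_commute mult.commute)

lemma norm2_sq_uminus:
  assumes [measurable]: "f \<in> borel_measurable borel"
  shows "norm2_sq (\<lambda>x::'a::euclidean_space. f (- x)) = norm2_sq f"
proof -
  have *: "lborel = distr lborel borel (\<lambda>x::'a. - x)" using lborel_affine[of "-1" "0::'a"]
      by (simp add: density_1)
  have "norm2_sq f = (\<integral>\<^sup>+x. ennreal ((norm (f x))\<^sup>2) \<partial>distr lborel borel (\<lambda>x::'a. - x))" unfolding norm2_sq_def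
      by (subst *) simp
  also have "\<dots> = norm2_sq (\<lambda>x. f (- x))" unfolding norm2_sq_def by (rule nn_integral_distr) measurable
  finally show ?thesis by simp
qed

text \<open>The constants \<open>a\<close> and \<open>\<gamma>\<close> are parameters because abbreviations for them would depend on \<open>'a\<close> only through
  \<open>DIM('a)\<close> and so acquire a type argument.\<close>

locale askey_setup =
  fixes \<alpha> a \<gamma> :: real and T :: "'a::euclidean_space itself"
  assumes a_eq: "a = (real DIM('a) + 1) / 2" and \<gamma>_eq: "\<gamma> = gamma_const DIM('a) \<alpha>"
    and \<alpha>2: "DIM('a) \<ge> 2 \<Longrightarrow> \<alpha> \<ge> (real DIM('a) + 1) / 2" and \<alpha>1: "DIM('a) = 1 \<Longrightarrow> \<alpha> \<ge> 2"
begin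

abbreviation A :: "'a \<Rightarrow> complex" where "A x \<equiv> complex_of_real (askey \<alpha> x)"
abbreviation \<Lambda> :: "'a \<Rightarrow> real" where "\<Lambda> \<xi> \<equiv> Lambda_fun DIM('a) \<alpha> (norm \<xi>)"
abbreviation W :: "'a \<Rightarrow> real" where "W \<xi> \<equiv> (1 + (norm \<xi>)\<^sup>2) powr (a / 2)"
abbreviation H :: "('a \<Rightarrow> complex) set" where "H \<equiv> sobolev_cont a"
abbreviation ip :: "('a \<Rightarrow> complex) \<Rightarrow> ('a \<Rightarrow> complex) \<Rightarrow> complex" where "ip \<equiv> askey_inner \<alpha>"

section \<open>The kernel, its transform and positive definiteness\<close>

lemma \<alpha>_ge: "\<alpha> \<ge> 1"
proof (cases "DIM('a) = 1")
  case False
  then have "DIM('a) \<ge> 2" using DIM_positive[where 'a='a] by linarith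
  then show ?thesis using \<alpha>2 by simp
qed (use \<alpha>1 in simp)

lemma W_pos: "W \<xi> > 0"
proof -
  have "1 + (norm \<xi>)\<^sup>2 > 0" by (rule add_pos_nonneg) auto
  then show ?thesis by simp
qed

lemma W_sq: "(W \<xi>)\<^sup>2 = (1 + (norm \<xi>)\<^sup>2) powr a"
  by (simp add: power2_eq_square powr_add[symmetric])

lemma \<gamma>_pos: "\<gamma> > 0"
  using \<alpha>_ge unfolding \<gamma>_eq gamma_const_def by (intro divide_pos_pos mult_pos_pos Gamma_real_pos)
      (auto simp: add_pos_nonneg)

lemma \<Lambda>_bounds:
  obtains c C where "c > 0" "C > 0" "\<And>\<xi>. c \<le> (W \<xi>)\<^sup>2 * \<Lambda> \<xi>" "\<And>\<xi>. (W \<xi>)\<^sup>2 * \<Lambda> \<xi> \<le> C"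
proof -
  obtain c C where c: "c > 0" and b: "\<And>r. r \<ge> 0 \<Longrightarrow> c * (1 + r\<^sup>2) powr (- a) \<le> Lambda_fun DIM('a) \<alpha> r"
    "\<And>r. r \<ge> 0 \<Longrightarrow> Lambda_fun DIM('a) \<alpha> r \<le> C * (1 + r\<^sup>2) powr (- a)"
    using Lambda_fun_two_sided[of "DIM('a)" \<alpha>] \<alpha>1 \<alpha>2 unfolding a_eq by (metis DIM_positive Suc_leI One_nat_def)
  have "c \<le> (W \<xi>)\<^sup>2 * \<Lambda> \<xi> \<and> (W \<xi>)\<^sup>2 * \<Lambda> \<xi> \<le> C" for \<xi>
  proof -
    have p: "(W \<xi>)\<^sup>2 > 0" using W_pos[of \<xi>] by (simp add: zero_less_power)
    have "(1 + (norm \<xi>)\<^sup>2) powr (- a) = 1 / (W \<xi>)\<^sup>2" unfolding W_sq by (rule powr_minus_divide)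
    then have "c * (1 / (W \<xi>)\<^sup>2) \<le> \<Lambda> \<xi>" "\<Lambda> \<xi> \<le> C * (1 / (W \<xi>)\<^sup>2)" using b[of "norm \<xi>"] by auto
    then show ?thesis using p by (simp add: divide_le_eq pos_le_divide_eq mult.commute)
  qed
  then have b': "c \<le> (W \<xi>)\<^sup>2 * \<Lambda> \<xi>" "(W \<xi>)\<^sup>2 * \<Lambda> \<xi> \<le> C" for \<xi> by auto
  then have "C > 0" using c by (metis less_le_trans)
  with c show thesis using b' by (rule that)
qed

lemma \<Lambda>_pos: "\<Lambda> \<xi> > 0"
proof -
  obtain c where "c > 0" "\<And>\<xi>. c \<le> (W \<xi>)\<^sup>2 * \<Lambda> \<xi>" using \<Lambda>_bounds by metis
  then have "0 < (W \<xi>)\<^sup>2 * \<Lambda> \<xi>" by (metis less_le_trans)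
  then show ?thesis by (simp add: zero_less_mult_iff)
qed

lemma A_integrable: "integrable lborel A"
  using askey_exp_integrable[of \<alpha> 0] \<alpha>_ge by (intro integrable_of_real) simp

lemma A_le_1: "0 \<le> askey \<alpha> x" "askey \<alpha> x \<le> 1"
  using \<alpha>_ge powr_mono2[of \<alpha> "max (1 - norm x) 0" 1] by (auto simp: askey_def)

lemma A_square_integrable: "square_integrable A"
proof -
  have "integrable lborel (\<lambda>x. (norm (A x))\<^sup>2)"
  proof (rule Bochner_Integration.integrable_bound[OF A_integrable])
    show "AE x in lborel. norm ((norm (A x))\<^sup>2) \<le> norm (A x)"
      by (intro AE_I2) (simp add: power2_eq_square mult_left_le A_le_1)
  qed simp
  then show ?thesis by (simp add: square_integrable_def)
qed

lemma A_continuous: "continuous_on UNIV (askey \<alpha> :: 'a \<Rightarrow> real)"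
  unfolding askey_def[abs_def] using \<alpha>_ge by (intro continuous_on_powr' continuous_intros) auto

lemma A_hat: "fourier A \<xi> = complex_of_real (\<gamma> * \<Lambda> \<xi>)"
  using fourier_L1_askey(1)[OF \<alpha>_ge] A_integrable by (simp add: fourier_def \<gamma>_eq)

lemma \<Lambda>_borel [measurable]: "\<Lambda> \<in> borel_measurable borel"
proof -
  have "fourier A \<in> borel_measurable borel" using square_integrable_fourier[OF A_square_integrable]
      by (simp add: square_integrable_iff)
  then have "(\<lambda>\<xi>. Re (fourier A \<xi>) / \<gamma>) \<in> borel_measurable borel" by measurable
  then show ?thesis using \<gamma>_pos by (simp add: A_hat)
qed

text \<open>The transform of the bounded function \<open>A\<close> is nonnegative, so Gaussian smoothing and monotone
  convergence show that it is integrable.\<close>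

lemma \<Lambda>_integrable: "integrable lborel \<Lambda>"
proof -
  let ?s = "\<lambda>m. inverse (real (Suc m))"
  have "(\<integral>\<^sup>+\<xi>. ennreal (\<gamma> * \<Lambda> \<xi>) \<partial>lborel) \<le> ennreal ((2 * pi) ^ DIM('a))"
  proof -
    have "(\<lambda>m. ennreal (\<gamma> * \<Lambda> \<xi> * exp (- ?s m * (norm \<xi>)\<^sup>2))) \<longlonglongrightarrow> ennreal (\<gamma> * \<Lambda> \<xi> * exp (- 0 * (norm \<xi>)\<^sup>2))"
        for \<xi>
      by (intro tendsto_ennrealI tendsto_intros LIMSEQ_inverse_real_of_nat)
    then have l: "ennreal (\<gamma> * \<Lambda> \<xi>) = liminf (\<lambda>m. ennreal (\<gamma> * \<Lambda> \<xi> * exp (- ?s m * (norm \<xi>)\<^sup>2)))" for \<xi>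
      by (intro lim_imp_Liminf[symmetric]) auto
    have "(\<integral>\<^sup>+\<xi>. ennreal (\<gamma> * \<Lambda> \<xi>) \<partial>lborel) \<le> liminf (\<lambda>m. \<integral>\<^sup>+\<xi>. ennreal (\<gamma> * \<Lambda> \<xi> * exp (- ?s m * (norm \<xi>)\<^sup>2))
        \<partial>lborel)"
      unfolding l by (rule nn_integral_liminf) measurable
    also have "\<dots> \<le> ennreal ((2 * pi) ^ DIM('a))"
    proof (rule Liminf_le[OF sequentially_bot always_eventually[OF allI]])
      fix m
      have e: "?s m > 0" by simp
      have i: "integrable lborel (\<lambda>\<xi>. \<gamma> * \<Lambda> \<xi> * exp (- ?s m * (norm \<xi>)\<^sup>2))"
      proof -
        have "integrable lborel (\<lambda>\<xi>. fourier A \<xi> * (exp (\<i> * complex_of_real (\<xi> \<bullet> 0)) * gauss (?s m) \<xi>))"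
          by (rule integrable_mult_square_integrable[OF square_integrable_fourier[OF A_square_integrable]
              square_integrable_modulated_gauss[OF e]])
        then have "integrable lborel (\<lambda>\<xi>. complex_of_real (\<gamma> * \<Lambda> \<xi> * exp (- ?s m * (norm \<xi>)\<^sup>2)))"
            by (simp add: A_hat)
        then have "integrable lborel (\<lambda>\<xi>. Re (complex_of_real (\<gamma> * \<Lambda> \<xi> * exp (- ?s m * (norm \<xi>)\<^sup>2))))"
            by (rule integrable_Re)
        then show ?thesis by (simp only: Re_complex_of_real)
      qed
      \<comment> \<open>Smoothing is evaluated at the point 0: up to the constant, the damped
        integral is A integrated against the Gaussian kernel, hence at most the mass of that kernel
        because A <= 1.\<close>
      have "complex_of_real (LINT \<xi>|lborel. \<gamma> * \<Lambda> \<xi> * exp (- ?s m * (norm \<xi>)\<^sup>2)) =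
        (LINT \<xi>|lborel. fourier_L1 A \<xi> * (exp (\<i> * complex_of_real (\<xi> \<bullet> 0)) * gauss (?s m) \<xi>))"
        using A_hat A_integrable by (simp add: fourier_def integral_complex_of_real[symmetric] del:
            integral_complex_of_real)
      also have "\<dots> = complex_of_real ((pi / ?s m) powr (real DIM('a) / 2)) * (LINT y|lborel. A y *
          complex_of_real (exp (- ((norm (0 - y))\<^sup>2 / (4 * ?s m)))))"
        by (rule fourier_L1_smoothing[OF A_integrable e])
      also have "\<dots> = complex_of_real ((pi / ?s m) powr (real DIM('a) / 2) * (LINT y|lborel. askey \<alpha> y * exp (-
          ((norm (0 - y :: 'a))\<^sup>2 / (4 * ?s m)))))"
        unfolding of_real_mult[symmetric] integral_complex_of_real ..
      finally have eq: "(LINT \<xi>|lborel. \<gamma> * \<Lambda> \<xi> * exp (- ?s m * (norm \<xi>)\<^sup>2)) =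
        (pi / ?s m) powr (real DIM('a) / 2) * (LINT y|lborel. askey \<alpha> y * exp (- ((norm (0 - y :: 'a))\<^sup>2 / (4 *
            ?s m))))"
        by (simp only: of_real_eq_iff)
      have K: "integrable lborel (\<lambda>y. exp (- ((norm (0 - y :: 'a))\<^sup>2 / (4 * ?s m))))"
        using gauss_kernel_nn_integral[OF e, of "0::'a"] by (intro integrableI_nonneg) auto
      have "(LINT y|lborel. askey \<alpha> y * exp (- ((norm (0 - y :: 'a))\<^sup>2 / (4 * ?s m)))) \<le>
          (LINT y|lborel. exp (- ((norm (0 - y :: 'a))\<^sup>2 / (4 * ?s m))))"
      proof (rule integral_mono[OF _ K])
        show "integrable lborel (\<lambda>y. askey \<alpha> y * exp (- ((norm (0 - y :: 'a))\<^sup>2 / (4 * ?s m))))"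
          by (rule Bochner_Integration.integrable_bound[OF K]) (auto simp: abs_mult A_le_1 intro!:
              mult_left_le_one_le)
      qed (auto simp: A_le_1 intro!: mult_left_le_one_le)
      also have "\<dots> = (4 * pi * ?s m) powr (real DIM('a) / 2)"
        by (rule integral_eq_nn_integral[THEN trans]) (use gauss_kernel_nn_integral[OF e, of "0::'a"] in auto)
      finally have "(pi / ?s m) powr (real DIM('a) / 2) * (LINT y|lborel. askey \<alpha> y * exp (- ((norm (0 -
          y :: 'a))\<^sup>2 / (4 * ?s m)))) \<le>
         (pi / ?s m) powr (real DIM('a) / 2) * (4 * pi * ?s m) powr (real DIM('a) / 2)"
             by (intro mult_left_mono) auto
      then have "(LINT \<xi>|lborel. \<gamma> * \<Lambda> \<xi> * exp (- ?s m * (norm \<xi>)\<^sup>2)) \<le> (2 * pi) ^ DIM('a)"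
        unfolding eq smoothing_constants[OF e] .
      then show "(\<integral>\<^sup>+\<xi>. ennreal (\<gamma> * \<Lambda> \<xi> * exp (- ?s m * (norm \<xi>)\<^sup>2)) \<partial>lborel) \<le> ennreal ((2 * pi) ^ DIM('a))"
        using nn_integral_eq_integral[OF i] \<gamma>_pos \<Lambda>_pos by (simp add: less_imp_le ennreal_leI)
    qed
    finally show ?thesis .
  qed
  then have "(\<integral>\<^sup>+\<xi>. ennreal (\<gamma> * \<Lambda> \<xi>) \<partial>lborel) < \<infinity>" by (rule le_less_trans) simp
  then have "integrable lborel (\<lambda>\<xi>. \<gamma> * \<Lambda> \<xi>)" using \<gamma>_pos \<Lambda>_pos by (intro integrableI_nonneg)
      (auto simp: less_imp_le)
  then show ?thesis using \<gamma>_pos by simp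
qed

lemma A_inversion: "complex_of_real ((2 * pi) ^ DIM('a)) * A x = (LINT \<xi>|lborel. complex_of_real (\<gamma> * \<Lambda> \<xi>) * exp
    (\<i> * complex_of_real (\<xi> \<bullet> x)))"
proof -
  have f: "fourier A = (\<lambda>\<xi>. complex_of_real (\<gamma> * \<Lambda> \<xi>))" using A_hat by (rule ext)
  have "isCont A x" using A_continuous by (intro isCont_of_real) (simp add: continuous_on_eq_continuous_at)
  then show ?thesis
    using fourier_inversion[OF is_fourier_L2_fourier[OF A_square_integrable], of x] \<Lambda>_integrable unfolding f
    by (simp del: of_real_mult)
qed

lemma exp_sum_integrable:
  assumes "integrable lborel (w :: 'a \<Rightarrow> real)"
  shows "integrable lborel (\<lambda>\<xi>. complex_of_real (w \<xi>) * exp (\<i> * complex_of_real (\<xi> \<bullet> x)))"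
  by (rule Bochner_Integration.integrable_bound[OF assms]) (use assms in \<open>auto simp: norm_mult\<close>)

text \<open>Expanding the squared modulus of the exponential sum gives the characters at x j - x k.
  The weight is general because it is used both with a multiple of \<Lambda> and with
  Gaussians.\<close>

lemma quadratic_form_integral:
  fixes x :: "nat \<Rightarrow> 'a" and z :: "nat \<Rightarrow> complex"
  assumes w: "integrable lborel (w :: 'a \<Rightarrow> real)"
  shows "(\<Sum>j<N. \<Sum>k<N. (LINT \<xi>|lborel. complex_of_real (w \<xi>) * exp (\<i> * complex_of_real (\<xi> \<bullet> (x j - x k)))) *
      z j * cnj (z k)) =
     complex_of_real (LINT \<xi>|lborel. w \<xi> * (norm (\<Sum>j<N. z j * exp (\<i> * complex_of_real (\<xi> \<bullet> x j))))\<^sup>2)"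
    and "integrable lborel (\<lambda>\<xi>. w \<xi> * (norm (\<Sum>j<N. z j * exp (\<i> * complex_of_real (\<xi> \<bullet> x j))))\<^sup>2)"
proof -
  let ?t = "\<lambda>j k \<xi>. complex_of_real (w \<xi>) * exp (\<i> * complex_of_real (\<xi> \<bullet> (x j - x k))) * z j * cnj (z k)"
  have i: "integrable lborel (?t j k)" for j k
    using exp_sum_integrable[OF w] by (intro integrable_mult_left)
  have eq: "complex_of_real (w \<xi> * (norm (\<Sum>j<N. z j * exp (\<i> * complex_of_real (\<xi> \<bullet> x j))))\<^sup>2) =
      (\<Sum>j<N. \<Sum>k<N. ?t j k \<xi>)" for \<xi>
  proof -
    have e: "exp (\<i> * complex_of_real (\<xi> \<bullet> x j)) * cnj (exp (\<i> * complex_of_real (\<xi> \<bullet> x k))) =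
        exp (\<i> * complex_of_real (\<xi> \<bullet> (x j - x k)))" for j k
      by (simp add: exp_cnj exp_add[symmetric] inner_diff_right algebra_simps)
    have "complex_of_real ((norm (\<Sum>j<N. z j * exp (\<i> * complex_of_real (\<xi> \<bullet> x j))))\<^sup>2) =
       (\<Sum>j<N. z j * exp (\<i> * complex_of_real (\<xi> \<bullet> x j))) * (\<Sum>k<N. cnj (z k) * cnj (exp (\<i> * complex_of_real
           (\<xi> \<bullet> x k))))"
      by (simp only: complex_norm_square cnj_sum complex_cnj_mult)
    also have "\<dots> = (\<Sum>j<N. \<Sum>k<N. (exp (\<i> * complex_of_real (\<xi> \<bullet> x j)) * cnj (exp (\<i> * complex_of_real
        (\<xi> \<bullet> x k)))) * (z j * cnj (z k)))"
      unfolding sum_product by (rule sum.cong[OF refl], rule sum.cong[OF refl]) (simp only: mult_ac)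
    finally show ?thesis unfolding e by (simp only: of_real_mult sum_distrib_left mult.assoc)
  qed
  have "(LINT \<xi>|lborel. (\<Sum>j<N. \<Sum>k<N. ?t j k \<xi>)) = (\<Sum>j<N. \<Sum>k<N. (LINT \<xi>|lborel. ?t j k \<xi>))"
    using i by (simp add: Bochner_Integration.integral_sum)
  also have "\<dots> = (\<Sum>j<N. \<Sum>k<N. (LINT \<xi>|lborel. complex_of_real (w \<xi>) * exp (\<i> * complex_of_real (\<xi> \<bullet> (x j -
      x k)))) * z j * cnj (z k))"
    by simp
  finally show "(\<Sum>j<N. \<Sum>k<N. (LINT \<xi>|lborel. complex_of_real (w \<xi>) * exp (\<i> * complex_of_real (\<xi> \<bullet> (x j -
      x k)))) * z j * cnj (z k)) =
     complex_of_real (LINT \<xi>|lborel. w \<xi> * (norm (\<Sum>j<N. z j * exp (\<i> * complex_of_real (\<xi> \<bullet> x j))))\<^sup>2)"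
    unfolding eq[symmetric] by (simp only: integral_complex_of_real)
  have "integrable lborel (\<lambda>\<xi>. complex_of_real (w \<xi> * (norm (\<Sum>j<N. z j * exp (\<i> * complex_of_real
      (\<xi> \<bullet> x j))))\<^sup>2))"
    unfolding eq using i by (intro Bochner_Integration.integrable_sum)
  from integrable_Re[OF this] show "integrable lborel (\<lambda>\<xi>. w \<xi> * (norm (\<Sum>j<N. z j * exp (\<i> * complex_of_real
      (\<xi> \<bullet> x j))))\<^sup>2)"
    by (simp only: Re_complex_of_real)
qed

text \<open>Independence of characters: if the exponential sum vanishes almost everywhere, its mean square
  against ever wider Gaussians is zero, and that mean square tends to the sum of the
  squared coefficients.\<close>

lemma exp_sum_zero_imp_coeffs_zero:
  fixes x :: "nat \<Rightarrow> 'a" and z :: "nat \<Rightarrow> complex"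
  assumes inj: "inj_on x {..<N}" and zero: "AE \<xi> in lborel. (\<Sum>j<N. z j * exp (\<i> * complex_of_real (\<xi> \<bullet> x j))) =
      0"
    and j: "j < N"
  shows "z j = 0"
proof -
  let ?e = "\<lambda>m. inverse (real (Suc m))"
  have q: "(\<Sum>j<N. \<Sum>k<N. complex_of_real (exp (- ((norm (x j - x k))\<^sup>2 / (4 * ?e m)))) * (z j * cnj (z k))) = 0"
      for m
  proof -
    have e: "?e m > 0" by simp
    note Q = quadratic_form_integral(1)[OF gaussian_integrable[OF e], of x z N]
    have "(LINT \<xi>|lborel. exp (- ?e m * (norm \<xi>)\<^sup>2) * (norm (\<Sum>j<N. z j * exp (\<i> * complex_of_real
        (\<xi> \<bullet> x j))))\<^sup>2) = (LINT \<xi>::'a|lborel. 0)"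
      using zero by (intro integral_cong_AE) (auto elim!: eventually_mono)
    moreover have G: "(LINT \<xi>|lborel. complex_of_real (exp (- ?e m * (norm \<xi>)\<^sup>2)) * exp (\<i> * complex_of_real
        (\<xi> \<bullet> y))) =
      complex_of_real ((pi / ?e m) powr (real DIM('a) / 2)) * complex_of_real (exp (- ((norm y)\<^sup>2 / (4 *
          ?e m))))" for y :: 'a
      using gaussian_fourier(2)[OF e, of y] by (simp only: inner_commute of_real_mult)
    ultimately have "(\<Sum>j<N. \<Sum>k<N. complex_of_real ((pi / ?e m) powr (real DIM('a) / 2)) * complex_of_real (exp
        (- ((norm (x j - x k))\<^sup>2 / (4 * ?e m)))) * z j * cnj (z k)) = 0"
      using Q unfolding G by simp
    then have "complex_of_real ((pi / ?e m) powr (real DIM('a) / 2)) * (\<Sum>j<N. \<Sum>k<N. complex_of_real (exp (-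
        ((norm (x j - x k))\<^sup>2 / (4 * ?e m)))) * (z j * cnj (z k))) = 0"
      by (simp only: sum_distrib_left mult.assoc)
    moreover have "complex_of_real ((pi / ?e m) powr (real DIM('a) / 2)) \<noteq> 0" by simp
    ultimately show ?thesis by (simp only: mult_eq_0_iff simp_thms)
  qed
  \<comment> \<open>As the frequency Gaussians widen, their transforms concentrate at 0; the points
    being distinct, the matrix of values at x j - x k tends to the identity.\<close>
  have "(\<lambda>m. \<Sum>j<N. \<Sum>k<N. complex_of_real (exp (- ((norm (x j - x k))\<^sup>2 / (4 * ?e m)))) * (z j * cnj (z k))) \<longlonglongrightarrow>
     (\<Sum>j<N. \<Sum>k<N. complex_of_real (if j = k then 1 else 0) * (z j * cnj (z k)))"
  proof (intro tendsto_sum tendsto_mult tendsto_const tendsto_of_real)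
    fix j k assume jk: "j \<in> {..<N}" "k \<in> {..<N}"
    have lim: "(\<lambda>m. exp (- (d / (4 * ?e m)))) \<longlonglongrightarrow> 0" if "d > 0" for d :: real
      using that by real_asymp
    show "(\<lambda>m. exp (- ((norm (x j - x k))\<^sup>2 / (4 * ?e m)))) \<longlonglongrightarrow> (if j = k then 1 else 0)"
    proof (cases "j = k")
      case False
      then have "(norm (x j - x k))\<^sup>2 > 0" using inj jk by (auto simp: inj_on_def)
      from lim[OF this] False show ?thesis by simp
    qed simp
  qed
  then have "(\<Sum>j<N. \<Sum>k<N. complex_of_real (if j = k then 1 else 0) * (z j * cnj (z k))) = 0"
    unfolding q by (simp add: LIMSEQ_const_iff)
  also have "(\<Sum>j<N. \<Sum>k<N. complex_of_real (if j = k then 1 else 0) * (z j * cnj (z k))) =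
      (\<Sum>j<N. complex_of_real ((norm (z j))\<^sup>2))"
  proof (intro sum.cong refl)
    fix j assume "j \<in> {..<N}"
    moreover have "z j * cnj (z j) = complex_of_real ((norm (z j))\<^sup>2)" by (simp only: complex_norm_square)
    ultimately show "(\<Sum>k<N. complex_of_real (if j = k then 1 else 0) * (z j * cnj (z k))) =
        complex_of_real ((norm (z j))\<^sup>2)"
      using sum.delta[of "{..<N}" j "\<lambda>k. z j * cnj (z k)"] by (simp add: if_distrib[of complex_of_real]
          if_distrib[of "\<lambda>c. c * _"] cong: if_cong)
  qed
  finally have "complex_of_real (\<Sum>j<N. (norm (z j))\<^sup>2) = 0" by simp
  then have "(\<Sum>j<N. (norm (z j))\<^sup>2) = 0" by (simp only: of_real_eq_0_iff)
  then show ?thesis using j by (simp add: sum_nonneg_eq_0_iff)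
qed

text \<open>The form is an integral against a density that is positive everywhere. If it is 0, the
  exponential sum vanishes almost everywhere, and independence of characters finishes the
  argument.\<close>

lemma A_positive_definite: "positive_definite A"
  unfolding positive_definite_def
proof (intro allI impI)
  fix N :: nat and x :: "nat \<Rightarrow> 'a" and z :: "nat \<Rightarrow> complex"
  assume inj: "inj_on x {..<N}"
  let ?P = "(2 * pi) ^ DIM('a)"
  let ?S = "\<lambda>\<xi>. \<Sum>j<N. z j * exp (\<i> * complex_of_real (\<xi> \<bullet> x j))"
  have wi: "integrable lborel (\<lambda>\<xi>. \<gamma> * \<Lambda> \<xi> / ?P)" using \<Lambda>_integrable by simp
  have "A y = (LINT \<xi>|lborel. complex_of_real (\<gamma> * \<Lambda> \<xi> / ?P) * exp (\<i> * complex_of_real (\<xi> \<bullet> y)))" for y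
  proof -
    have "(LINT \<xi>|lborel. complex_of_real (\<gamma> * \<Lambda> \<xi> / ?P) * exp (\<i> * complex_of_real (\<xi> \<bullet> y))) =
      (LINT \<xi>|lborel. complex_of_real (\<gamma> * \<Lambda> \<xi>) * exp (\<i> * complex_of_real (\<xi> \<bullet> y)) / complex_of_real ?P)"
          by simp
    also have "\<dots> = complex_of_real ?P * A y / complex_of_real ?P"
      unfolding A_inversion by (rule integral_divide_zero)
    finally show ?thesis by simp
  qed
  then have Q: "(\<Sum>j<N. \<Sum>k<N. A (x j - x k) * z j * cnj (z k)) = complex_of_real (LINT \<xi>|lborel. \<gamma> * \<Lambda> \<xi> / ?P *
      (norm (?S \<xi>))\<^sup>2)"
    using quadratic_form_integral(1)[OF wi, of x z N] by (simp only:)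
  have nn: "\<gamma> * \<Lambda> \<xi> / ?P > 0" for \<xi> using \<gamma>_pos \<Lambda>_pos by simp
  show "(\<Sum>j<N. \<Sum>k<N. A (x j - x k) * z j * cnj (z k)) \<in> \<real>\<^sub>\<ge>\<^sub>0 \<and>
    ((\<Sum>j<N. \<Sum>k<N. A (x j - x k) * z j * cnj (z k)) = 0 \<longrightarrow> (\<forall>j<N. z j = 0))"
    unfolding Q
  proof (intro conjI impI allI)
    have "(LINT \<xi>|lborel. \<gamma> * \<Lambda> \<xi> / ?P * (norm (?S \<xi>))\<^sup>2) \<ge> 0"
      using less_imp_le[OF nn] by (intro Bochner_Integration.integral_nonneg mult_nonneg_nonneg) auto
    then show "complex_of_real (LINT \<xi>|lborel. \<gamma> * \<Lambda> \<xi> / ?P * (norm (?S \<xi>))\<^sup>2) \<in> \<real>\<^sub>\<ge>\<^sub>0"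
      by (simp only: nonneg_Reals_of_real_iff)
    fix j assume "complex_of_real (LINT \<xi>|lborel. \<gamma> * \<Lambda> \<xi> / ?P * (norm (?S \<xi>))\<^sup>2) = 0" and j: "j < N"
    then have int0: "(LINT \<xi>|lborel. \<gamma> * \<Lambda> \<xi> / ?P * (norm (?S \<xi>))\<^sup>2) = 0" by (simp only: of_real_eq_0_iff)
    have nnS: "0 \<le> \<gamma> * \<Lambda> \<xi> / ?P * (norm (?S \<xi>))\<^sup>2" for \<xi>
      by (intro mult_nonneg_nonneg less_imp_le[OF nn]) simp
    from int0 have "AE \<xi> in lborel. \<gamma> * \<Lambda> \<xi> / ?P * (norm (?S \<xi>))\<^sup>2 = 0"
      by (rule iffD1[OF integral_nonneg_eq_0_iff_AE[OF quadratic_form_integral(2)[OF wi]], rotated])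
          (intro AE_I2 nnS)
    then have "AE \<xi> in lborel. ?S \<xi> = 0"
    proof eventually_elim
      case (elim \<xi>)
      have "\<gamma> * \<Lambda> \<xi> / ?P \<noteq> 0" using nn[of \<xi>] by (rule less_imp_neq[symmetric])
      then show ?case using elim by (simp only: mult_eq_0_iff power_eq_0_iff norm_eq_zero simp_thms)
    qed
    from exp_sum_zero_imp_coeffs_zero[OF inj this j] show "z j = 0" .
  qed
qed

end

section \<open>The Hilbert space and its reproducing kernel\<close>

lemma square_integrable_cong_AE:
  assumes "square_integrable f" "g \<in> borel_measurable borel" "AE x in lborel. f x = g x"
  shows "square_integrable g"
proof -
  have "norm2_sq f = norm2_sq g" unfolding norm2_sq_def using assms(3)
      by (intro nn_integral_cong_AE) (auto elim!: eventually_mono)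
  then show ?thesis using assms by (simp add: square_integrable_iff)
qed

lemma borel_measurable_cnj [measurable]:
  "f \<in> borel_measurable M \<Longrightarrow> (\<lambda>x. cnj (f x)) \<in> borel_measurable M"
  by (rule borel_measurable_continuous_on[OF continuous_on_cnj[OF continuous_on_id]])

lemma square_integrable_cnj: "square_integrable f \<Longrightarrow> square_integrable (\<lambda>x. cnj (f x))"
  by (auto simp: square_integrable_def)

context askey_setup begin

text \<open>Multiplication by \<open>R\<close> turns the inner product into that of \<open>L\<^sup>2\<close>,
    and \<open>R\<close> is comparable to the Sobolev weight \<open>W\<close>.\<close>

definition R :: "'a \<Rightarrow> real" where "R \<xi> = 1 / sqrt (\<Lambda> \<xi>)"
definition F :: "('a \<Rightarrow> complex) \<Rightarrow> 'a \<Rightarrow> complex" where "F u \<xi> = complex_of_real (R \<xi>) * fourier u \<xi>"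
definition \<kappa> :: real where "\<kappa> = 1 / (2 * pi) ^ DIM('a) * (1 / \<gamma>)"

lemma R_pos: "R \<xi> > 0"
  using \<Lambda>_pos by (simp add: R_def)

lemma R_sq: "R \<xi> * R \<xi> = 1 / \<Lambda> \<xi>"
  using \<Lambda>_pos[of \<xi>] by (simp add: R_def)

lemma R_borel [measurable]: "R \<in> borel_measurable borel"
  unfolding R_def[abs_def] by measurable

lemma \<kappa>_pos: "\<kappa> > 0"
  using \<gamma>_pos by (simp add: \<kappa>_def)

text \<open>The two-sided bound on W^2 * \<Lambda> is a two-sided bound on (W / R)^2. As W >= 1, R
  is also bounded away from 0, so that \<open>F u\<close> controls the transform itself in
  L^2.\<close>

lemma R_bounds:
  obtains k where "k > 0" "\<And>\<xi>. R \<xi> \<le> k * W \<xi>" "\<And>\<xi>. W \<xi> \<le> k * R \<xi>" "\<And>\<xi>. 1 \<le> k * R \<xi>"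
proof -
  obtain c C where cC: "c > 0" "C > 0" "\<And>\<xi>. c \<le> (W \<xi>)\<^sup>2 * \<Lambda> \<xi>" "\<And>\<xi>. (W \<xi>)\<^sup>2 * \<Lambda> \<xi> \<le> C" using \<Lambda>_bounds by blast
  let ?k = "max (1 / sqrt c) (sqrt C)"
  have s: "sqrt ((W \<xi>)\<^sup>2 * \<Lambda> \<xi>) = W \<xi> / R \<xi>" for \<xi>
    using W_pos[of \<xi>] by (simp add: real_sqrt_mult R_def)
  have 1: "R \<xi> \<le> ?k * W \<xi>" for \<xi>
  proof -
    have "sqrt c \<le> W \<xi> / R \<xi>" using cC(3)[of \<xi>] s by (metis real_sqrt_le_iff)
    then have "R \<xi> \<le> 1 / sqrt c * W \<xi>" using R_pos[of \<xi>] cC(1) by (simp add: field_simps)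
    also have "\<dots> \<le> ?k * W \<xi>" using W_pos[of \<xi>] by (intro mult_right_mono) auto
    finally show ?thesis .
  qed
  have 2: "W \<xi> \<le> ?k * R \<xi>" for \<xi>
  proof -
    have "W \<xi> / R \<xi> \<le> sqrt C" using cC(4)[of \<xi>] s by (metis real_sqrt_le_iff)
    then have "W \<xi> \<le> sqrt C * R \<xi>" using R_pos[of \<xi>] by (simp add: divide_le_eq)
    also have "\<dots> \<le> ?k * R \<xi>" using R_pos[of \<xi>] by (intro mult_right_mono) auto
    finally show ?thesis .
  qed
  have "1 \<le> W \<xi>" for \<xi> unfolding a_eq by (intro ge_one_powr_ge_zero) auto
  then have 3: "1 \<le> ?k * R \<xi>" for \<xi> using 2 order_trans by blast
  have "?k > 0" using cC by (simp add: less_max_iff_disj)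
  then show thesis using 1 2 3 by (rule that)
qed

lemma weight_exchange:
  assumes f: "square_integrable (\<lambda>\<xi>. complex_of_real (w \<xi>) * f \<xi>)" and
      m: "(\<lambda>\<xi>. complex_of_real (v \<xi>) * f \<xi>) \<in> borel_measurable borel"
    and b: "\<And>\<xi>. 0 \<le> v \<xi>" "\<And>\<xi>. v \<xi> \<le> k * w \<xi>"
  shows "square_integrable (\<lambda>\<xi>. complex_of_real (v \<xi>) * f \<xi>)"
proof (rule square_integrable_mono[OF square_integrable_cmult[OF f, of "complex_of_real k"] m])
  fix \<xi>
  have "\<bar>v \<xi>\<bar> \<le> \<bar>k\<bar> * \<bar>w \<xi>\<bar>" using b[of \<xi>] abs_ge_self[of "k * w \<xi>"] by (simp add: abs_mult)
  then have "\<bar>v \<xi>\<bar> * norm (f \<xi>) \<le> \<bar>k\<bar> * \<bar>w \<xi>\<bar> * norm (f \<xi>)" by (rule mult_right_mono) simp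
  then show "norm (complex_of_real (v \<xi>) * f \<xi>) \<le> norm (complex_of_real k * (complex_of_real (w \<xi>) * f \<xi>))"
    by (simp only: norm_mult norm_of_real mult.assoc)
qed

lemma fourier_borel: "square_integrable u \<Longrightarrow> fourier u \<in> borel_measurable borel"
  by (rule square_integrableD[OF square_integrable_fourier])

lemma F_borel: "square_integrable u \<Longrightarrow> F u \<in> borel_measurable borel"
  unfolding F_def[abs_def] using fourier_borel by measurable

lemma H_iff: "u \<in> H \<longleftrightarrow> square_integrable u \<and> square_integrable (F u) \<and> continuous_on UNIV u"
proof -
  obtain k where k: "\<And>\<xi>. R \<xi> \<le> k * W \<xi>" "\<And>\<xi>. W \<xi> \<le> k * R \<xi>" using R_bounds by metis
  have "square_integrable (\<lambda>\<xi>. complex_of_real (W \<xi>) * fourier u \<xi>) \<longleftrightarrow> square_integrable (\<lambda>\<xi>. complex_of_real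
      (R \<xi>) * fourier u \<xi>)"
    if u: "square_integrable u"
  proof
    note fourier_borel[OF u, measurable]
    show "square_integrable (\<lambda>\<xi>. complex_of_real (R \<xi>) * fourier u \<xi>)"
        if "square_integrable (\<lambda>\<xi>. complex_of_real (W \<xi>) * fourier u \<xi>)"
      by (rule weight_exchange[OF that _ less_imp_le[OF R_pos] k(1)]) measurable
    show "square_integrable (\<lambda>\<xi>. complex_of_real (W \<xi>) * fourier u \<xi>)"
        if "square_integrable (\<lambda>\<xi>. complex_of_real (R \<xi>) * fourier u \<xi>)"
      by (rule weight_exchange[OF that _ less_imp_le[OF W_pos] k(2)]) measurable
  qed
  then show ?thesis unfolding sobolev_cont_def sobolev_def F_def[abs_def] by auto
qed

lemma HD:
  assumes "u \<in> H"
  shows "square_integrable u" "square_integrable (F u)" "continuous_on UNIV u"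
  using assms by (auto simp: H_iff)

text \<open>1 / R is the square root of the integrable function \<Lambda>. Its product with
  \<open>F u\<close> is then integrable, so every element of H has its transform in L^1 and
  pointwise inversion is available.\<close>

lemma root_\<Lambda>_square_integrable: "square_integrable (\<lambda>\<xi>. complex_of_real (1 / R \<xi>))"
  unfolding square_integrable_def
proof
  have "(norm (complex_of_real (1 / R \<xi>)))\<^sup>2 = \<Lambda> \<xi>" for \<xi>
    unfolding norm_of_real power2_abs using \<Lambda>_pos[of \<xi>] by (simp add: R_def)
  then show "integrable lborel (\<lambda>\<xi>. (norm (complex_of_real (1 / R \<xi>)))\<^sup>2)" using \<Lambda>_integrable by simp
qed measurable

lemma fourier_eq_F: "fourier u \<xi> = F u \<xi> * complex_of_real (1 / R \<xi>)"
  using R_pos[of \<xi>] by (simp add: F_def)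

lemma fourier_integrable: "u \<in> H \<Longrightarrow> integrable lborel (fourier u)"
  unfolding fourier_eq_F[abs_def] by (intro integrable_mult_square_integrable HD root_\<Lambda>_square_integrable)

lemma inversion:
  assumes "u \<in> H"
  shows "complex_of_real ((2 * pi) ^ DIM('a)) * u x = (LINT \<xi>|lborel. fourier u \<xi> * exp (\<i> * complex_of_real
      (\<xi> \<bullet> x)))"
  using HD[OF assms] by (intro fourier_inversion is_fourier_L2_fourier fourier_integrable assms)
    (simp_all add: continuous_on_eq_continuous_at)

lemma F_lincomb_AE:
  assumes "square_integrable u" "square_integrable v"
  shows "AE \<xi> in lborel. F (\<lambda>x. u x + c * v x) \<xi> = F u \<xi> + c * F v \<xi>"
  using fourier_lincomb_AE[OF assms, of c] by eventually_elim (simp add: F_def algebra_simps)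

lemma lincomb_in_H:
  assumes u: "u \<in> H" and v: "v \<in> H"
  shows "(\<lambda>x. u x + c * v x) \<in> H"
proof -
  have s: "square_integrable (\<lambda>x. u x + c * v x)" using u v by (intro square_integrable_add
      square_integrable_cmult HD)
  have "square_integrable (F (\<lambda>x. u x + c * v x))"
  proof (rule square_integrable_cong_AE)
    show "square_integrable (\<lambda>\<xi>. F u \<xi> + c * F v \<xi>)" using u v by (intro square_integrable_add
        square_integrable_cmult HD)
    show "AE \<xi> in lborel. F u \<xi> + c * F v \<xi> = F (\<lambda>x. u x + c * v x) \<xi>"
      using F_lincomb_AE[OF HD(1)[OF u] HD(1)[OF v], of c] by eventually_elim simp
  qed (rule F_borel[OF s])
  moreover have "continuous_on UNIV (\<lambda>x. u x + c * v x)" using u v by (intro continuous_intros HD)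
  ultimately show ?thesis using s by (simp add: H_iff)
qed

lemma F_zero: "F (\<lambda>_. 0) = (\<lambda>_. 0)"
  by (simp add: F_def[abs_def] fourier_def fourier_L1_def)

lemma zero_in_H: "(\<lambda>_. 0) \<in> H"
  by (simp add: H_iff F_zero square_integrable_def)

lemma ip_eq: "ip u v = complex_of_real \<kappa> * (LINT \<xi>|lborel. F u \<xi> * cnj (F v \<xi>))"
proof -
  have "F u \<xi> * cnj (F v \<xi>) = fourier u \<xi> * cnj (fourier v \<xi>) / complex_of_real (\<Lambda> \<xi>)" for \<xi>
  proof -
    have "F u \<xi> * cnj (F v \<xi>) = fourier u \<xi> * cnj (fourier v \<xi>) * complex_of_real (R \<xi> * R \<xi>)"
      unfolding F_def complex_cnj_mult complex_cnj_complex_of_real of_real_mult by (simp only: mult_ac)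
    then show ?thesis unfolding R_sq by simp
  qed
  then show ?thesis by (simp add: askey_inner_def \<kappa>_def \<gamma>_eq[symmetric])
qed

lemma ip_integrable: "u \<in> H \<Longrightarrow> v \<in> H \<Longrightarrow> integrable lborel (\<lambda>\<xi>. F u \<xi> * cnj (F v \<xi>))"
  by (intro integrable_mult_square_integrable square_integrable_cnj HD)

lemma ip_lincomb:
  assumes u: "u \<in> H" and v: "v \<in> H" and w: "w \<in> H"
  shows "ip (\<lambda>x. u x + c * v x) w = ip u w + c * ip v w"
proof -
  note [measurable] = F_borel[OF HD(1)[OF u]] F_borel[OF HD(1)[OF v]] F_borel[OF HD(1)[OF w]] F_borel[OF
      HD(1)[OF lincomb_in_H[OF u v, of c]]]
  have "(LINT \<xi>|lborel. F (\<lambda>x. u x + c * v x) \<xi> * cnj (F w \<xi>)) = (LINT \<xi>|lborel. F u \<xi> * cnj (F w \<xi>) + c *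
      (F v \<xi> * cnj (F w \<xi>)))"
    using F_lincomb_AE[OF HD(1)[OF u] HD(1)[OF v], of c]
    by (intro integral_cong_AE) (measurable, auto elim!: eventually_mono simp: algebra_simps)
  also have "\<dots> = (LINT \<xi>|lborel. F u \<xi> * cnj (F w \<xi>)) + c * (LINT \<xi>|lborel. F v \<xi> * cnj (F w \<xi>))"
    using Bochner_Integration.integral_add[OF ip_integrable[OF u w] integrable_mult_right[OF ip_integrable[OF v
        w], of c]] by simp
  finally show ?thesis unfolding ip_eq by (simp add: distrib_left mult.left_commute)
qed

lemma ip_zero: "ip (\<lambda>_. 0) w = 0"
  by (simp add: ip_eq F_zero)

lemma ip_self: "ip u u = complex_of_real (\<kappa> * (LINT \<xi>|lborel. (norm (F u \<xi>))\<^sup>2))"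
  unfolding ip_eq complex_norm_square[symmetric] integral_complex_of_real by simp

lemma inner_product_H: "inner_product_on H ip"
  unfolding inner_product_on_def
proof (intro conjI ballI allI impI)
  fix u v w :: "'a \<Rightarrow> complex" and c :: complex
  assume u: "u \<in> H"
  show "(\<lambda>x. c * u x) \<in> H" using lincomb_in_H[OF zero_in_H u, of c] by simp
  show "ip u u \<in> \<real>\<^sub>\<ge>\<^sub>0"
    unfolding ip_self nonneg_Reals_of_real_iff using \<kappa>_pos by (intro mult_nonneg_nonneg
        Bochner_Integration.integral_nonneg) auto
  show "u = (\<lambda>_. 0)" if "ip u u = 0"
  proof (rule is_fourier_L2_continuous_zero[OF is_fourier_L2_fourier[OF HD(1)[OF u]] _ HD(3)[OF u]])
    have "(LINT \<xi>|lborel. (norm (F u \<xi>))\<^sup>2) = 0" using that \<kappa>_pos unfolding ip_self of_real_eq_0_iff by simp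
    then have "AE \<xi> in lborel. (norm (F u \<xi>))\<^sup>2 = 0"
      using HD(2)[OF u] by (subst (asm) integral_nonneg_eq_0_iff_AE) (auto simp: square_integrable_def)
    then show "AE \<xi> in lborel. fourier u \<xi> = 0" by eventually_elim (simp add: fourier_eq_F)
  qed
  assume v: "v \<in> H"
  show "(\<lambda>x. u x + v x) \<in> H" using lincomb_in_H[OF u v, of 1] by simp
  show "ip (\<lambda>x. c * u x) v = c * ip u v" using ip_lincomb[OF zero_in_H u v, of c] by (simp add: ip_zero)
  show "ip v u = cnj (ip u v)"
    unfolding ip_eq complex_cnj_mult Bochner_Integration.integral_cnj[symmetric] by (simp add: mult.commute)
  assume w: "w \<in> H"
  show "ip (\<lambda>x. u x + v x) w = ip u w + ip v w" using ip_lincomb[OF u v w, of 1] by simp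
qed (rule zero_in_H)

text \<open>\<open>F\<close> is an isometry into L^2 up to the factor \<kappa>. It is linear only
  almost everywhere, which is enough under the integral.\<close>

lemma norm2_sq_F_diff:
  assumes u: "u \<in> H" and v: "v \<in> H"
  shows "norm2_sq (\<lambda>\<xi>. F u \<xi> - F v \<xi>) = ennreal ((ip_dist ip u v)\<^sup>2 / \<kappa>)"
proof -
  let ?d = "\<lambda>x. u x - v x"
  have d: "?d \<in> H" using lincomb_in_H[OF u v, of "-1"] by simp
  have "(ip_dist ip u v)\<^sup>2 = \<kappa> * (LINT \<xi>|lborel. (norm (F ?d \<xi>))\<^sup>2)"
    unfolding ip_dist_def ip_self Re_complex_of_real
    using \<kappa>_pos by (intro real_sqrt_pow2 mult_nonneg_nonneg Bochner_Integration.integral_nonneg) auto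
  then have "(ip_dist ip u v)\<^sup>2 / \<kappa> = (LINT \<xi>|lborel. (norm (F ?d \<xi>))\<^sup>2)" using \<kappa>_pos by simp
  moreover have "norm2_sq (F ?d) = ennreal (LINT \<xi>|lborel. (norm (F ?d \<xi>))\<^sup>2)"
    unfolding norm2_sq_def using HD(2)[OF d] by (intro nn_integral_eq_integral)
        (auto simp: square_integrable_def)
  moreover have "norm2_sq (F ?d) = norm2_sq (\<lambda>\<xi>. F u \<xi> - F v \<xi>)"
    unfolding norm2_sq_def using F_lincomb_AE[OF HD(1)[OF u] HD(1)[OF v], of "-1"]
    by (intro nn_integral_cong_AE) (auto elim!: eventually_mono)
  ultimately show ?thesis by simp
qed

text \<open>The L^2 limit G of the images must itself be shown to be an image. Division by R puts g
  in both L^1 and L^2, and its inverse transform is the candidate u.\<close>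

lemma H_complete:
  assumes U: "\<And>n. U n \<in> H" and Cauchy: "\<And>\<epsilon>. \<epsilon> > 0 \<Longrightarrow> \<exists>M. \<forall>m\<ge>M. \<forall>n\<ge>M. ip_dist ip (U m) (U n) < \<epsilon>"
  shows "\<exists>u\<in>H. (\<lambda>n. ip_dist ip (U n) u) \<longlonglongrightarrow> 0"
proof -
  let ?P = "(2 * pi) ^ DIM('a)"
  have dist_nn: "0 \<le> ip_dist ip u v" for u v
    unfolding ip_dist_def ip_self Re_complex_of_real
    using \<kappa>_pos by (intro real_sqrt_ge_zero mult_nonneg_nonneg Bochner_Integration.integral_nonneg) auto
  have "\<exists>N. \<forall>m\<ge>N. \<forall>n\<ge>N. norm2_sq (\<lambda>\<xi>. F (U m) \<xi> - F (U n) \<xi>) < ennreal e" if e: "e > 0" for e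
  proof -
    have "sqrt (\<kappa> * e) > 0" using e \<kappa>_pos by simp
    from Cauchy[OF this] obtain M where M: "\<And>m n. m \<ge> M \<Longrightarrow> n \<ge> M \<Longrightarrow> ip_dist ip (U m) (U n) < sqrt (\<kappa> * e)"
        by blast
    have "norm2_sq (\<lambda>\<xi>. F (U m) \<xi> - F (U n) \<xi>) < ennreal e" if "m \<ge> M" "n \<ge> M" for m n
    proof -
      have "(ip_dist ip (U m) (U n))\<^sup>2 < (sqrt (\<kappa> * e))\<^sup>2" using M[OF that] dist_nn
          by (intro power_strict_mono) auto
      then have "(ip_dist ip (U m) (U n))\<^sup>2 / \<kappa> < e" using \<kappa>_pos e by (simp add: divide_less_eq mult.commute)
      then show ?thesis unfolding norm2_sq_F_diff[OF U U] using e by (intro ennreal_lessI)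
    qed
    then show ?thesis by blast
  qed
  from norm2_sq_complete[OF HD(2)[OF U] this] obtain G where G: "square_integrable G"
    and limG: "(\<lambda>n. norm2_sq (\<lambda>\<xi>. F (U n) \<xi> - G \<xi>)) \<longlonglongrightarrow> 0" .
  have [measurable]: "G \<in> borel_measurable borel" using G by (rule square_integrableD)
  note FU [measurable] = F_borel[OF HD(1)[OF U]] and fU [measurable] = fourier_borel[OF HD(1)[OF U]]
  define g where "g = (\<lambda>\<xi>. G \<xi> * complex_of_real (1 / R \<xi>))"
  have [measurable]: "g \<in> borel_measurable borel" unfolding g_def by measurable
  obtain k where k: "k > 0" "\<And>\<xi>. 1 \<le> k * R \<xi>" using R_bounds by metis
  have root: "norm (z * complex_of_real (1 / R \<xi>)) \<le> norm (complex_of_real k * z)" for z \<xi>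
  proof -
    have "1 / R \<xi> \<le> k" using k(2)[of \<xi>] R_pos[of \<xi>] by (simp add: divide_le_eq)
    then have "1 / R \<xi> * norm z \<le> k * norm z" by (rule mult_right_mono) simp
    then show ?thesis using k(1) R_pos[of \<xi>] by (simp add: norm_mult mult.commute norm_divide)
  qed
  have g_int: "integrable lborel g" unfolding g_def by (intro integrable_mult_square_integrable G
      root_\<Lambda>_square_integrable)
  have g_sq: "square_integrable g"
    by (rule square_integrable_mono[OF square_integrable_cmult[OF G, of "complex_of_real k"]])
        (use root in \<open>auto simp: g_def\<close>)
  have lim_g: "(\<lambda>n. norm2_sq (\<lambda>\<xi>. fourier (U n) \<xi> - g \<xi>)) \<longlonglongrightarrow> 0"
  proof (rule tendsto_sandwich[OF _ _ tendsto_const])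
    show "\<forall>\<^sub>F n in sequentially. norm2_sq (\<lambda>\<xi>. fourier (U n) \<xi> - g \<xi>) \<le>
        ennreal ((norm (complex_of_real k))\<^sup>2) * norm2_sq (\<lambda>\<xi>. F (U n) \<xi> - G \<xi>)"
    proof (intro always_eventually allI)
      fix n
      have "fourier (U n) \<xi> - g \<xi> = (F (U n) \<xi> - G \<xi>) * complex_of_real (1 / R \<xi>)" for \<xi>
        by (simp only: g_def fourier_eq_F[of "U n"] left_diff_distrib)
      then have "norm (fourier (U n) \<xi> - g \<xi>) \<le> norm (complex_of_real k * (F (U n) \<xi> - G \<xi>))" for \<xi> using root
          by simp
      then have "norm2_sq (\<lambda>\<xi>. fourier (U n) \<xi> - g \<xi>) \<le> norm2_sq (\<lambda>\<xi>. complex_of_real k * (F (U n) \<xi> - G \<xi>))"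
        unfolding norm2_sq_def by (intro nn_integral_mono ennreal_leI power_mono) auto
      also have "\<dots> = ennreal ((norm (complex_of_real k))\<^sup>2) * norm2_sq (\<lambda>\<xi>. F (U n) \<xi> - G \<xi>)"
          by (rule norm2_sq_cmult) measurable
      finally show "norm2_sq (\<lambda>\<xi>. fourier (U n) \<xi> - g \<xi>) \<le> ennreal ((norm (complex_of_real k))\<^sup>2) * norm2_sq
          (\<lambda>\<xi>. F (U n) \<xi> - G \<xi>)" .
    qed
    have "(\<lambda>n. ennreal ((norm (complex_of_real k))\<^sup>2) * norm2_sq (\<lambda>\<xi>. F (U n) \<xi> - G \<xi>)) \<longlonglongrightarrow>
        ennreal ((norm (complex_of_real k))\<^sup>2) * 0"
      by (rule ennreal_tendsto_cmult[OF _ limG]) simp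
    then show "(\<lambda>n. ennreal ((norm (complex_of_real k))\<^sup>2) * norm2_sq (\<lambda>\<xi>. F (U n) \<xi> - G \<xi>)) \<longlonglongrightarrow> 0" by simp
  qed simp
  \<comment> \<open>Defined by the absolutely convergent inverse integral rather than as an L^2
    limit, so that u is continuous at once.\<close>
  define u where "u = (\<lambda>x. complex_of_real (1 / ?P) * fourier_L1 g (- x))"
  have u_cont: "continuous_on UNIV u" unfolding u_def by (intro continuous_intros
      continuous_fourier_L1_reflected g_int)
  have refl_sq: "square_integrable (\<lambda>x::'a. f (- x))" if "square_integrable f" for f :: "'a \<Rightarrow> complex"
    using that unfolding square_integrable_iff by (subst norm2_sq_uminus) auto
  have u_sq: "square_integrable u"
    unfolding u_def by (intro square_integrable_cmult refl_sq square_integrable_fourier_L1 g_int g_sq)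
  \<comment> \<open>By inversion U n - u is, up to a constant and a reflection, the transform of the
    difference of the transforms. Plancherel's inequality then carries convergence from the
    transforms back to the functions.\<close>
  have "norm2_sq (\<lambda>x. U n x - u x) \<le> ennreal ((norm (complex_of_real (1 / ?P)))\<^sup>2) * (ennreal ?P * norm2_sq
      (\<lambda>\<xi>. fourier (U n) \<xi> - g \<xi>))" for n
  proof -
    let ?h = "\<lambda>\<xi>. fourier (U n) \<xi> - g \<xi>"
    have hi: "integrable lborel ?h" using fourier_integrable[OF U] g_int
        by (rule Bochner_Integration.integrable_diff)
    have hs: "square_integrable ?h" using square_integrable_fourier[OF HD(1)[OF U]] g_sq
        by (rule square_integrable_diff)
    have [measurable]: "fourier_L1 ?h \<in> borel_measurable borel" by (rule square_integrableD[OF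
        square_integrable_fourier_L1[OF hi hs]])
    have "U n x - u x = complex_of_real (1 / ?P) * fourier_L1 ?h (- x)" for x
    proof -
      have "complex_of_real ?P * U n x = fourier_L1 (fourier (U n)) (- x)"
        using inversion[OF U] unfolding inverse_fourier_eq .
      then have "U n x = complex_of_real (1 / ?P) * fourier_L1 (fourier (U n)) (- x)" by (simp add: field_simps)
      then show ?thesis unfolding u_def fourier_L1_diff[OF fourier_integrable[OF U] g_int]
          by (simp add: right_diff_distrib)
    qed
    then have "norm2_sq (\<lambda>x. U n x - u x) = ennreal ((norm (complex_of_real (1 / ?P)))\<^sup>2) * norm2_sq
        (\<lambda>x. fourier_L1 ?h (- x))"
      by (simp only:) (rule norm2_sq_cmult, measurable)
    also have "norm2_sq (\<lambda>x. fourier_L1 ?h (- x)) = norm2_sq (fourier_L1 ?h)"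
        by (rule norm2_sq_uminus) measurable
    also have "ennreal ((norm (complex_of_real (1 / ?P)))\<^sup>2) * norm2_sq (fourier_L1 ?h) \<le>
        ennreal ((norm (complex_of_real (1 / ?P)))\<^sup>2) * (ennreal ?P * norm2_sq ?h)"
      by (intro mult_left_mono norm2_sq_fourier_L1_le hi hs) simp
    finally show ?thesis .
  qed
  note le_u = this
  have "(\<lambda>n. ennreal ((norm (complex_of_real (1 / ?P)))\<^sup>2) * (ennreal ?P * norm2_sq (\<lambda>\<xi>. fourier (U n) \<xi> -
      g \<xi>))) \<longlonglongrightarrow>
      ennreal ((norm (complex_of_real (1 / ?P)))\<^sup>2) * (ennreal ?P * 0)"
    by (intro ennreal_tendsto_cmult lim_g) simp_all
  then have "(\<lambda>n. ennreal ((norm (complex_of_real (1 / ?P)))\<^sup>2) * (ennreal ?P * norm2_sq (\<lambda>\<xi>. fourier (U n) \<xi> -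
      g \<xi>))) \<longlonglongrightarrow> 0"
    by (simp only: mult_zero_right)
  then have lim_u: "(\<lambda>n. norm2_sq (\<lambda>x. U n x - u x)) \<longlonglongrightarrow> 0"
    by (rule tendsto_sandwich[OF _ always_eventually[OF allI[OF le_u]] tendsto_const, rotated]) simp
  have "is_fourier_L2 u g"
    by (rule is_fourier_L2_closed[OF is_fourier_L2_fourier[OF HD(1)[OF U]] u_sq g_sq lim_u lim_g])
  from is_fourier_L2_unique[OF is_fourier_L2_fourier[OF u_sq] this] have "AE \<xi> in lborel. F u \<xi> = G \<xi>"
  proof eventually_elim
    case (elim \<xi>)
    then show ?case using R_pos[of \<xi>] by (simp add: F_def g_def)
  qed
  note FG = this
  have uH: "u \<in> H"
  proof -
    have "square_integrable (F u)"
      by (rule square_integrable_cong_AE[OF G F_borel[OF u_sq]]) (use FG in \<open>auto elim!: eventually_mono\<close>)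
    then show ?thesis using u_sq u_cont by (simp add: H_iff)
  qed
  have "norm2_sq (\<lambda>\<xi>. F (U n) \<xi> - F u \<xi>) = norm2_sq (\<lambda>\<xi>. F (U n) \<xi> - G \<xi>)" for n
    unfolding norm2_sq_def using FG by (intro nn_integral_cong_AE) (auto elim!: eventually_mono)
  then have "(\<lambda>n. ennreal ((ip_dist ip (U n) u)\<^sup>2 / \<kappa>)) \<longlonglongrightarrow> ennreal 0"
    using limG by (simp add: norm2_sq_F_diff[OF U uH, symmetric])
  then have "(\<lambda>n. (ip_dist ip (U n) u)\<^sup>2 / \<kappa>) \<longlonglongrightarrow> 0"
    using \<kappa>_pos by (subst (asm) tendsto_ennreal_iff) (auto intro!: always_eventually)
  then have "(\<lambda>n. sqrt (\<kappa> * ((ip_dist ip (U n) u)\<^sup>2 / \<kappa>))) \<longlonglongrightarrow> sqrt (\<kappa> * 0)" by (intro tendsto_intros)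
  then have "(\<lambda>n. ip_dist ip (U n) u) \<longlonglongrightarrow> 0" using \<kappa>_pos dist_nn by simp
  with uH show ?thesis by blast
qed

lemma fourier_shifted_A: "fourier (\<lambda>y. A (y - x)) \<xi> = exp (- \<i> * complex_of_real (\<xi> \<bullet> x)) * complex_of_real (\<gamma> *
    \<Lambda> \<xi>)"
  and shifted_A_integrable: "integrable lborel (\<lambda>y. A (y - x))"
proof -
  show i: "integrable lborel (\<lambda>y. A (y - x))" using integrable_lborel_shift[where f = A and c =
      "- x"] A_integrable by simp
  have "fourier (\<lambda>y. A (y - x)) \<xi> = (LINT y|lborel. exp (- \<i> * complex_of_real (\<xi> \<bullet> y)) * A (y - x))"
    using i by (simp add: fourier_def fourier_L1_def)
  also have "\<dots> = (LINT y|lborel. exp (- \<i> * complex_of_real (\<xi> \<bullet> (y - x + x))) * A (y - x))" by simp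
  also have "\<dots> = (LINT y|lborel. exp (- \<i> * complex_of_real (\<xi> \<bullet> (y + x))) * A y)"
    using integral_lborel_shift[where f = "\<lambda>y. exp (- \<i> * complex_of_real (\<xi> \<bullet> (y + x))) * A y" and c = "- x"]
    by (simp only: uminus_add_conv_diff) simp
  also have "\<dots> = (LINT y|lborel. exp (- \<i> * complex_of_real (\<xi> \<bullet> x)) * (exp (- \<i> * complex_of_real (\<xi> \<bullet> y)) *
      A y))"
    by (simp add: inner_add_right distrib_left exp_add[symmetric] mult.assoc[symmetric] add.commute)
  also have "\<dots> = exp (- \<i> * complex_of_real (\<xi> \<bullet> x)) * fourier A \<xi>"
    using A_integrable by (simp add: fourier_def fourier_L1_def)
  finally show "fourier (\<lambda>y. A (y - x)) \<xi> = exp (- \<i> * complex_of_real (\<xi> \<bullet> x)) * complex_of_real (\<gamma> * \<Lambda> \<xi>)"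
    unfolding A_hat .
qed

lemma shifted_A_in_H: "(\<lambda>y. A (y - x)) \<in> H"
proof -
  have "continuous_on UNIV (\<lambda>y. askey \<alpha> (y - x))"
    by (rule continuous_on_compose2[OF A_continuous]) (auto intro!: continuous_intros)
  then have c: "continuous_on UNIV (\<lambda>y. A (y - x))" by (rule continuous_on_of_real)
  have s: "square_integrable (\<lambda>y. A (y - x))"
  proof -
    have "integrable lborel (\<lambda>y. (norm (A (y - x)))\<^sup>2)"
      using integrable_lborel_shift[where f = "\<lambda>y. (norm (A y))\<^sup>2" and c = "- x"] A_square_integrable
          by (simp add: square_integrable_def)
    then show ?thesis using shifted_A_integrable[of x] by (simp add: square_integrable_def
        borel_measurable_integrable)
  qed
  have "square_integrable (F (\<lambda>y. A (y - x)))"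
  proof (rule square_integrable_mono[OF square_integrable_cmult[OF root_\<Lambda>_square_integrable, of
      "complex_of_real \<gamma>"] F_borel[OF s]])
    fix \<xi>
    \<comment> \<open>The image of a translate therefore has modulus \<gamma> / R, which is square
      integrable because \<Lambda> is integrable.\<close>
    have "R \<xi> * \<Lambda> \<xi> = 1 / R \<xi>" using \<Lambda>_pos[of \<xi>] by (simp add: R_def real_div_sqrt)
    then show "norm (F (\<lambda>y. A (y - x)) \<xi>) \<le> norm (complex_of_real \<gamma> * complex_of_real (1 / R \<xi>))"
      using R_pos[of \<xi>] \<Lambda>_pos[of \<xi>] unfolding F_def fourier_shifted_A norm_mult norm_of_real
      by (simp add: norm_mult abs_mult mult.left_commute)
  qed
  with c s show ?thesis by (simp add: H_iff)
qed

lemma reproducing: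
  assumes u: "u \<in> H"
  shows "u x = ip u (\<lambda>y. A (y - x))"
proof -
  have "fourier u \<xi> * cnj (fourier (\<lambda>y. A (y - x)) \<xi>) / complex_of_real (\<Lambda> \<xi>) =
     complex_of_real \<gamma> * (fourier u \<xi> * exp (\<i> * complex_of_real (\<xi> \<bullet> x)))" for \<xi>
  proof -
    have "cnj (exp (- \<i> * complex_of_real (\<xi> \<bullet> x))) = exp (\<i> * complex_of_real (\<xi> \<bullet> x))" by (simp add: exp_cnj)
    then show ?thesis using \<Lambda>_pos[of \<xi>] unfolding fourier_shifted_A complex_cnj_mult complex_cnj_complex_of_real
        by simp
  qed
  then have "ip u (\<lambda>y. A (y - x)) = complex_of_real \<kappa> * (LINT \<xi>|lborel. complex_of_real \<gamma> * (fourier u \<xi> * exp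
      (\<i> * complex_of_real (\<xi> \<bullet> x))))"
    unfolding askey_inner_def \<kappa>_def \<gamma>_eq[symmetric] by (simp only:)
  also have "\<dots> = complex_of_real \<kappa> * (complex_of_real \<gamma> * (complex_of_real ((2 * pi) ^ DIM('a)) * u x))"
    unfolding inversion[OF u] by (simp only: integral_mult_right_zero)
  also have "\<dots> = complex_of_real (\<kappa> * \<gamma> * (2 * pi) ^ DIM('a)) * u x" by (simp only: of_real_mult mult.assoc)
  \<comment> \<open>The constant in front of the inner product undoes exactly the \<gamma> of the
    kernel and the (2 pi)^d of inversion.\<close>
  also have "\<kappa> * \<gamma> * (2 * pi) ^ DIM('a) = 1" using \<gamma>_pos by (simp add: \<kappa>_def)
  finally show ?thesis by simp
qed

lemma reproducing_kernel_A: "reproducing_kernel A H ip"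
  unfolding reproducing_kernel_def hilbert_space_on_def
  using inner_product_H H_complete shifted_A_in_H reproducing by blast

end

theorem corollary5p1:
  fixes \<alpha> :: real
  assumes "CARD('n::finite) \<ge> 2 \<Longrightarrow> \<alpha> \<ge> (real CARD('n) + 1) / 2"
    and "CARD('n) = 1 \<Longrightarrow> \<alpha> \<ge> 2"
  shows "continuous_on UNIV (askey \<alpha> :: real ^ 'n \<Rightarrow> real) \<and>
    positive_definite (\<lambda>x :: real ^ 'n. complex_of_real (askey \<alpha> x)) \<and>
    (\<forall>\<xi> :: real ^ 'n. fourier (\<lambda>x. complex_of_real (askey \<alpha> x)) \<xi> =
        complex_of_real (gamma_const CARD('n) \<alpha> * Lambda_fun CARD('n) \<alpha> (norm \<xi>))) \<and>
    reproducing_kernel (\<lambda>x :: real ^ 'n. complex_of_real (askey \<alpha> x))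
      (sobolev_cont ((real CARD('n) + 1) / 2)) (askey_inner \<alpha>)"
proof -
  \<comment> \<open>\<open>real ^ 'n\<close> has dimension CARD('n), so letting 'n range over the
    finite types covers every d >= 1.\<close>
  interpret askey_setup \<alpha> "(real CARD('n) + 1) / 2" "gamma_const CARD('n) \<alpha>" "TYPE(real ^ 'n)"
    by unfold_locales (use assms in simp_all)
  have "continuous_on UNIV (askey \<alpha> :: real ^ 'n \<Rightarrow> real)" by (rule A_continuous)
  moreover have "fourier (\<lambda>x :: real ^ 'n. complex_of_real (askey \<alpha> x)) \<xi> =
      complex_of_real (gamma_const CARD('n) \<alpha> * Lambda_fun CARD('n) \<alpha> (norm \<xi>))" for \<xi>
    using A_hat[of \<xi>] by simp
  ultimately show ?thesis using A_positive_definite reproducing_kernel_A by blast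
qed

end
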